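(* Work in $\mathsf{ZF}+\mathsf{AD}$. Let $\mathbb{P}$ be a non-trivial poset which is a surjective image of $\mathbb{R}$, and let $G$ be any $\mathbb{P}$-generic filter over $V$. Then $\mathsf{AD}$ fails in $V[G]$.
   Context: A poset $\mathbb{P}$ is non-trivial if forcing with it always adds a new set, i.e., every condition of $\mathbb{P}$ has two incompatible extensions (so that no $\mathbb{P}$-generic filter over $V$ lies in $V$). $\mathsf{AD}$ is the Axiom of Determinacy. *)

theory Defs
  imports Main
begin

text \<open>
  \<open>ZF\<close> is a first-order theory, so ``a theorem of \<open>ZF + AD\<close>'' is rendered as a statement about
  all models of \<open>ZF + AD\<close>. A model is a carrier set \<open>M\<close> with an arbitrary binary relation \<open>E\<close> for
  membership; it is neither assumed well-founded nor countable, so by completeness nothing is lost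
  with respect to provability. Objects of the model are elements of \<open>M\<close>; subsets of \<open>M\<close> in the
  sense of HOL play the role of classes, and need not be represented in the model.
\<close>

datatype fm = Member nat nat | Equal nat nat | Neg fm | Conj fm fm | All fm

text \<open>Variables are de Bruijn indices; \<open>All\<close> binds index \<open>0\<close>.\<close>

locale set_structure =
  fixes M :: "'a set" and E :: "'a \<Rightarrow> 'a \<Rightarrow> bool"
begin

primrec sat :: "(nat \<Rightarrow> 'a) \<Rightarrow> fm \<Rightarrow> bool" where
  "sat e (Member i j) \<longleftrightarrow> E (e i) (e j)"
| "sat e (Equal i j) \<longleftrightarrow> e i = e j"
| "sat e (Neg \<phi>) \<longleftrightarrow> \<not> sat e \<phi>"
| "sat e (Conj \<phi> \<psi>) \<longleftrightarrow> sat e \<phi> \<and> sat e \<psi>"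
| "sat e (All \<phi>) \<longleftrightarrow> (\<forall>x\<in>M. sat (case_nat x e) \<phi>)"

definition elts :: "'a \<Rightarrow> 'a set" where
  "elts x = {y \<in> M. E y x}"

definition is_succ :: "'a \<Rightarrow> 'a \<Rightarrow> bool" where
  "is_succ s n \<longleftrightarrow> elts s = insert n (elts n)"

definition inductive_set_of :: "'a \<Rightarrow> bool" where
  "inductive_set_of w \<longleftrightarrow>
     (\<exists>z\<in>elts w. elts z = {}) \<and> (\<forall>n\<in>elts w. \<exists>s\<in>elts w. is_succ s n)"

definition is_omega :: "'a \<Rightarrow> bool" where
  "is_omega w \<longleftrightarrow>
     inductive_set_of w \<and> (\<forall>v\<in>M. inductive_set_of v \<longrightarrow> elts w \<subseteq> elts v)"

subsection \<open>The axioms of ZF\<close>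

definition extensionality :: bool where
  "extensionality \<longleftrightarrow> (\<forall>x\<in>M. \<forall>y\<in>M. elts x = elts y \<longrightarrow> x = y)"

definition foundation :: bool where
  "foundation \<longleftrightarrow> (\<forall>x\<in>M. elts x \<noteq> {} \<longrightarrow> (\<exists>y\<in>elts x. elts y \<inter> elts x = {}))"

definition pairing :: bool where
  "pairing \<longleftrightarrow> (\<forall>x\<in>M. \<forall>y\<in>M. \<exists>z\<in>M. elts z = {x, y})"

definition union_ax :: bool where
  "union_ax \<longleftrightarrow> (\<forall>x\<in>M. \<exists>u\<in>M. elts u = (\<Union>y\<in>elts x. elts y))"

definition power_set :: bool where
  "power_set \<longleftrightarrow> (\<forall>x\<in>M. \<exists>p\<in>M. elts p = {y \<in> M. elts y \<subseteq> elts x})"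

definition infinity :: bool where
  "infinity \<longleftrightarrow> (\<exists>w\<in>M. inductive_set_of w)"

definition separation :: bool where
  "separation \<longleftrightarrow>
     (\<forall>\<phi> e. range e \<subseteq> M \<longrightarrow>
       (\<forall>a\<in>M. \<exists>b\<in>M. elts b = {x \<in> elts a. sat (case_nat x e) \<phi>}))"

definition replacement :: bool where
  "replacement \<longleftrightarrow>
     (\<forall>\<phi> e. range e \<subseteq> M \<longrightarrow>
       (\<forall>a\<in>M.
         (\<forall>x\<in>elts a. \<forall>y\<in>M. \<forall>z\<in>M.
            sat (case_nat x (case_nat y e)) \<phi> \<and> sat (case_nat x (case_nat z e)) \<phi> \<longrightarrow> y = z) \<longrightarrow>
         (\<exists>b\<in>M. elts b = {y \<in> M. \<exists>x\<in>elts a. sat (case_nat x (case_nat y e)) \<phi>})))"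

definition ZF :: bool where
  "ZF \<longleftrightarrow> extensionality \<and> foundation \<and> pairing \<and> union_ax \<and> power_set \<and> infinity
     \<and> separation \<and> replacement"

subsection \<open>Relations and functions in the model\<close>

definition is_opair :: "'a \<Rightarrow> 'a \<Rightarrow> 'a \<Rightarrow> bool" where
  "is_opair p x y \<longleftrightarrow> (\<exists>a\<in>M. \<exists>b\<in>M. elts a = {x} \<and> elts b = {x, y} \<and> elts p = {a, b})"

text \<open>Elements of \<open>r\<close> that are not ordered pairs are ignored by \<open>graph\<close>.\<close>

definition graph :: "'a \<Rightarrow> 'a rel" where
  "graph r = {(x, y). x \<in> M \<and> y \<in> M \<and> (\<exists>p\<in>elts r. is_opair p x y)}"

definition maps :: "'a \<Rightarrow> 'a set \<Rightarrow> 'a set \<Rightarrow> bool" where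
  "maps f A B \<longleftrightarrow>
     (\<forall>p\<in>elts f. \<exists>x\<in>A. \<exists>y\<in>B. is_opair p x y) \<and> (\<forall>x\<in>A. \<exists>!y. (x, y) \<in> graph f)"

definition is_restriction :: "'a \<Rightarrow> 'a \<Rightarrow> 'a \<Rightarrow> bool" where
  "is_restriction t x n \<longleftrightarrow> elts t = {p \<in> elts x. \<exists>k\<in>elts n. \<exists>y\<in>M. is_opair p k y}"

subsection \<open>The Axiom of Determinacy\<close>

text \<open>
  As usual in the context of determinacy, a real is an element of Baire space. Below, \<open>w\<close> is always
  the \<open>\<omega>\<close> of the model, which may be nonstandard; hence parity of positions is defined inside the
  model, by means of the unique subset of \<open>w\<close> that contains \<open>0\<close> and alternates.
\<close>

definition reals :: "'a \<Rightarrow> 'a set" where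
  "reals w = {x \<in> M. maps x (elts w) (elts w)}"

definition finite_seqs :: "'a \<Rightarrow> 'a set" where
  "finite_seqs w = {t \<in> M. \<exists>n\<in>elts w. maps t (elts n) (elts w)}"

definition alternating :: "'a \<Rightarrow> 'a \<Rightarrow> bool" where
  "alternating w d \<longleftrightarrow>
     elts d \<subseteq> elts w \<and> (\<forall>z\<in>elts w. elts z = {} \<longrightarrow> z \<in> elts d) \<and>
     (\<forall>n\<in>elts w. \<forall>s\<in>elts w. is_succ s n \<longrightarrow> (s \<in> elts d \<longleftrightarrow> n \<notin> elts d))"

definition evens :: "'a \<Rightarrow> 'a set" where
  "evens w = {n \<in> elts w. \<exists>d\<in>M. alternating w d \<and> n \<in> elts d}"

definition odds :: "'a \<Rightarrow> 'a set" where
  "odds w = elts w - evens w"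

definition strategies :: "'a \<Rightarrow> 'a set" where
  "strategies w = {s \<in> M. maps s (finite_seqs w) (elts w)}"

text \<open>The run \<open>x\<close> satisfies \<open>x(n) = s(x \<restriction> n)\<close> at each position \<open>n\<close> in \<open>N\<close>.\<close>

definition follows :: "'a set \<Rightarrow> 'a \<Rightarrow> 'a \<Rightarrow> bool" where
  "follows N s x \<longleftrightarrow>
     (\<forall>n\<in>N. \<exists>t\<in>M. \<exists>m\<in>M. is_restriction t x n \<and> (t, m) \<in> graph s \<and> (n, m) \<in> graph x)"

definition wins_I :: "'a \<Rightarrow> 'a \<Rightarrow> 'a \<Rightarrow> bool" where
  "wins_I w A s \<longleftrightarrow> (\<forall>x\<in>reals w. follows (evens w) s x \<longrightarrow> x \<in> elts A)"

definition wins_II :: "'a \<Rightarrow> 'a \<Rightarrow> 'a \<Rightarrow> bool" where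
  "wins_II w A s \<longleftrightarrow> (\<forall>x\<in>reals w. follows (odds w) s x \<longrightarrow> x \<notin> elts A)"

definition determined :: "'a \<Rightarrow> 'a \<Rightarrow> bool" where
  "determined w A \<longleftrightarrow>
     (\<exists>s\<in>strategies w. wins_I w A s) \<or> (\<exists>s\<in>strategies w. wins_II w A s)"

definition AD :: bool where
  "AD \<longleftrightarrow> (\<forall>w\<in>M. is_omega w \<longrightarrow> (\<forall>A\<in>M. elts A \<subseteq> reals w \<longrightarrow> determined w A))"

subsection \<open>Posets and generic filters\<close>

text \<open>
  A poset of the model is given by its underlying set \<open>P\<close> and its order relation \<open>L\<close>, both elements
  of the model; \<open>(p, q) \<in> graph L\<close> means \<open>p \<le> q\<close>, i.e. \<open>p\<close> is the stronger condition.
\<close>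

definition is_poset :: "'a \<Rightarrow> 'a \<Rightarrow> bool" where
  "is_poset P L \<longleftrightarrow> P \<in> M \<and> L \<in> M \<and> partial_order_on (elts P) (graph L)"

definition compatible :: "'a \<Rightarrow> 'a \<Rightarrow> 'a \<Rightarrow> 'a \<Rightarrow> bool" where
  "compatible P L p q \<longleftrightarrow> (\<exists>r\<in>elts P. (r, p) \<in> graph L \<and> (r, q) \<in> graph L)"

definition nontrivial :: "'a \<Rightarrow> 'a \<Rightarrow> bool" where
  "nontrivial P L \<longleftrightarrow>
     (\<forall>p\<in>elts P. \<exists>q\<in>elts P. \<exists>r\<in>elts P.
        (q, p) \<in> graph L \<and> (r, p) \<in> graph L \<and> \<not> compatible P L q r)"

definition surjective_image_of_reals :: "'a \<Rightarrow> bool" where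
  "surjective_image_of_reals P \<longleftrightarrow>
     (\<exists>w\<in>M. is_omega w \<and>
       (\<exists>f\<in>M. maps f (reals w) (elts P) \<and> (\<forall>p\<in>elts P. \<exists>x\<in>reals w. (x, p) \<in> graph f)))"

definition dense :: "'a \<Rightarrow> 'a \<Rightarrow> 'a \<Rightarrow> bool" where
  "dense P L D \<longleftrightarrow> elts D \<subseteq> elts P \<and> (\<forall>p\<in>elts P. \<exists>d\<in>elts D. (d, p) \<in> graph L)"

text \<open>The filter \<open>G\<close> is an arbitrary set of conditions, not necessarily represented in the model.\<close>

definition is_filter :: "'a \<Rightarrow> 'a \<Rightarrow> 'a set \<Rightarrow> bool" where
  "is_filter P L G \<longleftrightarrow>
     G \<subseteq> elts P \<and> G \<noteq> {} \<and>
     (\<forall>p\<in>G. \<forall>q\<in>elts P. (p, q) \<in> graph L \<longrightarrow> q \<in> G) \<and>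
     (\<forall>p\<in>G. \<forall>q\<in>G. \<exists>r\<in>G. (r, p) \<in> graph L \<and> (r, q) \<in> graph L)"

definition generic :: "'a \<Rightarrow> 'a \<Rightarrow> 'a set \<Rightarrow> bool" where
  "generic P L G \<longleftrightarrow>
     is_filter P L G \<and> (\<forall>D\<in>M. dense P L D \<longrightarrow> G \<inter> elts D \<noteq> {})"

subsection \<open>The generic extension\<close>

text \<open>
  As in Shoenfield's presentation, every element \<open>\<tau>\<close> of the model serves as a name: only its
  elements of the form \<open>(\<pi>, t)\<close> with \<open>t\<close> a condition matter, and its value is to be
  \<open>val \<tau> = {val \<pi> | (\<pi>, t) \<in> \<tau>, t \<in> G}\<close>. Since \<open>M\<close> may be ill-founded, this cannot be
  taken as a recursive definition of \<open>val\<close> in HOL. Instead, the model defines the relation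
  \<open>p \<tturnstile> \<sigma> = \<tau>\<close> by the usual recursion on names, two names are
  identified when some condition in \<open>G\<close> forces them to be equal, and membership of the resulting
  classes is given by the displayed equation. For well-founded \<open>M\<close>, this is the usual generic
  extension up to isomorphism.
\<close>

definition name_elts :: "'a \<Rightarrow> 'a \<Rightarrow> 'a rel" where
  "name_elts P \<tau> = {(\<pi>, t) \<in> graph \<tau>. t \<in> elts P}"

definition triples :: "'a \<Rightarrow> ('a \<times> 'a \<times> 'a) set" where
  "triples F = {(p, \<sigma>, \<tau>). \<exists>d\<in>M. is_opair d \<sigma> \<tau> \<and> (p, d) \<in> graph F}"

text \<open>
  With \<open>R\<close> the forced equality of names of smaller rank, \<open>forces_subset P L R p \<sigma> \<tau>\<close> says that
  \<open>p\<close> forces every element of \<open>\<sigma>\<close> to be an element of \<open>\<tau>\<close>.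
\<close>

definition forces_subset ::
  "'a \<Rightarrow> 'a \<Rightarrow> ('a \<times> 'a \<times> 'a) set \<Rightarrow> 'a \<Rightarrow> 'a \<Rightarrow> 'a \<Rightarrow> bool" where
  "forces_subset P L R p \<sigma> \<tau> \<longleftrightarrow>
     (\<forall>(\<rho>, s) \<in> name_elts P \<sigma>. \<forall>q\<in>elts P. (q, p) \<in> graph L \<and> (q, s) \<in> graph L \<longrightarrow>
        (\<exists>r\<in>elts P. (r, q) \<in> graph L \<and>
           (\<exists>(\<pi>, t) \<in> name_elts P \<tau>. (r, t) \<in> graph L \<and> (r, \<rho>, \<pi>) \<in> R)))"

text \<open>
  \<open>F\<close> is the solution of the recursion for forced equality on a set \<open>X\<close> of names that is closed
  under the names occurring in its elements.
\<close>

definition equality_recursion :: "'a \<Rightarrow> 'a \<Rightarrow> 'a \<Rightarrow> 'a \<Rightarrow> bool" where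
  "equality_recursion P L X F \<longleftrightarrow>
     (\<forall>\<nu>\<in>elts X. \<forall>(\<rho>, s) \<in> name_elts P \<nu>. \<rho> \<in> elts X) \<and>
     (\<forall>p\<in>elts P. \<forall>\<sigma>\<in>elts X. \<forall>\<tau>\<in>elts X.
        (p, \<sigma>, \<tau>) \<in> triples F \<longleftrightarrow>
          forces_subset P L (triples F) p \<sigma> \<tau> \<and> forces_subset P L (triples F) p \<tau> \<sigma>)"

definition forces_eq :: "'a \<Rightarrow> 'a \<Rightarrow> 'a \<Rightarrow> 'a \<Rightarrow> 'a \<Rightarrow> bool" where
  "forces_eq P L p \<sigma> \<tau> \<longleftrightarrow>
     (\<exists>X\<in>M. \<exists>F\<in>M. equality_recursion P L X F \<and> \<sigma> \<in> elts X \<and> \<tau> \<in> elts X \<and>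
        (p, \<sigma>, \<tau>) \<in> triples F)"

definition val :: "'a \<Rightarrow> 'a \<Rightarrow> 'a set \<Rightarrow> 'a \<Rightarrow> 'a set" where
  "val P L G \<tau> = {\<sigma> \<in> M. \<exists>p\<in>G. forces_eq P L p \<sigma> \<tau>}"

definition ext_carrier :: "'a \<Rightarrow> 'a \<Rightarrow> 'a set \<Rightarrow> 'a set set" where
  "ext_carrier P L G = val P L G ` M"

definition ext_mem :: "'a \<Rightarrow> 'a \<Rightarrow> 'a set \<Rightarrow> 'a set \<Rightarrow> 'a set \<Rightarrow> bool" where
  "ext_mem P L G x y \<longleftrightarrow>
     (\<exists>\<tau>\<in>M. y = val P L G \<tau> \<and> (\<exists>(\<pi>, t) \<in> name_elts P \<tau>. t \<in> G \<and> x = val P L G \<pi>))"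

end

end

theory Submission
  imports Defs
begin

text \<open>
  Suppose that \<open>AD\<close> holds in \<open>V[G]\<close>. There are new reals: otherwise the strategies for the game in which
  player I has to name a condition \<open>p \<in> G\<close> and player II a condition \<open>q \<in> G\<close> not forced into the generic
  filter by \<open>p\<close> lie in \<open>V\<close>, and genericity defeats them.

  Next, play in \<open>V[G]\<close> Davis' perfect set game for the set \<open>X\<close> of the binary reals of \<open>V\<close>. A winning
  strategy of player I yields a surjection from \<open>X\<close> onto the reals of \<open>V[G]\<close>; a winning strategy of
  player II makes \<open>X\<close>, hence also the poset, countable in \<open>V[G]\<close>, so that reals code names of reals. In
  both cases strategies are represented by elements \<open>x\<close> of a set \<open>N0\<close> of \<open>V\<close>, and reals of \<open>V[G]\<close> code
  the pairs of such an \<open>x\<close> and a condition \<open>q\<close>.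

  In \<open>V\<close>, build a set \<open>W\<close> in transfinitely many stages: a quadruple \<open>(x, q, n, i)\<close> enters as soon as the
  quadruples \<open>(x, q, n', i')\<close> with \<open>(n', i')\<close> lexicographically below \<open>(n, i)\<close> are present and \<open>q\<close> forces
  the current stage to be closed under the strategy \<open>x\<close>. Consider the game in which both players play
  elements \<open>r(n, i)\<close> of \<open>W\<close>, the first to leave \<open>W\<close> loses, and otherwise player I wins iff there is a
  sequence \<open>c \<in> V\<close> such that \<open>c n\<close> does not enter \<open>W\<close> before either move \<open>r(n, 0)\<close>, nor after both moves
  \<open>r(n, 1)\<close>. A winning strategy \<open>x\<close> keeps \<open>W\<close> closed, and some \<open>q \<in> G\<close> forces this, so all
  \<open>g(n, i) = (x, q, n, i)\<close> are in \<open>W\<close>, and the answers of \<open>x\<close> to moves entering before \<open>g(n, i)\<close> enter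
  before \<open>g(n, i)\<close> too. If the opponent plays the \<open>g(n, i)\<close>, then \<open>c n = g(n, 1)\<close> lets player I win. If the
  opponent plays \<open>g(n, i + 3)\<close> instead for those \<open>n\<close> with \<open>z n = 1\<close>, where \<open>z\<close> is a new binary real, then
  player I loses: any such \<open>c\<close> would put \<open>z\<close> into \<open>V\<close>, as \<open>z n = 0\<close> iff \<open>c n\<close> enters before \<open>g(n, 3)\<close>.
  So neither player can own \<open>x\<close>.
\<close>

section \<open>Definability\<close>

text \<open>The axioms of ZF are not derived for the extension. Everything is said in the structure
  \<open>M\<close> with \<open>G\<close> as a predicate: a real of \<open>V[G]\<close> is replaced
  by a name \<open>R\<close>, a quantifier over reals by one over names, and the truth lemma is
  needed only for relations \<open>dfn G\<close>, whose quantifiers range over \<open>M\<close>. No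
  finite sequences are added, so positions of games in \<open>V[G]\<close> are elements of
  \<open>M\<close>. The obstacle is that strategies live in \<open>V[G]\<close>, while the tower has
  to be built in \<open>V\<close>, where it is not known which strategy wins. Davis' game supplies a
  set of \<open>V\<close> whose elements represent all strategies and are themselves, together with
  conditions, coded by reals of \<open>V[G]\<close>, so that they can be played. The tower treats
  all pairs \<open>(x, q)\<close> at once; admitting \<open>(x, q, n, i)\<close> only when
  \<open>q\<close> vouches for closure under \<open>x\<close> makes it fit whichever strategy wins.
  The lexicographic order provides, for every \<open>n\<close>, stages closed under the strategy
  between successive \<open>g(n, i)\<close>, which trap its answers. A shift of the opponent's moves
  by \<open>z\<close> then becomes a comparison of entry times, which a sequence of \<open>V\<close>
  decodes.\<close>

named_theorems df "definability rules"

context set_structure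
begin

definition subst :: "(nat \<Rightarrow> nat + 'a) \<Rightarrow> (nat \<Rightarrow> 'a) \<Rightarrow> nat \<Rightarrow> 'a" where
  "subst g e i = (case g i of Inl j \<Rightarrow> e j | Inr c \<Rightarrow> c)"

text \<open>\<open>dfn C Q\<close>: the relation \<open>Q\<close> on environments is first-order definable from parameters with \<open>C\<close> as an
  additional predicate. Only \<open>C = {}\<close> (definable in the ground model) and \<open>C = G\<close> occur. The rule
  \<open>dfn_subst\<close> replaces variables by variables or parameters.\<close>

inductive dfn :: "'a set \<Rightarrow> ((nat \<Rightarrow> 'a) \<Rightarrow> bool) \<Rightarrow> bool" for C where
  dfn_E: "dfn C (\<lambda>e. E (e i) (e j))"
| dfn_eq: "dfn C (\<lambda>e. e i = e j)"
| dfn_C: "dfn C (\<lambda>e. e i \<in> C)"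
| dfn_not: "dfn C Q \<Longrightarrow> dfn C (\<lambda>e. \<not> Q e)"
| dfn_conj: "dfn C Q \<Longrightarrow> dfn C R \<Longrightarrow> dfn C (\<lambda>e. Q e \<and> R e)"
| dfn_all: "dfn C Q \<Longrightarrow> dfn C (\<lambda>e. \<forall>x\<in>M. Q (case_nat x e))"
| dfn_subst: "dfn C Q \<Longrightarrow> (\<And>i c. g i = Inr c \<Longrightarrow> c \<in> M) \<Longrightarrow> dfn C (\<lambda>e. Q (subst g e))"
| dfn_cong: "dfn C Q \<Longrightarrow> (\<And>e. range e \<subseteq> M \<Longrightarrow> Q e = Q' e) \<Longrightarrow> dfn C Q'"

text \<open>Terms let definability goals mention operations such as pairing or application directly,
  although formulas have no function symbols; such goals are then discharged by
  \<open>intro df\<close>.\<close>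

definition tm :: "'a set \<Rightarrow> ((nat \<Rightarrow> 'a) \<Rightarrow> 'a) \<Rightarrow> bool" where
  "tm C t \<longleftrightarrow> (\<forall>e. range e \<subseteq> M \<longrightarrow> t e \<in> M) \<and> dfn C (\<lambda>e. e 0 = t (\<lambda>i. e (Suc i)))"

lemma envD: "range e \<subseteq> M \<Longrightarrow> e i \<in> M"
  by (rule range_subsetD)

lemma range_case_nat: "x \<in> M \<Longrightarrow> range e \<subseteq> M \<Longrightarrow> range (case_nat x e) \<subseteq> M"
  by (auto split: nat.splits dest: envD)

lemma range_subst: "range e \<subseteq> M \<Longrightarrow> (\<And>i c. g i = Inr c \<Longrightarrow> c \<in> M) \<Longrightarrow> range (subst g e) \<subseteq> M"
  by (auto simp: subst_def split: sum.splits dest: envD)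

section \<open>Closure properties of definability\<close>

lemma dfn_ren:
  assumes "dfn C Q" shows "dfn C (\<lambda>e. Q (\<lambda>i. e (f i)))"
  using dfn_subst[OF assms, of "\<lambda>i. Inl (f i)"] by (simp add: subst_def[abs_def])

lemma df_not [df]: "dfn C Q \<Longrightarrow> dfn C (\<lambda>e. \<not> Q e)" by (rule dfn_not)

lemma df_conj [df]: "dfn C Q \<Longrightarrow> dfn C R \<Longrightarrow> dfn C (\<lambda>e. Q e \<and> R e)" by (rule dfn_conj)

lemma df_disj [df]: "dfn C Q \<Longrightarrow> dfn C R \<Longrightarrow> dfn C (\<lambda>e. Q e \<or> R e)"
  using dfn_not[OF dfn_conj[OF dfn_not dfn_not], of C Q R] by simp

lemma df_imp [df]: "dfn C Q \<Longrightarrow> dfn C R \<Longrightarrow> dfn C (\<lambda>e. Q e \<longrightarrow> R e)"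
  unfolding imp_conv_disj by (intro df_disj df_not)

lemma df_iff [df]: "dfn C Q \<Longrightarrow> dfn C R \<Longrightarrow> dfn C (\<lambda>e. Q e \<longleftrightarrow> R e)"
  using df_conj[OF df_imp df_imp, of C Q R R Q] by (simp add: iff_conv_conj_imp)

lemma df_False [df]: "dfn C (\<lambda>e. False)"
  using dfn_conj[OF dfn_eq dfn_not[OF dfn_eq], of C 0 0 0 0] by simp

lemma df_True [df]: "dfn C (\<lambda>e. True)"
  using dfn_not[OF df_False] by simp

lemma df_All [df]:
  assumes "dfn C (\<lambda>e. Q (e 0) (\<lambda>i. e (Suc i)))"
  shows "dfn C (\<lambda>e. \<forall>x\<in>M. Q x e)"
  using dfn_all[OF assms] by simp

lemma df_Ex [df]:
  assumes "dfn C (\<lambda>e. Q (e 0) (\<lambda>i. e (Suc i)))"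
  shows "dfn C (\<lambda>e. \<exists>x\<in>M. Q x e)"
  using df_not[OF df_All[of C "\<lambda>x e. \<not> Q x e"], OF df_not[OF assms]] by simp

lemma tm_var [df]: "tm C (\<lambda>e. e i)"
  unfolding tm_def by (auto intro: dfn_eq)

lemma tm_const [df]:
  assumes "c \<in> M" shows "tm C (\<lambda>e. c)"
proof -
  have "dfn C (\<lambda>e. subst (case_nat (Inl 0) (\<lambda>_. Inr c)) e 0 = subst (case_nat (Inl 0) (\<lambda>_. Inr c)) e 1)"
    by (rule dfn_subst[OF dfn_eq]) (use assms in \<open>auto split: nat.splits\<close>)
  then show ?thesis using assms by (simp add: tm_def subst_def)
qed

lemma tm_shift: "tm C t \<Longrightarrow> tm C (\<lambda>e. t (\<lambda>i. e (Suc i)))"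
proof -
  assume t: "tm C t"
  then have "dfn C (\<lambda>e. e 0 = t (\<lambda>i. e (Suc i)))" by (simp add: tm_def)
  from dfn_ren[OF this, of "case_nat 0 (\<lambda>i. Suc (Suc i))"] t
  have "dfn C (\<lambda>e. e 0 = t (\<lambda>i. e (Suc (Suc i))))" by simp
  moreover have "t (\<lambda>i. e (Suc i)) \<in> M" if "range e \<subseteq> M" for e
  proof -
    have "range (\<lambda>i. e (Suc i)) \<subseteq> M" using that by (auto dest: envD)
    with t show ?thesis by (simp add: tm_def)
  qed
  ultimately show ?thesis by (simp add: tm_def)
qed

text \<open>Substitution of a term is an existential quantifier over its value.\<close>

lemma df_let:
  assumes S: "dfn C (\<lambda>e. S (e 0) (\<lambda>i. e (Suc i)))" and t: "tm C t"
  shows "dfn C (\<lambda>e. S (t e) e)"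
proof (rule dfn_cong)
  show "dfn C (\<lambda>e. \<exists>x\<in>M. x = t e \<and> S x e)"
    using t by (intro df_Ex df_conj S) (simp add: tm_def)
  show "(\<exists>x\<in>M. x = t e \<and> S x e) = S (t e) e" if "range e \<subseteq> M" for e
    using t that by (auto simp: tm_def)
qed

lemma inst1:
  assumes S: "dfn C (\<lambda>e. S (e 0))" and t: "tm C t"
  shows "dfn C (\<lambda>e. S (t e))"
  by (rule df_let[of C "\<lambda>x e. S x"]) (use assms in auto)

text \<open>The arguments are reordered so that the last one is replaced first; the shift in its
  term makes room for the variable that is still waiting.\<close>

lemma inst2:
  assumes S: "dfn C (\<lambda>e. S (e 0) (e (Suc 0)))" and t: "tm C t1" "tm C t2"
  shows "dfn C (\<lambda>e. S (t1 e) (t2 e))"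
proof -
  have "dfn C (\<lambda>e. S (e (Suc 0)) (e 0))"
    using dfn_ren[OF S, of "case_nat 1 (\<lambda>_. 0)"] by simp
  then have "dfn C (\<lambda>e. S (e 0) (t2 (\<lambda>i. e (Suc i))))"
    by (intro df_let[of C "\<lambda>y e. S (e 0) y"] tm_shift t)
  then show ?thesis by (intro df_let[of C "\<lambda>x e. S x (t2 e)"] t)
qed

lemma inst3:
  assumes S: "dfn C (\<lambda>e. S (e 0) (e (Suc 0)) (e (Suc (Suc 0))))" and t: "tm C t1" "tm C t2" "tm C t3"
  shows "dfn C (\<lambda>e. S (t1 e) (t2 e) (t3 e))"
proof -
  have "dfn C (\<lambda>e. S (e (Suc (Suc 0))) (e (Suc 0)) (e 0))"
    using dfn_ren[OF S, of "case_nat 2 (case_nat 1 (\<lambda>_. 0))"] by (simp add: numeral_2_eq_2)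
  then have "dfn C (\<lambda>e. S (e (Suc 0)) (e 0) (t3 (\<lambda>i. e (Suc (Suc i)))))"
    by (intro df_let[of C "\<lambda>y e. S (e (Suc 0)) (e 0) y"] tm_shift[OF tm_shift] t)
  then have "dfn C (\<lambda>e. S (e 0) (t2 (\<lambda>i. e (Suc i))) (t3 (\<lambda>i. e (Suc i))))"
    by (intro df_let[of C "\<lambda>y e. S (e 0) y (t3 (\<lambda>i. e (Suc i)))"] tm_shift t)
  then show ?thesis by (intro df_let[of C "\<lambda>x e. S x (t2 e) (t3 e)"] t)
qed

lemma inst4:
  assumes S: "dfn C (\<lambda>e. S (e 0) (e (Suc 0)) (e (Suc (Suc 0))) (e (Suc (Suc (Suc 0)))))"
    and t: "tm C t1" "tm C t2" "tm C t3" "tm C t4"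
  shows "dfn C (\<lambda>e. S (t1 e) (t2 e) (t3 e) (t4 e))"
proof -
  have "dfn C (\<lambda>e. S (e (Suc (Suc (Suc 0)))) (e (Suc (Suc 0))) (e (Suc 0)) (e 0))"
    using dfn_ren[OF S, of "case_nat 3 (case_nat 2 (case_nat 1 (\<lambda>_. 0)))"]
    by (simp add: numeral_2_eq_2 numeral_3_eq_3)
  then have "dfn C (\<lambda>e. S (e 0) (t2 (\<lambda>i. e (Suc i))) (t3 (\<lambda>i. e (Suc i))) (t4 (\<lambda>i. e (Suc i))))"
    by (intro df_let[of C "\<lambda>y e. S (e 0) y (t3 (\<lambda>i. e (Suc i))) (t4 (\<lambda>i. e (Suc i)))"] tm_shift t)
      (rule df_let[of C "\<lambda>y e. S (e (Suc 0)) (e 0) y (t4 (\<lambda>i. e (Suc (Suc i))))"],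
       rule df_let[of C "\<lambda>y e. S (e (Suc (Suc 0))) (e (Suc 0)) (e 0) y"],
       simp_all add: tm_shift t tm_shift[OF tm_shift, OF t(4)] tm_shift[OF tm_shift[OF tm_shift], OF t(4)]
         tm_shift[OF tm_shift, OF t(3)])
  then show ?thesis by (intro df_let[of C "\<lambda>x e. S x (t2 e) (t3 e) (t4 e)"] t)
qed

lemma tm_inst1:
  assumes "tm C (\<lambda>e. F (e 0))" "tm C t" shows "tm C (\<lambda>e. F (t e))"
proof -
  have "dfn C (\<lambda>e. e 0 = F (e (Suc 0)))" using assms(1) by (simp add: tm_def)
  then have "dfn C (\<lambda>e. e 0 = F (t (\<lambda>i. e (Suc i))))"
    by (rule inst2[where S="\<lambda>x y. x = F y"]) (intro tm_var tm_shift assms)+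
  moreover have "F (t e) \<in> M" if "range e \<subseteq> M" for e
  proof -
    have "range (\<lambda>_::nat. t e) \<subseteq> M" using assms that by (auto simp: tm_def)
    then show ?thesis using assms(1) unfolding tm_def by fastforce
  qed
  ultimately show ?thesis by (simp add: tm_def)
qed

lemma tm_inst2:
  assumes "tm C (\<lambda>e. F (e 0) (e (Suc 0)))" "tm C t1" "tm C t2"
  shows "tm C (\<lambda>e. F (t1 e) (t2 e))"
proof -
  have "dfn C (\<lambda>e. e 0 = F (e (Suc 0)) (e (Suc (Suc 0))))" using assms(1) by (simp add: tm_def)
  then have "dfn C (\<lambda>e. e 0 = F (t1 (\<lambda>i. e (Suc i))) (t2 (\<lambda>i. e (Suc i))))"
    by (rule inst3[where S="\<lambda>x y z. x = F y z"]) (intro tm_var tm_shift assms)+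
  moreover have "F (t1 e) (t2 e) \<in> M" if "range e \<subseteq> M" for e
  proof -
    have "t1 e \<in> M" "t2 e \<in> M" using assms that by (auto simp: tm_def)
    then have "range (case_nat (t1 e) (\<lambda>_. t2 e)) \<subseteq> M" by (auto split: nat.splits)
    then show ?thesis using assms(1) unfolding tm_def by fastforce
  qed
  ultimately show ?thesis by (simp add: tm_def)
qed

lemma df_E [df]: "tm C t1 \<Longrightarrow> tm C t2 \<Longrightarrow> dfn C (\<lambda>e. E (t1 e) (t2 e))"
  by (rule inst2[where S=E]) (rule dfn_E)

lemma df_eq [df]: "tm C t1 \<Longrightarrow> tm C t2 \<Longrightarrow> dfn C (\<lambda>e. t1 e = t2 e)"
  by (rule inst2[where S="(=)"]) (rule dfn_eq)

lemma df_C: "tm C t \<Longrightarrow> dfn C (\<lambda>e. t e \<in> C)"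
  by (rule inst1[where S="\<lambda>x. x \<in> C"]) (rule dfn_C)

lemma df_elts [df]:
  assumes "tm C t1" "tm C t2" shows "dfn C (\<lambda>e. t1 e \<in> elts (t2 e))"
  by (rule dfn_cong, rule df_E[OF assms]) (use assms in \<open>auto simp: elts_def tm_def\<close>)

lemma df_ball [df]:
  assumes "tm C t" "dfn C (\<lambda>e. Q (e 0) (\<lambda>i. e (Suc i)))"
  shows "dfn C (\<lambda>e. \<forall>x\<in>elts (t e). Q x e)"
  by (rule dfn_cong, rule df_All[of C "\<lambda>x e. x \<in> elts (t e) \<longrightarrow> Q x e"],
      intro df_imp df_elts df tm_shift assms) (auto simp: elts_def)

lemma df_bex [df]:
  assumes "tm C t" "dfn C (\<lambda>e. Q (e 0) (\<lambda>i. e (Suc i)))"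
  shows "dfn C (\<lambda>e. \<exists>x\<in>elts (t e). Q x e)"
  by (rule dfn_cong, rule df_Ex[of C "\<lambda>x e. x \<in> elts (t e) \<and> Q x e"],
      intro df_conj df_elts df tm_shift assms) (auto simp: elts_def)

lemma df_inM [df]: "tm C t \<Longrightarrow> dfn C (\<lambda>e. t e \<in> M)"
  by (rule dfn_cong[OF df_True]) (auto simp: tm_def)

lemma df_elts_eq [df]:
  assumes "tm C t" "dfn C (\<lambda>e. Q (e 0) (\<lambda>i. e (Suc i)))"
  shows "dfn C (\<lambda>e. elts (t e) = {x \<in> M. Q x e})"
  by (rule dfn_cong, rule df_All[of C "\<lambda>x e. x \<in> elts (t e) \<longleftrightarrow> Q x e"],
      intro df tm_shift assms) (auto simp: elts_def)

lemma df_subset [df]: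
  assumes "tm C t1" "tm C t2" shows "dfn C (\<lambda>e. elts (t1 e) \<subseteq> elts (t2 e))"
  unfolding subset_eq by (intro df assms tm_shift)

lemma dfn_empty: "dfn {} Q \<Longrightarrow> dfn C Q"
proof (induction rule: dfn.induct)
  case (dfn_C i) then show ?case using df_False by simp
qed (auto intro: dfn.intros)

text \<open>A term is definable as soon as its graph has a definable description.\<close>

lemma tmI:
  assumes "\<And>e. range e \<subseteq> M \<Longrightarrow> t e \<in> M"
    and "\<And>e v. range e \<subseteq> M \<Longrightarrow> v \<in> M \<Longrightarrow> v = t e \<longleftrightarrow> S v e"
    and "dfn C (\<lambda>e. S (e 0) (\<lambda>i. e (Suc i)))"
  shows "tm C t"
  unfolding tm_def
proof (intro conjI allI impI dfn_cong[OF assms(3)])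
  fix e :: "nat \<Rightarrow> 'a" assume e: "range e \<subseteq> M"
  then have "range (\<lambda>i. e (Suc i)) \<subseteq> M" "e 0 \<in> M" by auto
  from assms(2)[OF this] show "S (e 0) (\<lambda>i. e (Suc i)) = (e 0 = t (\<lambda>i. e (Suc i)))" by simp
qed (use assms in auto)

section \<open>From definable relations to formulas\<close>

primrec ren :: "(nat \<Rightarrow> nat) \<Rightarrow> fm \<Rightarrow> fm" where
  "ren f (Member i j) = Member (f i) (f j)"
| "ren f (Equal i j) = Equal (f i) (f j)"
| "ren f (Neg \<phi>) = Neg (ren f \<phi>)"
| "ren f (Conj \<phi> \<psi>) = Conj (ren f \<phi>) (ren f \<psi>)"
| "ren f (All \<phi>) = All (ren (case_nat 0 (\<lambda>i. Suc (f i))) \<phi>)"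

lemma sat_ren: "sat e (ren f \<phi>) = sat (\<lambda>i. e (f i)) \<phi>"
proof (induction \<phi> arbitrary: e f)
  case (All \<phi>)
  have "(\<lambda>i. case_nat x e (case_nat 0 (\<lambda>i. Suc (f i)) i)) = case_nat x (\<lambda>i. e (f i))" for x
    by (auto split: nat.splits)
  with All show ?case by simp
qed auto

text \<open>The axiom schemes speak of formulas, so a derivation of definability has to be turned
  into one. The map \<open>g\<close> carries the parameters alongside the formula, and so no
  substitution into formulas is required.\<close>

lemma dfn_sat:
  assumes "dfn {} Q"
  shows "\<exists>\<phi> g. (\<forall>i c. g i = Inr c \<longrightarrow> c \<in> M) \<and> (\<forall>e. range e \<subseteq> M \<longrightarrow> Q e = sat (subst g e) \<phi>)"
  using assms
proof (induction rule: dfn.induct)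
  case (dfn_E i j)
  show ?case by (rule exI[of _ "Member i j"], rule exI[of _ Inl]) (simp add: subst_def)
next
  case (dfn_eq i j)
  show ?case by (rule exI[of _ "Equal i j"], rule exI[of _ Inl]) (simp add: subst_def)
next
  case (dfn_C i)
  show ?case by (rule exI[of _ "Conj (Equal 0 0) (Neg (Equal 0 0))"], rule exI[of _ Inl]) (simp add: subst_def)
next
  case (dfn_not Q)
  then obtain \<phi> g where "\<forall>i c. g i = Inr c \<longrightarrow> c \<in> M" "\<forall>e. range e \<subseteq> M \<longrightarrow> Q e = sat (subst g e) \<phi>" by blast
  then show ?case by (intro exI[of _ "Neg \<phi>"] exI[of _ g]) simp
next
  case (dfn_conj Q R)
  then obtain \<phi> g \<psi> h where
    q: "\<forall>i c. g i = Inr c \<longrightarrow> c \<in> M" "\<forall>e. range e \<subseteq> M \<longrightarrow> Q e = sat (subst g e) \<phi>" and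
    r: "\<forall>i c. h i = Inr c \<longrightarrow> c \<in> M" "\<forall>e. range e \<subseteq> M \<longrightarrow> R e = sat (subst h e) \<psi>"
    by blast
  \<comment> \<open>Even variables serve the first conjunct and odd ones the second, so the
    assignments \<open>g\<close> and \<open>h\<close> cannot collide.\<close>
  define k where "k i = (if even i then g (i div 2) else h (i div 2))" for i
  have k: "(\<lambda>i. subst k e (2 * i)) = subst g e" "(\<lambda>i. subst k e (Suc (2 * i))) = subst h e" for e
    by (auto simp: subst_def k_def)
  have "c \<in> M" if "k i = Inr c" for i c using that q(1) r(1) unfolding k_def by metis
  moreover have "(Q e \<and> R e) = sat (subst k e) (Conj (ren (\<lambda>i. 2 * i) \<phi>) (ren (\<lambda>i. Suc (2 * i)) \<psi>))"
    if "range e \<subseteq> M" for e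
    using q(2) r(2) that by (simp add: sat_ren k)
  ultimately show ?case by blast
next
  case (dfn_all Q)
  then obtain \<phi> g where
    q: "\<forall>i c. g i = Inr c \<longrightarrow> c \<in> M" "\<forall>e. range e \<subseteq> M \<longrightarrow> Q e = sat (subst g e) \<phi>" by blast
  define h where "h i = (case g i of Inl j \<Rightarrow> Inl (j - 1) | Inr c \<Rightarrow> Inr c)" for i
  \<comment> \<open>All free variables that \<open>g\<close> sends to the quantified variable are
    merged into the bound index 0; the others move past the binder.\<close>
  define f where "f i = (if g i = Inl 0 then 0 else Suc i)" for i
  have "(\<lambda>i. case_nat x (subst h e) (f i)) = subst g (case_nat x e)" for x e
    by (auto simp: fun_eq_iff subst_def h_def f_def split: sum.splits nat.splits)
  then have "(\<forall>x\<in>M. Q (case_nat x e)) = sat (subst h e) (All (ren f \<phi>))" if "range e \<subseteq> M" for e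
    using q(2) range_case_nat[OF _ that] by (simp add: sat_ren)
  moreover have "c \<in> M" if "h i = Inr c" for i c
  proof (cases "g i")
    case (Inr d)
    with that have "d = c" by (simp add: h_def)
    with Inr q(1) show ?thesis by blast
  qed (use that in \<open>simp add: h_def\<close>)
  ultimately show ?case by blast
next
  case (dfn_subst Q k)
  then obtain \<phi> g where
    q: "\<forall>i c. g i = Inr c \<longrightarrow> c \<in> M" "\<forall>e. range e \<subseteq> M \<longrightarrow> Q e = sat (subst g e) \<phi>" by blast
  define h where "h i = (case g i of Inl j \<Rightarrow> k j | Inr c \<Rightarrow> Inr c)" for i
  have "subst h e = subst g (subst k e)" for e
    by (auto simp: fun_eq_iff subst_def h_def split: sum.splits)
  then have "Q (subst k e) = sat (subst h e) \<phi>" if "range e \<subseteq> M" for e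
    using q(2) range_subst[OF that dfn_subst(2)] by auto
  moreover have "c \<in> M" if "h i = Inr c" for i c
  proof (cases "g i")
    case (Inl j)
    with that have "k j = Inr c" by (simp add: h_def)
    then show ?thesis by (rule dfn_subst(2))
  next
    case (Inr d)
    with that have "d = c" by (simp add: h_def)
    with Inr q(1) show ?thesis by blast
  qed
  ultimately show ?case by blast
next
  case (dfn_cong Q Q')
  then show ?case by metis
qed

text \<open>This is the shape in which replacement and separation take their formulas: the arguments
  sit at indices 0 and 1, and \<open>z\<close> fills the remaining variables.\<close>

lemma dfn_sat2:
  assumes "dfn {} (\<lambda>e. Q (e 0) (e (Suc 0)))" "z \<in> M"
  shows "\<exists>\<phi> e. range e \<subseteq> M \<and> (\<forall>x\<in>M. \<forall>y\<in>M. Q x y = sat (case_nat x (case_nat y e)) \<phi>)"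
proof -
  obtain \<phi> g where g: "\<forall>i c. g i = Inr c \<longrightarrow> c \<in> M"
    "\<forall>e. range e \<subseteq> M \<longrightarrow> Q (e 0) (e (Suc 0)) = sat (subst g e) \<phi>"
    using dfn_sat[OF assms(1)] by auto
  define f where "f i = (if g i = Inl 0 then 0 else if g i = Inl (Suc 0) then 1 else Suc (Suc i))" for i
  define e where "e i = (case g i of Inl j \<Rightarrow> z | Inr c \<Rightarrow> c)" for i
  have *: "(\<lambda>i. case_nat x (case_nat y e) (f i)) = subst g (case_nat x (case_nat y (\<lambda>_. z)))" for x y
    by (auto simp: fun_eq_iff subst_def e_def f_def split: sum.splits nat.splits)
  have "Q x y = sat (case_nat x (case_nat y e)) (ren f \<phi>)" if "x \<in> M" "y \<in> M" for x y
  proof -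
    have "range (case_nat x (case_nat y (\<lambda>_. z))) \<subseteq> M"
      using that assms(2) by (auto split: nat.splits)
    from g(2)[rule_format, OF this] show ?thesis by (simp add: sat_ren *)
  qed
  moreover have "e i \<in> M" for i
  proof (cases "g i")
    case (Inr c)
    with g(1) have "c \<in> M" by blast
    with Inr show ?thesis by (simp add: e_def)
  qed (use assms(2) in \<open>simp add: e_def\<close>)
  ultimately show ?thesis by blast
qed

end

section \<open>Set theory inside the model\<close>

locale zf_model = set_structure M E for M :: "'a set" and E :: "'a \<Rightarrow> 'a \<Rightarrow> bool" +
  assumes ZF: ZF
begin

section \<open>Sets of the model as HOL sets\<close>

lemma elts_M: "x \<in> elts y \<Longrightarrow> x \<in> M"
  by (simp add: elts_def)

lemma extn: "a \<in> M \<Longrightarrow> b \<in> M \<Longrightarrow> elts a = elts b \<Longrightarrow> a = b"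
  using ZF by (auto simp: ZF_def extensionality_def)

text \<open>Constructions are carried out on extensions in the set notation of HOL and brought back
  into the model by \<open>mk\<close>; \<open>isset\<close> separates sets of the model from proper
  classes and external sets.\<close>

definition isset :: "'a set \<Rightarrow> bool" where "isset A \<longleftrightarrow> (\<exists>a\<in>M. elts a = A)"

definition mk :: "'a set \<Rightarrow> 'a" where "mk A = (SOME a. a \<in> M \<and> elts a = A)"

lemma mk: assumes "isset A" shows "mk A \<in> M" "elts (mk A) = A"
proof -
  have "\<exists>a. a \<in> M \<and> elts a = A" using assms by (auto simp: isset_def)
  from someI_ex[OF this] show "mk A \<in> M" "elts (mk A) = A" by (auto simp: mk_def)
qed

lemma mk_eq: "a \<in> M \<Longrightarrow> elts a = A \<Longrightarrow> mk A = a"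
  using mk[of A] extn by (auto simp: isset_def)

lemma mk_iff: "isset A \<Longrightarrow> v \<in> M \<Longrightarrow> v = mk A \<longleftrightarrow> elts v = A"
  using mk mk_eq by auto

lemma isset_M: "isset A \<Longrightarrow> A \<subseteq> M"
  by (auto simp: isset_def elts_def)

lemma isset_elts: "a \<in> M \<Longrightarrow> isset (elts a)"
  by (auto simp: isset_def)

lemma M_ne: "\<exists>z. z \<in> M"
  using ZF by (auto simp: ZF_def infinity_def)

lemma isset_sep:
  assumes "isset A" "dfn {} (\<lambda>e. Q (e 0))" shows "isset {x \<in> A. Q x}"
proof -
  obtain a where a: "a \<in> M" "elts a = A" using assms by (auto simp: isset_def)
  obtain \<phi> e where *: "range e \<subseteq> M" "\<forall>x\<in>M. \<forall>y\<in>M. Q x = sat (case_nat x (case_nat y e)) \<phi>"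
    using dfn_sat2[of "\<lambda>x y. Q x", OF assms(2) a(1)] by blast
  have r: "range (case_nat a e) \<subseteq> M" by (rule range_case_nat[OF a(1) *(1)])
  have "\<exists>b\<in>M. elts b = {x \<in> elts a. sat (case_nat x (case_nat a e)) \<phi>}"
    using ZF a(1) r unfolding ZF_def separation_def by blast
  moreover have "{x \<in> elts a. sat (case_nat x (case_nat a e)) \<phi>} = {x \<in> A. Q x}"
    using * a elts_M by auto
  ultimately show ?thesis by (simp add: isset_def)
qed

lemma isset_repl:
  assumes "isset A" "dfn {} (\<lambda>e. R (e 0) (e (Suc 0)))"
    and u: "\<And>x y z. x \<in> A \<Longrightarrow> y \<in> M \<Longrightarrow> z \<in> M \<Longrightarrow> R x y \<Longrightarrow> R x z \<Longrightarrow> y = z"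
  shows "isset {y \<in> M. \<exists>x\<in>A. R x y}"
proof -
  obtain a where a: "a \<in> M" "elts a = A" using assms by (auto simp: isset_def)
  obtain \<phi> e where *: "range e \<subseteq> M" "\<forall>x\<in>M. \<forall>y\<in>M. R x y = sat (case_nat x (case_nat y e)) \<phi>"
    using dfn_sat2[of R, OF assms(2) a(1)] by blast
  have **: "R x y = sat (case_nat x (case_nat y e)) \<phi>" if "x \<in> elts a" "y \<in> M" for x y
    using *(2) elts_M that by blast
  have "\<forall>x\<in>elts a. \<forall>y\<in>M. \<forall>z\<in>M. sat (case_nat x (case_nat y e)) \<phi> \<and> sat (case_nat x (case_nat z e)) \<phi> \<longrightarrow> y = z"
    using ** u a(2) by blast
  then obtain b where b: "b \<in> M" "elts b = {y \<in> M. \<exists>x\<in>elts a. sat (case_nat x (case_nat y e)) \<phi>}"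
    using ZF[unfolded ZF_def replacement_def] a(1) *(1) by blast
  moreover have "{y \<in> M. \<exists>x\<in>elts a. sat (case_nat x (case_nat y e)) \<phi>} = {y \<in> M. \<exists>x\<in>A. R x y}"
    using ** a by blast
  ultimately show ?thesis by (auto simp: isset_def)
qed

lemma isset_pair: "x \<in> M \<Longrightarrow> y \<in> M \<Longrightarrow> isset {x, y}"
  using ZF by (auto simp: ZF_def pairing_def isset_def)

lemma isset_sing: "x \<in> M \<Longrightarrow> isset {x}"
  using isset_pair[of x x] by simp

lemma isset_UN: "isset A \<Longrightarrow> isset (\<Union>y\<in>A. elts y)"
  using ZF by (fastforce simp: ZF_def union_ax_def isset_def)

lemma isset_Un:
  assumes "isset A" "isset B" shows "isset (A \<union> B)"
proof -
  have "isset {mk A, mk B}" by (intro isset_pair mk assms)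
  from isset_UN[OF this] show ?thesis by (simp add: mk assms)
qed

lemma isset_insert: "x \<in> M \<Longrightarrow> isset A \<Longrightarrow> isset (insert x A)"
  using isset_Un[OF isset_sing, of x A] by simp

lemma isset_empty: "isset {}"
proof -
  obtain z where "z \<in> M" using M_ne by blast
  from isset_sep[OF isset_elts[OF this] df_False] show ?thesis by simp
qed

definition Pw :: "'a set \<Rightarrow> 'a set" where "Pw A = {y \<in> M. elts y \<subseteq> A}"

lemma isset_Pw: "isset A \<Longrightarrow> isset (Pw A)"
  using ZF by (fastforce simp: ZF_def power_set_def isset_def Pw_def)

definition emp :: 'a where "emp = mk {}"
definition pr :: "'a \<Rightarrow> 'a \<Rightarrow> 'a" where "pr x y = mk {mk {x}, mk {x, y}}"
definition suc :: "'a \<Rightarrow> 'a" where "suc x = mk (insert x (elts x))"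

lemma emp [simp]: "emp \<in> M" "elts emp = {}"
  by (simp_all add: emp_def mk isset_empty)

lemma pr_M: "x \<in> M \<Longrightarrow> y \<in> M \<Longrightarrow> pr x y \<in> M"
  by (simp add: pr_def mk isset_pair isset_sing)

lemma suc_M [simp]: "x \<in> M \<Longrightarrow> suc x \<in> M"
  by (simp add: suc_def mk isset_insert isset_elts)

lemma elts_suc [simp]: "x \<in> M \<Longrightarrow> elts (suc x) = insert x (elts x)"
  by (simp add: suc_def mk isset_insert isset_elts)

lemma is_opair: "x \<in> M \<Longrightarrow> y \<in> M \<Longrightarrow> p \<in> M \<Longrightarrow> is_opair p x y \<longleftrightarrow> p = pr x y"
  unfolding is_opair_def pr_def
  by (metis isset_pair isset_sing mk mk_eq)

lemma pr_inj [simp]: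
  assumes "x \<in> M" "y \<in> M" "x' \<in> M" "y' \<in> M"
  shows "pr x y = pr x' y' \<longleftrightarrow> x = x' \<and> y = y'"
proof
  assume eq: "pr x y = pr x' y'"
  have mM: "mk {a} \<in> M" "mk {a, b} \<in> M" "elts (mk {a}) = {a}" "elts (mk {a, b}) = {a, b}"
    if "a \<in> M" "b \<in> M" for a b
    using that by (simp_all add: mk isset_sing isset_pair)
  have pe: "elts ` elts (pr a b) = {{a}, {a, b}}" if "a \<in> M" "b \<in> M" for a b
    using mM[OF that] by (simp add: pr_def mk isset_pair)
  have "{{x}, {x, y}} = {{x'}, {x', y'}}"
    using pe[of x y] pe[of x' y'] eq assms by simp
  then show "x = x' \<and> y = y'" by (auto simp: doubleton_eq_iff)
qed auto

lemma is_opair_M: "is_opair p x y \<Longrightarrow> x \<in> M \<and> y \<in> M"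
  unfolding is_opair_def by (metis elts_M insertI1 insertI2)

lemma graph_iff: "(x, y) \<in> graph r \<longleftrightarrow> x \<in> M \<and> y \<in> M \<and> pr x y \<in> elts r"
  unfolding graph_def using is_opair elts_M pr_M by auto

lemma tm_emp [df]: "tm C (\<lambda>e. emp)" by (intro df) simp

lemma tm_pr0: "tm C (\<lambda>e. pr (e 0) (e (Suc 0)))"
proof (rule tmI[where S="\<lambda>v e. \<exists>a\<in>M. \<exists>b\<in>M. elts a = {u\<in>M. u = e 0} \<and> elts b = {u\<in>M. u = e 0 \<or> u = e (Suc 0)} \<and> elts v = {u\<in>M. u = a \<or> u = b}"], goal_cases)
  case (1 e) then show ?case by (intro pr_M envD)
next
  case (2 e v)
  have e: "e 0 \<in> M" "e (Suc 0) \<in> M" using 2 by (auto dest: envD)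
  have *: "{u\<in>M. u = e 0} = {e 0}" "{u\<in>M. u = e 0 \<or> u = e (Suc 0)} = {e 0, e (Suc 0)}"
    using e by auto
  have **: "{u\<in>M. u = a \<or> u = b} = {a, b}" if "a \<in> M" "b \<in> M" for a b using that by auto
  show ?case unfolding is_opair[OF e \<open>v \<in> M\<close>, symmetric] is_opair_def *
    by (intro bex_cong refl) (auto simp: **)
next
  case 3 show ?case by (intro df)
qed

lemmas tm_pr [df] = tm_inst2[where F=pr, OF tm_pr0]

lemma tm_suc0: "tm C (\<lambda>e. suc (e 0))"
proof (rule tmI[where S="\<lambda>v e. elts v = {u\<in>M. u = e 0 \<or> u \<in> elts (e 0)}"], goal_cases)
  case (1 e) then show ?case by (intro suc_M envD)
next
  case (2 e v)
  then have "{u\<in>M. u = e 0 \<or> u \<in> elts (e 0)} = insert (e 0) (elts (e 0))"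
    using envD elts_M by blast
  with 2 show ?case by (simp add: suc_def mk_iff isset_insert isset_elts envD)
next
  case 3 show ?case by (intro df)
qed

lemmas tm_suc [df] = tm_inst1[where F=suc, OF tm_suc0]

definition prd :: "'a set \<Rightarrow> 'a set \<Rightarrow> 'a set" where "prd A B = {pr x y |x y. x \<in> A \<and> y \<in> B}"

text \<open>Separation from the double power set of the union, where Kuratowski pairs live.\<close>

lemma isset_prd:
  assumes "isset A" "isset B" shows "isset (prd A B)"
proof -
  let ?X = "Pw (Pw (A \<union> B))"
  have "isset {p \<in> ?X. \<exists>x\<in>elts (mk A). \<exists>y\<in>elts (mk B). p = pr x y}"
    by (rule isset_sep) (intro isset_Pw isset_Un assms df mk)+
  moreover have "pr x y \<in> ?X" if "x \<in> A" "y \<in> B" for x y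
  proof -
    have m: "x \<in> M" "y \<in> M" using that assms isset_M by auto
    then have "mk {x} \<in> Pw (A \<union> B)" "mk {x, y} \<in> Pw (A \<union> B)"
      using that by (auto simp: Pw_def mk isset_sing isset_pair)
    moreover have "elts (pr x y) = {mk {x}, mk {x, y}}"
      using m by (simp add: pr_def mk isset_sing isset_pair)
    ultimately show ?thesis using m by (auto simp: Pw_def pr_M)
  qed
  ultimately show ?thesis
    by (auto simp: prd_def mk assms elim!: back_subst[of isset])
qed

lemma foundE: "x \<in> M \<Longrightarrow> y \<in> elts x \<Longrightarrow> \<exists>y\<in>elts x. elts y \<inter> elts x = {}"
  using ZF by (auto simp: ZF_def foundation_def)

lemma notin_self [simp]: "x \<notin> elts x"
proof
  assume x: "x \<in> elts x"
  then have "x \<in> M" by (rule elts_M)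
  with x show False using foundE[of "mk {x}" x] by (auto simp: mk isset_sing)
qed

lemma notin_cycle: "x \<in> elts y \<Longrightarrow> y \<in> elts x \<Longrightarrow> False"
proof -
  assume *: "x \<in> elts y" "y \<in> elts x"
  then have "x \<in> M" "y \<in> M" by (auto dest: elts_M)
  with * show False using foundE[of "mk {x, y}" x] by (auto simp: mk isset_pair)
qed

section \<open>The natural numbers of the model\<close>

lemma is_succ_iff: "n \<in> M \<Longrightarrow> s \<in> M \<Longrightarrow> is_succ s n \<longleftrightarrow> s = suc n"
  by (auto simp: is_succ_def intro: extn)

lemma inductive_set_of_iff:
  "v \<in> M \<Longrightarrow> inductive_set_of v \<longleftrightarrow> emp \<in> elts v \<and> (\<forall>n\<in>elts v. suc n \<in> elts v)"
  unfolding inductive_set_of_def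
  by (metis (full_types) elts_M emp extn is_succ_iff suc_M)

lemma omega_ex: "\<exists>w\<in>M. is_omega w"
proof -
  obtain w where w: "w \<in> M" "inductive_set_of w" using ZF by (auto simp: ZF_def infinity_def)
  let ?Q = "\<lambda>x. \<forall>v\<in>M. emp \<in> elts v \<and> (\<forall>n\<in>elts v. suc n \<in> elts v) \<longrightarrow> x \<in> elts v"
  have "isset {x \<in> elts w. ?Q x}"
    by (rule isset_sep) (intro isset_elts w df)+
  then obtain o' where o: "o' \<in> M" "elts o' = {x \<in> elts w. ?Q x}" by (auto simp: isset_def)
  then have "is_omega o'" using w unfolding is_omega_def
    by (auto simp: inductive_set_of_iff)
  with o show ?thesis by blast
qed

definition w :: 'a where "w = (SOME w. w \<in> M \<and> is_omega w)"
abbreviation Om :: "'a set" where "Om \<equiv> elts w"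

lemma w: "w \<in> M" "is_omega w"
  using someI_ex[of "\<lambda>w. w \<in> M \<and> is_omega w"] omega_ex by (auto simp: w_def)

lemma w_unique: "v \<in> M \<Longrightarrow> is_omega v \<Longrightarrow> v = w"
  using w by (auto simp: is_omega_def intro!: extn)

lemma tm_w [df]: "tm C (\<lambda>e. w)" by (intro df w)

lemma emp_Om [simp]: "emp \<in> Om" and suc_Om [simp]: "n \<in> Om \<Longrightarrow> suc n \<in> Om"
  using w by (auto simp: is_omega_def inductive_set_of_iff)

lemma Om_M: "n \<in> Om \<Longrightarrow> n \<in> M" by (rule elts_M)

text \<open>\<open>Om\<close> may be nonstandard, so induction is available only for definable
  properties. The case \<open>dfn\<close> that opens the inductions below is the price.\<close>

lemma Om_induct0 [consumes 1, case_names dfn zero suc]: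
  assumes n: "n \<in> Om" and d: "dfn {} (\<lambda>e. Q (e 0))" and 0: "Q emp"
    and s: "\<And>n. n \<in> Om \<Longrightarrow> Q n \<Longrightarrow> Q (suc n)"
  shows "Q n"
proof -
  obtain v where v: "v \<in> M" "elts v = {n \<in> Om. Q n}"
    using isset_sep[OF isset_elts[OF w(1)] d] by (auto simp: isset_def)
  then have "inductive_set_of v" using 0 s by (simp add: inductive_set_of_iff)
  then have "Om \<subseteq> elts v" using w v by (auto simp: is_omega_def)
  with v n show ?thesis by blast
qed

lemma Om_elts: "n \<in> Om \<Longrightarrow> elts n \<subseteq> Om"
  by (induction n rule: Om_induct0) (intro df w, auto simp: Om_M)

lemma Om_trans: "k \<in> elts n \<Longrightarrow> n \<in> Om \<Longrightarrow> k \<in> Om" using Om_elts by blast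

lemma Om_sub: "n \<in> Om \<Longrightarrow> \<forall>k\<in>elts n. elts k \<subseteq> elts n"
  by (induction n rule: Om_induct0) (intro df, auto simp: Om_M)

lemma Om_less_trans: "n \<in> Om \<Longrightarrow> k \<in> elts n \<Longrightarrow> l \<in> elts k \<Longrightarrow> l \<in> elts n"
  using Om_sub by blast

lemma emp_elts_suc: "n \<in> Om \<Longrightarrow> n = emp \<or> emp \<in> elts n"
  by (induction n rule: Om_induct0) (intro df, auto simp: Om_M)

lemma Om_cases: "n \<in> Om \<Longrightarrow> n = emp \<or> (\<exists>m\<in>Om. n = suc m)"
  by (induction n rule: Om_induct0) (intro df, auto simp: Om_M)

lemma suc_ne [simp]: "n \<in> M \<Longrightarrow> suc n \<noteq> emp" "n \<in> M \<Longrightarrow> emp \<noteq> suc n"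
  by (metis elts_suc emp(2) insert_not_empty)+

lemma suc_inj [simp]: "n \<in> M \<Longrightarrow> m \<in> M \<Longrightarrow> suc n = suc m \<longleftrightarrow> n = m"
  by (metis elts_suc insertCI insertE notin_cycle)

lemma suc_mono: "n \<in> Om \<Longrightarrow> \<forall>k\<in>elts n. suc k = n \<or> suc k \<in> elts n"
  by (induction n rule: Om_induct0) (intro df, auto simp: Om_M)

lemma Om_linear: "n \<in> Om \<Longrightarrow> \<forall>k\<in>Om. k \<in> elts n \<or> k = n \<or> n \<in> elts k"
proof (induction n rule: Om_induct0)
  case dfn show ?case by (intro df)
next
  case zero then show ?case using emp_elts_suc by blast
next
  case (suc n)
  show ?case
  proof
    fix k assume "k \<in> Om"
    then show "k \<in> elts (suc n) \<or> k = suc n \<or> suc n \<in> elts k"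
      using suc suc_mono[of k] by (auto simp: Om_M)
  qed
qed

section \<open>Transitive closures and membership induction\<close>

definition un :: "'a \<Rightarrow> 'a" where "un v = mk (\<Union>y\<in>elts v. elts y)"

lemma un: "v \<in> M \<Longrightarrow> un v \<in> M" "v \<in> M \<Longrightarrow> elts (un v) = (\<Union>y\<in>elts v. elts y)"
  by (simp_all add: un_def mk isset_UN isset_elts)

lemma tm_un0: "tm C (\<lambda>e. un (e 0))"
proof (rule tmI[where S="\<lambda>v e. elts v = {u\<in>M. \<exists>y\<in>elts (e 0). u \<in> elts y}"], goal_cases)
  case (1 e) then show ?case by (intro un envD)
next
  case (2 e v)
  then have "{u\<in>M. \<exists>y\<in>elts (e 0). u \<in> elts y} = (\<Union>y\<in>elts (e 0). elts y)"
    using elts_M by blast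
  with 2 show ?case by (simp add: un_def mk_iff isset_UN isset_elts envD)
next
  case 3 show ?case by (intro df)
qed

lemmas tm_un [df] = tm_inst1[where F=un, OF tm_un0]

text \<open>\<open>f\<close> approximates the iteration of unions up to step \<open>n\<close>. It
  may contain further pairs, which is why \<open>iter_unique\<close> compares values only within
  both ranges.\<close>

definition iter :: "'a \<Rightarrow> 'a \<Rightarrow> 'a \<Rightarrow> bool" where
  "iter x n f \<longleftrightarrow> pr emp x \<in> elts f \<and>
     (\<forall>k\<in>elts (suc n). \<exists>v\<in>M. pr k v \<in> elts f \<and> (\<forall>u\<in>M. pr k u \<in> elts f \<longrightarrow> u = v)) \<and>
     (\<forall>k\<in>elts n. \<forall>v\<in>M. pr k v \<in> elts f \<longrightarrow> pr (suc k) (un v) \<in> elts f)"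

lemma df_iter0: "dfn C (\<lambda>e. iter (e 0) (e (Suc 0)) (e (Suc (Suc 0))))"
  unfolding iter_def by (intro df)

lemmas df_iter [df] = inst3[where S=iter, OF df_iter0]

lemma iter_unique:
  assumes "x \<in> M" "k \<in> Om"
  shows "\<forall>n\<in>Om. \<forall>n'\<in>Om. \<forall>f\<in>M. \<forall>f'\<in>M. \<forall>v\<in>M. \<forall>v'\<in>M. iter x n f \<longrightarrow> iter x n' f' \<longrightarrow> k \<in> elts (suc n) \<longrightarrow>
     k \<in> elts (suc n') \<longrightarrow> pr k v \<in> elts f \<longrightarrow> pr k v' \<in> elts f' \<longrightarrow> v = v'"
  using assms(2)
proof (induction k rule: Om_induct0)
  case dfn show ?case by (intro df assms w)
next
  case zero
  show ?case using assms(1) unfolding iter_def by metis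
next
  case (suc k)
  show ?case
  proof (intro ballI impI)
    fix n n' f f' v v'
    assume n: "n \<in> Om" "n' \<in> Om" and M: "f \<in> M" "f' \<in> M" "v \<in> M" "v' \<in> M"
      and i: "iter x n f" "iter x n' f'" and k: "suc k \<in> elts (suc n)" "suc k \<in> elts (suc n')"
      and v: "pr (suc k) v \<in> elts f" "pr (suc k) v' \<in> elts f'"
    have "k \<in> elts (suc k)" using suc by (simp add: Om_M)
    then have kn: "k \<in> elts n" "k \<in> elts n'"
      using k n Om_less_trans[of n "suc k" k] Om_less_trans[of n' "suc k" k] by (auto simp: Om_M)
    then have kn': "k \<in> elts (suc n)" "k \<in> elts (suc n')" using n by (auto simp: Om_M)
    obtain u u' where u: "u \<in> M" "pr k u \<in> elts f" "u' \<in> M" "pr k u' \<in> elts f'"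
      using i kn' unfolding iter_def by metis
    then have "u = u'" using suc(2) n M i kn' by blast
    moreover have "pr (suc k) (un u) \<in> elts f" "pr (suc k) (un u') \<in> elts f'"
      using i kn u unfolding iter_def by auto
    moreover have "un u \<in> M" "un u' \<in> M" using u by (auto intro: un)
    ultimately show "v = v'" using i k v M unfolding iter_def by metis
  qed
qed

lemma iter_exists:
  assumes x: "x \<in> M" and n: "n \<in> Om"
  shows "\<exists>f\<in>M. iter x n f"
  using n
proof (induction n rule: Om_induct0)
  case dfn show ?case by (intro df assms)
next
  case zero
  have f: "mk {pr emp x} \<in> M" "elts (mk {pr emp x}) = {pr emp x}"
    using x by (auto simp: mk isset_sing pr_M)
  have "iter x emp (mk {pr emp x})"
    using x by (auto simp: iter_def f)
  with f show ?case by blast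
next
  case (suc n)
  then obtain f where f: "f \<in> M" "iter x n f" by blast
  obtain v where v: "v \<in> M" "pr n v \<in> elts f" "\<forall>u\<in>M. pr n u \<in> elts f \<longrightarrow> u = v"
    using f(2) suc(1) by (auto simp: iter_def Om_M)
  \<comment> \<open>Pairs of \<open>f\<close> beyond position \<open>n\<close> are dropped:
    \<open>iter\<close> does not control them, and they could clash with the new value at
    \<open>suc n\<close>.\<close>
  define B where "B = {p \<in> elts f. \<exists>k\<in>elts (suc n). \<exists>u\<in>M. p = pr k u}"
  have nM: "n \<in> M" using suc Om_M by blast
  have "isset B" unfolding B_def by (rule isset_sep) (intro isset_elts f df nM)+
  define g where "g = mk (insert (pr (suc n) (un v)) B)"
  have g: "g \<in> M" "elts g = insert (pr (suc n) (un v)) B"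
    unfolding g_def using nM by (auto intro!: mk isset_insert \<open>isset B\<close> pr_M un v)
  have old: "pr k u \<in> elts g \<longleftrightarrow> pr k u \<in> elts f" if "k \<in> elts (suc n)" "u \<in> M" for k u
  proof -
    have "k \<in> M" "k \<noteq> suc n" using that elts_M notin_self by auto
    with that show ?thesis by (auto simp: g B_def nM un v)
  qed
  have new: "pr (suc n) u \<in> elts g \<longleftrightarrow> u = un v" if "u \<in> M" for u
  proof -
    have "pr (suc n) u \<notin> B"
    proof
      assume "pr (suc n) u \<in> B"
      then obtain k u' where "k \<in> elts (suc n)" "u' \<in> M" "pr (suc n) u = pr k u'" by (auto simp: B_def)
      then have "suc n \<in> elts (suc n)" using that nM elts_M by auto
      then show False using notin_self by blast
    qed
    then show ?thesis using that by (auto simp: g nM un v)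
  qed
  have "iter x (suc n) g"
    unfolding iter_def
  proof (intro conjI ballI impI)
    have "emp \<in> elts (suc n)" using suc(1) emp_elts_suc[of "suc n"] nM suc_Om by (metis suc_ne(1))
    then show "pr emp x \<in> elts g" using f(2) x by (simp add: old iter_def del: elts_suc)
  next
    fix k assume "k \<in> elts (suc (suc n))"
    then consider "k = suc n" | "k \<in> elts (suc n)" using nM by auto
    then show "\<exists>v\<in>M. pr k v \<in> elts g \<and> (\<forall>u\<in>M. pr k u \<in> elts g \<longrightarrow> u = v)"
    proof cases
      case 1 then show ?thesis using new un(1)[OF v(1)] by blast
    next
      case 2
      then obtain u where "u \<in> M" "pr k u \<in> elts f" "\<forall>u'\<in>M. pr k u' \<in> elts f \<longrightarrow> u' = u"
        using f(2) unfolding iter_def by blast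
      with 2 old show ?thesis by blast
    qed
  next
    fix k u assume k: "k \<in> elts (suc n)" and u: "u \<in> M" "pr k u \<in> elts g"
    then have uf: "pr k u \<in> elts f" using old by blast
    show "pr (suc k) (un u) \<in> elts g"
    proof (cases "k = n")
      case True
      with uf u v have "u = v" by blast
      with True show ?thesis using new un(1)[OF v(1)] by simp
    next
      case False
      then have kn: "k \<in> elts n" using k nM by auto
      then have "pr (suc k) (un u) \<in> elts f" using f(2) u uf by (auto simp: iter_def)
      moreover have "suc k \<in> elts (suc n)" using suc_mono suc(1) kn nM by auto
      ultimately show ?thesis using old un u by blast
    qed
  qed
  with g show ?case by blast
qed

text \<open>The finite iterates of union are collected by replacement; the elements of an element of
  one iterate belong to the next iterate.\<close>

lemma trans_closure:
  assumes x: "x \<in> M"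
  shows "\<exists>t\<in>M. x \<in> elts t \<and> (\<forall>y\<in>elts t. elts y \<subseteq> elts t)"
proof -
  let ?R = "\<lambda>n v. \<exists>f\<in>M. iter x n f \<and> pr n v \<in> elts f"
  have "isset {v \<in> M. \<exists>n\<in>Om. ?R n v}"
  proof (rule isset_repl)
    show "dfn {} (\<lambda>e. \<exists>f\<in>M. iter x (e 0) f \<and> pr (e 0) (e (Suc 0)) \<in> elts f)" by (intro df x)
    fix n y z assume "n \<in> Om" "y \<in> M" "z \<in> M" "?R n y" "?R n z"
    then show "y = z" using iter_unique[OF x, of n] by (auto simp: Om_M)
  qed (intro isset_elts w)
  then obtain l where l: "l \<in> M" "elts l = {v \<in> M. \<exists>n\<in>Om. ?R n v}" by (auto simp: isset_def)
  obtain f where f: "f \<in> M" "iter x emp f" using iter_exists[OF x emp_Om] by blast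
  have "pr emp x \<in> elts f" using f(2) by (simp add: iter_def)
  then have xl: "x \<in> elts l" using l x f emp_Om by blast
  have step: "un v \<in> elts l" if vl: "v \<in> elts l" for v
  proof -
    obtain n f where n: "n \<in> Om" "f \<in> M" "iter x n f" "pr n v \<in> elts f" and v: "v \<in> M"
      using vl l by auto
    have nM: "n \<in> M" using n Om_M by blast
    obtain g where g: "g \<in> M" "iter x (suc n) g" using iter_exists[OF x suc_Om[OF n(1)]] by blast
    then obtain u where u: "u \<in> M" "pr n u \<in> elts g" unfolding iter_def
      using nM by (metis elts_suc insertCI suc_M)
    then have "u = v" using iter_unique[OF x n(1)] n g v nM
      by (metis elts_suc insertCI suc_M suc_Om)
    then have "pr (suc n) (un v) \<in> elts g" using g u nM unfolding iter_def by auto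
    with g n v show ?thesis unfolding l using un(1) suc_Om by blast
  qed
  have t: "isset (insert x (\<Union>v\<in>elts l. elts v))" by (intro isset_insert x isset_UN isset_elts l)
  show ?thesis
  proof (intro bexI[of _ "mk (insert x (\<Union>v\<in>elts l. elts v))"] conjI ballI)
    fix y assume "y \<in> elts (mk (insert x (\<Union>v\<in>elts l. elts v)))"
    then consider "y = x" | v where "v \<in> elts l" "y \<in> elts v" by (auto simp: mk t)
    then show "elts y \<subseteq> elts (mk (insert x (\<Union>v\<in>elts l. elts v)))"
    proof cases
      case 1 with xl show ?thesis by (auto simp: mk t)
    next
      case 2
      then have "elts y \<subseteq> elts (un v)" using un elts_M by blast
      with step[OF 2(1)] show ?thesis by (auto simp: mk t)
    qed
  qed (auto simp: mk t)
qed

text \<open>The class of all counterexamples need not be a set, so foundation is applied to those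
  inside a transitive set.\<close>

lemma eps_induct [consumes 1, case_names dfn step]:
  assumes x: "x \<in> M" and d: "dfn {} (\<lambda>e. Q (e 0))"
    and s: "\<And>x. x \<in> M \<Longrightarrow> (\<And>y. y \<in> elts x \<Longrightarrow> Q y) \<Longrightarrow> Q x"
  shows "Q x"
proof (rule ccontr)
  assume "\<not> Q x"
  obtain t where t: "t \<in> M" "x \<in> elts t" "\<forall>y\<in>elts t. elts y \<subseteq> elts t" using trans_closure[OF x] by blast
  have b: "isset {y \<in> elts t. \<not> Q y}" by (rule isset_sep) (intro isset_elts t df d)+
  then obtain y where "y \<in> elts t" "\<not> Q y" "elts y \<inter> {y \<in> elts t. \<not> Q y} = {}"
    using foundE[of "mk {y \<in> elts t. \<not> Q y}" x] \<open>\<not> Q x\<close> t by (auto simp: mk)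
  with s[of y] t elts_M show False by blast
qed

text \<open>The default \<open>emp\<close> makes application total, hence a definable term without
  side conditions.\<close>

definition ap :: "'a \<Rightarrow> 'a \<Rightarrow> 'a" where
  "ap f x = (if \<exists>!y. y \<in> M \<and> pr x y \<in> elts f then THE y. y \<in> M \<and> pr x y \<in> elts f else emp)"

lemma ap_eq: "y \<in> M \<Longrightarrow> pr x y \<in> elts f \<Longrightarrow> (\<And>z. z \<in> M \<Longrightarrow> pr x z \<in> elts f \<Longrightarrow> z = y) \<Longrightarrow> ap f x = y"
proof -
  assume *: "y \<in> M" "pr x y \<in> elts f" "\<And>z. z \<in> M \<Longrightarrow> pr x z \<in> elts f \<Longrightarrow> z = y"
  then have "\<exists>!y. y \<in> M \<and> pr x y \<in> elts f" by blast
  moreover have "(THE y. y \<in> M \<and> pr x y \<in> elts f) = y" by (rule the_equality) (use * in blast)+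
  ultimately show ?thesis by (simp add: ap_def)
qed

lemma ap_M [simp]: "ap f x \<in> M"
  unfolding ap_def using theI'[of "\<lambda>y. y \<in> M \<and> pr x y \<in> elts f"] by auto

lemma tm_ap0: "tm C (\<lambda>e. ap (e 0) (e (Suc 0)))"
proof (rule tmI[where S="\<lambda>v e. (pr (e (Suc 0)) v \<in> elts (e 0) \<and> (\<forall>z\<in>M. pr (e (Suc 0)) z \<in> elts (e 0) \<longrightarrow> z = v)) \<or>
    (v = emp \<and> \<not> (\<exists>u\<in>M. pr (e (Suc 0)) u \<in> elts (e 0) \<and> (\<forall>z\<in>M. pr (e (Suc 0)) z \<in> elts (e 0) \<longrightarrow> z = u)))"], goal_cases)
  case (2 e v)
  let ?P = "\<lambda>y. y \<in> M \<and> pr (e (Suc 0)) y \<in> elts (e 0)"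
  show ?case
  proof (cases "\<exists>!y. ?P y")
    case True
    then obtain y where y: "?P y" "\<And>z. ?P z \<Longrightarrow> z = y" by blast
    then have "ap (e 0) (e (Suc 0)) = y" by (intro ap_eq) blast+
    with y 2 show ?thesis by metis
  next
    case False
    then have "ap (e 0) (e (Suc 0)) = emp" by (simp add: ap_def)
    with False 2 show ?thesis by metis
  qed
next
  case 3 show ?case by (intro df)
qed simp

lemmas tm_ap [df] = tm_inst2[where F=ap, OF tm_ap0]

lemma maps_iff:
  assumes "A \<subseteq> M" "B \<subseteq> M"
  shows "maps f A B \<longleftrightarrow> (\<forall>p\<in>elts f. \<exists>x\<in>A. \<exists>y\<in>B. p = pr x y) \<and>
     (\<forall>x\<in>A. \<exists>y\<in>M. pr x y \<in> elts f \<and> (\<forall>z\<in>M. pr x z \<in> elts f \<longrightarrow> z = y))"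
proof -
  have "(\<forall>p\<in>elts f. \<exists>x\<in>A. \<exists>y\<in>B. is_opair p x y) \<longleftrightarrow> (\<forall>p\<in>elts f. \<exists>x\<in>A. \<exists>y\<in>B. p = pr x y)"
    by (intro ball_cong bex_cong refl is_opair) (use assms elts_M in auto)
  moreover have "(\<exists>!y. (x, y) \<in> graph f) \<longleftrightarrow> (\<exists>y\<in>M. pr x y \<in> elts f \<and> (\<forall>z\<in>M. pr x z \<in> elts f \<longrightarrow> z = y))"
    if "x \<in> A" for x
  proof -
    have "x \<in> M" using assms that by blast
    then have "(\<exists>!y. (x, y) \<in> graph f) \<longleftrightarrow> (\<exists>y. (y \<in> M \<and> pr x y \<in> elts f) \<and> (\<forall>z. z \<in> M \<and> pr x z \<in> elts f \<longrightarrow> z = y))"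
      by (simp add: graph_iff Ex1_def)
    then show ?thesis unfolding Bex_def Ball_def imp_conjL by simp
  qed
  then have "(\<forall>x\<in>A. \<exists>!y. (x, y) \<in> graph f) \<longleftrightarrow>
      (\<forall>x\<in>A. \<exists>y\<in>M. pr x y \<in> elts f \<and> (\<forall>z\<in>M. pr x z \<in> elts f \<longrightarrow> z = y))"
    by (intro ball_cong refl)
  ultimately show ?thesis by (simp only: maps_def)
qed

lemma df_maps0: "dfn C (\<lambda>e. maps (e 0) (elts (e (Suc 0))) (elts (e (Suc (Suc 0)))))"
proof (rule dfn_cong)
  show "dfn C (\<lambda>e. (\<forall>p\<in>elts (e 0). \<exists>x\<in>elts (e (Suc 0)). \<exists>y\<in>elts (e (Suc (Suc 0))). p = pr x y) \<and>
     (\<forall>x\<in>elts (e (Suc 0)). \<exists>y\<in>M. pr x y \<in> elts (e 0) \<and> (\<forall>z\<in>M. pr x z \<in> elts (e 0) \<longrightarrow> z = y)))"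
    by (intro df)
qed (auto simp: maps_iff[OF subsetI subsetI, OF elts_M elts_M])

lemmas df_maps [df] = inst3[where S="\<lambda>f a b. maps f (elts a) (elts b)", OF df_maps0]

lemma maps_ap:
  assumes "maps f A B" "A \<subseteq> M" "B \<subseteq> M" "x \<in> A"
  shows "ap f x \<in> B" "pr x (ap f x) \<in> elts f" "y \<in> M \<Longrightarrow> pr x y \<in> elts f \<longleftrightarrow> y = ap f x"
proof -
  have m: "\<forall>p\<in>elts f. \<exists>x\<in>A. \<exists>y\<in>B. p = pr x y"
    "\<forall>x\<in>A. \<exists>y\<in>M. pr x y \<in> elts f \<and> (\<forall>z\<in>M. pr x z \<in> elts f \<longrightarrow> z = y)"
    using assms(1) unfolding maps_iff[OF assms(2,3)] by blast+
  obtain y0 where y0: "y0 \<in> M" "pr x y0 \<in> elts f" "\<forall>z\<in>M. pr x z \<in> elts f \<longrightarrow> z = y0"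
    using m(2) assms(4) by blast
  then have "ap f x = y0" by (intro ap_eq) blast+
  then show "pr x (ap f x) \<in> elts f" "y \<in> M \<Longrightarrow> pr x y \<in> elts f \<longleftrightarrow> y = ap f x" using y0 by blast+
  from y0 obtain x' y' where "x' \<in> A" "y' \<in> B" "pr x y0 = pr x' y'" using m(1) by blast
  then have "y0 = y'" using assms(2-4) y0(1) pr_inj[of x y0 x' y'] by blast
  with \<open>ap f x = y0\<close> \<open>y' \<in> B\<close> show "ap f x \<in> B" by simp
qed

lemma maps_ext:
  assumes "f \<in> M" "g \<in> M" "maps f A B" "maps g A B" "A \<subseteq> M" "B \<subseteq> M" "\<And>x. x \<in> A \<Longrightarrow> ap f x = ap g x"
  shows "f = g"
proof (rule extn)
  have *: "elts f = (\<lambda>x. pr x (ap f x)) ` A" if m: "maps f A B" for f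
  proof (intro set_eqI iffI)
    fix p assume p: "p \<in> elts f"
    then obtain x y where "x \<in> A" "y \<in> B" "p = pr x y"
      using m unfolding maps_iff[OF assms(5,6)] by blast
    with p maps_ap(3)[OF m assms(5,6), of x y] assms show "p \<in> (\<lambda>x. pr x (ap f x)) ` A" by auto
  qed (use maps_ap(2)[OF m assms(5,6)] in auto)
  show "elts f = elts g" unfolding *[OF assms(3)] *[OF assms(4)] by (intro image_cong refl) (simp add: assms(7))
qed (use assms in auto)

lemma maps_ex:
  assumes A: "isset A" and B: "isset B" and d: "dfn {} (\<lambda>e. Q (e 0) (e (Suc 0)))"
    and Q: "\<And>x. x \<in> A \<Longrightarrow> \<exists>y. y \<in> B \<and> Q x y \<and> (\<forall>z. z \<in> B \<and> Q x z \<longrightarrow> z = y)"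
  shows "\<exists>f\<in>M. maps f A B \<and> (\<forall>x\<in>A. Q x (ap f x))"
proof -
  have M: "A \<subseteq> M" "B \<subseteq> M" using A B isset_M by auto
  have "isset {p \<in> prd A B. \<exists>x\<in>M. \<exists>y\<in>M. p = pr x y \<and> Q x y}"
    by (rule isset_sep) (intro isset_prd A B df inst2[where S=Q, OF d])+
  then obtain f where f: "f \<in> M" "elts f = {p \<in> prd A B. \<exists>x\<in>M. \<exists>y\<in>M. p = pr x y \<and> Q x y}"
    by (auto simp: isset_def)
  have *: "pr x y \<in> elts f \<longleftrightarrow> y \<in> B \<and> Q x y" if "x \<in> A" "y \<in> M" for x y
    using that M by (auto simp: f prd_def subset_iff)
  have m: "maps f A B"
    unfolding maps_iff[OF M]
  proof (intro conjI ballI)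
    fix x assume x: "x \<in> A"
    then obtain y where "y \<in> B" "Q x y" "\<forall>z. z \<in> B \<and> Q x z \<longrightarrow> z = y" using Q by blast
    with x M * show "\<exists>y\<in>M. pr x y \<in> elts f \<and> (\<forall>z\<in>M. pr x z \<in> elts f \<longrightarrow> z = y)"
      by blast
  qed (auto simp: f prd_def)
  with f * maps_ap(2)[OF m M] show ?thesis by (intro bexI[of _ f]) auto
qed

lemma OmM: "Om \<subseteq> M" by (auto intro: Om_M)

lemma eltsM: "elts x \<subseteq> M" by (auto intro: elts_M)

declare w(1) [df] emp(1) [df]

section \<open>Finite sequences, recursion and coding\<close>

definition fsq :: "'a \<Rightarrow> 'a \<Rightarrow> bool" where
  "fsq n t \<longleftrightarrow> n \<in> Om \<and> t \<in> M \<and> maps t (elts n) Om"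

lemma df_fsq0: "dfn C (\<lambda>e. fsq (e 0) (e (Suc 0)))"
  unfolding fsq_def by (intro df)

lemmas df_fsq [df] = inst2[where S=fsq, OF df_fsq0]

lemma fsqD: "fsq n t \<Longrightarrow> n \<in> Om" "fsq n t \<Longrightarrow> t \<in> M" "fsq n t \<Longrightarrow> n \<in> M"
  by (auto simp: fsq_def Om_M)

lemma fsq_ap: "fsq n t \<Longrightarrow> k \<in> elts n \<Longrightarrow> ap t k \<in> Om"
  using maps_ap(1)[OF _ eltsM OmM] by (auto simp: fsq_def)

lemma fsq_dom: "fsq n t \<Longrightarrow> elts n = {x \<in> M. \<exists>y\<in>M. pr x y \<in> elts t}"
proof -
  assume t: "fsq n t"
  then have m: "maps t (elts n) Om" by (simp add: fsq_def)
  show ?thesis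
  proof (intro set_eqI iffI)
    fix x assume "x \<in> elts n"
    then show "x \<in> {x \<in> M. \<exists>y\<in>M. pr x y \<in> elts t}"
      using maps_ap(1,2)[OF m eltsM OmM] elts_M by blast
  next
    fix x assume "x \<in> {x \<in> M. \<exists>y\<in>M. pr x y \<in> elts t}"
    then obtain y where x: "x \<in> M" "y \<in> M" "pr x y \<in> elts t" by blast
    then obtain x' y' where "x' \<in> elts n" "y' \<in> Om" "pr x y = pr x' y'"
      using m unfolding maps_iff[OF eltsM OmM] by blast
    with x elts_M show "x \<in> elts n" by (metis pr_inj)
  qed
qed

lemma fsq_unique: "fsq n t \<Longrightarrow> fsq n' t \<Longrightarrow> n = n'"
  using fsq_dom[of n t] fsq_dom[of n' t] fsqD by (metis extn)

lemma fsq_ext: "fsq n t \<Longrightarrow> fsq n t' \<Longrightarrow> (\<And>k. k \<in> elts n \<Longrightarrow> ap t k = ap t' k) \<Longrightarrow> t = t'"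
  by (rule maps_ext[OF _ _ _ _ eltsM OmM]) (auto simp: fsq_def)

lemma fsq_mk:
  assumes n: "n \<in> Om" and d: "dfn {} (\<lambda>e. Q (e 0) (e (Suc 0)))"
    and Q: "\<And>x. x \<in> elts n \<Longrightarrow> \<exists>y. y \<in> Om \<and> Q x y \<and> (\<forall>z. z \<in> Om \<and> Q x z \<longrightarrow> z = y)"
  shows "\<exists>t. fsq n t \<and> (\<forall>k\<in>elts n. Q k (ap t k))"
proof -
  obtain t where "t \<in> M" "maps t (elts n) Om" "\<forall>x\<in>elts n. Q x (ap t x)"
    using maps_ex[OF isset_elts[OF Om_M[OF n]] isset_elts[OF w(1)] d Q] by blast
  with n show ?thesis by (auto simp: fsq_def)
qed

definition len :: "'a \<Rightarrow> 'a" where "len t = (if \<exists>n. fsq n t then THE n. fsq n t else emp)"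

lemma len: "fsq n t \<Longrightarrow> len t = n"
proof -
  assume t: "fsq n t"
  have "(THE n. fsq n t) = n" using t fsq_unique by (intro the_equality)
  with t show ?thesis by (auto simp: len_def)
qed

lemma len_M: "len t \<in> M"
proof (cases "\<exists>n. fsq n t")
  case True then show ?thesis using len fsqD(3) by blast
qed (simp add: len_def)

lemma tm_len0: "tm C (\<lambda>e. len (e 0))"
proof (rule tmI[where S="\<lambda>v e. fsq v (e 0) \<or> (v = emp \<and> \<not> (\<exists>n\<in>M. fsq n (e 0)))"], goal_cases)
  case (2 e v)
  show ?case
  proof (cases "\<exists>n. fsq n (e 0)")
    case True then show ?thesis using len fsqD(3) by blast
  next
    case False
    then have "len (e 0) = emp" by (simp add: len_def)
    with False show ?thesis by simp
  qed
next
  case 3 show ?case by (intro df)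
qed (rule len_M)

lemmas tm_len [df] = tm_inst1[where F=len, OF tm_len0]

definition FS :: "'a set" where "FS = {t \<in> M. \<exists>n\<in>Om. fsq n t}"

lemma FS_iff: "t \<in> FS \<longleftrightarrow> fsq (len t) t"
proof
  assume "t \<in> FS"
  then obtain n where "fsq n t" by (auto simp: FS_def)
  then show "fsq (len t) t" using len by simp
qed (use fsqD in \<open>auto simp: FS_def\<close>)

lemma isset_FS: "isset FS"
proof -
  have "FS = {t \<in> Pw (prd Om Om). \<exists>n\<in>Om. fsq n t}"
  proof (intro set_eqI iffI)
    fix t assume "t \<in> FS"
    then obtain n where n: "n \<in> Om" "fsq n t" "t \<in> M" by (auto simp: FS_def)
    have "p \<in> prd Om Om" if "p \<in> elts t" for p
      using n that Om_trans unfolding fsq_def maps_iff[OF eltsM OmM] prd_def by blast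
    with n show "t \<in> {t \<in> Pw (prd Om Om). \<exists>n\<in>Om. fsq n t}" by (auto simp: Pw_def)
  qed (auto simp: FS_def Pw_def)
  also have "isset \<dots>" by (rule isset_sep) (intro isset_Pw isset_prd isset_elts w df)+
  finally show ?thesis .
qed

definition sn :: "'a \<Rightarrow> 'a \<Rightarrow> 'a" where "sn t m = mk (insert (pr (len t) m) (elts t))"

lemma sn_M: "t \<in> M \<Longrightarrow> m \<in> M \<Longrightarrow> sn t m \<in> M"
  unfolding sn_def by (intro mk isset_insert isset_elts pr_M len_M)

lemma tm_sn0: "tm C (\<lambda>e. sn (e 0) (e (Suc 0)))"
proof (rule tmI[where S="\<lambda>v e. elts v = {u\<in>M. u = pr (len (e 0)) (e (Suc 0)) \<or> u \<in> elts (e 0)}"], goal_cases)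
  case (1 e) then show ?case by (intro sn_M envD)
next
  case (2 e v)
  then have *: "pr (len (e 0)) (e (Suc 0)) \<in> M" by (intro pr_M len_M envD)
  then have "{u\<in>M. u = pr (len (e 0)) (e (Suc 0)) \<or> u \<in> elts (e 0)} = insert (pr (len (e 0)) (e (Suc 0))) (elts (e 0))"
    using elts_M by blast
  with 2 * show ?case by (simp add: sn_def mk_iff isset_insert isset_elts envD)
next
  case 3 show ?case by (intro df)
qed

lemmas tm_sn [df] = tm_inst2[where F=sn, OF tm_sn0]

lemma sn:
  assumes t: "fsq n t" and m: "m \<in> Om"
  shows "fsq (suc n) (sn t m)" "ap (sn t m) n = m" "k \<in> elts n \<Longrightarrow> ap (sn t m) k = ap t k"
proof -
  have M: "t \<in> M" "n \<in> M" "m \<in> M" "n \<in> Om" using t m fsqD Om_M by auto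
  have e: "elts (sn t m) = insert (pr n m) (elts t)"
    using t M by (simp add: sn_def len mk isset_insert isset_elts pr_M)
  have m': "maps t (elts n) Om" using t by (simp add: fsq_def)
  have nn: "pr n y \<notin> elts t" if "y \<in> M" for y
    using fsq_dom[OF t] M that notin_self by blast
  have new: "pr n y \<in> elts (sn t m) \<longleftrightarrow> y = m" if "y \<in> M" for y using that nn M by (auto simp: e)
  have old: "pr k y \<in> elts (sn t m) \<longleftrightarrow> y = ap t k" if "k \<in> elts n" "y \<in> M" for k y
  proof -
    have "k \<in> M" "k \<noteq> n" using that elts_M notin_self by auto
    with that M maps_ap(3)[OF m' eltsM OmM that] show ?thesis by (simp add: e)
  qed
  show "ap (sn t m) n = m" using new M by (intro ap_eq) auto
  show "ap (sn t m) k = ap t k" if "k \<in> elts n" for k using old that by (intro ap_eq) auto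
  have "maps (sn t m) (elts (suc n)) Om"
    unfolding maps_iff[OF eltsM OmM]
  proof (intro conjI ballI)
    fix p assume "p \<in> elts (sn t m)"
    then consider "p = pr n m" | "p \<in> elts t" by (auto simp: e)
    then show "\<exists>x\<in>elts (suc n). \<exists>y\<in>Om. p = pr x y"
    proof cases
      case 2 then show ?thesis using m' M unfolding maps_iff[OF eltsM OmM] by auto
    qed (use M m in auto)
  next
    fix x assume "x \<in> elts (suc n)"
    then show "\<exists>y\<in>M. pr x y \<in> elts (sn t m) \<and> (\<forall>z\<in>M. pr x z \<in> elts (sn t m) \<longrightarrow> z = y)"
      using old new M by (cases "x = n") auto
  qed
  then show "fsq (suc n) (sn t m)" using M by (auto simp: fsq_def sn_M)
qed

lemma fsq_emp: "fsq emp emp"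
  by (simp add: fsq_def maps_iff[OF _ OmM])

lemma fsq_emp_iff: "fsq emp t \<longleftrightarrow> t = emp"
  using fsq_emp fsq_ext by fastforce

text \<open>For the empty predicate this follows from ZF, for \<open>G\<close> it takes genericity
  and is proved as \<open>ind_G\<close>. With \<open>ind\<close> as a hypothesis, one recursion
  theorem serves both the ground model and the extension.\<close>

definition ind :: "'a set \<Rightarrow> bool" where
  "ind C \<longleftrightarrow> (\<forall>Q n. n \<in> Om \<longrightarrow> dfn C (\<lambda>e. Q (e 0)) \<longrightarrow> Q emp \<longrightarrow> (\<forall>n\<in>Om. Q n \<longrightarrow> Q (suc n)) \<longrightarrow> Q n)"

lemma ind_empty: "ind {}"
  unfolding ind_def using Om_induct0 by blast

lemma ind_induct [consumes 2, case_names dfn zero suc]: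
  "ind C \<Longrightarrow> n \<in> Om \<Longrightarrow> dfn C (\<lambda>e. Q (e 0)) \<Longrightarrow> Q emp \<Longrightarrow> (\<And>n. n \<in> Om \<Longrightarrow> Q n \<Longrightarrow> Q (suc n)) \<Longrightarrow> Q n"
  unfolding ind_def by blast

text \<open>Such a function is only definable; for \<open>C = G\<close> it need not be an element of
  the model.\<close>

definition gfun :: "'a set \<Rightarrow> ('a \<Rightarrow> 'a) \<Rightarrow> bool" where
  "gfun C r \<longleftrightarrow> (\<forall>n\<in>Om. r n \<in> Om) \<and> dfn C (\<lambda>e. e 0 \<in> Om \<and> e (Suc 0) = r (e 0))"

definition hs :: "('a \<Rightarrow> 'a) \<Rightarrow> 'a \<Rightarrow> 'a" where
  "hs r n = (THE t. fsq n t \<and> (\<forall>k\<in>elts n. ap t k = r k))"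

lemma hs_eq: "fsq n t \<Longrightarrow> (\<And>k. k \<in> elts n \<Longrightarrow> ap t k = r k) \<Longrightarrow> hs r n = t"
  unfolding hs_def
proof (rule the_equality)
  fix t' assume *: "fsq n t" "\<And>k. k \<in> elts n \<Longrightarrow> ap t k = r k" "fsq n t' \<and> (\<forall>k\<in>elts n. ap t' k = r k)"
  show "t' = t" by (rule fsq_ext[of n]) (use * in auto)
qed blast

text \<open>Appending one value at a time stays inside the model, even if the whole function does
  not belong to it. For \<open>C = G\<close> this says that forcing adds no finite sequences, so
  positions of games played in the extension are elements of \<open>M\<close>.\<close>

lemma hs_ex:
  assumes i: "ind C" and r: "gfun C r" and n: "n \<in> Om"
  shows "\<exists>t\<in>M. fsq n t \<and> (\<forall>k\<in>elts n. k \<in> Om \<and> ap t k = r k)"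
  using i n
proof (induction n rule: ind_induct)
  case dfn
  define R where "R x t \<longleftrightarrow> x \<in> Om \<and> ap t x = r x" for x t
  have "dfn C (\<lambda>e. e 0 \<in> Om \<and> e (Suc 0) = r (e 0))" using r by (simp add: gfun_def)
  then have dR: "dfn C (\<lambda>e. R (e 0) (e (Suc 0)))"
    unfolding R_def by (rule inst2[where S="\<lambda>x y. x \<in> Om \<and> y = r x"]) (intro df)+
  show ?case unfolding R_def[symmetric] by (intro df inst2[where S=R, OF dR])
next
  case zero show ?case using fsq_emp by auto
next
  case (suc n)
  then obtain t where t: "fsq n t" "\<forall>k\<in>elts n. k \<in> Om \<and> ap t k = r k" by blast
  have rn: "r n \<in> Om" using r suc by (simp add: gfun_def)
  have "ap (sn t (r n)) k = r k \<and> k \<in> Om" if "k \<in> elts (suc n)" for k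
    using that t sn(2,3)[OF t(1) rn] suc(1) by (auto simp: Om_M)
  then show ?case using sn(1)[OF t(1) rn] fsqD(2) by blast
qed

lemma hs:
  assumes "ind C" "gfun C r" "n \<in> Om"
  shows "fsq n (hs r n)" "k \<in> elts n \<Longrightarrow> ap (hs r n) k = r k"
proof -
  obtain t where "fsq n t" "\<forall>k\<in>elts n. ap t k = r k" using hs_ex[OF assms] by blast
  then show "fsq n (hs r n)" "k \<in> elts n \<Longrightarrow> ap (hs r n) k = r k"
    using hs_eq[of n t r] by auto
qed

lemma hs_cong: "(\<And>k. k \<in> elts n \<Longrightarrow> r k = r' k) \<Longrightarrow> hs r n = hs r' n"
  unfolding hs_def by (metis (no_types, lifting))

text \<open>Course-of-values recursion: \<open>S t m\<close> says that \<open>m\<close> comes next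
  after the history \<open>t\<close>. There is exactly one history of each length that obeys
  \<open>S\<close>, and \<open>r n\<close> is what \<open>S\<close> prescribes after the one of
  length \<open>n\<close>.\<close>

lemma run_ex:
  assumes i: "ind C" and d: "dfn C (\<lambda>e. S (e 0) (e (Suc 0)))"
    and S: "\<And>n t. fsq n t \<Longrightarrow> \<exists>m. m \<in> Om \<and> S t m \<and> (\<forall>m'. m' \<in> Om \<and> S t m' \<longrightarrow> m' = m)"
  shows "\<exists>r. gfun C r \<and> (\<forall>n\<in>Om. S (hs r n) (r n))"
proof -
  define good where "good n t \<longleftrightarrow> fsq n t \<and> (\<forall>k\<in>elts n. \<exists>s\<in>M. fsq k s \<and> (\<forall>i\<in>elts k. ap s i = ap t i) \<and> S s (ap t k))" for n t
  have dg: "dfn C (\<lambda>e. good (e 0) (e (Suc 0)))"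
    unfolding good_def by (intro df inst2[where S=S, OF d])
  \<comment> \<open>Initial segments of good histories are good; this carries uniqueness from length
    \<open>n\<close> to \<open>suc n\<close>.\<close>
  have restr: "good k s" if g: "good n t" and k: "k \<in> elts n" and s: "fsq k s" "\<forall>i\<in>elts k. ap s i = ap t i" for n t k s
    unfolding good_def
  proof (intro conjI ballI s)
    fix j assume j: "j \<in> elts k"
    have n: "n \<in> Om" using g by (auto simp: good_def fsqD)
    then have "j \<in> elts n" using Om_less_trans k j by blast
    then obtain u where u: "u \<in> M" "fsq j u" "\<forall>i\<in>elts j. ap u i = ap t i" "S u (ap t j)" using g by (auto simp: good_def)
    have "\<forall>i\<in>elts j. ap u i = ap s i" using u s Om_less_trans[of k j] j k n Om_trans by metis
    moreover have "ap s j = ap t j" using s j by blast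
    ultimately show "\<exists>sa\<in>M. fsq j sa \<and> (\<forall>i\<in>elts j. ap sa i = ap s i) \<and> S sa (ap s j)" using u by auto
  qed
  have ex: "\<exists>t\<in>M. good n t \<and> (\<forall>t'\<in>M. good n t' \<longrightarrow> t' = t)" if "n \<in> Om" for n
    using i that
  proof (induction n rule: ind_induct)
    case dfn show ?case by (intro df inst2[where S=good, OF dg])
  next
    case zero
    have "good emp emp" using fsq_emp by (simp add: good_def)
    moreover have "t = emp" if "good emp t" for t using that fsq_emp_iff unfolding good_def by blast
    ultimately show ?case using emp(1) by blast
  next
    case (suc n)
    then obtain t where t: "good n t" "\<forall>t'\<in>M. good n t' \<longrightarrow> t' = t" by blast
    then have ft: "fsq n t" by (simp add: good_def)
    obtain m where m: "m \<in> Om" "S t m" "\<forall>m'. m' \<in> Om \<and> S t m' \<longrightarrow> m' = m" using S[OF ft] by blast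
    note s = sn[OF ft m(1)]
    have nM: "n \<in> M" using suc Om_M by blast
    have "good (suc n) (sn t m)"
      unfolding good_def
    proof (intro conjI ballI s)
      fix k assume "k \<in> elts (suc n)"
      then consider "k = n" | "k \<in> elts n" using nM by auto
      then show "\<exists>u\<in>M. fsq k u \<and> (\<forall>i\<in>elts k. ap u i = ap (sn t m) i) \<and> S u (ap (sn t m) k)"
      proof cases
        case 1
        have "\<forall>i\<in>elts n. ap t i = ap (sn t m) i" using s(3) by simp
        then show ?thesis unfolding 1 s(2) using ft m(2) fsqD(2)[OF ft] by blast
      next
        case 2
        then obtain u where u: "u \<in> M" "fsq k u" "\<forall>i\<in>elts k. ap u i = ap t i" "S u (ap t k)" using t by (auto simp: good_def)
        have "ap (sn t m) i = ap t i" if "i \<in> elts k" for i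
          using s(3) Om_less_trans[OF suc(1) 2 that] .
        with u s(3)[OF 2] show ?thesis by auto
      qed
    qed
    moreover have "u = sn t m" if u: "good (suc n) u" for u
    proof -
      have fu: "fsq (suc n) u" using u by (simp add: good_def)
      obtain v where v: "v \<in> M" "fsq n v" "\<forall>i\<in>elts n. ap v i = ap u i" "S v (ap u n)"
        using u nM unfolding good_def by auto
      then have "good n v" using restr[OF u, of n v] nM by auto
      with t v have vt: "v = t" by blast
      have "ap u n \<in> Om" using fsq_ap[OF fu] nM by auto
      then have "ap u n = m" using m(3) v(4) vt by blast
      then show ?thesis using v(3) vt s(2,3) nM by (intro fsq_ext[OF fu s(1)]) auto
    qed
    ultimately show ?case using fsqD(2)[OF s(1)] by blast
  qed
  define r where "r n = (THE m. m \<in> Om \<and> (\<exists>t\<in>M. good n t \<and> S t m))" for n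
  have r: "m = r n \<longleftrightarrow> m \<in> Om \<and> (\<exists>t\<in>M. good n t \<and> S t m)" if n: "n \<in> Om" for n m
  proof -
    obtain t where t: "good n t" "t \<in> M" "\<forall>t'\<in>M. good n t' \<longrightarrow> t' = t" using ex[OF n] by blast
    then obtain m0 where m0: "m0 \<in> Om" "S t m0" "\<forall>m'. m' \<in> Om \<and> S t m' \<longrightarrow> m' = m0"
      using S[of n t] unfolding good_def by blast
    have *: "m \<in> Om \<and> (\<exists>t\<in>M. good n t \<and> S t m) \<longleftrightarrow> m = m0" for m using t m0 by blast
    then have "r n = m0" unfolding r_def * by simp
    with * show ?thesis by simp
  qed
  have rO: "r n \<in> Om" if "n \<in> Om" for n using r[OF that] by blast
  have dd: "dfn C (\<lambda>e. e 0 \<in> Om \<and> e (Suc 0) \<in> Om \<and> (\<exists>t\<in>M. good (e 0) t \<and> S t (e (Suc 0))))"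
    by (intro df inst2[where S=good, OF dg] inst2[where S=S, OF d])
  have "dfn C (\<lambda>e. e 0 \<in> Om \<and> e (Suc 0) = r (e 0))"
    by (rule dfn_cong[OF dd]) (use r in blast)
  with rO have g: "gfun C r" by (simp add: gfun_def)
  have "S (hs r n) (r n)" if n: "n \<in> Om" for n
  proof -
    obtain t where t: "good n t" "t \<in> M" "S t (r n)" using r[OF n] by blast
    have "ap t k = r k" if k: "k \<in> elts n" for k
    proof -
      obtain s where "s \<in> M" "fsq k s" "\<forall>i\<in>elts k. ap s i = ap t i" "S s (ap t k)" using t k by (auto simp: good_def)
      moreover from this have "good k s" using restr[OF t(1) k] by blast
      moreover have "ap t k \<in> Om" "k \<in> Om" using t fsq_ap k n Om_trans by (auto simp: good_def)
      ultimately show ?thesis using r by blast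
    qed
    then have "hs r n = t" using t by (intro hs_eq) (auto simp: good_def)
    with t show ?thesis by simp
  qed
  with g show ?thesis by blast
qed

text \<open>Primitive recursion is course-of-values recursion that reads only the last entry of the
  history.\<close>

lemma rec_ex:
  assumes a: "a \<in> Om" and d: "dfn {} (\<lambda>e. R (e 0) (e (Suc 0)) (e (Suc (Suc 0))))"
    and R: "\<And>k v. k \<in> Om \<Longrightarrow> v \<in> Om \<Longrightarrow> \<exists>m. m \<in> Om \<and> R k v m \<and> (\<forall>m'. m' \<in> Om \<and> R k v m' \<longrightarrow> m' = m)"
  shows "\<exists>f\<in>M. maps f Om Om \<and> ap f emp = a \<and> (\<forall>k\<in>Om. R k (ap f k) (ap f (suc k)))"
proof -
  define S where "S t m \<longleftrightarrow> (len t = emp \<and> m = a) \<or> (\<exists>k\<in>Om. len t = suc k \<and> R k (ap t k) m)" for t m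
  have aM: "a \<in> M" using a Om_M by blast
  have "dfn {} (\<lambda>e. S (e 0) (e (Suc 0)))"
    unfolding S_def by (intro df inst3[where S=R, OF d] aM)
  moreover have "\<exists>m. m \<in> Om \<and> S t m \<and> (\<forall>m'. m' \<in> Om \<and> S t m' \<longrightarrow> m' = m)" if t: "fsq n t" for n t
  proof -
    have l: "len t = n" using t len by blast
    have n: "n \<in> Om" using t fsqD by blast
    consider "n = emp" | k where "k \<in> Om" "n = suc k" using Om_cases n by blast
    then show ?thesis
    proof cases
      case 1
      then have "S t m \<longleftrightarrow> m = a" for m unfolding S_def l using suc_ne(2) Om_M by metis
      with a show ?thesis by blast
    next
      case 2
      have "S t m \<longleftrightarrow> R k (ap t k) m" for m
        unfolding S_def l using 2 suc_ne(1)[OF Om_M[OF 2(1)]] suc_inj Om_M by metis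
      moreover have "ap t k \<in> Om" using fsq_ap[OF t, of k] 2 Om_M by auto
      ultimately show ?thesis using R[OF 2(1)] by presburger
    qed
  qed
  ultimately obtain r where r: "gfun {} r" "\<forall>n\<in>Om. S (hs r n) (r n)"
    using run_ex[OF ind_empty] by blast
  have rO: "r n \<in> Om" if "n \<in> Om" for n using r(1) that by (simp add: gfun_def)
  have "dfn {} (\<lambda>e. e 0 \<in> Om \<and> e (Suc 0) = r (e 0))" using r(1) by (simp add: gfun_def)
  then have "\<exists>f\<in>M. maps f Om Om \<and> (\<forall>x\<in>Om. x \<in> Om \<and> ap f x = r x)"
    by (rule maps_ex[OF isset_elts[OF w(1)] isset_elts[OF w(1)]]) (use rO in blast)
  then obtain f where f: "f \<in> M" "maps f Om Om" "\<forall>x\<in>Om. ap f x = r x" by blast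
  have l: "len (hs r n) = n" if "n \<in> Om" for n using hs(1)[OF ind_empty r(1) that] len by blast
  have "r emp = a" using r(2) l[OF emp_Om] suc_ne Om_M unfolding S_def by (metis emp_Om)
  moreover have "R k (r k) (r (suc k))" if k: "k \<in> Om" for k
  proof -
    have kM: "k \<in> M" using k Om_M by blast
    have "S (hs r (suc k)) (r (suc k))" using r(2) k by auto
    then have "R k (ap (hs r (suc k)) k) (r (suc k))"
      unfolding S_def l[OF suc_Om[OF k]] using suc_ne(1)[OF kM] suc_inj[OF kM] Om_M by metis
    moreover have "ap (hs r (suc k)) k = r k"
      using hs(2)[OF ind_empty r(1) suc_Om[OF k]] kM by auto
    ultimately show ?thesis by simp
  qed
  ultimately show ?thesis using f by auto
qed

lemma maps_Om_ext:
  assumes "f \<in> M" "g \<in> M" "maps f Om Om" "maps g Om Om" "ap f emp = ap g emp"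
    and "\<And>k. k \<in> Om \<Longrightarrow> ap f k = ap g k \<Longrightarrow> ap f (suc k) = ap g (suc k)"
  shows "f = g"
proof (rule maps_ext[OF assms(1-4) OmM OmM])
  fix x assume "x \<in> Om"
  then show "ap f x = ap g x"
    by (induction x rule: Om_induct0) (intro df assms(1,2), use assms in auto)
qed

lemma ap_Om: "maps f Om Om \<Longrightarrow> n \<in> Om \<Longrightarrow> ap f n \<in> Om"
  using maps_ap(1)[OF _ OmM OmM] .

section \<open>Codes of pairs and of finite sequences\<close>

definition d0 :: 'a where
  "d0 = (SOME f. f \<in> M \<and> maps f Om Om \<and> ap f emp = emp \<and> (\<forall>k\<in>Om. ap f (suc k) = suc (suc (ap f k))))"

abbreviation D0 :: "'a \<Rightarrow> 'a" where "D0 n \<equiv> ap d0 n"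
abbreviation D1 :: "'a \<Rightarrow> 'a" where "D1 n \<equiv> suc (ap d0 n)"

lemma d0: "d0 \<in> M" "maps d0 Om Om" "D0 emp = emp" "k \<in> Om \<Longrightarrow> D0 (suc k) = suc (suc (D0 k))"
proof -
  have "\<exists>f\<in>M. maps f Om Om \<and> ap f emp = emp \<and> (\<forall>k\<in>Om. ap f (suc k) = suc (suc (ap f k)))"
    by (rule rec_ex[where R="\<lambda>k v m. m = suc (suc v)"]) (intro emp_Om, intro df, auto)
  then have "\<exists>f. f \<in> M \<and> maps f Om Om \<and> ap f emp = emp \<and> (\<forall>k\<in>Om. ap f (suc k) = suc (suc (ap f k)))" by blast
  from someI_ex[OF this]
  show "d0 \<in> M" "maps d0 Om Om" "D0 emp = emp" "k \<in> Om \<Longrightarrow> D0 (suc k) = suc (suc (D0 k))"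
    unfolding d0_def by blast+
qed

declare d0(1) [df]

lemma D_Om [simp]: "n \<in> Om \<Longrightarrow> D0 n \<in> Om" "n \<in> Om \<Longrightarrow> D1 n \<in> Om"
  using ap_Om[OF d0(2)] by auto

lemma D0_inj0: "n \<in> Om \<Longrightarrow> \<forall>m\<in>Om. D0 n = D0 m \<longrightarrow> n = m"
proof (induction n rule: Om_induct0)
  case dfn show ?case by (intro df)
next
  case zero
  show ?case using Om_cases d0(3,4) by (metis ap_M suc_M suc_ne(2))
next
  case (suc n)
  show ?case
  proof (intro ballI impI)
    fix m assume m: "m \<in> Om" "D0 (suc n) = D0 m"
    consider "m = emp" | k where "k \<in> Om" "m = suc k" using Om_cases m by blast
    then show "suc n = m"
    proof cases
      case 1
      then show ?thesis using m d0(3) d0(4)[OF suc(1)] by simp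
    next
      case 2
      then have "D0 n = D0 k" using m d0(4) suc(1) by simp
      then show ?thesis using suc(2) 2 by blast
    qed
  qed
qed

lemma D0_inj [simp]: "n \<in> Om \<Longrightarrow> m \<in> Om \<Longrightarrow> D0 n = D0 m \<longleftrightarrow> n = m"
  using D0_inj0 by blast

lemma D0_D1_0: "n \<in> Om \<Longrightarrow> \<forall>m\<in>Om. D0 n \<noteq> D1 m"
proof (induction n rule: Om_induct0)
  case dfn show ?case by (intro df)
next
  case zero show ?case by (simp add: d0(3))
next
  case (suc n)
  show ?case
  proof
    fix m assume m: "m \<in> Om"
    consider "m = emp" | k where "k \<in> Om" "m = suc k" using Om_cases m by blast
    then show "D0 (suc n) \<noteq> D1 m"
      using suc m d0(3,4) by cases auto
  qed
qed

lemma D0_D1 [simp]: "n \<in> Om \<Longrightarrow> m \<in> Om \<Longrightarrow> D0 n \<noteq> D1 m" "n \<in> Om \<Longrightarrow> m \<in> Om \<Longrightarrow> D1 m \<noteq> D0 n"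
  using D0_D1_0 by fastforce+

lemma D_cases: "n \<in> Om \<Longrightarrow> (\<exists>k\<in>Om. n = D0 k) \<or> (\<exists>k\<in>Om. n = D1 k)"
proof (induction n rule: Om_induct0)
  case dfn show ?case by (intro df)
next
  case zero show ?case using d0(3)[symmetric] emp_Om by blast
next
  case (suc n) then show ?case using d0(4) suc_Om by metis
qed

definition Jrec :: "'a \<Rightarrow> 'a \<Rightarrow> bool" where
  "Jrec n f \<longleftrightarrow> f \<in> M \<and> maps f Om Om \<and> ap f emp = D1 n \<and> (\<forall>k\<in>Om. ap f (suc k) = D0 (ap f k))"

lemma df_Jrec0: "dfn C (\<lambda>e. Jrec (e 0) (e (Suc 0)))"
  unfolding Jrec_def by (intro df)

lemmas df_Jrec [df] = inst2[where S=Jrec, OF df_Jrec0]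

lemma Jrec_ex: "n \<in> Om \<Longrightarrow> \<exists>f. Jrec n f"
proof -
  assume n: "n \<in> Om"
  have "\<exists>f\<in>M. maps f Om Om \<and> ap f emp = D1 n \<and> (\<forall>k\<in>Om. ap f (suc k) = D0 (ap f k))"
    by (rule rec_ex[where R="\<lambda>k v m. m = D0 v"]) (intro D_Om n, intro df, auto)
  then show ?thesis by (auto simp: Jrec_def)
qed

lemma Jrec_unique: "Jrec n f \<Longrightarrow> Jrec n g \<Longrightarrow> f = g"
  unfolding Jrec_def by (rule maps_Om_ext) auto

definition jf :: 'a where
  "jf = (SOME f. f \<in> M \<and> maps f (prd Om Om) Om \<and>
     (\<forall>m\<in>Om. \<forall>n\<in>Om. \<forall>g. Jrec n g \<longrightarrow> ap f (pr m n) = ap g m))"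

text \<open>In terms of arithmetic, \<open>D0 n = 2 n\<close>, \<open>D1 n = 2 n + 1\<close> and \<open>J m n = 2^m (2 n + 1)\<close>.\<close>

abbreviation J :: "'a \<Rightarrow> 'a \<Rightarrow> 'a" where "J m n \<equiv> ap jf (pr m n)"

lemma jf: "jf \<in> M" "maps jf (prd Om Om) Om" "m \<in> Om \<Longrightarrow> n \<in> Om \<Longrightarrow> Jrec n g \<Longrightarrow> J m n = ap g m"
proof -
  let ?Q = "\<lambda>p v. \<exists>m\<in>Om. \<exists>n\<in>Om. p = pr m n \<and> (\<exists>f\<in>M. Jrec n f \<and> v = ap f m)"
  have "\<exists>f\<in>M. maps f (prd Om Om) Om \<and> (\<forall>p\<in>prd Om Om. ?Q p (ap f p))"
  proof (rule maps_ex)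
    show "dfn {} (\<lambda>e. ?Q (e 0) (e (Suc 0)))" by (intro df)
    fix p assume "p \<in> prd Om Om"
    then obtain m n where p: "p = pr m n" "m \<in> Om" "n \<in> Om" by (auto simp: prd_def)
    obtain f where f: "Jrec n f" using Jrec_ex p by blast
    have "?Q p v \<longleftrightarrow> v = ap f m" for v
    proof
      assume "?Q p v"
      then obtain m' n' f' where q: "m' \<in> Om" "n' \<in> Om" "p = pr m' n'" "Jrec n' f'" "v = ap f' m'" by blast
      then have "m' = m" "n' = n" using p Om_M by auto
      with q f Jrec_unique show "v = ap f m" by blast
    qed (use p f in \<open>auto simp: Jrec_def\<close>)
    moreover have "ap f m \<in> Om" using f p ap_Om by (auto simp: Jrec_def)
    ultimately show "\<exists>y. y \<in> Om \<and> ?Q p y \<and> (\<forall>z. z \<in> Om \<and> ?Q p z \<longrightarrow> z = y)" by presburger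
  qed (intro isset_prd isset_elts w)+
  then obtain f where f: "f \<in> M" "maps f (prd Om Om) Om" "\<forall>p\<in>prd Om Om. ?Q p (ap f p)" by blast
  have "ap f (pr m n) = ap g m" if mn: "m \<in> Om" "n \<in> Om" "Jrec n g" for m n g
  proof -
    have "pr m n \<in> prd Om Om" using mn by (auto simp: prd_def)
    then obtain m' n' f' where q: "m' \<in> Om" "n' \<in> Om" "pr m n = pr m' n'" "Jrec n' f'" "ap f (pr m n) = ap f' m'"
      using f(3) by blast
    then have "m' = m" "n' = n" using mn Om_M by auto
    with q mn Jrec_unique show ?thesis by blast
  qed
  with f have "\<exists>f. f \<in> M \<and> maps f (prd Om Om) Om \<and>
     (\<forall>m\<in>Om. \<forall>n\<in>Om. \<forall>g. Jrec n g \<longrightarrow> ap f (pr m n) = ap g m)" by blast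
  from someI_ex[OF this]
  show "jf \<in> M" "maps jf (prd Om Om) Om" "m \<in> Om \<Longrightarrow> n \<in> Om \<Longrightarrow> Jrec n g \<Longrightarrow> J m n = ap g m"
    unfolding jf_def by blast+
qed

declare jf(1) [df]

lemma J_Om [simp]: "m \<in> Om \<Longrightarrow> n \<in> Om \<Longrightarrow> J m n \<in> Om"
  using maps_ap(1)[OF jf(2) isset_M OmM] isset_prd isset_elts w by (auto simp: prd_def)

lemma J_rec: "n \<in> Om \<Longrightarrow> J emp n = D1 n" "n \<in> Om \<Longrightarrow> m \<in> Om \<Longrightarrow> J (suc m) n = D0 (J m n)"
  using Jrec_ex[of n] jf(3) by (auto simp: Jrec_def)

lemma J_inj0: "m \<in> Om \<Longrightarrow> \<forall>n\<in>Om. \<forall>m'\<in>Om. \<forall>n'\<in>Om. J m n = J m' n' \<longrightarrow> m = m' \<and> n = n'"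
proof (induction m rule: Om_induct0)
  case dfn show ?case by (intro df)
next
  case zero
  show ?case
  proof (intro ballI impI)
    fix n m' n' assume *: "n \<in> Om" "m' \<in> Om" "n' \<in> Om" "J emp n = J m' n'"
    consider "m' = emp" | k where "k \<in> Om" "m' = suc k" using Om_cases * by blast
    then show "emp = m' \<and> n = n'" using * by cases (auto simp: J_rec)
  qed
next
  case (suc m)
  show ?case
  proof (intro ballI impI)
    fix n m' n' assume *: "n \<in> Om" "m' \<in> Om" "n' \<in> Om" "J (suc m) n = J m' n'"
    consider "m' = emp" | k where "k \<in> Om" "m' = suc k" using Om_cases * by blast
    then show "suc m = m' \<and> n = n'"
    proof cases
      case 1
      then show ?thesis using *(1,3,4) suc(1) by (simp add: J_rec)
    next
      case 2
      then have "J m n = J k n'" using *(1,3,4) suc(1) by (simp add: J_rec)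
      then show ?thesis using suc(2) 2 * by blast
    qed
  qed
qed

lemma J_inj [simp]:
  "m \<in> Om \<Longrightarrow> n \<in> Om \<Longrightarrow> m' \<in> Om \<Longrightarrow> n' \<in> Om \<Longrightarrow> J m n = J m' n' \<longleftrightarrow> m = m' \<and> n = n'"
  using J_inj0 by blast

lemma J_ne0: "m \<in> Om \<Longrightarrow> \<forall>n\<in>Om. J m n \<noteq> emp"
proof (induction m rule: Om_induct0)
  case dfn show ?case by (intro df)
next
  case zero show ?case by (auto simp: J_rec)
next
  case (suc m)
  then show ?case using D0_inj[of _ emp] d0(3) by (auto simp: J_rec)
qed

text \<open>\<open>f\<close> lists raw codes of the initial segments of \<open>t\<close>: 0 for the
  empty one, and appending \<open>m\<close> turns the code \<open>c\<close> into
  \<open>J c m\<close>. Past the end of \<open>t\<close> it stays constant, so that it is total on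
  \<open>Om\<close>.\<close>

definition Krec :: "'a \<Rightarrow> 'a \<Rightarrow> bool" where
  "Krec t f \<longleftrightarrow> f \<in> M \<and> maps f Om Om \<and> ap f emp = emp \<and> (\<forall>k\<in>Om.
     (k \<in> elts (len t) \<longrightarrow> ap f (suc k) = J (ap f k) (ap t k)) \<and> (k \<notin> elts (len t) \<longrightarrow> ap f (suc k) = ap f k))"

lemma df_Krec0: "dfn C (\<lambda>e. Krec (e 0) (e (Suc 0)))"
  unfolding Krec_def by (intro df)

lemmas df_Krec [df] = inst2[where S=Krec, OF df_Krec0]

lemma Krec_ex: assumes t: "fsq n t" shows "\<exists>f. Krec t f"
proof -
  have tM: "t \<in> M" using t fsqD by blast
  have "\<exists>f\<in>M. maps f Om Om \<and> ap f emp = emp \<and> (\<forall>k\<in>Om.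
     (k \<in> elts (len t) \<longrightarrow> ap f (suc k) = J (ap f k) (ap t k)) \<and> (k \<notin> elts (len t) \<longrightarrow> ap f (suc k) = ap f k))"
  proof (rule rec_ex[where R="\<lambda>k v m. (k \<in> elts (len t) \<longrightarrow> m = J v (ap t k)) \<and> (k \<notin> elts (len t) \<longrightarrow> m = v)"])
    show "dfn {} (\<lambda>e. (e 0 \<in> elts (len t) \<longrightarrow> e (Suc (Suc 0)) = J (e (Suc 0)) (ap t (e 0))) \<and>
       (e 0 \<notin> elts (len t) \<longrightarrow> e (Suc (Suc 0)) = e (Suc 0)))" by (intro df tM len_M)
    fix k v assume "k \<in> Om" "v \<in> Om"
    then show "\<exists>m. m \<in> Om \<and> ((k \<in> elts (len t) \<longrightarrow> m = J v (ap t k)) \<and> (k \<notin> elts (len t) \<longrightarrow> m = v)) \<and>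
      (\<forall>m'. m' \<in> Om \<and> ((k \<in> elts (len t) \<longrightarrow> m' = J v (ap t k)) \<and> (k \<notin> elts (len t) \<longrightarrow> m' = v)) \<longrightarrow> m' = m)"
      using fsq_ap[OF t] len[OF t] by (cases "k \<in> elts (len t)") auto
  qed simp
  then show ?thesis by (auto simp: Krec_def)
qed

lemma Krec_unique: "Krec t f \<Longrightarrow> Krec t g \<Longrightarrow> f = g"
  unfolding Krec_def by (rule maps_Om_ext) metis+

text \<open>\<open>J\<close> is injective and never 0, so a code can be read backwards: it reveals
  whether there is a last entry, that entry, and the code before it. As the lengths are not known to
  agree, \<open>k\<close> and \<open>k'\<close> vary independently in the induction.\<close>

lemma Krec_inj:
  assumes t: "fsq n t" "fsq n' t'" and f: "Krec t f" "Krec t' f'" and eq: "ap f n = ap f' n'"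
  shows "t = t'"
proof -
  have M: "t \<in> M" "t' \<in> M" "f \<in> M" "f' \<in> M" "n \<in> M" "n' \<in> M" "n \<in> Om" "n' \<in> Om"
    using t f fsqD by (auto simp: Krec_def)
  have fO: "ap f k \<in> Om" "ap f' k \<in> Om" if "k \<in> Om" for k
    using f that ap_Om by (auto simp: Krec_def)
  have z: "ap f emp = emp" "ap f' emp = emp" using f by (auto simp: Krec_def)
  have s: "ap f (suc k) = J (ap f k) (ap t k)" if "k \<in> elts n" for k
    using f(1) that len[OF t(1)] Om_trans[OF that M(7)] unfolding Krec_def by blast
  have s': "ap f' (suc k) = J (ap f' k) (ap t' k)" if "k \<in> elts n'" for k
    using f(2) that len[OF t(2)] Om_trans[OF that M(8)] unfolding Krec_def by blast
  have low: "k \<in> elts m" if "suc k \<in> elts (suc m)" "k \<in> Om" "m \<in> Om" for k m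
    using that Om_less_trans[of m "suc k" k] by (auto simp: Om_M)
  have "\<forall>k'\<in>Om. k \<in> elts (suc n) \<longrightarrow> k' \<in> elts (suc n') \<longrightarrow> ap f k = ap f' k' \<longrightarrow>
      k = k' \<and> (\<forall>i\<in>elts k. ap t i = ap t' i)" if "k \<in> Om" for k
    using that
  proof (induction k rule: Om_induct0)
    case dfn show ?case by (intro df M suc_M)
  next
    case zero
    show ?case
    proof (intro ballI impI)
      fix k' assume *: "k' \<in> Om" "k' \<in> elts (suc n')" "ap f emp = ap f' k'"
      consider "k' = emp" | l where "l \<in> Om" "k' = suc l" using Om_cases * by blast
      then show "emp = k' \<and> (\<forall>i\<in>elts emp. ap t i = ap t' i)"
      proof cases
        case 2
        then have "l \<in> elts n'" using * M low by blast
        then have "ap f' k' = J (ap f' l) (ap t' l)" using 2 s' by simp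
        moreover have "ap t' l \<in> Om" using fsq_ap[OF t(2) \<open>l \<in> elts n'\<close>] .
        ultimately have "ap f' k' \<noteq> emp" using J_ne0 fO 2 by metis
        with * z show ?thesis by simp
      qed simp
    qed
  next
    case (suc k)
    show ?case
    proof (intro ballI impI)
      fix k' assume *: "k' \<in> Om" "suc k \<in> elts (suc n)" "k' \<in> elts (suc n')" "ap f (suc k) = ap f' k'"
      have kn: "k \<in> elts n" using * suc M low by blast
      then have e: "ap f (suc k) = J (ap f k) (ap t k)" by (rule s)
      have tk: "ap t k \<in> Om" using fsq_ap[OF t(1) kn] .
      consider "k' = emp" | l where "l \<in> Om" "k' = suc l" using Om_cases * by blast
      then show "suc k = k' \<and> (\<forall>i\<in>elts (suc k). ap t i = ap t' i)"
      proof cases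
        case 1
        then have "ap f (suc k) = emp" using * z by simp
        then show ?thesis using e J_ne0 fO suc(1) tk by metis
      next
        case 2
        then have ln: "l \<in> elts n'" using * M low by blast
        then have "ap f' k' = J (ap f' l) (ap t' l)" using 2 s' by simp
        moreover have "ap t' l \<in> Om" using fsq_ap[OF t(2) ln] .
        ultimately have "ap f k = ap f' l" "ap t k = ap t' l" using * e fO suc(1) 2 tk by auto
        moreover have "k \<in> elts (suc n)" "l \<in> elts (suc n')" using kn ln M by auto
        ultimately have "k = l \<and> (\<forall>i\<in>elts k. ap t i = ap t' i)" using suc(2) 2(1) by blast
        then show ?thesis using \<open>ap t k = ap t' l\<close> 2 suc(1) by (auto simp: Om_M)
      qed
    qed
  qed
  moreover have "n \<in> elts (suc n)" "n' \<in> elts (suc n')" using M by auto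
  ultimately have *: "n = n'" "\<forall>i\<in>elts n. ap t i = ap t' i" using eq M(7,8) by blast+
  with t show ?thesis using fsq_ext by blast
qed

text \<open>The raw code of the empty sequence is 0. The successor frees 0, where a coded strategy
  will record which player it belongs to.\<close>

definition kf :: 'a where
  "kf = (SOME f. f \<in> M \<and> maps f FS Om \<and> (\<forall>n t g. fsq n t \<longrightarrow> Krec t g \<longrightarrow> ap f t = suc (ap g n)))"

abbreviation kap :: "'a \<Rightarrow> 'a" where "kap t \<equiv> ap kf t"

lemma kf: "kf \<in> M" "maps kf FS Om" "fsq n t \<Longrightarrow> Krec t g \<Longrightarrow> kap t = suc (ap g n)"
proof -
  let ?Q = "\<lambda>t v. \<exists>f\<in>M. Krec t f \<and> v = suc (ap f (len t))"
  have "\<exists>f\<in>M. maps f FS Om \<and> (\<forall>t\<in>FS. ?Q t (ap f t))"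
  proof (rule maps_ex)
    show "dfn {} (\<lambda>e. ?Q (e 0) (e (Suc 0)))" by (intro df)
    fix t assume "t \<in> FS"
    then have t: "fsq (len t) t" by (simp add: FS_iff)
    obtain f where f: "Krec t f" using Krec_ex t by blast
    have fM: "f \<in> M" using f by (simp add: Krec_def)
    have "?Q t v \<longleftrightarrow> v = suc (ap f (len t))" for v
      using f fM Krec_unique[OF f] by blast
    moreover have "suc (ap f (len t)) \<in> Om" using f t fsqD ap_Om by (auto simp: Krec_def)
    ultimately show "\<exists>y. y \<in> Om \<and> ?Q t y \<and> (\<forall>z. z \<in> Om \<and> ?Q t z \<longrightarrow> z = y)" by presburger
  qed (intro isset_FS isset_elts w)+
  then obtain f where f: "f \<in> M" "maps f FS Om" "\<forall>t\<in>FS. ?Q t (ap f t)" by blast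
  have "ap f t = suc (ap g n)" if "fsq n t" "Krec t g" for n t g
    using f(3) that Krec_unique len FS_iff by metis
  with f have "\<exists>f. f \<in> M \<and> maps f FS Om \<and> (\<forall>n t g. fsq n t \<longrightarrow> Krec t g \<longrightarrow> ap f t = suc (ap g n))" by blast
  from someI_ex[OF this]
  show "kf \<in> M" "maps kf FS Om" "fsq n t \<Longrightarrow> Krec t g \<Longrightarrow> kap t = suc (ap g n)"
    unfolding kf_def by blast+
qed

declare kf(1) [df]

lemma kap_Om [simp]: "fsq n t \<Longrightarrow> kap t \<in> Om"
  using maps_ap(1)[OF kf(2) isset_M[OF isset_FS] OmM] FS_iff len by metis

lemma kap_ne: "fsq n t \<Longrightarrow> kap t \<noteq> emp"
  using kf(3) Krec_ex by (metis ap_M suc_ne(1))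

lemma kap_inj: "fsq n t \<Longrightarrow> fsq n' t' \<Longrightarrow> kap t = kap t' \<Longrightarrow> t = t'"
  using kf(3) Krec_ex Krec_inj by (metis ap_M suc_inj)

end

section \<open>Forced equality\<close>

locale forcing = zf_model M E for M :: "'a set" and E :: "'a \<Rightarrow> 'a \<Rightarrow> bool" +
  fixes P L :: 'a and G :: "'a set"
  assumes poset: "is_poset P L" and gen: "generic P L G"
begin

section \<open>Conditions and the generic filter\<close>

abbreviation Pc :: "'a set" where "Pc \<equiv> elts P"

definition le :: "'a \<Rightarrow> 'a \<Rightarrow> bool" where "le p q \<longleftrightarrow> pr p q \<in> elts L"

lemma PL [df]: "P \<in> M" "L \<in> M"
  using poset by (auto simp: is_poset_def)

lemma df_le [df]: "tm C t1 \<Longrightarrow> tm C t2 \<Longrightarrow> dfn C (\<lambda>e. le (t1 e) (t2 e))"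
  unfolding le_def by (intro df)

lemma le_graph: "p \<in> Pc \<Longrightarrow> q \<in> Pc \<Longrightarrow> (p, q) \<in> graph L \<longleftrightarrow> le p q"
  by (auto simp: graph_iff le_def elts_M)

lemma Pc_M: "p \<in> Pc \<Longrightarrow> p \<in> M" by (rule elts_M)

lemma le_refl [simp]: "p \<in> Pc \<Longrightarrow> le p p"
  using poset by (auto simp: is_poset_def partial_order_on_def preorder_on_def refl_on_def le_graph[symmetric])

lemma le_trans: "p \<in> Pc \<Longrightarrow> q \<in> Pc \<Longrightarrow> r \<in> Pc \<Longrightarrow> le p q \<Longrightarrow> le q r \<Longrightarrow> le p r"
  using poset by (auto simp: is_poset_def partial_order_on_def preorder_on_def le_graph[symmetric] elim: transE)

lemma GP: "p \<in> G \<Longrightarrow> p \<in> Pc"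
  using gen by (auto simp: generic_def is_filter_def)

lemma G_ne: "\<exists>p. p \<in> G"
  using gen by (auto simp: generic_def is_filter_def)

lemma G_up: "p \<in> G \<Longrightarrow> q \<in> Pc \<Longrightarrow> le p q \<Longrightarrow> q \<in> G"
  using gen GP le_graph unfolding generic_def is_filter_def by blast

lemma G_dir: "p \<in> G \<Longrightarrow> q \<in> G \<Longrightarrow> \<exists>r\<in>G. le r p \<and> le r q"
  using gen GP unfolding generic_def is_filter_def by (metis le_graph)

lemma G_meet:
  assumes d: "dfn {} (\<lambda>e. D (e 0))" and dense: "\<And>p. p \<in> Pc \<Longrightarrow> \<exists>d\<in>Pc. D d \<and> le d p"
  shows "\<exists>p\<in>G. D p"
proof -
  have "isset {p \<in> Pc. D p}" by (intro isset_sep isset_elts PL d)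
  then obtain X where X: "X \<in> M" "elts X = {p \<in> Pc. D p}" by (auto simp: isset_def)
  have "dense P L X"
    unfolding dense_def X(2) using dense le_graph by blast
  with gen X show ?thesis by (auto simp: generic_def)
qed

text \<open>Genericity is applied to the conditions that are in \<open>D\<close> below
  \<open>p0\<close> or incompatible with \<open>p0\<close>; those of the second kind cannot lie in
  \<open>G\<close>.\<close>

lemma G_meet_below:
  assumes d: "dfn {} (\<lambda>e. D (e 0))" and p0: "p0 \<in> G"
    and dense: "\<And>p. p \<in> Pc \<Longrightarrow> le p p0 \<Longrightarrow> \<exists>d\<in>Pc. D d \<and> le d p"
  shows "\<exists>p\<in>G. D p \<and> le p p0"
proof -
  have p0P: "p0 \<in> Pc" "p0 \<in> M" using p0 GP Pc_M by auto
  have "\<exists>p\<in>G. (D p \<and> le p p0) \<or> (\<forall>r\<in>Pc. \<not> (le r p \<and> le r p0))"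
  proof (rule G_meet)
    show "dfn {} (\<lambda>e. (D (e 0) \<and> le (e 0) p0) \<or> (\<forall>r\<in>Pc. \<not> (le r (e 0) \<and> le r p0)))"
      by (intro df inst1[where S=D, OF d] p0P)
    fix p assume p: "p \<in> Pc"
    show "\<exists>d\<in>Pc. ((D d \<and> le d p0) \<or> (\<forall>r\<in>Pc. \<not> (le r d \<and> le r p0))) \<and> le d p"
    proof (cases "\<exists>r\<in>Pc. le r p \<and> le r p0")
      case True
      then obtain r where r: "r \<in> Pc" "le r p" "le r p0" by blast
      then obtain d where "d \<in> Pc" "D d" "le d r" using dense by blast
      with r p p0P le_trans show ?thesis by blast
    qed (use p in auto)
  qed
  with p0 G_dir GP show ?thesis by blast
qed

text \<open>The relation \<open>R\<close> is left open so that the same clause covers the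
  approximations \<open>tr F\<close> and the final relation \<open>feq\<close>.\<close>

definition fsub :: "('a \<Rightarrow> 'a \<Rightarrow> 'a \<Rightarrow> bool) \<Rightarrow> 'a \<Rightarrow> 'a \<Rightarrow> 'a \<Rightarrow> bool" where
  "fsub R p \<sigma> \<tau> \<longleftrightarrow> (\<forall>\<rho>\<in>M. \<forall>s\<in>Pc. pr \<rho> s \<in> elts \<sigma> \<longrightarrow> (\<forall>q\<in>Pc. le q p \<and> le q s \<longrightarrow>
     (\<exists>r\<in>Pc. le r q \<and> (\<exists>\<pi>\<in>M. \<exists>t\<in>Pc. pr \<pi> t \<in> elts \<tau> \<and> le r t \<and> R r \<rho> \<pi>))))"

lemma name_elts_iff: "(\<pi>, t) \<in> name_elts P \<tau> \<longleftrightarrow> \<pi> \<in> M \<and> t \<in> Pc \<and> pr \<pi> t \<in> elts \<tau>"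
  by (auto simp: name_elts_def graph_iff elts_M)

lemma forces_subset_iff: "p \<in> Pc \<Longrightarrow> forces_subset P L R p \<sigma> \<tau> \<longleftrightarrow> fsub (\<lambda>p \<sigma> \<tau>. (p, \<sigma>, \<tau>) \<in> R) p \<sigma> \<tau>"
  unfolding forces_subset_def fsub_def
  by (simp add: split_def Ball_def Bex_def name_elts_iff le_graph cong: conj_cong imp_cong) blast

definition tr :: "'a \<Rightarrow> 'a \<Rightarrow> 'a \<Rightarrow> 'a \<Rightarrow> bool" where
  "tr F p \<sigma> \<tau> \<longleftrightarrow> pr p (pr \<sigma> \<tau>) \<in> elts F"

lemma triples_iff: "(p, \<sigma>, \<tau>) \<in> triples F \<longleftrightarrow> p \<in> M \<and> \<sigma> \<in> M \<and> \<tau> \<in> M \<and> tr F p \<sigma> \<tau>"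
proof -
  have "(\<exists>d\<in>M. is_opair d \<sigma> \<tau> \<and> (p, d) \<in> graph F) \<longleftrightarrow> p \<in> M \<and> \<sigma> \<in> M \<and> \<tau> \<in> M \<and> pr p (pr \<sigma> \<tau>) \<in> elts F"
    unfolding graph_iff using is_opair is_opair_M pr_M by blast
  then show ?thesis by (simp add: triples_def tr_def)
qed

lemma df_tr [df]: "tm C t0 \<Longrightarrow> tm C t1 \<Longrightarrow> tm C t2 \<Longrightarrow> tm C t3 \<Longrightarrow> dfn C (\<lambda>e. tr (t0 e) (t1 e) (t2 e) (t3 e))"
  unfolding tr_def by (intro df)

lemma df_fsub_tr0: "dfn C (\<lambda>e. fsub (tr (e 0)) (e (Suc 0)) (e (Suc (Suc 0))) (e (Suc (Suc (Suc 0)))))"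
  unfolding fsub_def by (intro df)

lemmas df_fsub_tr [df] = inst4[where S="\<lambda>F. fsub (tr F)", OF df_fsub_tr0]

definition nclosed :: "'a \<Rightarrow> bool" where
  "nclosed X \<longleftrightarrow> (\<forall>\<nu>\<in>elts X. \<forall>\<rho>\<in>M. \<forall>s\<in>Pc. pr \<rho> s \<in> elts \<nu> \<longrightarrow> \<rho> \<in> elts X)"

definition eqrec :: "'a \<Rightarrow> 'a \<Rightarrow> bool" where
  "eqrec X F \<longleftrightarrow> nclosed X \<and> (\<forall>p\<in>Pc. \<forall>\<sigma>\<in>elts X. \<forall>\<tau>\<in>elts X.
     tr F p \<sigma> \<tau> \<longleftrightarrow> fsub (tr F) p \<sigma> \<tau> \<and> fsub (tr F) p \<tau> \<sigma>)"

lemma fsub_cong: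
  assumes "\<And>r \<rho> \<pi> s t. r \<in> Pc \<Longrightarrow> \<rho> \<in> M \<Longrightarrow> s \<in> Pc \<Longrightarrow> pr \<rho> s \<in> elts \<sigma> \<Longrightarrow> \<pi> \<in> M \<Longrightarrow> t \<in> Pc \<Longrightarrow> pr \<pi> t \<in> elts \<tau> \<Longrightarrow> R r \<rho> \<pi> = R' r \<rho> \<pi>"
  shows "fsub R p \<sigma> \<tau> = fsub R' p \<sigma> \<tau>"
  unfolding fsub_def using assms by (intro ball_cong refl imp_cong bex_cong conj_cong)

lemma equality_recursion_iff: "equality_recursion P L X F \<longleftrightarrow> eqrec X F"
proof -
  have f: "forces_subset P L (triples F) p \<sigma> \<tau> \<longleftrightarrow> fsub (tr F) p \<sigma> \<tau>"
    if "p \<in> Pc" "\<sigma> \<in> M" "\<tau> \<in> M" for p \<sigma> \<tau>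
    unfolding forces_subset_iff[OF that(1)]
    by (rule fsub_cong) (auto simp: triples_iff Pc_M)
  have "(\<forall>\<nu>\<in>elts X. \<forall>(\<rho>, s)\<in>name_elts P \<nu>. \<rho> \<in> elts X) \<longleftrightarrow> nclosed X"
    unfolding nclosed_def Ball_def split_paired_All prod.case name_elts_iff by blast
  moreover have "(\<forall>p\<in>Pc. \<forall>\<sigma>\<in>elts X. \<forall>\<tau>\<in>elts X. (p, \<sigma>, \<tau>) \<in> triples F \<longleftrightarrow>
       forces_subset P L (triples F) p \<sigma> \<tau> \<and> forces_subset P L (triples F) p \<tau> \<sigma>) \<longleftrightarrow>
     (\<forall>p\<in>Pc. \<forall>\<sigma>\<in>elts X. \<forall>\<tau>\<in>elts X. tr F p \<sigma> \<tau> \<longleftrightarrow> fsub (tr F) p \<sigma> \<tau> \<and> fsub (tr F) p \<tau> \<sigma>)"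
    by (intro ball_cong refl) (simp add: f triples_iff elts_M)
  ultimately show ?thesis unfolding equality_recursion_def eqrec_def by simp
qed

abbreviation feq :: "'a \<Rightarrow> 'a \<Rightarrow> 'a \<Rightarrow> bool" where "feq \<equiv> forces_eq P L"

lemma feq_def: "feq p \<sigma> \<tau> \<longleftrightarrow> p \<in> M \<and> (\<exists>X\<in>M. \<exists>F\<in>M. eqrec X F \<and> \<sigma> \<in> elts X \<and> \<tau> \<in> elts X \<and> tr F p \<sigma> \<tau>)"
  unfolding forces_eq_def equality_recursion_iff triples_iff using elts_M by blast

lemma df_feq0: "dfn C (\<lambda>e. feq (e 0) (e (Suc 0)) (e (Suc (Suc 0))))"
  unfolding feq_def eqrec_def nclosed_def by (intro df)

lemmas df_feq [df] = inst3[where S=feq, OF df_feq0]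

lemma fsub_mono:
  "fsub R p \<sigma> \<tau> \<Longrightarrow> (\<And>r \<rho> \<pi>. R r \<rho> \<pi> \<Longrightarrow> R' r \<rho> \<pi>) \<Longrightarrow> fsub R' p \<sigma> \<tau>"
  unfolding fsub_def by meson

text \<open>Forced equality of smaller names occurs positively in the recursion, so a solution is
  obtained as the greatest fixed point inside the model.\<close>

lemma eqrec_ex:
  assumes X: "X \<in> M" "nclosed X"
  shows "\<exists>F\<in>M. eqrec X F"
proof -
  let ?B = "prd Pc (prd (elts X) (elts X))"
  define T where "T F = {u \<in> ?B. \<exists>p\<in>Pc. \<exists>\<sigma>\<in>elts X. \<exists>\<tau>\<in>elts X. u = pr p (pr \<sigma> \<tau>) \<and>
      fsub (tr F) p \<sigma> \<tau> \<and> fsub (tr F) p \<tau> \<sigma>}" for F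
  have B: "isset ?B" by (intro isset_prd isset_elts PL X)
  have T: "isset (T F)" if "F \<in> M" for F
    unfolding T_def by (intro isset_sep B df X that)
  have T_iff: "pr p (pr \<sigma> \<tau>) \<in> T F \<longleftrightarrow> fsub (tr F) p \<sigma> \<tau> \<and> fsub (tr F) p \<tau> \<sigma>"
    if "p \<in> Pc" "\<sigma> \<in> elts X" "\<tau> \<in> elts X" for p \<sigma> \<tau> F
  proof -
    have "p \<in> M" "\<sigma> \<in> M" "\<tau> \<in> M" using that elts_M by auto
    moreover have "pr p (pr \<sigma> \<tau>) \<in> ?B" using that by (auto simp: prd_def)
    ultimately show ?thesis using that elts_M unfolding T_def by (auto simp: pr_M)
  qed
  have T_mono: "T F \<subseteq> T F'" if "elts F \<subseteq> elts F'" for F F'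
  proof -
    have "fsub (tr F) p \<sigma> \<tau> \<Longrightarrow> fsub (tr F') p \<sigma> \<tau>" for p \<sigma> \<tau>
      by (erule fsub_mono) (use that in \<open>auto simp: tr_def\<close>)
    then show ?thesis unfolding T_def by blast
  qed
  have "isset {F \<in> Pw ?B. \<forall>u\<in>elts F. \<exists>p\<in>Pc. \<exists>\<sigma>\<in>elts X. \<exists>\<tau>\<in>elts X. u = pr p (pr \<sigma> \<tau>) \<and>
      fsub (tr F) p \<sigma> \<tau> \<and> fsub (tr F) p \<tau> \<sigma>}"
    by (intro isset_sep isset_Pw B df X)
  also have "{F \<in> Pw ?B. \<forall>u\<in>elts F. \<exists>p\<in>Pc. \<exists>\<sigma>\<in>elts X. \<exists>\<tau>\<in>elts X. u = pr p (pr \<sigma> \<tau>) \<and>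
      fsub (tr F) p \<sigma> \<tau> \<and> fsub (tr F) p \<tau> \<sigma>} = {F \<in> Pw ?B. elts F \<subseteq> T F}"
    by (auto simp: T_def Pw_def)
  finally have "isset (\<Union>F\<in>{F \<in> Pw ?B. elts F \<subseteq> T F}. elts F)" by (rule isset_UN)
  then obtain U where U: "U \<in> M" "elts U = (\<Union>F\<in>{F \<in> Pw ?B. elts F \<subseteq> T F}. elts F)"
    by (auto simp: isset_def)
  have sub: "elts F \<subseteq> elts U" if "F \<in> M" "elts F \<subseteq> ?B" "elts F \<subseteq> T F" for F
    using that U by (auto simp: Pw_def)
  have 1: "elts U \<subseteq> T U"
  proof
    fix u assume "u \<in> elts U"
    then obtain F where "F \<in> M" "elts F \<subseteq> ?B" "elts F \<subseteq> T F" "u \<in> elts F" using U by (auto simp: Pw_def)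
    with sub T_mono show "u \<in> T U" by blast
  qed
  \<comment> \<open>\<open>T U\<close> is itself contained in its image under the operator, hence
    one of the sets united in \<open>U\<close>.\<close>
  have "T U \<subseteq> elts U"
    using sub[of "mk (T U)"] mk[OF T[OF U(1)]] T_mono[of U "mk (T U)"] 1 by (auto simp: T_def)
  with 1 have "elts U = T U" by blast
  then have "eqrec X U" using X T_iff by (auto simp: eqrec_def tr_def)
  with U show ?thesis by blast
qed

text \<open>A name \<rho> in a pair of \<sigma> lies three membership steps below \<sigma>, since
  pairs are Kuratowski pairs; the induction therefore carries the property two levels further
  down.\<close>

lemma name_induct [consumes 1, case_names dfn step]:
  assumes x: "x \<in> M" and d: "dfn {} (\<lambda>e. Q (e 0))"
    and s: "\<And>\<sigma>. \<sigma> \<in> M \<Longrightarrow> (\<And>\<rho> s. pr \<rho> s \<in> elts \<sigma> \<Longrightarrow> \<rho> \<in> M \<Longrightarrow> s \<in> M \<Longrightarrow> Q \<rho>) \<Longrightarrow> Q \<sigma>"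
  shows "Q x"
proof -
  have "Q x \<and> (\<forall>y\<in>elts x. Q y \<and> (\<forall>z\<in>elts y. Q z))"
    using x
  proof (induction x rule: eps_induct)
    case dfn show ?case by (intro df inst1[where S=Q, OF d])
  next
    case (step x)
    have "Q x"
    proof (rule s[OF step(1)])
      fix \<rho> s assume *: "pr \<rho> s \<in> elts x" "\<rho> \<in> M" "s \<in> M"
      have "mk {\<rho>} \<in> elts (pr \<rho> s)" "\<rho> \<in> elts (mk {\<rho>})"
        using * by (auto simp: pr_def mk isset_sing isset_pair)
      with step(2)[OF *(1)] show "Q \<rho>" by blast
    qed
    with step(2) show ?case by blast
  qed
  then show ?thesis by blast
qed

text \<open>The recursion descends along names, so solutions agree on common names even though one
  was obtained as a greatest fixed point. Both orders of the arguments are carried, because the two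
  inclusions exchange the roles of \<sigma> and \<tau>.\<close>

lemma eqrec_unique:
  assumes "\<sigma> \<in> M" "X \<in> M" "F \<in> M" "X' \<in> M" "F' \<in> M" "eqrec X F" "eqrec X' F'"
  shows "\<sigma> \<in> elts X \<and> \<sigma> \<in> elts X' \<longrightarrow> (\<forall>\<tau>\<in>elts X. \<tau> \<in> elts X' \<longrightarrow> (\<forall>p\<in>Pc.
     (tr F p \<sigma> \<tau> \<longleftrightarrow> tr F' p \<sigma> \<tau>) \<and> (tr F p \<tau> \<sigma> \<longleftrightarrow> tr F' p \<tau> \<sigma>)))"
  using assms(1)
proof (induction \<sigma> rule: name_induct)
  case dfn show ?case by (intro df assms)
next
  case (step \<sigma>)
  show ?case
  proof (intro impI ballI)
    fix \<tau> p assume \<sigma>: "\<sigma> \<in> elts X \<and> \<sigma> \<in> elts X'" and \<tau>: "\<tau> \<in> elts X" "\<tau> \<in> elts X'" and p: "p \<in> Pc"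
    have cl: "\<rho> \<in> elts X \<and> \<rho> \<in> elts X'" if "\<nu> \<in> elts X" "\<nu> \<in> elts X'" "\<rho> \<in> M" "s \<in> Pc" "pr \<rho> s \<in> elts \<nu>" for \<nu> \<rho> s
      using that assms(6,7) unfolding eqrec_def nclosed_def by blast
    have 1: "fsub (tr F) p \<sigma> \<tau> = fsub (tr F') p \<sigma> \<tau>" if "p \<in> Pc" for p
    proof (rule fsub_cong)
      fix r \<rho> \<pi> s t
      assume *: "r \<in> Pc" "\<rho> \<in> M" "s \<in> Pc" "pr \<rho> s \<in> elts \<sigma>" "\<pi> \<in> M" "t \<in> Pc" "pr \<pi> t \<in> elts \<tau>"
      then show "tr F r \<rho> \<pi> = tr F' r \<rho> \<pi>"
        using step(2)[OF *(4,2) Pc_M[OF *(3)]] cl[of \<sigma> \<rho> s] cl[of \<tau> \<pi> t] \<sigma> \<tau> by blast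
    qed
    have 2: "fsub (tr F) p \<tau> \<sigma> = fsub (tr F') p \<tau> \<sigma>" if "p \<in> Pc" for p
    proof (rule fsub_cong)
      fix r \<rho> \<pi> s t
      assume *: "r \<in> Pc" "\<rho> \<in> M" "s \<in> Pc" "pr \<rho> s \<in> elts \<tau>" "\<pi> \<in> M" "t \<in> Pc" "pr \<pi> t \<in> elts \<sigma>"
      then show "tr F r \<rho> \<pi> = tr F' r \<rho> \<pi>"
        using step(2)[OF *(7,5) Pc_M[OF *(6)]] cl[of \<tau> \<rho> s] cl[of \<sigma> \<pi> t] \<sigma> \<tau> by blast
    qed
    show "(tr F p \<sigma> \<tau> \<longleftrightarrow> tr F' p \<sigma> \<tau>) \<and> (tr F p \<tau> \<sigma> \<longleftrightarrow> tr F' p \<tau> \<sigma>)"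
      using 1[OF p] 2[OF p] assms(6,7) \<sigma> \<tau> p unfolding eqrec_def by blast
  qed
qed

lemma nclosed_ex:
  assumes "\<sigma> \<in> M" "\<tau> \<in> M" shows "\<exists>X\<in>M. nclosed X \<and> \<sigma> \<in> elts X \<and> \<tau> \<in> elts X"
proof -
  have m: "mk {\<sigma>, \<tau>} \<in> M" "elts (mk {\<sigma>, \<tau>}) = {\<sigma>, \<tau>}" using assms by (auto simp: mk isset_pair)
  obtain X where X: "X \<in> M" "mk {\<sigma>, \<tau>} \<in> elts X" "\<forall>y\<in>elts X. elts y \<subseteq> elts X"
    using trans_closure[OF m(1)] by blast
  have "nclosed X"
    unfolding nclosed_def
  proof (intro ballI impI)
    fix \<nu> \<rho> s assume *: "\<nu> \<in> elts X" "\<rho> \<in> M" "s \<in> Pc" "pr \<rho> s \<in> elts \<nu>"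
    then have "s \<in> M" by (auto intro: Pc_M)
    then have "mk {\<rho>} \<in> elts (pr \<rho> s)" "\<rho> \<in> elts (mk {\<rho>})"
      using * by (auto simp: pr_def mk isset_sing isset_pair)
    with X(3) * show "\<rho> \<in> elts X" by blast
  qed
  with X m show ?thesis by blast
qed

text \<open>By uniqueness any one closed set of names computes \<open>feq\<close>; the later
  arguments about forced equality work from this recursion equation.\<close>

lemma feq_iff:
  assumes p: "p \<in> Pc" and M: "\<sigma> \<in> M" "\<tau> \<in> M"
  shows "feq p \<sigma> \<tau> \<longleftrightarrow> fsub feq p \<sigma> \<tau> \<and> fsub feq p \<tau> \<sigma>"
proof -
  obtain X where X: "X \<in> M" "nclosed X" "\<sigma> \<in> elts X" "\<tau> \<in> elts X" using nclosed_ex M by blast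
  obtain F where F: "F \<in> M" "eqrec X F" using eqrec_ex X by blast
  have *: "feq p \<sigma> \<tau> \<longleftrightarrow> tr F p \<sigma> \<tau>" if "p \<in> Pc" "\<sigma> \<in> elts X" "\<tau> \<in> elts X" for p \<sigma> \<tau>
    using that X F eqrec_unique[of \<sigma> X F] unfolding feq_def by (meson elts_M)
  have cl: "\<rho> \<in> elts X" if "\<nu> \<in> elts X" "\<rho> \<in> M" "s \<in> Pc" "pr \<rho> s \<in> elts \<nu>" for \<nu> \<rho> s
    using that X unfolding nclosed_def by blast
  have "fsub feq p \<sigma> \<tau> = fsub (tr F) p \<sigma> \<tau>" if "\<sigma> \<in> elts X" "\<tau> \<in> elts X" for \<sigma> \<tau>
    by (rule fsub_cong) (use that * cl in blast)
  then show ?thesis using * p X F by (auto simp: eqrec_def)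
qed

lemma feq_sym: "p \<in> Pc \<Longrightarrow> \<sigma> \<in> M \<Longrightarrow> \<tau> \<in> M \<Longrightarrow> feq p \<sigma> \<tau> \<Longrightarrow> feq p \<tau> \<sigma>"
  by (simp add: feq_iff)

lemma fsubD: "fsub R p \<sigma> \<tau> \<Longrightarrow> \<rho> \<in> M \<Longrightarrow> s \<in> Pc \<Longrightarrow> pr \<rho> s \<in> elts \<sigma> \<Longrightarrow> q \<in> Pc \<Longrightarrow> le q p \<Longrightarrow> le q s \<Longrightarrow>
   \<exists>r\<in>Pc. le r q \<and> (\<exists>\<pi>\<in>M. \<exists>t\<in>Pc. pr \<pi> t \<in> elts \<tau> \<and> le r t \<and> R r \<rho> \<pi>)"
  unfolding fsub_def by blast

lemma fsubE:
  assumes "fsub R p \<sigma> \<tau>" "\<rho> \<in> M" "s \<in> Pc" "pr \<rho> s \<in> elts \<sigma>" "q \<in> Pc" "le q p" "le q s"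
  obtains r \<pi> t where "r \<in> Pc" "le r q" "\<pi> \<in> M" "t \<in> Pc" "pr \<pi> t \<in> elts \<tau>" "le r t" "R r \<rho> \<pi>"
  using fsubD[OF assms] by blast

lemma feq_refl0: "\<sigma> \<in> M \<Longrightarrow> \<forall>p\<in>Pc. feq p \<sigma> \<sigma>"
proof (induction \<sigma> rule: name_induct)
  case dfn show ?case by (intro df)
next
  case (step \<sigma>)
  show ?case
  proof
    fix p assume p: "p \<in> Pc"
    have "fsub feq p \<sigma> \<sigma>"
      unfolding fsub_def
    proof (intro ballI impI)
      fix \<rho> s q assume *: "\<rho> \<in> M" "s \<in> Pc" "pr \<rho> s \<in> elts \<sigma>" "q \<in> Pc" "le q p \<and> le q s"
      then have "feq q \<rho> \<rho>" using step(2) Pc_M by blast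
      with * le_refl show "\<exists>r\<in>Pc. le r q \<and> (\<exists>\<pi>\<in>M. \<exists>t\<in>Pc. pr \<pi> t \<in> elts \<sigma> \<and> le r t \<and> feq r \<rho> \<pi>)" by blast
    qed
    with p step(1) show "feq p \<sigma> \<sigma>" by (simp add: feq_iff)
  qed
qed

lemma feq_refl: "p \<in> Pc \<Longrightarrow> \<sigma> \<in> M \<Longrightarrow> feq p \<sigma> \<sigma>"
  using feq_refl0 by blast

lemma fsub_le: "p \<in> Pc \<Longrightarrow> q \<in> Pc \<Longrightarrow> le q p \<Longrightarrow> fsub R p \<sigma> \<tau> \<Longrightarrow> fsub R q \<sigma> \<tau>"
  unfolding fsub_def using le_trans by meson

lemma feq_le: "p \<in> Pc \<Longrightarrow> q \<in> Pc \<Longrightarrow> le q p \<Longrightarrow> \<sigma> \<in> M \<Longrightarrow> \<tau> \<in> M \<Longrightarrow> feq p \<sigma> \<tau> \<Longrightarrow> feq q \<sigma> \<tau>"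
  using fsub_le by (simp add: feq_iff)

lemma feq_trans0: "\<sigma> \<in> M \<Longrightarrow> \<forall>\<tau>\<in>M. \<forall>\<upsilon>\<in>M. \<forall>p\<in>Pc. feq p \<sigma> \<tau> \<longrightarrow> feq p \<tau> \<upsilon> \<longrightarrow> feq p \<sigma> \<upsilon>"
proof (induction \<sigma> rule: name_induct)
  case dfn show ?case by (intro df)
next
  case (step \<sigma>)
  have IH: "feq p \<rho> \<upsilon>" if "pr \<rho> s \<in> elts \<sigma>" "\<rho> \<in> M" "s \<in> Pc" "p \<in> Pc" "\<tau> \<in> M" "\<upsilon> \<in> M" "feq p \<rho> \<tau>" "feq p \<tau> \<upsilon>" for \<rho> s p \<tau> \<upsilon>
    using step(2)[of \<rho> s] that Pc_M by blast
  show ?case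
  proof (intro ballI impI)
    fix \<tau> \<upsilon> p assume M: "\<tau> \<in> M" "\<upsilon> \<in> M" and p: "p \<in> Pc" and 1: "feq p \<sigma> \<tau>" and 2: "feq p \<tau> \<upsilon>"
    have f1: "fsub feq p \<sigma> \<tau>" "fsub feq p \<tau> \<sigma>" using 1 p M step(1) by (auto simp: feq_iff)
    have f2: "fsub feq p \<tau> \<upsilon>" "fsub feq p \<upsilon> \<tau>" using 2 p M by (auto simp: feq_iff)
    have "fsub feq p \<sigma> \<upsilon>"
      unfolding fsub_def
    proof (intro ballI impI)
      fix \<rho> s q assume *: "\<rho> \<in> M" "s \<in> Pc" "pr \<rho> s \<in> elts \<sigma>" "q \<in> Pc" "le q p \<and> le q s"
      then obtain r \<pi> t where r: "r \<in> Pc" "le r q" "\<pi> \<in> M" "t \<in> Pc" "pr \<pi> t \<in> elts \<tau>" "le r t" "feq r \<rho> \<pi>"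
        using fsubE[OF f1(1) *(1-4)] by blast
      have "le r p" using le_trans r * p by blast
      then obtain r' \<chi> u where r': "r' \<in> Pc" "le r' r" "\<chi> \<in> M" "u \<in> Pc" "pr \<chi> u \<in> elts \<upsilon>" "le r' u" "feq r' \<pi> \<chi>"
        using fsubE[OF f2(1) r(3,4,5,1) _ r(6)] by blast
      have "feq r' \<rho> \<pi>" using feq_le r r' * by blast
      then have "feq r' \<rho> \<chi>" using IH * r r' by blast
      moreover have "le r' q" using le_trans r r' * by blast
      ultimately show "\<exists>r\<in>Pc. le r q \<and> (\<exists>\<pi>\<in>M. \<exists>t\<in>Pc. pr \<pi> t \<in> elts \<upsilon> \<and> le r t \<and> feq r \<rho> \<pi>)" using r' by blast
    qed
    moreover have "fsub feq p \<upsilon> \<sigma>"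
      unfolding fsub_def
    proof (intro ballI impI)
      fix \<rho> s q assume *: "\<rho> \<in> M" "s \<in> Pc" "pr \<rho> s \<in> elts \<upsilon>" "q \<in> Pc" "le q p \<and> le q s"
      then obtain r \<pi> t where r: "r \<in> Pc" "le r q" "\<pi> \<in> M" "t \<in> Pc" "pr \<pi> t \<in> elts \<tau>" "le r t" "feq r \<rho> \<pi>"
        using fsubE[OF f2(2) *(1-4)] by blast
      have "le r p" using le_trans r * p by blast
      then obtain r' \<chi> u where r': "r' \<in> Pc" "le r' r" "\<chi> \<in> M" "u \<in> Pc" "pr \<chi> u \<in> elts \<sigma>" "le r' u" "feq r' \<pi> \<chi>"
        using fsubE[OF f1(2) r(3,4,5,1) _ r(6)] by blast
      have "feq r' \<rho> \<pi>" using feq_le r r' * by blast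
      \<comment> \<open>The induction hypothesis speaks of names occurring in \<sigma>, so
        transitivity is applied starting from \<chi>, with symmetry before and after.\<close>
      then have "feq r' \<chi> \<rho>" using IH[of \<chi> u r' \<pi> \<rho>] feq_sym * r r' by blast
      then have "feq r' \<rho> \<chi>" using feq_sym * r' by blast
      moreover have "le r' q" using le_trans r r' * by blast
      ultimately show "\<exists>r\<in>Pc. le r q \<and> (\<exists>\<pi>\<in>M. \<exists>t\<in>Pc. pr \<pi> t \<in> elts \<sigma> \<and> le r t \<and> feq r \<rho> \<pi>)" using r' by blast
    qed
    ultimately show "feq p \<sigma> \<upsilon>" using p M step(1) by (simp add: feq_iff)
  qed
qed

lemma feq_trans:
  "p \<in> Pc \<Longrightarrow> \<sigma> \<in> M \<Longrightarrow> \<tau> \<in> M \<Longrightarrow> \<upsilon> \<in> M \<Longrightarrow> feq p \<sigma> \<tau> \<Longrightarrow> feq p \<tau> \<upsilon> \<Longrightarrow> feq p \<sigma> \<upsilon>"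
  using feq_trans0 by blast

section \<open>Names up to equality in the extension\<close>

definition eqv :: "'a \<Rightarrow> 'a \<Rightarrow> bool" where "eqv \<sigma> \<tau> \<longleftrightarrow> (\<exists>p\<in>G. feq p \<sigma> \<tau>)"

lemma eqv_refl: "\<sigma> \<in> M \<Longrightarrow> eqv \<sigma> \<sigma>"
  using G_ne GP feq_refl by (auto simp: eqv_def)

lemma eqv_sym: "\<sigma> \<in> M \<Longrightarrow> \<tau> \<in> M \<Longrightarrow> eqv \<sigma> \<tau> \<Longrightarrow> eqv \<tau> \<sigma>"
  unfolding eqv_def using GP feq_sym by blast

lemma eqv_trans: "\<sigma> \<in> M \<Longrightarrow> \<tau> \<in> M \<Longrightarrow> \<upsilon> \<in> M \<Longrightarrow> eqv \<sigma> \<tau> \<Longrightarrow> eqv \<tau> \<upsilon> \<Longrightarrow> eqv \<sigma> \<upsilon>"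
proof -
  assume M: "\<sigma> \<in> M" "\<tau> \<in> M" "\<upsilon> \<in> M" and "eqv \<sigma> \<tau>" "eqv \<tau> \<upsilon>"
  then obtain p q where p: "p \<in> G" "feq p \<sigma> \<tau>" "q \<in> G" "feq q \<tau> \<upsilon>" by (auto simp: eqv_def)
  then obtain r where r: "r \<in> G" "le r p" "le r q" using G_dir by blast
  have "feq r \<sigma> \<tau>" "feq r \<tau> \<upsilon>" using p r M GP feq_le by blast+
  then have "feq r \<sigma> \<upsilon>" using feq_trans[OF GP[OF r(1)] M] by blast
  with r show "eqv \<sigma> \<upsilon>" by (auto simp: eqv_def)
qed

abbreviation vl :: "'a \<Rightarrow> 'a set" where "vl \<equiv> val P L G"

lemma vl_def: "vl \<tau> = {\<sigma> \<in> M. eqv \<sigma> \<tau>}"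
  by (auto simp: val_def eqv_def)

lemma vl_eq: "\<sigma> \<in> M \<Longrightarrow> \<tau> \<in> M \<Longrightarrow> vl \<sigma> = vl \<tau> \<longleftrightarrow> eqv \<sigma> \<tau>"
proof
  assume M: "\<sigma> \<in> M" "\<tau> \<in> M"
  show "eqv \<sigma> \<tau>" if "vl \<sigma> = vl \<tau>" using that M eqv_refl[OF M(1)] by (auto simp: vl_def)
  show "vl \<sigma> = vl \<tau>" if "eqv \<sigma> \<tau>"
    unfolding vl_def using that eqv_trans[OF _ M] eqv_trans[OF _ M(2,1)] eqv_sym[OF M] by blast
qed

text \<open>Below a common extension in \<open>G\<close> of \<open>t\<close> and the condition that
  forces equality, the conditions that find a partner of \<pi> in \<tau> are dense. So membership
  does not depend on the chosen name.\<close>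

lemma eqv_elt:
  assumes M: "\<sigma> \<in> M" "\<tau> \<in> M" and e: "eqv \<sigma> \<tau>" and \<pi>: "\<pi> \<in> M" "t \<in> G" "pr \<pi> t \<in> elts \<sigma>"
  shows "\<exists>\<pi>'\<in>M. \<exists>t'\<in>G. pr \<pi>' t' \<in> elts \<tau> \<and> eqv \<pi> \<pi>'"
proof -
  obtain p where p: "p \<in> G" "feq p \<sigma> \<tau>" using e by (auto simp: eqv_def)
  then have f: "fsub feq p \<sigma> \<tau>" using M GP by (simp add: feq_iff)
  obtain p0 where p0: "p0 \<in> G" "le p0 p" "le p0 t" using G_dir p \<pi> by blast
  have "\<exists>r\<in>G. (\<exists>\<pi>'\<in>M. \<exists>t'\<in>Pc. pr \<pi>' t' \<in> elts \<tau> \<and> le r t' \<and> feq r \<pi> \<pi>') \<and> le r p0"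
  proof (rule G_meet_below[OF _ p0(1)])
    show "dfn {} (\<lambda>e. \<exists>\<pi>'\<in>M. \<exists>t'\<in>Pc. pr \<pi>' t' \<in> elts \<tau> \<and> le (e 0) t' \<and> feq (e 0) \<pi> \<pi>')"
      by (intro df M \<pi>)
    fix q assume q: "q \<in> Pc" "le q p0"
    then have "le q p" "le q t" using le_trans p0 p \<pi> GP by blast+
    from fsubD[OF f \<pi>(1) GP[OF \<pi>(2)] \<pi>(3) q(1) this]
    show "\<exists>d\<in>Pc. (\<exists>\<pi>'\<in>M. \<exists>t'\<in>Pc. pr \<pi>' t' \<in> elts \<tau> \<and> le d t' \<and> feq d \<pi> \<pi>') \<and> le d q" by blast
  qed
  then show ?thesis using G_up by (auto simp: eqv_def)
qed

abbreviation mem :: "'a set \<Rightarrow> 'a set \<Rightarrow> bool" where "mem \<equiv> ext_mem P L G"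
abbreviation N :: "'a set set" where "N \<equiv> ext_carrier P L G"

lemma N_iff: "x \<in> N \<longleftrightarrow> (\<exists>\<tau>\<in>M. x = vl \<tau>)"
  by (auto simp: ext_carrier_def)

lemma mem_iff: "\<tau> \<in> M \<Longrightarrow> mem x (vl \<tau>) \<longleftrightarrow> (\<exists>\<pi>\<in>M. \<exists>t\<in>G. pr \<pi> t \<in> elts \<tau> \<and> x = vl \<pi>)"
proof
  assume \<tau>: "\<tau> \<in> M" and m: "mem x (vl \<tau>)"
  then obtain \<sigma> \<pi> t where s: "\<sigma> \<in> M" "vl \<tau> = vl \<sigma>" "t \<in> G" "x = vl \<pi>" "\<pi> \<in> M" "pr \<pi> t \<in> elts \<sigma>"
    unfolding ext_mem_def by (auto simp: name_elts_iff)
  then have "eqv \<sigma> \<tau>" using vl_eq \<tau> by metis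
  with s \<tau> eqv_elt[of \<sigma> \<tau> \<pi> t] show "\<exists>\<pi>\<in>M. \<exists>t\<in>G. pr \<pi> t \<in> elts \<tau> \<and> x = vl \<pi>" using vl_eq by metis
next
  assume "\<tau> \<in> M" "\<exists>\<pi>\<in>M. \<exists>t\<in>G. pr \<pi> t \<in> elts \<tau> \<and> x = vl \<pi>"
  then show "mem x (vl \<tau>)" unfolding ext_mem_def using GP name_elts_iff by blast
qed

lemma mem_N: "mem x y \<Longrightarrow> x \<in> N"
  unfolding ext_mem_def N_iff by (auto simp: name_elts_iff)

text \<open>Some condition in \<open>G\<close> forces equality or is a witness \<open>D\<close>
  against one of the inclusions; a witness in \<open>G\<close> would exhibit an element of one value
  that is missing from the other.\<close>

lemma ext_extn0:
  assumes M: "\<sigma> \<in> M" "\<tau> \<in> M" and s: "\<And>x. mem x (vl \<sigma>) \<longleftrightarrow> mem x (vl \<tau>)"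
  shows "vl \<sigma> = vl \<tau>"
proof -
  define D where "D p \<sigma> \<tau> \<longleftrightarrow> (\<exists>\<rho>\<in>M. \<exists>s\<in>Pc. pr \<rho> s \<in> elts \<sigma> \<and> le p s \<and>
     (\<forall>r\<in>Pc. le r p \<longrightarrow> \<not> (\<exists>\<pi>\<in>M. \<exists>t\<in>Pc. pr \<pi> t \<in> elts \<tau> \<and> le r t \<and> feq r \<rho> \<pi>)))" for p \<sigma> \<tau>
  have ex: "\<exists>q\<in>Pc. D q \<sigma> \<tau> \<and> le q p" if "p \<in> Pc" "\<not> fsub feq p \<sigma> \<tau>" for p \<sigma> \<tau>
    using that unfolding fsub_def D_def by blast
  have no: "False" if pD: "p \<in> G" "D p \<sigma> \<tau>" and st: "\<sigma> \<in> M" "\<tau> \<in> M" and sub: "\<And>x. mem x (vl \<sigma>) \<Longrightarrow> mem x (vl \<tau>)" for p \<sigma> \<tau>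
  proof -
    obtain \<rho> s where r: "\<rho> \<in> M" "s \<in> Pc" "pr \<rho> s \<in> elts \<sigma>" "le p s"
      "\<forall>r\<in>Pc. le r p \<longrightarrow> \<not> (\<exists>\<pi>\<in>M. \<exists>t\<in>Pc. pr \<pi> t \<in> elts \<tau> \<and> le r t \<and> feq r \<rho> \<pi>)" using pD(2) unfolding D_def by blast
    have "s \<in> G" using G_up pD(1) r by blast
    then have "mem (vl \<rho>) (vl \<sigma>)" unfolding mem_iff[OF st(1)] using r(1,3) by blast
    then have "\<exists>\<pi>\<in>M. \<exists>t\<in>G. pr \<pi> t \<in> elts \<tau> \<and> vl \<rho> = vl \<pi>"
      using sub mem_iff[OF st(2)] by simp
    then obtain \<pi> t where \<pi>: "\<pi> \<in> M" "t \<in> G" "pr \<pi> t \<in> elts \<tau>" "vl \<rho> = vl \<pi>" by (elim bexE conjE)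
    then have "eqv \<rho> \<pi>" using vl_eq[OF r(1)] by simp
    then obtain p1 where "p1 \<in> G" "feq p1 \<rho> \<pi>" unfolding eqv_def by blast
    then obtain r0 where r0: "r0 \<in> G" "le r0 p1" "le r0 t" using G_dir \<pi> by blast
    then obtain r1 where "r1 \<in> G" "le r1 r0" "le r1 p" using G_dir pD(1) by blast
    moreover from this have "le r1 t" "le r1 p1"
      using r0 \<pi> \<open>p1 \<in> G\<close> GP le_trans by blast+
    moreover from this have "feq r1 \<rho> \<pi>"
      using feq_le[of p1 r1] \<open>r1 \<in> G\<close> \<pi> \<open>p1 \<in> G\<close> \<open>feq p1 \<rho> \<pi>\<close> GP r(1) by blast
    ultimately show False using r(5) \<pi> GP by blast
  qed
  have "\<exists>p\<in>G. feq p \<sigma> \<tau> \<or> D p \<sigma> \<tau> \<or> D p \<tau> \<sigma>"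
  proof (rule G_meet)
    show "dfn {} (\<lambda>e. feq (e 0) \<sigma> \<tau> \<or> D (e 0) \<sigma> \<tau> \<or> D (e 0) \<tau> \<sigma>)"
      unfolding D_def by (intro df M)
    fix p assume p: "p \<in> Pc"
    then show "\<exists>d\<in>Pc. (feq d \<sigma> \<tau> \<or> D d \<sigma> \<tau> \<or> D d \<tau> \<sigma>) \<and> le d p"
      using feq_iff[OF p M] ex[OF p] le_refl[OF p] by blast
  qed
  then have "eqv \<sigma> \<tau>" using no M s unfolding eqv_def by blast
  with M vl_eq show ?thesis by blast
qed

lemma ext_extn: "x \<in> N \<Longrightarrow> y \<in> N \<Longrightarrow> (\<And>u. mem u x \<longleftrightarrow> mem u y) \<Longrightarrow> x = y"
  using ext_extn0 by (auto simp: N_iff)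

section \<open>The truth lemma\<close>

text \<open>\<open>F\<close> is a forcing relation for \<open>Q\<close>. As the quantifiers of
  \<open>Q\<close> range over the ground model and \<open>G\<close> is a mere predicate, the clauses
  are those of forcing over a fixed domain. The clause that a condition forces what is forced
  densely below it is what the universal quantifier lives on.\<close>

definition forced :: "((nat \<Rightarrow> 'a) \<Rightarrow> bool) \<Rightarrow> ('a \<Rightarrow> (nat \<Rightarrow> 'a) \<Rightarrow> bool) \<Rightarrow> bool" where
  "forced Q F \<longleftrightarrow> dfn {} (\<lambda>e. F (e 0) (\<lambda>i. e (Suc i))) \<and> (\<forall>e. range e \<subseteq> M \<longrightarrow>
     (\<forall>p\<in>Pc. \<forall>q\<in>Pc. le q p \<longrightarrow> F p e \<longrightarrow> F q e) \<and>
     (\<forall>p\<in>Pc. (\<forall>q\<in>Pc. le q p \<longrightarrow> (\<exists>r\<in>Pc. le r q \<and> F r e)) \<longrightarrow> F p e) \<and>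
     (Q e \<longleftrightarrow> (\<exists>p\<in>G. F p e)))"

lemma forcedI:
  assumes "dfn {} (\<lambda>e. F (e 0) (\<lambda>i. e (Suc i)))"
    and "\<And>e p q. range e \<subseteq> M \<Longrightarrow> p \<in> Pc \<Longrightarrow> q \<in> Pc \<Longrightarrow> le q p \<Longrightarrow> F p e \<Longrightarrow> F q e"
    and "\<And>e p. range e \<subseteq> M \<Longrightarrow> p \<in> Pc \<Longrightarrow> (\<And>q. q \<in> Pc \<Longrightarrow> le q p \<Longrightarrow> \<exists>r\<in>Pc. le r q \<and> F r e) \<Longrightarrow> F p e"
    and "\<And>e. range e \<subseteq> M \<Longrightarrow> Q e \<Longrightarrow> \<exists>p\<in>G. F p e"
    and "\<And>e p. range e \<subseteq> M \<Longrightarrow> p \<in> G \<Longrightarrow> F p e \<Longrightarrow> Q e"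
  shows "forced Q F"
  unfolding forced_def using assms by meson

lemma forcedD:
  assumes "forced Q F"
  shows "dfn {} (\<lambda>e. F (e 0) (\<lambda>i. e (Suc i)))"
    and "range e \<subseteq> M \<Longrightarrow> p \<in> Pc \<Longrightarrow> q \<in> Pc \<Longrightarrow> le q p \<Longrightarrow> F p e \<Longrightarrow> F q e"
    and "range e \<subseteq> M \<Longrightarrow> p \<in> Pc \<Longrightarrow> (\<And>q. q \<in> Pc \<Longrightarrow> le q p \<Longrightarrow> \<exists>r\<in>Pc. le r q \<and> F r e) \<Longrightarrow> F p e"
    and "range e \<subseteq> M \<Longrightarrow> Q e \<longleftrightarrow> (\<exists>p\<in>G. F p e)"
proof -
  show "dfn {} (\<lambda>e. F (e 0) (\<lambda>i. e (Suc i)))" using assms unfolding forced_def by (rule conjunct1)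
  note * = assms[unfolded forced_def, THEN conjunct2, rule_format, of e]
  show "range e \<subseteq> M \<Longrightarrow> p \<in> Pc \<Longrightarrow> q \<in> Pc \<Longrightarrow> le q p \<Longrightarrow> F p e \<Longrightarrow> F q e" using * by blast
  show "range e \<subseteq> M \<Longrightarrow> p \<in> Pc \<Longrightarrow> (\<And>q. q \<in> Pc \<Longrightarrow> le q p \<Longrightarrow> \<exists>r\<in>Pc. le r q \<and> F r e) \<Longrightarrow> F p e" using * by blast
  show "range e \<subseteq> M \<Longrightarrow> Q e \<longleftrightarrow> (\<exists>p\<in>G. F p e)" using * by blast
qed

lemma forced_ren:
  assumes "forced Q F" shows "dfn {} (\<lambda>e. F (e k) (\<lambda>i. e (f i)))"
  using dfn_ren[OF forcedD(1)[OF assms], of "case_nat k f"] by simp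

lemma forced_at:
  assumes "forced Q F" "range e \<subseteq> M" shows "dfn {} (\<lambda>d. F (d 0) e)"
proof -
  have "dfn {} (\<lambda>d. F (subst (case_nat (Inl 0) (\<lambda>i. Inr (e i))) d 0) (\<lambda>i. subst (case_nat (Inl 0) (\<lambda>i. Inr (e i))) d (Suc i)))"
    by (rule dfn_subst[OF forcedD(1)[OF assms(1)]]) (use envD[OF assms(2)] in \<open>auto split: nat.splits\<close>)
  then show ?thesis by (simp add: subst_def)
qed

lemma forced_M:
  assumes "dfn {} Q" shows "forced Q (\<lambda>p. Q)"
proof (rule forcedI)
  show "dfn {} (\<lambda>e. Q (\<lambda>i. e (Suc i)))" by (rule dfn_ren[OF assms])
qed (use G_ne le_refl in blast)+

lemma forced_G: "forced (\<lambda>e. e i \<in> G) (\<lambda>p e. e i \<in> Pc \<and> (\<forall>q\<in>Pc. le q p \<longrightarrow> (\<exists>r\<in>Pc. le r q \<and> le r (e i))))"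
proof (rule forcedI, goal_cases)
  case 1 show ?case by (intro df)
next
  case (2 e p q) then show ?case using le_trans by blast
next
  case (3 e p)
  show ?case
  proof (intro conjI ballI impI)
    show "e i \<in> Pc" using 3(2) 3(3)[OF 3(2)] by auto
    fix q assume q: "q \<in> Pc" "le q p"
    then obtain r where r: "r \<in> Pc" "le r q" "\<forall>q\<in>Pc. le q r \<longrightarrow> (\<exists>s\<in>Pc. le s q \<and> le s (e i))"
      using 3(3) by blast
    then obtain s where "s \<in> Pc" "le s r" "le s (e i)" using le_refl by blast
    with r q show "\<exists>r\<in>Pc. le r q \<and> le r (e i)" using le_trans by blast
  qed
next
  case (4 e)
  have "\<exists>r\<in>Pc. le r q \<and> le r (e i)" if "q \<in> Pc" "le q (e i)" for q
    using that le_refl by blast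
  with 4 GP show ?case by blast
next
  case (5 e p)
  have eM: "e i \<in> M" using 5 envD by blast
  have "\<exists>r\<in>G. (le r (e i) \<or> (\<forall>s\<in>Pc. le s r \<longrightarrow> \<not> le s (e i)))"
  proof (rule G_meet)
    show "dfn {} (\<lambda>d. le (d 0) (e i) \<or> (\<forall>s\<in>Pc. le s (d 0) \<longrightarrow> \<not> le s (e i)))" by (intro df eM)
  qed (use le_refl le_trans in blast)
  then obtain r where r: "r \<in> G" "le r (e i) \<or> (\<forall>s\<in>Pc. le s r \<longrightarrow> \<not> le s (e i))" by blast
  obtain s where s: "s \<in> G" "le s r" "le s p" using G_dir r 5 by blast
  then obtain s' where "s' \<in> Pc" "le s' s" "le s' (e i)" using 5 GP by blast
  moreover from this have "le s' r" using le_trans s r GP by blast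
  ultimately have "le r (e i)" using r by blast
  then show ?case using G_up r 5 by blast
qed

lemma forced_not:
  assumes F: "forced Q F" shows "forced (\<lambda>e. \<not> Q e) (\<lambda>p e. \<forall>q\<in>Pc. le q p \<longrightarrow> \<not> F q e)"
proof (rule forcedI, goal_cases)
  case 1 show ?case by (intro df forced_ren[OF F])
next
  case (2 e p q) then show ?case using le_trans by blast
next
  case (3 e p)
  show ?case
  proof (intro ballI impI notI)
    fix q assume q: "q \<in> Pc" "le q p" "F q e"
    then obtain r where "r \<in> Pc" "le r q" "\<forall>s\<in>Pc. le s r \<longrightarrow> \<not> F s e" using 3 by blast
    then show False using forcedD(2)[OF F 3(1) q(1)] q le_refl by blast
  qed
next
  case (4 e)
  have "\<exists>p\<in>G. F p e \<or> (\<forall>q\<in>Pc. le q p \<longrightarrow> \<not> F q e)"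
  proof (rule G_meet)
    have "dfn {} (\<lambda>d. F (d 0) e)" by (rule forced_at[OF F 4(1)])
    note dF = inst1[where S="\<lambda>x. F x e", OF this]
    show "dfn {} (\<lambda>d. F (d 0) e \<or> (\<forall>q\<in>Pc. le q (d 0) \<longrightarrow> \<not> F q e))" by (intro df dF)
  qed (use le_refl in blast)
  then show ?case using 4 forcedD(4)[OF F 4(1)] by blast
next
  case (5 e p)
  show ?case
  proof
    assume "Q e"
    then obtain q where "q \<in> G" "F q e" using forcedD(4)[OF F 5(1)] by blast
    then obtain r where "r \<in> G" "le r q" "le r p" using G_dir 5 by blast
    then show False using 5 forcedD(2)[OF F 5(1)] \<open>q \<in> G\<close> \<open>F q e\<close> GP by blast
  qed
qed

lemma forced_conj:
  assumes F: "forced Q F" and F': "forced Q' F'"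
  shows "forced (\<lambda>e. Q e \<and> Q' e) (\<lambda>p e. F p e \<and> F' p e)"
proof (rule forcedI, goal_cases)
  case 1 show ?case by (intro df forced_ren[OF F] forced_ren[OF F'])
next
  case (2 e p q) then show ?case using forcedD(2)[OF F] forcedD(2)[OF F'] by blast
next
  case (3 e p) then show ?case using forcedD(3)[OF F 3(1,2)] forcedD(3)[OF F' 3(1,2)] by blast
next
  case (4 e)
  then obtain p q where "p \<in> G" "F p e" "q \<in> G" "F' q e" using forcedD(4)[OF F] forcedD(4)[OF F'] by blast
  moreover from this obtain r where "r \<in> G" "le r p" "le r q" using G_dir by blast
  ultimately show ?case using forcedD(2)[OF F 4(1)] forcedD(2)[OF F' 4(1)] GP by blast
next
  case (5 e p) then show ?case using forcedD(4)[OF F 5(1)] forcedD(4)[OF F' 5(1)] by blast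
qed

lemma forced_all:
  assumes F: "forced Q F"
  shows "forced (\<lambda>e. \<forall>x\<in>M. Q (case_nat x e)) (\<lambda>p e. \<forall>x\<in>M. F p (case_nat x e))"
proof (rule forcedI, goal_cases)
  case 1
  have "(\<lambda>i. e (case i of 0 \<Rightarrow> 0 | Suc j \<Rightarrow> Suc (Suc j))) = case_nat (e 0) (\<lambda>i. e (Suc (Suc i)))" for e :: "nat \<Rightarrow> 'a"
    by (auto split: nat.splits)
  with forced_ren[OF F, of "Suc 0" "\<lambda>i. case i of 0 \<Rightarrow> 0 | Suc j \<Rightarrow> Suc (Suc j)"]
  have "dfn {} (\<lambda>e. F (e (Suc 0)) (case_nat (e 0) (\<lambda>i. e (Suc (Suc i)))))" by simp
  then show ?case by (rule df_All)
next
  case (2 e p q)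
  then show ?case using forcedD(2)[OF F range_case_nat[OF _ 2(1)] 2(2-4)] by blast
next
  case (3 e p)
  show ?case
  proof
    fix x assume x: "x \<in> M"
    show "F p (case_nat x e)"
      by (rule forcedD(3)[OF F range_case_nat[OF x 3(1)] 3(2)]) (use 3 x in blast)
  qed
next
  case (4 e)
  \<comment> \<open>If \<open>p\<close> does not force every instance, then by the density clause
    some extension of \<open>p\<close> has no further extension that forces a certain
    instance.\<close>
  have "\<exists>p\<in>G. (\<forall>x\<in>M. F p (case_nat x e)) \<or> (\<exists>x\<in>M. \<forall>q\<in>Pc. le q p \<longrightarrow> \<not> F q (case_nat x e))"
  proof (rule G_meet)
    have "dfn {} (\<lambda>d. F (subst (case_nat (Inl 0) (case_nat (Inl 1) (\<lambda>i. Inr (e i)))) d 0)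
        (\<lambda>i. subst (case_nat (Inl 0) (case_nat (Inl 1) (\<lambda>i. Inr (e i)))) d (Suc i)))"
      by (rule dfn_subst[OF forcedD(1)[OF F]]) (use envD[OF 4(1)] in \<open>auto split: nat.splits\<close>)
    moreover have "(\<lambda>i. subst (case_nat (Inl 0) (case_nat (Inl 1) (\<lambda>i. Inr (e i)))) d (Suc i)) = case_nat (d 1) e" for d
      by (auto simp: subst_def split: nat.splits)
    ultimately have "dfn {} (\<lambda>d. F (d 0) (case_nat (d (Suc 0)) e))" by (simp add: subst_def)
    note dF = inst2[where S="\<lambda>p x. F p (case_nat x e)", OF this]
    show "dfn {} (\<lambda>d. (\<forall>x\<in>M. F (d 0) (case_nat x e)) \<or> (\<exists>x\<in>M. \<forall>q\<in>Pc. le q (d 0) \<longrightarrow> \<not> F q (case_nat x e)))"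
      by (intro df dF)
    fix p assume p: "p \<in> Pc"
    show "\<exists>d\<in>Pc. ((\<forall>x\<in>M. F d (case_nat x e)) \<or> (\<exists>x\<in>M. \<forall>q\<in>Pc. le q d \<longrightarrow> \<not> F q (case_nat x e))) \<and> le d p"
    proof (cases "\<forall>x\<in>M. F p (case_nat x e)")
      case True then show ?thesis using p le_refl by blast
    next
      case False
      then obtain x where x: "x \<in> M" "\<not> F p (case_nat x e)" by blast
      then obtain q where "q \<in> Pc" "le q p" "\<not> (\<exists>r\<in>Pc. le r q \<and> F r (case_nat x e))"
        using forcedD(3)[OF F range_case_nat[OF x(1) 4(1)] p] by blast
      with x show ?thesis by blast
    qed
  qed
  then obtain p where p: "p \<in> G" "(\<forall>x\<in>M. F p (case_nat x e)) \<or> (\<exists>x\<in>M. \<forall>q\<in>Pc. le q p \<longrightarrow> \<not> F q (case_nat x e))" by blast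
  have False if x: "x \<in> M" "\<forall>q\<in>Pc. le q p \<longrightarrow> \<not> F q (case_nat x e)" for x
  proof -
    obtain q where "q \<in> G" "F q (case_nat x e)" using 4 forcedD(4)[OF F range_case_nat[OF x(1) 4(1)]] x by blast
    moreover obtain r where "r \<in> G" "le r q" "le r p" using G_dir p \<open>q \<in> G\<close> by blast
    ultimately show False using x forcedD(2)[OF F range_case_nat[OF x(1) 4(1)]] GP by blast
  qed
  with p show ?case by blast
next
  case (5 e p)
  then show ?case using forcedD(4)[OF F range_case_nat[OF _ 5(1)]] by blast
qed

lemma forced_subst:
  assumes F: "forced Q F" and g: "\<And>i c. g i = Inr c \<Longrightarrow> c \<in> M"
  shows "forced (\<lambda>e. Q (subst g e)) (\<lambda>p e. F p (subst g e))"
proof -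
  have rs: "range (subst g e) \<subseteq> M" if "range e \<subseteq> M" for e
    by (rule range_subst[OF that]) (rule g)
  show ?thesis
proof (rule forcedI, goal_cases)
  case 1
  define h where "h = case_nat (Inl 0) (\<lambda>i. case g i of Inl j \<Rightarrow> Inl (Suc j) | Inr c \<Rightarrow> Inr c)"
  have "c \<in> M" if h: "h i = Inr c" for i c
  proof (cases i)
    case 0 with h show ?thesis by (simp add: h_def)
  next
    case (Suc j)
    then show ?thesis using h g[of j c] by (cases "g j") (auto simp: h_def)
  qed
  then have "dfn {} (\<lambda>e. F (subst h e 0) (\<lambda>i. subst h e (Suc i)))"
    by (rule dfn_subst[OF forcedD(1)[OF F]])
  moreover have "(\<lambda>i. subst h e (Suc i)) = subst g (\<lambda>i. e (Suc i))" for e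
    by (auto simp: subst_def h_def split: sum.splits)
  ultimately show ?case by (simp add: subst_def h_def)
next
  case (2 e p q)
  then show ?case using forcedD(2)[OF F rs[OF 2(1)] 2(2-4)] by simp
next
  case (3 e p)
  show ?case by (rule forcedD(3)[OF F rs[OF 3(1)] 3(2)]) (use 3 in blast)+
next
  case (4 e) then show ?case using forcedD(4)[OF F rs[OF 4(1)]] by simp
next
  case (5 e p)
  then show ?case using forcedD(4)[OF F rs[OF 5(1)]] by blast
qed
qed

lemma truth: "dfn G Q \<Longrightarrow> \<exists>F. forced Q F"
proof (induction rule: dfn.induct)
  case (dfn_E i j) show ?case using forced_M[OF dfn.dfn_E] by blast
next
  case (dfn_eq i j) show ?case using forced_M[OF dfn.dfn_eq] by blast
next
  case (dfn_C i) show ?case using forced_G by blast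
next
  case (dfn_not Q) then show ?case using forced_not by blast
next
  case (dfn_conj Q R) then show ?case using forced_conj by blast
next
  case (dfn_all Q) then show ?case using forced_all by blast
next
  case (dfn_subst Q g) then show ?case using forced_subst by blast
next
  case (dfn_cong Q Q')
  then obtain F where F: "forced Q F" by blast
  have "forced Q' F"
  proof (rule forcedI)
    show "dfn {} (\<lambda>e. F (e 0) (\<lambda>i. e (Suc i)))" by (rule forcedD(1)[OF F])
  next
    fix e p q assume "range e \<subseteq> M" "p \<in> Pc" "q \<in> Pc" "le q p" "F p e"
    then show "F q e" by (rule forcedD(2)[OF F])
  next
    fix e p assume "range e \<subseteq> M" "p \<in> Pc" "\<And>q. q \<in> Pc \<Longrightarrow> le q p \<Longrightarrow> \<exists>r\<in>Pc. le r q \<and> F r e"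
    then show "F p e" by (rule forcedD(3)[OF F])
  next
    fix e assume e: "range e \<subseteq> M" "Q' e"
    with dfn_cong(2)[OF e(1)] forcedD(4)[OF F e(1)] show "\<exists>p\<in>G. F p e" by simp
  next
    fix e p assume e: "range e \<subseteq> M" "p \<in> G" "F p e"
    with dfn_cong(2)[OF e(1)] forcedD(4)[OF F e(1)] show "Q' e" by blast
  qed
  then show ?case by blast
qed

lemma truth2:
  assumes "dfn G (\<lambda>e. Q (e 0) (e (Suc 0)))"
  shows "\<exists>F. dfn {} (\<lambda>e. F (e 0) (e (Suc 0)) (e (Suc (Suc 0)))) \<and> (\<forall>x\<in>M. \<forall>y\<in>M.
    (\<forall>p\<in>Pc. \<forall>q\<in>Pc. le q p \<longrightarrow> F p x y \<longrightarrow> F q x y) \<and> (Q x y \<longleftrightarrow> (\<exists>p\<in>G. F p x y)))"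
proof -
  obtain F where F: "forced (\<lambda>e. Q (e 0) (e (Suc 0))) F" using truth[OF assms] by blast
  let ?e = "\<lambda>x y. case_nat x (\<lambda>_. y)"
  have r: "range (?e x y) \<subseteq> M" if "x \<in> M" "y \<in> M" for x y using that by (auto split: nat.splits)
  have "(\<lambda>i. e (case i of 0 \<Rightarrow> Suc 0 | Suc j \<Rightarrow> Suc (Suc 0))) = ?e (e (Suc 0)) (e (Suc (Suc 0)))" for e :: "nat \<Rightarrow> 'a"
    by (auto split: nat.splits)
  with forced_ren[OF F, of 0 "\<lambda>i. case i of 0 \<Rightarrow> Suc 0 | Suc j \<Rightarrow> Suc (Suc 0)"]
  have 1: "dfn {} (\<lambda>e. F (e 0) (?e (e (Suc 0)) (e (Suc (Suc 0)))))" by simp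
  have 2: "(\<forall>p\<in>Pc. \<forall>q\<in>Pc. le q p \<longrightarrow> F p (?e x y) \<longrightarrow> F q (?e x y)) \<and> (Q x y \<longleftrightarrow> (\<exists>p\<in>G. F p (?e x y)))"
    if "x \<in> M" "y \<in> M" for x y
    using forcedD(2)[OF F r[OF that]] forcedD(4)[OF F r[OF that]] by auto
  show ?thesis by (rule exI[of _ "\<lambda>p x y. F p (?e x y)"]) (use 1 2 in blast)
qed

text \<open>For subsets of the ground model a one-level name suffices: it pairs conditions with the
  elements themselves rather than with names of them.\<close>

definition ev :: "'a \<Rightarrow> 'a set" where "ev R = {x \<in> M. \<exists>q\<in>G. pr q x \<in> elts R}"

lemma df_G [df]: "tm G t \<Longrightarrow> dfn G (\<lambda>e. t e \<in> G)" by (rule df_C)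

lemma df_bexG [df]:
  assumes "dfn G (\<lambda>e. Q (e 0) (\<lambda>i. e (Suc i)))"
  shows "dfn G (\<lambda>e. \<exists>x\<in>G. Q x e)"
proof (rule dfn_cong)
  show "dfn G (\<lambda>e. \<exists>x\<in>M. x \<in> G \<and> Q x e)" by (intro df_Ex df_conj df_G tm_var assms)
qed (use GP Pc_M in blast)

lemma df_ev0: "dfn G (\<lambda>e. e 0 \<in> ev (e (Suc 0)))"
  unfolding ev_def mem_Collect_eq by (intro df)

lemmas df_ev [df] = inst2[where S="\<lambda>x R. x \<in> ev R", OF df_ev0]

text \<open>Separation with \<open>G\<close> as a predicate: the name collects the pairs of a
  condition and an element for which the condition forces \<open>Q\<close>. Names of reals and of
  pay-off sets come from here.\<close>

lemma sepG:
  assumes "isset A" "dfn G (\<lambda>e. Q (e 0))"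
  shows "\<exists>R\<in>M. elts R \<subseteq> prd Pc A \<and> ev R = {x \<in> A. Q x}"
proof -
  obtain F where F: "dfn {} (\<lambda>e. F (e 0) (e (Suc 0)) (e (Suc (Suc 0))))"
    "\<forall>x\<in>M. \<forall>y\<in>M. Q x \<longleftrightarrow> (\<exists>p\<in>G. F p x y)"
    using truth2[of "\<lambda>x y. Q x", OF assms(2)] by blast
  let ?S = "\<lambda>u. \<exists>q\<in>M. \<exists>x\<in>M. u = pr q x \<and> F q x x"
  have "isset {u \<in> prd Pc A. ?S u}"
    by (intro isset_sep isset_prd isset_elts PL assms df inst3[where S=F, OF F(1)])
  then obtain R where R: "R \<in> M" "elts R = {u \<in> prd Pc A. ?S u}" by (auto simp: isset_def)
  have AM: "A \<subseteq> M" using assms isset_M by blast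
  have "pr q x \<in> elts R \<longleftrightarrow> x \<in> A \<and> F q x x" if "q \<in> G" "x \<in> M" for q x
  proof -
    have q: "q \<in> M" "q \<in> Pc" using that GP Pc_M by auto
    have "pr q x \<in> prd Pc A \<longleftrightarrow> x \<in> A"
      using q that AM Pc_M by (auto simp: prd_def subset_iff)
    moreover have "?S (pr q x) \<longleftrightarrow> F q x x" using q that by auto
    ultimately show ?thesis unfolding R(2) by simp
  qed
  then have "ev R = {x \<in> A. Q x}" using F(2) AM unfolding ev_def by blast
  with R show ?thesis by (intro bexI[of _ R]) auto
qed

text \<open>The failures of \<open>Q\<close> need not form a set of the model, but a condition can
  decide the least one: below \<open>q\<close>, take the least \<open>n\<close> whose failure is
  forced by some extension \<open>r\<close>; then no extension of \<open>r\<close> forces an earlier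
  failure.\<close>

lemma ind_G: "ind G"
  unfolding ind_def
proof (intro allI impI, rule ccontr)
  fix Q n0 assume n0: "n0 \<in> Om" and d: "dfn G (\<lambda>e. Q (e 0))" and z: "Q emp"
    and s: "\<forall>n\<in>Om. Q n \<longrightarrow> Q (suc n)" and nQ: "\<not> Q n0"
  obtain F where F: "dfn {} (\<lambda>e. F (e 0) (e (Suc 0)) (e (Suc (Suc 0))))"
    "\<forall>x\<in>M. \<forall>y\<in>M. (\<forall>p\<in>Pc. \<forall>q\<in>Pc. le q p \<longrightarrow> F p x y \<longrightarrow> F q x y) \<and> (\<not> Q x \<longleftrightarrow> (\<exists>p\<in>G. F p x y))"
    using truth2[of "\<lambda>x y. \<not> Q x", OF df_not[OF d]] by blast
  note dF = inst3[where S=F, OF F(1)]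
  have t: "\<not> Q x \<longleftrightarrow> (\<exists>p\<in>G. F p x x)" and mono: "p \<in> Pc \<Longrightarrow> q \<in> Pc \<Longrightarrow> le q p \<Longrightarrow> F p x x \<Longrightarrow> F q x x"
    if "x \<in> M" for x p q using F(2) that by blast+
  obtain p where p: "p \<in> G" "F p n0 n0" using t nQ n0 Om_M by blast
  let ?D = "\<lambda>r. \<exists>n\<in>Om. F r n n \<and> (\<forall>m\<in>elts n. \<forall>s\<in>Pc. le s r \<longrightarrow> \<not> F s m m)"
  have "\<exists>r\<in>G. ?D r \<and> le r p"
  proof (rule G_meet_below[OF _ p(1)])
    show "dfn {} (\<lambda>e. ?D (e 0))" by (intro df dF)
    fix q assume q: "q \<in> Pc" "le q p"
    let ?B = "{n \<in> Om. \<exists>r\<in>Pc. le r q \<and> F r n n}"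
    have B: "isset ?B" by (intro isset_sep isset_elts df dF Pc_M q)
    have "F q n0 n0" using mono[of n0 p q] Om_M n0 p GP q by blast
    then have "n0 \<in> elts (mk ?B)" unfolding mk(2)[OF B] using q n0 le_refl by blast
    then obtain n where n: "n \<in> ?B" "elts n \<inter> ?B = {}"
      using foundE[OF mk(1)[OF B], of n0] unfolding mk(2)[OF B] by blast
    then obtain r where r: "r \<in> Pc" "le r q" "F r n n" "n \<in> Om" by blast
    have "\<forall>m\<in>elts n. \<forall>s\<in>Pc. le s r \<longrightarrow> \<not> F s m m"
      using n r q le_trans Om_trans by blast
    with r show "\<exists>d\<in>Pc. ?D d \<and> le d q" by blast
  qed
  then obtain r n where r: "r \<in> G" "n \<in> Om" "F r n n" "\<forall>m\<in>elts n. \<forall>s\<in>Pc. le s r \<longrightarrow> \<not> F s m m" by blast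
  have nn: "\<not> Q n" using t r Om_M by blast
  then obtain m where m: "m \<in> Om" "n = suc m" using Om_cases r z by blast
  then have "\<not> Q m" using s nn by blast
  then obtain p' where p': "p' \<in> G" "F p' m m" using t m Om_M by blast
  obtain s' where "s' \<in> G" "le s' p'" "le s' r" using G_dir r p' by blast
  moreover have "m \<in> elts n" using m Om_M by auto
  ultimately show False using r p' mono[of m p' s'] m Om_M GP by blast
qed

section \<open>The generic extension\<close>

text \<open>\<open>f\<close> sends each element of the transitive set \<open>T\<close> to its
  canonical name. Every condition is used as a tag, since the poset need not have a greatest
  element.\<close>

definition att :: "'a \<Rightarrow> 'a \<Rightarrow> bool" where
  "att T f \<longleftrightarrow> (\<forall>z\<in>elts T. elts z \<subseteq> elts T \<and>
     elts (ap f z) = {u \<in> M. \<exists>v\<in>elts z. \<exists>t\<in>Pc. u = pr (ap f v) t})"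

definition Ck :: "'a \<Rightarrow> 'a \<Rightarrow> bool" where
  "Ck x y \<longleftrightarrow> (\<exists>T\<in>M. \<exists>f\<in>M. att T f \<and> x \<in> elts T \<and> y = ap f x)"

lemma df_att0: "dfn C (\<lambda>e. att (e 0) (e (Suc 0)))"
  unfolding att_def by (intro df)

lemmas df_att [df] = inst2[where S=att, OF df_att0]

lemma df_Ck0: "dfn C (\<lambda>e. Ck (e 0) (e (Suc 0)))"
  unfolding Ck_def by (intro df)

lemmas df_Ck [df] = inst2[where S=Ck, OF df_Ck0]

lemma att_unique:
  assumes a: "att T f" "att T' f'" "T \<in> M" "f \<in> M" "T' \<in> M" "f' \<in> M" and x: "x \<in> M"
  shows "x \<in> elts T \<and> x \<in> elts T' \<longrightarrow> ap f x = ap f' x"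
  using x
proof (induction x rule: eps_induct)
  case dfn show ?case by (intro df a)
next
  case (step x)
  show ?case
  proof
    assume x: "x \<in> elts T \<and> x \<in> elts T'"
    have "ap f v = ap f' v" if "v \<in> elts x" for v
      using step(2)[OF that] a(1,2) x that unfolding att_def by blast
    then have "{u \<in> M. \<exists>v\<in>elts x. \<exists>t\<in>Pc. u = pr (ap f v) t} = {u \<in> M. \<exists>v\<in>elts x. \<exists>t\<in>Pc. u = pr (ap f' v) t}"
      by auto
    moreover have "elts (ap f x) = {u \<in> M. \<exists>v\<in>elts x. \<exists>t\<in>Pc. u = pr (ap f v) t}"
      "elts (ap f' x) = {u \<in> M. \<exists>v\<in>elts x. \<exists>t\<in>Pc. u = pr (ap f' v) t}"
      using a(1,2) x unfolding att_def by blast+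
    ultimately have "elts (ap f x) = elts (ap f' x)" by simp
    then show "ap f x = ap f' x" by (intro extn) auto
  qed
qed

lemma Ck_unique: "Ck x y \<Longrightarrow> Ck x y' \<Longrightarrow> y = y'"
  unfolding Ck_def using att_unique elts_M by metis

lemma Ck_ex: "x \<in> M \<Longrightarrow> \<exists>y\<in>M. Ck x y"
proof (induction x rule: eps_induct)
  case dfn show ?case by (intro df)
next
  case (step x)
  obtain T0 where T0: "T0 \<in> M" "x \<in> elts T0" "\<forall>y\<in>elts T0. elts y \<subseteq> elts T0"
    using trans_closure[OF step(1)] by blast
  show ?case
  proof (rule ccontr)
    \<comment> \<open>This assumption keeps \<open>x\<close> out of \<open>T1\<close>, so the new
      pair cannot clash with the pairs already in \<open>f1\<close>.\<close>
    assume no: "\<not> ?case"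
    define T1 where "T1 = {z \<in> elts T0. \<exists>y\<in>M. Ck z y}"
    have T1: "isset T1" unfolding T1_def by (intro isset_sep isset_elts T0 df)
    define f1 where "f1 = {u \<in> M. \<exists>z\<in>T1. \<exists>y\<in>M. Ck z y \<and> u = pr z y}"
    have f1: "isset f1" unfolding f1_def
    proof (rule isset_repl[OF T1])
      show "dfn {} (\<lambda>e. \<exists>y\<in>M. Ck (e 0) y \<and> e (Suc 0) = pr (e 0) y)" by (intro df)
    qed (use Ck_unique in blast)
    define y0 where "y0 = {u \<in> M. \<exists>p\<in>prd (elts x) Pc. \<exists>v\<in>M. \<exists>t\<in>M. \<exists>y\<in>M. p = pr v t \<and> Ck v y \<and> u = pr y t}"
    have y0: "isset y0" unfolding y0_def
    proof (rule isset_repl)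
      show "isset (prd (elts x) Pc)" by (intro isset_prd isset_elts PL step)
      show "dfn {} (\<lambda>e. \<exists>v\<in>M. \<exists>t\<in>M. \<exists>y\<in>M. e 0 = pr v t \<and> Ck v y \<and> e (Suc 0) = pr y t)" by (intro df)
      fix p u u' assume "\<exists>v\<in>M. \<exists>t\<in>M. \<exists>y\<in>M. p = pr v t \<and> Ck v y \<and> u = pr y t"
        "\<exists>v\<in>M. \<exists>t\<in>M. \<exists>y\<in>M. p = pr v t \<and> Ck v y \<and> u' = pr y t"
      then show "u = u'" using Ck_unique pr_inj by metis
    qed
    define T2 where "T2 = mk (insert x T1)"
    have T2: "T2 \<in> M" "elts T2 = insert x T1" unfolding T2_def by (intro mk isset_insert step T1)+
    define f where "f = mk (insert (pr x (mk y0)) f1)"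
    have f: "f \<in> M" "elts f = insert (pr x (mk y0)) f1"
      unfolding f_def by (intro mk isset_insert f1 pr_M step y0)+
    have xT1: "x \<notin> T1" using no by (auto simp: T1_def)
    have T1M: "z \<in> M" if "z \<in> T1" for z using that elts_M by (auto simp: T1_def)
    have apx: "ap f x = mk y0"
    proof (rule ap_eq)
      fix z assume z: "z \<in> M" "pr x z \<in> elts f"
      have "pr x z \<notin> f1"
      proof
        assume "pr x z \<in> f1"
        then obtain v y where "v \<in> T1" "y \<in> M" "pr x z = pr v y" by (auto simp: f1_def)
        then have "x = v" using pr_inj[of x z v y] z step(1) T1M by blast
        with xT1 \<open>v \<in> T1\<close> show False by simp
      qed
      then show "z = mk y0" using z f step(1) mk(1)[OF y0] by simp
    qed (use f mk(1)[OF y0] in auto)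
    have apz: "ap f z = y" if z: "z \<in> T1" "Ck z y" "y \<in> M" for z y
    proof (rule ap_eq)
      have zM: "z \<in> M" "z \<noteq> x" using T1M z xT1 by auto
      show "pr z y \<in> elts f" using z zM by (auto simp: f f1_def pr_M)
      fix y' assume y': "y' \<in> M" "pr z y' \<in> elts f"
      then have "pr z y' \<in> f1" using f zM step(1) mk(1)[OF y0] by simp
      then obtain v y'' where v: "v \<in> T1" "y'' \<in> M" "Ck v y''" "pr z y' = pr v y''" by (auto simp: f1_def)
      then have "z = v" "y' = y''" using pr_inj[of z y' v y''] zM y' T1M by blast+
      then show "y' = y" using v Ck_unique z by blast
    qed (rule z)
    have xT: "v \<in> T1" if "v \<in> elts x" for v
      using that T0 step(2) by (auto simp: T1_def)
    have "att T2 f"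
      unfolding att_def
    proof
      fix z assume "z \<in> elts T2"
      then consider "z = x" | "z \<in> T1" using T2 by auto
      then show "elts z \<subseteq> elts T2 \<and> elts (ap f z) = {u \<in> M. \<exists>v\<in>elts z. \<exists>t\<in>Pc. u = pr (ap f v) t}"
      proof cases
        case 1
        have "y0 = {u \<in> M. \<exists>v\<in>elts x. \<exists>t\<in>Pc. u = pr (ap f v) t}"
        proof (intro set_eqI iffI)
          fix u assume "u \<in> y0"
          then obtain v t v' t' y where u: "u \<in> M" "v \<in> elts x" "t \<in> Pc" "v' \<in> M" "t' \<in> M" "y \<in> M" "pr v t = pr v' t'" "Ck v' y" "u = pr y t'"
            by (auto simp: y0_def prd_def)
          then have "v' = v" "t' = t" using pr_inj[of v t v' t'] elts_M by blast+
          with u apz xT show "u \<in> {u \<in> M. \<exists>v\<in>elts x. \<exists>t\<in>Pc. u = pr (ap f v) t}" by blast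
        next
          fix u assume "u \<in> {u \<in> M. \<exists>v\<in>elts x. \<exists>t\<in>Pc. u = pr (ap f v) t}"
          then obtain v t where u: "u \<in> M" "v \<in> elts x" "t \<in> Pc" "u = pr (ap f v) t" by blast
          then obtain y where y: "y \<in> M" "Ck v y" using step(2) by blast
          have "pr v t \<in> prd (elts x) Pc" using u by (auto simp: prd_def)
          moreover have "u = pr y t" using u y apz xT by simp
          ultimately show "u \<in> y0" unfolding y0_def using u y elts_M by blast
        qed
        with 1 xT T2 apx mk[OF y0] show ?thesis by auto
      next
        case 2
        then obtain y where y: "y \<in> M" "Ck z y" by (auto simp: T1_def)
        then obtain T g where g: "T \<in> M" "g \<in> M" "att T g" "z \<in> elts T" "y = ap g z" by (auto simp: Ck_def)
        have sub: "v \<in> T1" "Ck v (ap g v)" if v: "v \<in> elts z" for v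
        proof -
          have vT: "v \<in> elts T" using g v unfolding att_def by blast
          then show "Ck v (ap g v)" using g unfolding Ck_def by blast
          moreover have "v \<in> elts T0" using T0 2 v unfolding T1_def by blast
          ultimately show "v \<in> T1" unfolding T1_def using ap_M by blast
        qed
        have e: "ap f v = ap g v" if "v \<in> elts z" for v using apz[OF sub[OF that]] ap_M by blast
        have "elts (ap g z) = {u \<in> M. \<exists>v\<in>elts z. \<exists>t\<in>Pc. u = pr (ap g v) t}"
          using g(3,4) unfolding att_def by blast
        moreover have "ap f z = ap g z" using apz[OF 2 y(2,1)] g by simp
        ultimately show ?thesis using e sub T2 by auto
      qed
    qed
    moreover have "x \<in> elts T2" using T2 by simp
    ultimately have "Ck x (ap f x)" using T2 f unfolding Ck_def by blast
    with no ap_M show False by blast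
  qed
qed

definition chk :: "'a \<Rightarrow> 'a" where "chk x = (THE y. y \<in> M \<and> Ck x y)"

lemma chk: "x \<in> M \<Longrightarrow> chk x \<in> M" "x \<in> M \<Longrightarrow> Ck x (chk x)"
proof -
  assume "x \<in> M"
  then have "\<exists>!y. y \<in> M \<and> Ck x y" using Ck_ex Ck_unique by blast
  from theI'[OF this] show "chk x \<in> M" "Ck x (chk x)" by (auto simp: chk_def)
qed

lemma tm_chk0: "tm C (\<lambda>e. chk (e 0))"
proof (rule tmI[where S="\<lambda>v e. Ck (e 0) v"], goal_cases)
  case (1 e) then show ?case by (intro chk envD)
next
  case (2 e v) then show ?case using chk(2)[OF envD[OF 2(1)]] Ck_unique by blast
next
  case 3 show ?case by (intro df)
qed

lemmas tm_chk [df] = tm_inst1[where F=chk, OF tm_chk0]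

lemma elts_chk: "x \<in> M \<Longrightarrow> elts (chk x) = {pr (chk v) t |v t. v \<in> elts x \<and> t \<in> Pc}"
proof -
  assume x: "x \<in> M"
  obtain T f where f: "T \<in> M" "f \<in> M" "att T f" "x \<in> elts T" "chk x = ap f x"
    using chk(2)[OF x] by (auto simp: Ck_def)
  have "ap f v = chk v" if "v \<in> elts x" for v
  proof -
    have "v \<in> elts T" using f that unfolding att_def by blast
    then have "Ck v (ap f v)" using f unfolding Ck_def by blast
    then show ?thesis using chk(2)[OF elts_M[OF that]] Ck_unique by blast
  qed
  moreover have "elts (chk x) = {u \<in> M. \<exists>v\<in>elts x. \<exists>t\<in>Pc. u = pr (ap f v) t}"
    using f unfolding att_def by simp
  moreover have "pr (chk v) t \<in> M" if "v \<in> elts x" "t \<in> Pc" for v t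
    using that elts_M chk by (intro pr_M) auto
  ultimately show ?thesis by auto
qed

definition j :: "'a \<Rightarrow> 'a set" where "j x = vl (chk x)"

lemma mem_j: "x \<in> M \<Longrightarrow> mem y (j x) \<longleftrightarrow> (\<exists>v\<in>elts x. y = j v)"
proof -
  assume x: "x \<in> M"
  obtain p where p: "p \<in> G" using G_ne by blast
  show ?thesis
    unfolding j_def mem_iff[OF chk(1)[OF x]] elts_chk[OF x]
  proof
    assume "\<exists>\<pi>\<in>M. \<exists>t\<in>G. pr \<pi> t \<in> {pr (chk v) t |v t. v \<in> elts x \<and> t \<in> Pc} \<and> y = vl \<pi>"
    then obtain \<pi> t v t' where *: "\<pi> \<in> M" "t \<in> G" "v \<in> elts x" "t' \<in> Pc" "pr \<pi> t = pr (chk v) t'" "y = vl \<pi>" by blast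
    then have "\<pi> = chk v" using pr_inj[of \<pi> t "chk v" t'] GP Pc_M chk elts_M by blast
    with * show "\<exists>v\<in>elts x. y = vl (chk v)" by blast
  next
    assume "\<exists>v\<in>elts x. y = vl (chk v)"
    then obtain v where "v \<in> elts x" "y = vl (chk v)" by blast
    with p GP chk elts_M show "\<exists>\<pi>\<in>M. \<exists>t\<in>G. pr \<pi> t \<in> {pr (chk v) t |v t. v \<in> elts x \<and> t \<in> Pc} \<and> y = vl \<pi>" by blast
  qed
qed

text \<open>Any single condition that forces the equality is enough, in \<open>G\<close> or not;
  that form can be passed to the extensions produced by \<open>fsub\<close>.\<close>

lemma feq_chk0: "x \<in> M \<Longrightarrow> \<forall>y\<in>M. \<forall>p\<in>Pc. feq p (chk x) (chk y) \<longrightarrow> x = y"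
proof (induction x rule: eps_induct)
  case dfn show ?case by (intro df)
next
  case (step x)
  show ?case
  proof (intro ballI impI)
    fix y p assume y: "y \<in> M" and p: "p \<in> Pc" and "feq p (chk x) (chk y)"
    then have f: "fsub feq p (chk x) (chk y)" "fsub feq p (chk y) (chk x)"
      using chk step(1) by (auto simp: feq_iff)
    have sub: "\<exists>v\<in>elts b. \<exists>r\<in>Pc. feq r (chk u) (chk v)"
      if f: "fsub feq p (chk a) (chk b)" and u: "u \<in> elts a" and ab: "a \<in> M" "b \<in> M" for a b u
    proof -
      have uM: "chk u \<in> M" using u elts_M chk by blast
      have "pr (chk u) p \<in> elts (chk a)" using u ab p by (auto simp: elts_chk)
      then obtain r \<pi> t where r: "r \<in> Pc" "le r p" "\<pi> \<in> M" "t \<in> Pc" "pr \<pi> t \<in> elts (chk b)" "le r t" "feq r (chk u) \<pi>"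
        using fsubE[OF f uM p] p le_refl by blast
      then obtain v t' where v: "v \<in> elts b" "t' \<in> Pc" "pr \<pi> t = pr (chk v) t'" using ab by (auto simp: elts_chk)
      then have "\<pi> = chk v" using pr_inj[of \<pi> t "chk v" t'] r Pc_M chk elts_M by blast
      with r v show ?thesis by blast
    qed
    show "x = y"
    proof (rule extn[OF step(1) y], intro set_eqI iffI)
      fix u assume u: "u \<in> elts x"
      then show "u \<in> elts y" using sub[OF f(1) u step(1) y] step(2)[OF u] elts_M by blast
    next
      fix u assume u: "u \<in> elts y"
      then obtain v r where v: "v \<in> elts x" "r \<in> Pc" "feq r (chk u) (chk v)" using sub[OF f(2) u y step(1)] by blast
      then have "feq r (chk v) (chk u)" using feq_sym u chk elts_M by blast
      then have "v = u" using step(2)[OF v(1)] v elts_M u by blast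
      with v show "u \<in> elts x" by simp
    qed
  qed
qed

lemma j_inj [simp]: "x \<in> M \<Longrightarrow> y \<in> M \<Longrightarrow> j x = j y \<longleftrightarrow> x = y"
  unfolding j_def using vl_eq[OF chk(1) chk(1)] feq_chk0 GP unfolding eqv_def by blast

text \<open>This is the bridge from sets of the extension back to \<open>dfn G\<close>: it allows
  induction on statements about them and lets a strategy be read off its name.\<close>

lemma df_mem:
  assumes "\<tau> \<in> M" "tm G t" shows "dfn G (\<lambda>e. mem (j (t e)) (vl \<tau>))"
proof (rule dfn_cong)
  show "dfn G (\<lambda>e. \<exists>\<pi>\<in>M. \<exists>s\<in>G. pr \<pi> s \<in> elts \<tau> \<and> (\<exists>p\<in>G. feq p (chk (t e)) \<pi>))"
    by (intro df assms tm_shift)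
  fix e :: "nat \<Rightarrow> 'a" assume "range e \<subseteq> M"
  then have "t e \<in> M" using assms by (simp add: tm_def)
  then have "vl (chk (t e)) = vl \<pi> \<longleftrightarrow> (\<exists>p\<in>G. feq p (chk (t e)) \<pi>)" if "\<pi> \<in> M" for \<pi>
    using vl_eq[OF chk(1) that] by (simp add: eqv_def)
  then show "(\<exists>\<pi>\<in>M. \<exists>s\<in>G. pr \<pi> s \<in> elts \<tau> \<and> (\<exists>p\<in>G. feq p (chk (t e)) \<pi>)) = mem (j (t e)) (vl \<tau>)"
    unfolding mem_iff[OF assms(1)] j_def by blast
qed

text \<open>Converts a one-level name \<open>D\<close> into a genuine name of the set of values of
  the names \<open>F x\<close>. With \<open>chk\<close> for \<open>F\<close> this names the set
  itself, with \<open>nn\<close> a set of reals. The components are swapped because genuine names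
  carry the condition second.\<close>

definition nmk :: "('a \<Rightarrow> 'a) \<Rightarrow> 'a \<Rightarrow> 'a" where
  "nmk F D = mk {v \<in> M. \<exists>q\<in>M. \<exists>x\<in>M. pr q x \<in> elts D \<and> v = pr (F x) q}"

lemma isset_nmk:
  assumes D: "D \<in> M" and F: "tm {} (\<lambda>e. F (e 0))"
  shows "isset {v \<in> M. \<exists>q\<in>M. \<exists>x\<in>M. pr q x \<in> elts D \<and> v = pr (F x) q}"
proof -
  note tF = tm_inst1[where F=F, OF F]
  have "isset {v \<in> M. \<exists>u\<in>elts D. \<exists>q\<in>M. \<exists>x\<in>M. u = pr q x \<and> v = pr (F x) q}"
  proof (rule isset_repl[OF isset_elts[OF D]])
    show "dfn {} (\<lambda>e. \<exists>q\<in>M. \<exists>x\<in>M. e 0 = pr q x \<and> e (Suc 0) = pr (F x) q)" by (intro df tF)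
    fix u v v' assume "\<exists>q\<in>M. \<exists>x\<in>M. u = pr q x \<and> v = pr (F x) q" "\<exists>q\<in>M. \<exists>x\<in>M. u = pr q x \<and> v' = pr (F x) q"
    then show "v = v'" using pr_inj by metis
  qed
  moreover have "{v \<in> M. \<exists>u\<in>elts D. \<exists>q\<in>M. \<exists>x\<in>M. u = pr q x \<and> v = pr (F x) q} =
    {v \<in> M. \<exists>q\<in>M. \<exists>x\<in>M. pr q x \<in> elts D \<and> v = pr (F x) q}" by blast
  ultimately show ?thesis by simp
qed

lemma tm_F: "tm {} (\<lambda>e. F (e 0)) \<Longrightarrow> x \<in> M \<Longrightarrow> F x \<in> M"
proof -
  assume t: "tm {} (\<lambda>e. F (e 0))" and "x \<in> M"
  then have "range (\<lambda>_::nat. x) \<subseteq> M" by auto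
  with t show ?thesis unfolding tm_def by fastforce
qed

lemma nmk:
  assumes D: "D \<in> M" and F: "tm {} (\<lambda>e. F (e 0))"
  shows "nmk F D \<in> M" "mem y (vl (nmk F D)) \<longleftrightarrow> (\<exists>x\<in>ev D. y = vl (F x))"
proof -
  show m: "nmk F D \<in> M" unfolding nmk_def by (rule mk(1)[OF isset_nmk[OF assms]])
  have e: "elts (nmk F D) = {v \<in> M. \<exists>q\<in>M. \<exists>x\<in>M. pr q x \<in> elts D \<and> v = pr (F x) q}"
    unfolding nmk_def by (rule mk(2)[OF isset_nmk[OF assms]])
  show "mem y (vl (nmk F D)) \<longleftrightarrow> (\<exists>x\<in>ev D. y = vl (F x))"
    unfolding mem_iff[OF m]
  proof
    assume "\<exists>\<pi>\<in>M. \<exists>t\<in>G. pr \<pi> t \<in> elts (nmk F D) \<and> y = vl \<pi>"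
    then obtain \<pi> t q x where *: "\<pi> \<in> M" "t \<in> G" "q \<in> M" "x \<in> M" "pr q x \<in> elts D" "pr \<pi> t = pr (F x) q" "y = vl \<pi>"
      unfolding e by blast
    then have "\<pi> = F x" "t = q" using pr_inj[of \<pi> t "F x" q] tm_F[OF F *(4)] GP Pc_M by blast+
    with * show "\<exists>x\<in>ev D. y = vl (F x)" unfolding ev_def by blast
  next
    assume "\<exists>x\<in>ev D. y = vl (F x)"
    then obtain x q where *: "x \<in> M" "q \<in> G" "pr q x \<in> elts D" "y = vl (F x)" unfolding ev_def by blast
    moreover have "F x \<in> M" "q \<in> M" using tm_F[OF F] * GP Pc_M by blast+
    moreover from this have "pr (F x) q \<in> M" by (rule pr_M)
    ultimately show "\<exists>\<pi>\<in>M. \<exists>t\<in>G. pr \<pi> t \<in> elts (nmk F D) \<and> y = vl \<pi>" unfolding e by blast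
  qed
qed

abbreviation nn :: "'a \<Rightarrow> 'a" where "nn \<equiv> nmk chk"

lemma tm_nn: "tm {} (\<lambda>e. nn (e 0))"
proof (rule tmI[where S="\<lambda>v e. elts v = {u \<in> M. \<exists>q\<in>M. \<exists>x\<in>M. pr q x \<in> elts (e 0) \<and> u = pr (chk x) q}"], goal_cases)
  case (1 e) then show ?case by (intro nmk tm_chk0 envD)
next
  case (2 e v) show ?case unfolding nmk_def by (rule mk_iff[OF isset_nmk[OF envD[OF 2(1)] tm_chk0] 2(2)])
next
  case 3 show ?case by (intro df)
qed

lemma mem_nn: "R \<in> M \<Longrightarrow> x \<in> M \<Longrightarrow> mem (j x) (vl (nn R)) \<longleftrightarrow> x \<in> ev R"
proof -
  assume R: "R \<in> M" and x: "x \<in> M"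
  have "mem (j x) (vl (nn R)) \<longleftrightarrow> (\<exists>y\<in>ev R. j x = j y)" unfolding nmk(2)[OF R tm_chk0] j_def ..
  also have "\<dots> \<longleftrightarrow> x \<in> ev R" using x by (auto simp: ev_def)
  finally show ?thesis .
qed

section \<open>Absoluteness of pairs, functions, natural numbers and parity\<close>

sublocale X: set_structure N mem .

lemma j_N [simp]: "x \<in> M \<Longrightarrow> j x \<in> N"
  unfolding j_def N_iff using chk by blast

lemma vl_N: "\<tau> \<in> M \<Longrightarrow> vl \<tau> \<in> N"
  unfolding N_iff by blast

lemma X_elts: "x \<in> X.elts y \<longleftrightarrow> mem x y"
  unfolding X.elts_def using mem_N by blast

lemma X_elts_j: "x \<in> M \<Longrightarrow> X.elts (j x) = j ` elts x"
  by (auto simp: X_elts mem_j)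

lemma X_extn: "a \<in> N \<Longrightarrow> b \<in> N \<Longrightarrow> X.elts a = X.elts b \<Longrightarrow> a = b"
  by (rule ext_extn) (auto simp: X_elts set_eq_iff)

lemma X_opair_unique: "p \<in> N \<Longrightarrow> p' \<in> N \<Longrightarrow> X.is_opair p a b \<Longrightarrow> X.is_opair p' a b \<Longrightarrow> p = p'"
  unfolding X.is_opair_def using X_extn by metis

lemma X_opair_j: "x \<in> M \<Longrightarrow> y \<in> M \<Longrightarrow> X.is_opair (j (pr x y)) (j x) (j y)"
  unfolding X.is_opair_def
  by (intro bexI[of _ "j (mk {x})"] bexI[of _ "j (mk {x, y})"])
    (auto simp: X_elts_j mk isset_sing isset_pair pr_M, auto simp: pr_def mk isset_sing isset_pair)

lemma X_opair: "x \<in> M \<Longrightarrow> y \<in> M \<Longrightarrow> p \<in> N \<Longrightarrow> X.is_opair p (j x) (j y) \<longleftrightarrow> p = j (pr x y)"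
  using X_opair_j X_opair_unique pr_M j_N by metis

lemma X_graph: "x \<in> M \<Longrightarrow> y \<in> M \<Longrightarrow> (j x, j y) \<in> X.graph u \<longleftrightarrow> mem (j (pr x y)) u"
proof -
  assume *: "x \<in> M" "y \<in> M"
  have "(j x, j y) \<in> X.graph u \<longleftrightarrow> (\<exists>p\<in>X.elts u. X.is_opair p (j x) (j y))"
    using * by (simp add: X.graph_def)
  also have "\<dots> \<longleftrightarrow> mem (j (pr x y)) u"
    using X_opair[OF *] X_elts mem_N by blast
  finally show ?thesis .
qed

lemma X_opair_inj: "X.is_opair p a b \<Longrightarrow> X.is_opair p a' b' \<Longrightarrow> a = a' \<and> b = b'"
proof -
  assume p: "X.is_opair p a b" "X.is_opair p a' b'"
  have e: "X.elts ` X.elts p = {{a}, {a, b}}" if ab: "X.is_opair p a b" for a b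
  proof -
    obtain c d where "X.elts c = {a}" "X.elts d = {a, b}" "X.elts p = {c, d}"
      using ab unfolding X.is_opair_def by (elim bexE conjE)
    then show ?thesis by simp
  qed
  have "{{a}, {a, b}} = {{a'}, {a', b'}}" using e[OF p(1)] e[OF p(2)] by simp
  then show ?thesis by (auto simp: doubleton_eq_iff)
qed

lemma X_mapsI:
  assumes AB: "A \<subseteq> M" "B \<subseteq> M"
    and 1: "\<And>p. mem p u \<Longrightarrow> \<exists>x\<in>A. \<exists>y\<in>B. p = j (pr x y)"
    and 2: "\<And>x. x \<in> A \<Longrightarrow> \<exists>y\<in>B. mem (j (pr x y)) u \<and> (\<forall>z\<in>B. mem (j (pr x z)) u \<longrightarrow> z = y)"
  shows "X.maps u (j ` A) (j ` B)"
  unfolding X.maps_def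
proof (intro conjI ballI)
  fix p assume "p \<in> X.elts u"
  then obtain x y where "x \<in> A" "y \<in> B" "p = j (pr x y)" using 1 X_elts by blast
  with AB X_opair_j show "\<exists>a\<in>j ` A. \<exists>b\<in>j ` B. X.is_opair p a b" by blast
next
  fix a assume "a \<in> j ` A"
  then obtain x where x: "x \<in> A" "x \<in> M" "a = j x" using AB by blast
  then obtain y where y: "y \<in> B" "mem (j (pr x y)) u" "\<forall>z\<in>B. mem (j (pr x z)) u \<longrightarrow> z = y" using 2 by blast
  have "b = j y" if b: "(a, b) \<in> X.graph u" for b
  proof -
    obtain p where p: "p \<in> X.elts u" "X.is_opair p a b" using b by (auto simp: X.graph_def)
    then obtain x' y' where q: "x' \<in> A" "y' \<in> B" "p = j (pr x' y')" using 1 X_elts by blast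
    then have M: "x' \<in> M" "y' \<in> M" using AB by auto
    then have "a = j x'" "b = j y'" using X_opair_inj p(2) X_opair_j[of x' y'] q by blast+
    moreover from this have "x' = x" using x M by simp
    ultimately show ?thesis using y q p X_elts by blast
  qed
  moreover have "(a, j y) \<in> X.graph u" using X_graph[of x y u] x y AB by blast
  ultimately show "\<exists>!b. (a, b) \<in> X.graph u" by blast
qed

lemma X_mapsD:
  assumes m: "X.maps u D (j ` B)" and t: "t \<in> M" "j t \<in> D" and B: "B \<subseteq> M"
  shows "\<exists>y\<in>B. mem (j (pr t y)) u \<and> (\<forall>z\<in>B. mem (j (pr t z)) u \<longrightarrow> z = y)"
proof -
  obtain b where b: "(j t, b) \<in> X.graph u" "\<forall>b'. (j t, b') \<in> X.graph u \<longrightarrow> b' = b"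
    using m t(2) unfolding X.maps_def Ex1_def by blast
  then obtain p where p: "p \<in> X.elts u" "X.is_opair p (j t) b" by (auto simp: X.graph_def)
  then obtain a y where "y \<in> B" "X.is_opair p a (j y)" using m unfolding X.maps_def by blast
  then have y: "y \<in> B" "y \<in> M" "b = j y" using X_opair_inj[OF p(2)] B by auto
  have "z = y" if z: "z \<in> B" "mem (j (pr t z)) u" for z
  proof -
    have zM: "z \<in> M" using z B by blast
    then have "(j t, j z) \<in> X.graph u" using X_graph t z by blast
    then have "j z = j y" using b y by blast
    then show ?thesis using zM y by simp
  qed
  moreover have "mem (j (pr t y)) u" using b(1) X_graph[of t y u] t y by simp
  ultimately show ?thesis using y by blast
qed

lemma X_succ: "n \<in> M \<Longrightarrow> s \<in> M \<Longrightarrow> X.is_succ (j s) (j n) \<longleftrightarrow> s = suc n"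
proof -
  assume *: "n \<in> M" "s \<in> M"
  have "X.is_succ (j s) (j n) \<longleftrightarrow> j ` elts s = j ` insert n (elts n)"
    using * by (simp add: X.is_succ_def X_elts_j)
  also have "\<dots> \<longleftrightarrow> elts s = insert n (elts n)"
    by (rule inj_on_image_eq_iff[of j M]) (use * elts_M in \<open>auto simp: inj_on_def\<close>)
  also have "\<dots> \<longleftrightarrow> s = suc n" using * extn[of s "suc n"] by auto
  finally show ?thesis .
qed

lemma X_succ': "n \<in> M \<Longrightarrow> s \<in> N \<Longrightarrow> X.is_succ s (j n) \<Longrightarrow> s = j (suc n)"
  using X_succ[of n "suc n"] X_extn[of s "j (suc n)"] by (simp add: X.is_succ_def)

text \<open>An inductive set of the extension contains every \<open>j n\<close> by induction with
  \<open>G\<close> as a predicate, so no natural numbers are added.\<close>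

lemma X_omega: "X.is_omega (j w)"
  unfolding X.is_omega_def
proof (intro conjI ballI impI)
  have emp: "X.elts (j emp) = {}" by (simp add: X_elts_j)
  show "X.inductive_set_of (j w)"
    unfolding X.inductive_set_of_def X_elts_j[OF w(1)]
    using emp emp_Om X_succ suc_Om Om_M by (auto intro!: bexI[of _ "emp"])
  fix v assume v: "v \<in> N" "X.inductive_set_of v"
  then obtain \<tau> where \<tau>: "\<tau> \<in> M" "v = vl \<tau>" by (auto simp: N_iff)
  have "mem (j n) v" if "n \<in> Om" for n
    using ind_G that
  proof (induction n rule: ind_induct)
    case dfn show ?case unfolding \<tau> by (intro df_mem \<tau> df)
  next
    case zero
    obtain z where "z \<in> X.elts v" "X.elts z = {}" using v by (auto simp: X.inductive_set_of_def)
    moreover from this have "z = j emp" using X_extn[of z "j emp"] emp mem_N X_elts by auto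
    ultimately show ?case by (simp add: X_elts)
  next
    case (suc n)
    then have "j n \<in> X.elts v" by (simp add: X_elts)
    then obtain s where "s \<in> X.elts v" "X.is_succ s (j n)" using v(2) unfolding X.inductive_set_of_def by blast
    then show ?case using X_succ'[of n s] suc Om_M X_elts mem_N by metis
  qed
  then show "X.elts (j w) \<subseteq> X.elts v" by (auto simp: X_elts_j w X_elts)
qed

lemma X_alt:
  assumes d: "d \<in> N" "X.alternating (j w) d" and k: "k \<in> Om"
  shows "mem (j (D0 k)) d \<and> \<not> mem (j (D1 k)) d"
proof -
  obtain \<tau> where \<tau>: "\<tau> \<in> M" "d = vl \<tau>" using d by (auto simp: N_iff)
  have s: "mem (j (suc n)) d \<longleftrightarrow> \<not> mem (j n) d" if "n \<in> Om" for n
    using d(2) that X_succ[of n "suc n"] Om_M unfolding X.alternating_def X_elts_j[OF w(1)] X_elts by auto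
  show ?thesis
    using ind_G k
  proof (induction k rule: ind_induct)
    case dfn show ?case unfolding \<tau> by (intro df_mem \<tau> df)
  next
    case zero
    have "mem (j emp) d"
      using d(2) emp_Om X_elts_j[of emp] unfolding X.alternating_def X_elts_j[OF w(1)] X_elts by auto
    then show ?case using s[of emp] by (simp add: d0)
  next
    case (suc k)
    then show ?case using s[of "D1 k"] s[of "D0 (suc k)"] by (simp add: d0)
  qed
qed

lemma X_evens: "X.evens (j w) = (\<lambda>k. j (D0 k)) ` Om"
proof (intro set_eqI iffI)
  fix n assume "n \<in> X.evens (j w)"
  then obtain m d where m: "m \<in> Om" "n = j m" "d \<in> N" "X.alternating (j w) d" "mem n d"
    by (auto simp: X.evens_def X_elts_j w X_elts)
  with D_cases[OF m(1)] X_alt show "n \<in> (\<lambda>k. j (D0 k)) ` Om" by blast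
next
  fix n assume "n \<in> (\<lambda>k. j (D0 k)) ` Om"
  then obtain k where k: "k \<in> Om" "n = j (D0 k)" by blast
  \<comment> \<open>Parity in the extension asks for an alternating set there; the even numbers of
    the ground model provide one.\<close>
  let ?Ev = "{n \<in> Om. \<exists>k\<in>Om. n = D0 k}"
  have E: "isset ?Ev" by (intro isset_sep isset_elts df)
  have "X.alternating (j w) (j (mk ?Ev))"
    unfolding X.alternating_def X_elts_j[OF w(1)] X_elts_j[OF mk(1)[OF E]] mk(2)[OF E]
  proof (intro conjI ballI impI)
    fix z assume "z \<in> j ` Om" "X.elts z = {}"
    then obtain m where m: "m \<in> Om" "z = j m" by blast
    then have "m = emp" using \<open>X.elts z = {}\<close> extn[of m emp] Om_M by (simp add: X_elts_j)
    then show "z \<in> j ` ?Ev" using m d0(3)[symmetric] emp_Om by blast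
  next
    fix n s assume "n \<in> j ` Om" "s \<in> j ` Om" "X.is_succ s n"
    then obtain m where m: "m \<in> Om" "n = j m" by blast
    have "s \<in> N" using \<open>s \<in> j ` Om\<close> Om_M by auto
    then have m': "s = j (suc m)" using X_succ'[of m s] \<open>X.is_succ s n\<close> m Om_M by simp
    have J: "j a \<in> j ` ?Ev \<longleftrightarrow> (\<exists>k\<in>Om. a = D0 k)" if "a \<in> Om" for a
      using that Om_M j_inj by (auto simp: image_iff)
    have "(\<exists>k\<in>Om. suc m = D0 k) \<longleftrightarrow> \<not> (\<exists>k\<in>Om. m = D0 k)"
      using D_cases[OF m(1)] d0(4) D0_D1 suc_Om by (metis)
    then show "s \<in> j ` ?Ev \<longleftrightarrow> n \<notin> j ` ?Ev" using m m' J by simp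
  qed auto
  moreover have "n \<in> X.elts (j (mk ?Ev))" using k by (auto simp: X_elts_j mk[OF E])
  ultimately show "n \<in> X.evens (j w)"
    unfolding X.evens_def X_elts_j[OF w(1)] using k mk(1)[OF E] by auto
qed

lemma X_odds: "X.odds (j w) \<subseteq> (\<lambda>k. j (D1 k)) ` Om"
  unfolding X.odds_def X_evens X_elts_j[OF w(1)] using D_cases by blast

text \<open>Names of reals are normalised to sets of pairs \<open>(p, (n, m))\<close> with \<open>m\<close> and \<open>n\<close> natural numbers; \<open>nn R\<close>
  is the actual name.\<close>

definition NR :: 'a where "NR = mk (Pw (prd Pc (prd Om Om)))"

lemma NR: "NR \<in> M" "R \<in> elts NR \<longleftrightarrow> R \<in> M \<and> elts R \<subseteq> prd Pc (prd Om Om)"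
proof -
  have "isset (Pw (prd Pc (prd Om Om)))" by (intro isset_Pw isset_prd isset_elts w PL)
  then show "NR \<in> M" "R \<in> elts NR \<longleftrightarrow> R \<in> M \<and> elts R \<subseteq> prd Pc (prd Om Om)"
    by (simp_all add: NR_def mk Pw_def)
qed

declare NR(1) [df]

definition isreal :: "'a \<Rightarrow> bool" where
  "isreal R \<longleftrightarrow> R \<in> elts NR \<and>
     (\<forall>n\<in>Om. \<exists>m\<in>Om. pr n m \<in> ev R \<and> (\<forall>m'\<in>Om. pr n m' \<in> ev R \<longrightarrow> m' = m))"

lemma df_isreal0: "dfn G (\<lambda>e. isreal (e 0))" unfolding isreal_def by (intro df)
lemmas df_isreal [df] = inst1[where S=isreal, OF df_isreal0]

lemma isreal_M: "isreal R \<Longrightarrow> R \<in> M" by (simp add: isreal_def NR)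

text \<open>Thanks to the default outside \<open>Om\<close>, two names of the same real give equal
  functions, as \<open>rv_ext\<close> states.\<close>

definition rv :: "'a \<Rightarrow> 'a \<Rightarrow> 'a" where
  "rv R n = (if isreal R \<and> n \<in> Om then THE m. m \<in> Om \<and> pr n m \<in> ev R else emp)"

lemma rv: assumes "isreal R" "n \<in> Om"
  shows "rv R n \<in> Om" "m \<in> Om \<Longrightarrow> pr n m \<in> ev R \<longleftrightarrow> m = rv R n"
proof -
  have ex: "\<exists>!m. m \<in> Om \<and> pr n m \<in> ev R" using assms unfolding isreal_def by blast
  from theI'[OF this] show "rv R n \<in> Om" using assms by (simp add: rv_def)
  from theI'[OF ex] have "pr n (rv R n) \<in> ev R" "rv R n \<in> Om" using assms by (simp_all add: rv_def)
  then show "m \<in> Om \<Longrightarrow> pr n m \<in> ev R \<longleftrightarrow> m = rv R n" using ex by blast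
qed

lemma rv_M [simp]: "rv R n \<in> M"
  using rv(1) Om_M by (cases "isreal R \<and> n \<in> Om") (auto simp: rv_def)

lemma tm_rv0: "tm G (\<lambda>e. rv (e 0) (e (Suc 0)))"
proof (rule tmI[where S="\<lambda>v e. (isreal (e 0) \<and> e (Suc 0) \<in> Om \<and> v \<in> Om \<and> pr (e (Suc 0)) v \<in> ev (e 0)) \<or>
    (\<not> (isreal (e 0) \<and> e (Suc 0) \<in> Om) \<and> v = emp)"], goal_cases)
  case (2 e v)
  show ?case
  proof (cases "isreal (e 0) \<and> e (Suc 0) \<in> Om")
    case True
    then show ?thesis using rv by blast
  next
    case False
    moreover from this have "rv (e 0) (e (Suc 0)) = emp" unfolding rv_def by auto
    ultimately show ?thesis by auto
  qed
next
  case 3 show ?case by (intro df)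
qed simp

lemmas tm_rv [df] = tm_inst2[where F=rv, OF tm_rv0]

lemma gfun_rv: "isreal R \<Longrightarrow> gfun G (rv R)"
  unfolding gfun_def using rv(1) by (auto intro!: df isreal_M)

lemma real_ex:
  assumes d: "dfn G (\<lambda>e. Q (e 0) (e (Suc 0)))"
    and Q: "\<And>n. n \<in> Om \<Longrightarrow> \<exists>m. m \<in> Om \<and> Q n m \<and> (\<forall>m'. m' \<in> Om \<and> Q n m' \<longrightarrow> m' = m)"
  shows "\<exists>R. isreal R \<and> (\<forall>n\<in>Om. Q n (rv R n))"
proof -
  let ?A = "prd Om Om"
  have A: "isset ?A" by (intro isset_prd isset_elts w)
  have "dfn G (\<lambda>e. \<exists>n\<in>Om. \<exists>m\<in>Om. e 0 = pr n m \<and> Q n m)" by (intro df inst2[where S=Q, OF d])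
  from sepG[OF A, of "\<lambda>p. \<exists>n\<in>Om. \<exists>m\<in>Om. p = pr n m \<and> Q n m", OF this]
  obtain R where R: "R \<in> M" "elts R \<subseteq> prd Pc ?A" "ev R = {p \<in> ?A. \<exists>n\<in>Om. \<exists>m\<in>Om. p = pr n m \<and> Q n m}"
    by blast
  have *: "pr n m \<in> ev R \<longleftrightarrow> Q n m" if "n \<in> Om" "m \<in> Om" for n m
    unfolding R(3) using that pr_inj Om_M by (auto simp: prd_def)
  have r: "isreal R" unfolding isreal_def NR
  proof (intro conjI ballI R)
    fix n assume n: "n \<in> Om"
    then obtain m where "m \<in> Om" "Q n m" "\<forall>m'. m' \<in> Om \<and> Q n m' \<longrightarrow> m' = m" using Q by blast
    with * n show "\<exists>m\<in>Om. pr n m \<in> ev R \<and> (\<forall>m'\<in>Om. pr n m' \<in> ev R \<longrightarrow> m' = m)" by blast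
  qed
  have "Q n (rv R n)" if "n \<in> Om" for n using rv[OF r that] * that by blast
  with r show ?thesis by blast
qed

section \<open>Games on names of reals\<close>

definition hr :: "'a \<Rightarrow> 'a \<Rightarrow> 'a" where
  "hr R n = (if isreal R \<and> n \<in> Om then hs (rv R) n else emp)"

lemma hr: assumes "isreal R" "n \<in> Om"
  shows "fsq n (hr R n)" "k \<in> elts n \<Longrightarrow> ap (hr R n) k = rv R k"
  using hs[OF ind_G gfun_rv] assms by (simp_all add: hr_def)

lemma hr_M: "hr R n \<in> M"
  using hr(1)[of R n] fsqD by (cases "isreal R \<and> n \<in> Om") (auto simp: hr_def)

lemma hr_eq: "isreal R \<Longrightarrow> fsq n t \<Longrightarrow> (\<And>k. k \<in> elts n \<Longrightarrow> ap t k = rv R k) \<Longrightarrow> hr R n = t"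
  using hs_eq fsqD by (simp add: hr_def)

lemma hr_cong: "isreal R \<Longrightarrow> isreal R' \<Longrightarrow> n \<in> Om \<Longrightarrow> (\<And>k. k \<in> elts n \<Longrightarrow> rv R k = rv R' k) \<Longrightarrow> hr R n = hr R' n"
  using hs_cong[of n "rv R" "rv R'"] by (simp add: hr_def)

lemma tm_hr0: "tm G (\<lambda>e. hr (e 0) (e (Suc 0)))"
proof (rule tmI[where S="\<lambda>v e. (isreal (e 0) \<and> e (Suc 0) \<in> Om \<and> fsq (e (Suc 0)) v \<and> (\<forall>k\<in>elts (e (Suc 0)). ap v k = rv (e 0) k)) \<or>
    (\<not> (isreal (e 0) \<and> e (Suc 0) \<in> Om) \<and> v = emp)"], goal_cases)
  case (2 e v)
  show ?case
  proof (cases "isreal (e 0) \<and> e (Suc 0) \<in> Om")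
    case True
    then show ?thesis using hr[of "e 0" "e (Suc 0)"] hr_eq by blast
  next
    case False
    then have "hr (e 0) (e (Suc 0)) = emp" unfolding hr_def by auto
    with False show ?thesis by auto
  qed
next
  case 3 show ?case by (intro df)
qed (rule hr_M)

lemmas tm_hr [df] = tm_inst2[where F=hr, OF tm_hr0]

definition fol0 :: "'a \<Rightarrow> 'a \<Rightarrow> bool" where
  "fol0 A R \<longleftrightarrow> (\<forall>k\<in>Om. rv R (D0 k) = rv A (kap (hr R (D0 k))))"

definition fol1 :: "'a \<Rightarrow> 'a \<Rightarrow> bool" where
  "fol1 A R \<longleftrightarrow> (\<forall>k\<in>Om. rv R (D1 k) = rv A (kap (hr R (D1 k))))"

lemma df_fol00: "dfn G (\<lambda>e. fol0 (e 0) (e (Suc 0)))" unfolding fol0_def by (intro df)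
lemma df_fol10: "dfn G (\<lambda>e. fol1 (e 0) (e (Suc 0)))" unfolding fol1_def by (intro df)
lemmas df_fol [df] = inst2[where S=fol0, OF df_fol00] inst2[where S=fol1, OF df_fol10]

lemma ev_sub: "elts R \<subseteq> prd Pc A \<Longrightarrow> isset A \<Longrightarrow> ev R \<subseteq> A"
proof
  fix x assume R: "elts R \<subseteq> prd Pc A" and A: "isset A" and "x \<in> ev R"
  then obtain q where "x \<in> M" "q \<in> G" "pr q x \<in> elts R" by (auto simp: ev_def)
  then obtain q' x' where *: "q' \<in> Pc" "x' \<in> A" "pr q x = pr q' x'" using R unfolding prd_def by blast
  then have "x = x'" using pr_inj[of q x q' x'] \<open>x \<in> M\<close> \<open>q \<in> G\<close> GP Pc_M isset_M[OF A] by blast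
  with * show "x \<in> A" by simp
qed

lemma isset_OO: "isset (prd Om Om)" by (intro isset_prd isset_elts w)

lemma mem_nn_real:
  assumes R: "isreal R"
  shows "mem p (vl (nn R)) \<longleftrightarrow> (\<exists>n\<in>Om. p = j (pr n (rv R n)))"
proof -
  have sub: "ev R \<subseteq> prd Om Om" using ev_sub[OF _ isset_OO] R NR by (simp add: isreal_def)
  have "mem p (vl (nn R)) \<longleftrightarrow> (\<exists>x\<in>ev R. p = j x)"
    unfolding nmk(2)[OF isreal_M[OF R] tm_chk0] j_def ..
  also have "\<dots> \<longleftrightarrow> (\<exists>n\<in>Om. p = j (pr n (rv R n)))"
  proof
    assume "\<exists>x\<in>ev R. p = j x"
    then obtain n m where *: "n \<in> Om" "m \<in> Om" "pr n m \<in> ev R" "p = j (pr n m)"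
      using sub unfolding prd_def by blast
    then have "m = rv R n" using rv(2)[OF R] by blast
    with * show "\<exists>n\<in>Om. p = j (pr n (rv R n))" by blast
  next
    assume "\<exists>n\<in>Om. p = j (pr n (rv R n))"
    then obtain n where n: "n \<in> Om" "p = j (pr n (rv R n))" by blast
    then have "pr n (rv R n) \<in> ev R" using rv[OF R] by blast
    with n show "\<exists>x\<in>ev R. p = j x" by blast
  qed
  finally show ?thesis .
qed

lemma nn_N: "isreal R \<Longrightarrow> vl (nn R) \<in> N"
  using nmk(1)[OF isreal_M tm_chk0] vl_N by blast

lemma nn_reals: assumes R: "isreal R" shows "vl (nn R) \<in> X.reals (j w)"
  unfolding X.reals_def X_elts_j[OF w(1)]
proof (intro CollectI conjI nn_N[OF R] X_mapsI OmM)
  fix p assume "mem p (vl (nn R))"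
  then obtain n where "n \<in> Om" "p = j (pr n (rv R n))" unfolding mem_nn_real[OF R] by (elim bexE)
  then show "\<exists>x\<in>Om. \<exists>y\<in>Om. p = j (pr x y)" using rv(1)[OF R] by blast
next
  fix x assume x: "x \<in> Om"
  have "mem (j (pr x z)) (vl (nn R)) \<longleftrightarrow> z = rv R x" if "z \<in> Om" for z
    using mem_nn[OF isreal_M[OF R] pr_M] rv(2)[OF R x that] Om_M x that by blast
  then show "\<exists>y\<in>Om. mem (j (pr x y)) (vl (nn R)) \<and> (\<forall>z\<in>Om. mem (j (pr x z)) (vl (nn R)) \<longrightarrow> z = y)"
    using rv(1)[OF R x] by blast
qed

lemma fsq_elts: assumes t: "fsq n t" shows "p \<in> elts t \<longleftrightarrow> (\<exists>k\<in>elts n. p = pr k (ap t k))"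
proof -
  have m: "maps t (elts n) Om" using t by (simp add: fsq_def)
  show ?thesis
  proof
    assume p: "p \<in> elts t"
    then obtain k y where "k \<in> elts n" "y \<in> Om" "p = pr k y" using m unfolding maps_iff[OF eltsM OmM] by blast
    with p maps_ap(3)[OF m eltsM OmM] Om_M show "\<exists>k\<in>elts n. p = pr k (ap t k)" by blast
  qed (use maps_ap(2)[OF m eltsM OmM] in blast)
qed

text \<open>Hence a strategy of the extension can be evaluated at the positions that
  \<open>M\<close> provides.\<close>

lemma j_FS: assumes t: "fsq n t" shows "j t \<in> X.finite_seqs (j w)"
proof -
  have M: "t \<in> M" "n \<in> M" "n \<in> Om" using t fsqD by auto
  have "X.maps (j t) (j ` elts n) (j ` Om)"
  proof (rule X_mapsI[OF eltsM OmM])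
    fix p assume "mem p (j t)"
    then obtain u where u: "u \<in> elts t" "p = j u" unfolding mem_j[OF M(1)] by (elim bexE)
    from u(1) obtain k where "k \<in> elts n" "u = pr k (ap t k)" unfolding fsq_elts[OF t] by (elim bexE)
    with u show "\<exists>x\<in>elts n. \<exists>y\<in>Om. p = j (pr x y)" using fsq_ap[OF t] by blast
  next
    fix x assume x: "x \<in> elts n"
    have m: "maps t (elts n) Om" using t by (simp add: fsq_def)
    have "mem (j (pr x z)) (j t) \<longleftrightarrow> z = ap t x" if z: "z \<in> Om" for z
    proof -
      have "pr x z \<in> M" using x z elts_M pr_M by blast
      then have "mem (j (pr x z)) (j t) \<longleftrightarrow> pr x z \<in> elts t"
        unfolding mem_j[OF M(1)] using j_inj elts_M by blast
      then show ?thesis using maps_ap(3)[OF m eltsM OmM x] Om_M[OF z] by blast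
    qed
    then show "\<exists>y\<in>Om. mem (j (pr x y)) (j t) \<and> (\<forall>z\<in>Om. mem (j (pr x z)) (j t) \<longrightarrow> z = y)"
      using fsq_ap[OF t x] by blast
  qed
  then have "X.maps (j t) (X.elts (j n)) (j ` Om)" unfolding X_elts_j[OF M(2)] .
  then show ?thesis unfolding X.finite_seqs_def X_elts_j[OF w(1)] using M(3) j_N[OF M(1)] by blast
qed

lemma X_restr: assumes R: "isreal R" and n: "n \<in> Om"
  shows "X.is_restriction (j (hr R n)) (vl (nn R)) (j n)"
proof -
  note h = hr[OF R n]
  have M: "hr R n \<in> M" "n \<in> M" using hr_M n Om_M by auto
  have "u \<in> X.elts (j (hr R n)) \<longleftrightarrow> u \<in> {p \<in> X.elts (vl (nn R)). \<exists>k\<in>X.elts (j n). \<exists>y\<in>N. X.is_opair p k y}" for u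
  proof
    assume "u \<in> X.elts (j (hr R n))"
    then obtain k where k: "k \<in> elts n" "u = j (pr k (rv R k))" using X_elts_j[OF M(1)] fsq_elts[OF h(1)] h(2) by auto
    then have kO: "k \<in> Om" "k \<in> M" using n Om_trans Om_M by blast+
    have "X.is_opair u (j k) (j (rv R k))" using X_opair_j[of k "rv R k"] kO k by simp
    moreover have "u \<in> X.elts (vl (nn R))" unfolding X_elts mem_nn_real[OF R] using k kO by blast
    moreover have "j k \<in> X.elts (j n)" unfolding X_elts_j[OF M(2)] using k by blast
    moreover have "j (rv R k) \<in> N" by simp
    ultimately show "u \<in> {p \<in> X.elts (vl (nn R)). \<exists>k\<in>X.elts (j n). \<exists>y\<in>N. X.is_opair p k y}" by blast
  next
    assume "u \<in> {p \<in> X.elts (vl (nn R)). \<exists>k\<in>X.elts (j n). \<exists>y\<in>N. X.is_opair p k y}"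
    then obtain m k y where u: "m \<in> Om" "u = j (pr m (rv R m))" "k \<in> elts n" "X.is_opair u (j k) y"
      using X_elts mem_nn_real[OF R] X_elts_j[OF M(2)] by auto
    have "m \<in> M" "k \<in> M" using u Om_M elts_M by auto
    then have "m = k" using X_opair_inj[OF u(4)] X_opair_j[of m "rv R m"] u(2) j_inj by (metis rv_M)
    with u have "pr k (ap (hr R n) k) \<in> elts (hr R n)" "u = j (pr k (ap (hr R n) k))"
      using fsq_elts[OF h(1)] h(2) by auto
    then show "u \<in> X.elts (j (hr R n))" unfolding X_elts_j[OF M(1)] by blast
  qed
  then show ?thesis unfolding X.is_restriction_def by blast
qed

text \<open>Determinacy of the extension in terms of names: a strategy is a real \<open>A\<close> through the
  coding \<open>kap\<close> of finite sequences, and its value at \<open>emp\<close>, which is no code, tells the player.\<close>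

lemma AD_names:
  assumes AD: "X.AD" and d: "dfn G (\<lambda>e. W (e 0))"
    and inv: "\<And>R R'. isreal R \<Longrightarrow> isreal R' \<Longrightarrow> (\<And>n. n \<in> Om \<Longrightarrow> rv R n = rv R' n) \<Longrightarrow> W R \<Longrightarrow> W R'"
  shows "\<exists>A. isreal A \<and> ((rv A emp = emp \<and> (\<forall>R. isreal R \<longrightarrow> fol0 A R \<longrightarrow> W R)) \<or>
     (rv A emp \<noteq> emp \<and> (\<forall>R. isreal R \<longrightarrow> fol1 A R \<longrightarrow> \<not> W R)))"
proof -
  have dd: "dfn G (\<lambda>e. isreal (e 0) \<and> W (e 0))" by (intro df d)
  obtain D where D: "D \<in> M" "ev D = {R \<in> elts NR. isreal R \<and> W R}"
    using sepG[OF isset_elts[OF NR(1)], of "\<lambda>R. isreal R \<and> W R", OF dd] by blast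
  \<comment> \<open>The pay-off set as an object of the extension: \<open>D\<close> lists names of
    reals, and \<open>nmk nn\<close> passes to the set of their values.\<close>
  define B where "B = vl (nmk nn D)"
  have B: "B \<in> N" unfolding B_def using nmk(1)[OF D(1) tm_nn] vl_N by blast
  have memB: "mem y B \<longleftrightarrow> (\<exists>R. isreal R \<and> W R \<and> y = vl (nn R))" for y
    unfolding B_def nmk(2)[OF D(1) tm_nn] D(2) using isreal_def by blast
  \<comment> \<open>A real has many names; the invariance of \<open>W\<close> makes the choice among
    them harmless.\<close>
  have BW: "vl (nn R) \<in> X.elts B \<longleftrightarrow> W R" if R: "isreal R" for R
  proof
    assume "vl (nn R) \<in> X.elts B"
    then obtain R' where R': "isreal R'" "W R'" "vl (nn R) = vl (nn R')"
      unfolding X_elts memB by (elim exE conjE)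
    have "rv R' n = rv R n" if n: "n \<in> Om" for n
    proof -
      have "mem (j (pr n (rv R n))) (vl (nn R'))" using mem_nn_real[OF R] n R'(3) by auto
      then show ?thesis using mem_nn[OF isreal_M[OF R'(1)] pr_M] rv(2)[OF R'(1) n] rv(1)[OF R n] Om_M n by metis
    qed
    with inv[OF R'(1) R] R'(2) show "W R" by blast
  next
    assume "W R"
    with R show "vl (nn R) \<in> X.elts B" unfolding X_elts memB by blast
  qed
  have "X.elts B \<subseteq> X.reals (j w)"
  proof
    fix y assume "y \<in> X.elts B"
    then obtain R where "isreal R" "y = vl (nn R)" unfolding X_elts memB by (elim exE conjE)
    then show "y \<in> X.reals (j w)" using nn_reals by simp
  qed
  then have "X.determined (j w) B" using AD B X_omega w(1) unfolding X.AD_def by auto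
  then obtain s side where s: "s \<in> X.strategies (j w)"
    "(side \<and> X.wins_I (j w) B s) \<or> (\<not> side \<and> X.wins_II (j w) B s)"
    unfolding X.determined_def by blast
  have sN: "s \<in> N" and sm: "X.maps s (X.finite_seqs (j w)) (j ` Om)"
    using s(1) X_elts_j[OF w(1)] by (auto simp: X.strategies_def)
  obtain \<tau> where \<tau>: "\<tau> \<in> M" "s = vl \<tau>" using sN by (auto simp: N_iff)
  have st: "\<exists>m\<in>Om. mem (j (pr t m)) s \<and> (\<forall>m'\<in>Om. mem (j (pr t m')) s \<longrightarrow> m' = m)" if "fsq n t" for n t
    using X_mapsD[OF sm _ j_FS[OF that] OmM] fsqD(2)[OF that] by blast
  \<comment> \<open>Every number that codes no sequence receives the label \<open>sd\<close> of the
    winner; \<open>emp\<close> is one of them.\<close>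
  define sd where "sd = (if side then emp else suc emp)"
  have sd: "sd \<in> Om" by (simp add: sd_def)
  define Q where "Q i m \<longleftrightarrow> (\<exists>t\<in>M. \<exists>n\<in>Om. fsq n t \<and> kap t = i \<and> mem (j (pr t m)) s) \<or>
     ((\<forall>t\<in>M. \<forall>n\<in>Om. fsq n t \<longrightarrow> kap t \<noteq> i) \<and> m = sd)" for i m
  have dQ: "dfn G (\<lambda>e. Q (e 0) (e (Suc 0)))"
    unfolding Q_def \<tau>(2) by (intro df df_mem \<tau>(1) Om_M[OF sd])
  have Qk: "Q (kap t) m \<longleftrightarrow> mem (j (pr t m)) s" if t: "fsq n t" for t n m
  proof
    assume "Q (kap t) m"
    then obtain t' n' where "fsq n' t'" "kap t' = kap t" "mem (j (pr t' m)) s"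
      unfolding Q_def using t fsqD by blast
    then show "mem (j (pr t m)) s" using kap_inj[OF _ t] by blast
  next
    assume "mem (j (pr t m)) s"
    then show "Q (kap t) m" unfolding Q_def using t fsqD(1,2)[OF t] by blast
  qed
  have "\<exists>A. isreal A \<and> (\<forall>n\<in>Om. Q n (rv A n))"
  proof (rule real_ex[OF dQ])
    fix i assume i: "i \<in> Om"
    show "\<exists>m. m \<in> Om \<and> Q i m \<and> (\<forall>m'. m' \<in> Om \<and> Q i m' \<longrightarrow> m' = m)"
    proof (cases "\<exists>t n. fsq n t \<and> kap t = i")
      case True
      then obtain t n where t: "fsq n t" "kap t = i" by blast
      then show ?thesis using st[OF t(1)] Qk[OF t(1)] by blast
    next
      case False
      then have "Q i m \<longleftrightarrow> m = sd" for m unfolding Q_def by blast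
      with sd show ?thesis by blast
    qed
  qed
  then obtain A where A: "isreal A" "\<And>n. n \<in> Om \<Longrightarrow> Q n (rv A n)" by blast
  have g: "(j t, j (rv A (kap t))) \<in> X.graph s" if t: "fsq n t" for t n
  proof -
    have "mem (j (pr t (rv A (kap t)))) s" using A(2)[OF kap_Om[OF t]] Qk[OF t] by blast
    then show ?thesis using X_graph[of t "rv A (kap t)" s] fsqD(2)[OF t] by simp
  qed
  have Ae: "rv A emp = sd" using A(2)[OF emp_Om] kap_ne unfolding Q_def by blast
  have F: "X.follows Z s (vl (nn R))" if R: "isreal R" and Z: "\<And>z. z \<in> Z \<Longrightarrow> \<exists>n\<in>Om. z = j n \<and> rv R n = rv A (kap (hr R n))" for Z R
    unfolding X.follows_def
  proof
    fix z assume "z \<in> Z"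
    then obtain n where n: "n \<in> Om" "z = j n" "rv R n = rv A (kap (hr R n))" using Z by blast
    have "mem (j (pr n (rv R n))) (vl (nn R))" unfolding mem_nn_real[OF R] using n(1) by blast
    then have "(j n, j (rv R n)) \<in> X.graph (vl (nn R))"
      using X_graph[OF Om_M[OF n(1)] rv_M] by blast
    with X_restr[OF R n(1)] g[OF hr(1)[OF R n(1)]] n
    show "\<exists>t\<in>N. \<exists>m\<in>N. X.is_restriction t (vl (nn R)) z \<and> (t, m) \<in> X.graph s \<and> (z, m) \<in> X.graph (vl (nn R))"
      using hr_M by (metis j_N rv_M)
  qed
  show ?thesis
  proof (cases side)
    case True
    then have wI: "X.wins_I (j w) B s" using s(2) by blast
    have "W R" if R: "isreal R" "fol0 A R" for R
    proof -
      have "X.follows (X.evens (j w)) s (vl (nn R))"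
        by (rule F[OF R(1)]) (use R(2) in \<open>auto simp: X_evens fol0_def\<close>)
      with wI nn_reals[OF R(1)] BW[OF R(1)] show ?thesis unfolding X.wins_I_def by blast
    qed
    with A(1) Ae True show ?thesis unfolding sd_def by auto
  next
    case False
    then have wII: "X.wins_II (j w) B s" using s(2) by blast
    have "\<not> W R" if R: "isreal R" "fol1 A R" for R
    proof -
      have "X.follows (X.odds (j w)) s (vl (nn R))"
      proof (rule F[OF R(1)])
        fix z assume "z \<in> X.odds (j w)"
        then obtain k where "k \<in> Om" "z = j (D1 k)" using X_odds by blast
        with R(2) show "\<exists>n\<in>Om. z = j n \<and> rv R n = rv A (kap (hr R n))" unfolding fol1_def
          using D_Om(2) by blast
      qed
      with wII nn_reals[OF R(1)] BW[OF R(1)] show ?thesis unfolding X.wins_II_def by blast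
    qed
    with A(1) Ae False show ?thesis unfolding sd_def by auto
  qed
qed

section \<open>Constructing runs\<close>

lemma run_real:
  assumes d: "dfn G (\<lambda>e. S (e 0) (e (Suc 0)))"
    and S: "\<And>n t. fsq n t \<Longrightarrow> \<exists>m. m \<in> Om \<and> S t m \<and> (\<forall>m'. m' \<in> Om \<and> S t m' \<longrightarrow> m' = m)"
  shows "\<exists>R. isreal R \<and> (\<forall>n\<in>Om. S (hr R n) (rv R n))"
proof -
  have "\<exists>r. gfun G r \<and> (\<forall>n\<in>Om. S (hs r n) (r n))" by (rule run_ex[OF ind_G d]) (rule S)
  then obtain r where r: "gfun G r" "\<forall>n\<in>Om. S (hs r n) (r n)" by blast
  have "\<exists>R. isreal R \<and> (\<forall>n\<in>Om. n \<in> Om \<and> rv R n = r n)"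
    by (rule real_ex) (use r(1) in \<open>auto simp: gfun_def\<close>)
  then obtain R where R: "isreal R" "\<forall>n\<in>Om. rv R n = r n" by blast
  have "hr R n = hs r n" if n: "n \<in> Om" for n
    using hs_cong[of n "rv R" r] R n Om_trans by (auto simp: hr_def)
  with r R show ?thesis by auto
qed

text \<open>\<open>True\<close> stands for player II, who moves at odd positions.\<close>

definition DD :: "bool \<Rightarrow> 'a \<Rightarrow> 'a" where "DD s k = (if s then D1 k else D0 k)"

lemma tm_DD [df]: "tm C t \<Longrightarrow> tm C (\<lambda>e. DD s (t e))"
  by (cases s) (simp_all add: DD_def, (intro df; assumption)+)

definition fol :: "bool \<Rightarrow> 'a \<Rightarrow> 'a \<Rightarrow> bool" where
  "fol s A R \<longleftrightarrow> (if s then fol1 A R else fol0 A R)"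

lemma fol_cong: "rv A = rv A' \<Longrightarrow> fol s A R \<longleftrightarrow> fol s A' R"
  by (simp add: fol_def fol0_def fol1_def)

lemma DD_Om [simp]: "k \<in> Om \<Longrightarrow> DD s k \<in> Om"
  by (simp add: DD_def)

lemma DD_inj: "k \<in> Om \<Longrightarrow> k' \<in> Om \<Longrightarrow> DD s k = DD s' k' \<longleftrightarrow> s = s' \<and> k = k'"
  by (simp add: DD_def)

lemma fol_iff: "fol s A R \<longleftrightarrow> (\<forall>k\<in>Om. rv R (DD s k) = rv A (kap (hr R (DD s k))))"
  by (simp add: fol_def fol0_def fol1_def DD_def)

text \<open>Player \<open>s\<close> is bound to \<open>A\<close>, the opponent to the rule
  \<open>Q\<close>, which may look at the position. The length of a position tells whose turn it is,
  so both become a single rule for \<open>run_real\<close>.\<close>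

lemma play:
  assumes A: "isreal A" and d: "dfn G (\<lambda>e. Q (e 0) (e (Suc 0)))"
    and Q: "\<And>n t. fsq n t \<Longrightarrow> \<exists>m. m \<in> Om \<and> Q t m \<and> (\<forall>m'. m' \<in> Om \<and> Q t m' \<longrightarrow> m' = m)"
  shows "\<exists>R. isreal R \<and> fol s A R \<and> (\<forall>k\<in>Om. Q (hr R (DD (\<not> s) k)) (rv R (DD (\<not> s) k)))"
proof -
  define S where "S t m \<longleftrightarrow> (\<exists>k\<in>Om. len t = DD s k \<and> m = rv A (kap t)) \<or> ((\<forall>k\<in>Om. len t \<noteq> DD s k) \<and> Q t m)" for t m
  have dS: "dfn G (\<lambda>e. S (e 0) (e (Suc 0)))"
    unfolding S_def by (intro df isreal_M[OF A] inst2[where S=Q, OF d])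
  have S: "\<exists>m. m \<in> Om \<and> S t m \<and> (\<forall>m'. m' \<in> Om \<and> S t m' \<longrightarrow> m' = m)" if t: "fsq n t" for n t
  proof (cases "\<exists>k\<in>Om. len t = DD s k")
    case True
    then have "S t m \<longleftrightarrow> m = rv A (kap t)" for m unfolding S_def by blast
    with rv(1)[OF A kap_Om[OF t]] show ?thesis by blast
  next
    case False
    then have "S t m \<longleftrightarrow> Q t m" for m unfolding S_def by blast
    with Q[OF t] show ?thesis by presburger
  qed
  have "\<exists>R. isreal R \<and> (\<forall>n\<in>Om. S (hr R n) (rv R n))" by (rule run_real[OF dS]) (rule S)
  then obtain R where R: "isreal R" "\<forall>n\<in>Om. S (hr R n) (rv R n)" by blast
  have l: "len (hr R n) = n" if "n \<in> Om" for n using len[OF hr(1)[OF R(1) that]] .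
  have "rv R (DD s k) = rv A (kap (hr R (DD s k)))" if k: "k \<in> Om" for k
  proof -
    have "S (hr R (DD s k)) (rv R (DD s k))" using R(2) k by simp
    then show ?thesis unfolding S_def l[OF DD_Om[OF k]] using k by blast
  qed
  moreover have "Q (hr R (DD (\<not> s) k)) (rv R (DD (\<not> s) k))" if k: "k \<in> Om" for k
  proof -
    have "DD (\<not> s) k \<noteq> DD s k'" if "k' \<in> Om" for k' using DD_inj[OF k that] by blast
    moreover have "S (hr R (DD (\<not> s) k)) (rv R (DD (\<not> s) k))" using R(2) k by simp
    ultimately show ?thesis unfolding S_def l[OF DD_Om[OF k]] by blast
  qed
  ultimately show ?thesis using R(1) unfolding fol_iff by blast
qed

lemmas play0 = play[of _ _ False, unfolded fol_def DD_def not_False_eq_True if_True if_False]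
  and play1 = play[of _ _ True, unfolded fol_def DD_def not_True_eq_False if_True if_False]

lemma play_real:
  assumes "isreal A" "isreal Y"
  shows "\<exists>R. isreal R \<and> fol s A R \<and> (\<forall>k\<in>Om. rv R (DD (\<not> s) k) = rv Y k)"
proof -
  let ?D = "DD (\<not> s)"
  define Q where "Q t m \<longleftrightarrow> (\<exists>k\<in>Om. len t = ?D k \<and> m = rv Y k) \<or> ((\<forall>k\<in>Om. len t \<noteq> ?D k) \<and> m = emp)" for t m
  have "dfn G (\<lambda>e. Q (e 0) (e (Suc 0)))" unfolding Q_def by (intro df isreal_M[OF assms(2)])
  moreover have Qk: "Q t m \<longleftrightarrow> m = rv Y k" if "k \<in> Om" "len t = ?D k" for t m k
    unfolding Q_def using that DD_inj by metis
  moreover have "\<exists>m. m \<in> Om \<and> Q t m \<and> (\<forall>m'. m' \<in> Om \<and> Q t m' \<longrightarrow> m' = m)" for t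
  proof (cases "\<exists>k\<in>Om. len t = ?D k")
    case True
    then show ?thesis using Qk rv(1)[OF assms(2)] by metis
  next
    case False
    then have "Q t m \<longleftrightarrow> m = emp" for m unfolding Q_def by blast
    with emp_Om show ?thesis by blast
  qed
  ultimately obtain R where R: "isreal R" "fol s A R" "\<forall>k\<in>Om. Q (hr R (?D k)) (rv R (?D k))"
    using play[OF assms(1)] by blast
  have "rv R (?D k) = rv Y k" if k: "k \<in> Om" for k
    using R(3) Qk[OF k len[OF hr(1)[OF R(1) DD_Om[OF k]]]] k by blast
  with R show ?thesis by blast
qed

section \<open>New reals\<close>

definition mreal :: "'a \<Rightarrow> bool" where "mreal x \<longleftrightarrow> x \<in> M \<and> maps x Om Om"

lemma df_mreal0: "dfn C (\<lambda>e. mreal (e 0))" unfolding mreal_def by (intro df)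
lemmas df_mreal [df] = inst1[where S=mreal, OF df_mreal0]

lemma mreal_M: "mreal x \<Longrightarrow> x \<in> M" by (simp add: mreal_def)

lemma mreal_ap: "mreal x \<Longrightarrow> n \<in> Om \<Longrightarrow> ap x n \<in> Om"
  using ap_Om by (simp add: mreal_def)

lemma mreal_ext: "mreal x \<Longrightarrow> mreal y \<Longrightarrow> (\<And>n. n \<in> Om \<Longrightarrow> ap x n = ap y n) \<Longrightarrow> x = y"
  using maps_ext[OF _ _ _ _ OmM OmM] unfolding mreal_def by blast

lemma mreal_ex:
  assumes d: "dfn {} (\<lambda>e. Q (e 0) (e (Suc 0)))"
    and Q: "\<And>n. n \<in> Om \<Longrightarrow> \<exists>m. m \<in> Om \<and> Q n m \<and> (\<forall>m'. m' \<in> Om \<and> Q n m' \<longrightarrow> m' = m)"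
  shows "\<exists>x. mreal x \<and> (\<forall>n\<in>Om. Q n (ap x n))"
  using maps_ex[OF isset_elts[OF w(1)] isset_elts[OF w(1)] d Q] unfolding mreal_def by blast

lemma real_of: "mreal x \<Longrightarrow> \<exists>R. isreal R \<and> (\<forall>n\<in>Om. rv R n = ap x n)"
  by (rule real_ex) (auto intro!: df simp: mreal_ap mreal_M)

end

locale forcing_R = forcing +
  fixes f :: 'a
  assumes nontriv: "nontrivial P L" and fM: "f \<in> M" and fmaps: "maps f (reals w) (elts P)"
    and fonto: "\<And>p. p \<in> elts P \<Longrightarrow> \<exists>x\<in>reals w. (x, p) \<in> graph f"
begin

section \<open>Conditions as images of reals\<close>

lemma reals_mreal: "x \<in> reals w \<longleftrightarrow> mreal x"
  by (auto simp: reals_def mreal_def)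

lemma f_P: "mreal x \<Longrightarrow> ap f x \<in> Pc"
  using maps_ap(1)[OF fmaps _ eltsM] reals_mreal mreal_M by blast

lemma f_onto: "p \<in> Pc \<Longrightarrow> \<exists>x. mreal x \<and> ap f x = p"
proof -
  assume p: "p \<in> Pc"
  then obtain x where x: "mreal x" "(x, p) \<in> graph f" using fonto reals_mreal by blast
  have "reals w \<subseteq> M" using reals_mreal mreal_M by blast
  then have "p = ap f x" using maps_ap(3)[OF fmaps _ eltsM, of x p] x reals_mreal by (simp add: graph_iff)
  with x show ?thesis by blast
qed

definition perp :: "'a \<Rightarrow> 'a \<Rightarrow> bool" where "perp p q \<longleftrightarrow> (\<forall>r\<in>Pc. \<not> (le r p \<and> le r q))"

lemma df_perp [df]: "tm C t1 \<Longrightarrow> tm C t2 \<Longrightarrow> dfn C (\<lambda>e. perp (t1 e) (t2 e))"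
  by (rule inst2[where S=perp]) (unfold perp_def, intro df)+

lemma perp_G: "p \<in> G \<Longrightarrow> q \<in> G \<Longrightarrow> \<not> perp p q"
  using G_dir GP unfolding perp_def by blast

lemma split: "p \<in> Pc \<Longrightarrow> \<exists>q\<in>Pc. \<exists>r\<in>Pc. le q p \<and> le r p \<and> perp q r"
proof -
  assume p: "p \<in> Pc"
  then obtain q r where qr: "q \<in> Pc" "r \<in> Pc" "(q, p) \<in> graph L" "(r, p) \<in> graph L" "\<not> compatible P L q r"
    using nontriv unfolding nontrivial_def by blast
  then have "perp q r" unfolding perp_def compatible_def using le_graph by blast
  with qr p le_graph show ?thesis by blast
qed

declare fM [df]

text \<open>\<open>x\<close> and \<open>y\<close> are the reals built by players I and II in a run
  in which player I follows \<open>a\<close>. All objects belong to \<open>M\<close>, so the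
  relation is definable without \<open>G\<close> and may be used to define dense sets.\<close>

definition rel0 :: "'a \<Rightarrow> 'a \<Rightarrow> 'a \<Rightarrow> bool" where
  "rel0 a x y \<longleftrightarrow> mreal x \<and> mreal y \<and> (\<exists>r\<in>M. mreal r \<and> (\<forall>k\<in>Om. ap r (D0 k) = ap x k \<and> ap r (D1 k) = ap y k \<and>
     (\<forall>t\<in>M. fsq (D0 k) t \<longrightarrow> (\<forall>i\<in>elts (D0 k). ap t i = ap r i) \<longrightarrow> ap r (D0 k) = ap a (kap t))))"

definition rel1 :: "'a \<Rightarrow> 'a \<Rightarrow> 'a \<Rightarrow> bool" where
  "rel1 a x y \<longleftrightarrow> mreal x \<and> mreal y \<and> (\<exists>r\<in>M. mreal r \<and> (\<forall>k\<in>Om. ap r (D0 k) = ap x k \<and> ap r (D1 k) = ap y k \<and>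
     (\<forall>t\<in>M. fsq (D1 k) t \<longrightarrow> (\<forall>i\<in>elts (D1 k). ap t i = ap r i) \<longrightarrow> ap r (D1 k) = ap a (kap t))))"

lemma df_rel00: "dfn C (\<lambda>e. rel0 (e 0) (e (Suc 0)) (e (Suc (Suc 0))))" unfolding rel0_def by (intro df)
lemma df_rel10: "dfn C (\<lambda>e. rel1 (e 0) (e (Suc 0)) (e (Suc (Suc 0))))" unfolding rel1_def by (intro df)
lemmas df_rel [df] = inst3[where S=rel0, OF df_rel00] inst3[where S=rel1, OF df_rel10]

text \<open>If no real is added, then the strategies lie in the ground model, and no such strategy can
  take account of the generic filter. In the game, \<open>V x y\<close> says that player I wins if the players build
  the reals \<open>x\<close> and \<open>y\<close>.\<close>

lemma new_real:
  assumes AD: "X.AD"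
  shows "\<exists>R. isreal R \<and> \<not> (\<exists>x. mreal x \<and> (\<forall>n\<in>Om. ap x n = rv R n))"
proof (rule ccontr)
  assume "\<not> ?thesis"
  then have old: "\<exists>x. mreal x \<and> (\<forall>n\<in>Om. ap x n = rv R n)" if "isreal R" for R using that by blast
  define V where "V x y \<longleftrightarrow> ap f x \<in> G \<and> \<not> (ap f y \<in> G \<and> (\<exists>p\<in>Pc. le p (ap f x) \<and> perp p (ap f y)))" for x y
  define W where "W R \<longleftrightarrow> (\<exists>x\<in>M. \<exists>y\<in>M. mreal x \<and> mreal y \<and>
     (\<forall>i\<in>Om. rv R (D0 i) = ap x i \<and> rv R (D1 i) = ap y i) \<and> V x y)" for R
  have dW: "dfn G (\<lambda>e. W (e 0))" unfolding W_def V_def by (intro df)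
  have W_inv: "W R'" if "\<And>n. n \<in> Om \<Longrightarrow> rv R n = rv R' n" "W R" for R R'
    using that(2) that(1)[OF D_Om(1)] that(1)[OF D_Om(2)] unfolding W_def by (metis (no_types, lifting))
  have W_V: "W R \<longleftrightarrow> V x y" if xy: "mreal x" "mreal y" "\<forall>i\<in>Om. rv R (D0 i) = ap x i \<and> rv R (D1 i) = ap y i" for R x y
  proof
    assume "W R"
    then obtain x' y' where *: "mreal x'" "mreal y'" "V x' y'" "\<forall>i\<in>Om. rv R (D0 i) = ap x' i \<and> rv R (D1 i) = ap y' i"
      unfolding W_def by blast
    have "x' = x" by (rule mreal_ext[OF *(1) xy(1)]) (use *(4) xy(3) in metis)
    moreover have "y' = y" by (rule mreal_ext[OF *(2) xy(2)]) (use *(4) xy(3) in metis)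
    ultimately show "V x y" using *(3) by simp
  next
    assume "V x y"
    then show "W R" unfolding W_def using xy mreal_M by blast
  qed
  have "\<exists>A. isreal A \<and> ((rv A emp = emp \<and> (\<forall>R. isreal R \<longrightarrow> fol0 A R \<longrightarrow> W R)) \<or>
     (rv A emp \<noteq> emp \<and> (\<forall>R. isreal R \<longrightarrow> fol1 A R \<longrightarrow> \<not> W R)))"
    by (rule AD_names[OF AD dW]) (rule W_inv)
  then obtain A where A: "isreal A" "(rv A emp = emp \<and> (\<forall>R. isreal R \<longrightarrow> fol0 A R \<longrightarrow> W R)) \<or>
     (rv A emp \<noteq> emp \<and> (\<forall>R. isreal R \<longrightarrow> fol1 A R \<longrightarrow> \<not> W R))"
    by (elim exE conjE)
  obtain a where a: "mreal a" "\<And>n. n \<in> Om \<Longrightarrow> ap a n = rv A n" using old[OF A(1)] by blast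
  have aM: "a \<in> M" using a mreal_M by blast
  show False
    using A(2)
  proof (elim disjE conjE)
    assume win: "\<forall>R. isreal R \<longrightarrow> fol0 A R \<longrightarrow> W R"
    have V: "V x y" if xy: "rel0 a x y" for x y
    proof -
      obtain r where r: "mreal x" "mreal y" "mreal r" "\<forall>k\<in>Om. ap r (D0 k) = ap x k \<and> ap r (D1 k) = ap y k \<and>
        (\<forall>t\<in>M. fsq (D0 k) t \<longrightarrow> (\<forall>i\<in>elts (D0 k). ap t i = ap r i) \<longrightarrow> ap r (D0 k) = ap a (kap t))"
        using xy unfolding rel0_def by blast
      obtain R where R: "isreal R" "\<forall>n\<in>Om. rv R n = ap r n" using real_of[OF r(3)] by blast
      have "fol0 A R" unfolding fol0_def
      proof
        fix k assume k: "k \<in> Om"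
        note h = hr[OF R(1) D_Om(1)[OF k]]
        have "\<forall>i\<in>elts (D0 k). ap (hr R (D0 k)) i = ap r i"
          using h(2) R(2) Om_trans D_Om(1)[OF k] by auto
        then have "ap r (D0 k) = ap a (kap (hr R (D0 k)))" using r(4) k h(1) hr_M by blast
        then show "rv R (D0 k) = rv A (kap (hr R (D0 k)))" using R(2) a(2)[OF kap_Om[OF h(1)]] k by simp
      qed
      then have "W R" using win R by blast
      then show ?thesis using W_V[OF r(1,2)] R(2) r(4) by auto
    qed
    have ex: "\<exists>x. rel0 a x y" if y: "mreal y" for y
    proof -
      obtain Y where Y: "isreal Y" "\<forall>n\<in>Om. rv Y n = ap y n" using real_of[OF y] by blast
      obtain R where R: "isreal R" "fol0 A R" "\<forall>k\<in>Om. rv R (D1 k) = rv Y k" using play_real[of _ _ False, unfolded fol_def DD_def not_False_eq_True if_True if_False, OF A(1) Y(1)] by blast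
      obtain r where r: "mreal r" "\<forall>n\<in>Om. ap r n = rv R n" using old[OF R(1)] by blast
      have "\<exists>x. mreal x \<and> (\<forall>n\<in>Om. ap x n = ap r (D0 n))"
      proof (rule mreal_ex)
        show "dfn {} (\<lambda>e. e (Suc 0) = ap r (D0 (e 0)))" by (intro df mreal_M r)
      qed (use r(1) mreal_ap D_Om(1) in blast)
      then obtain x where x: "mreal x" "\<forall>n\<in>Om. ap x n = ap r (D0 n)" by blast
      have "ap r (D0 k) = ap a (kap t)" if k: "k \<in> Om" and t: "fsq (D0 k) t" "\<forall>i\<in>elts (D0 k). ap t i = ap r i" for k t
      proof -
        have "hr R (D0 k) = t" by (rule hr_eq[OF R(1) t(1)]) (use t(2) r(2) Om_trans D_Om(1)[OF k] in auto)
        then show ?thesis using R(2) k r(2) a(2)[OF kap_Om[OF t(1)]] unfolding fol0_def by auto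
      qed
      moreover have "ap r (D1 k) = ap y k" if "k \<in> Om" for k using r(2) R(3) Y(2) D_Om(2)[OF that] that by metis
      ultimately show ?thesis unfolding rel0_def using x y r(1) mreal_M by (intro exI[of _ x]) auto
    qed
    \<comment> \<open>Either no extension of \<open>q\<close> contradicts any condition that the
      strategy can play, or \<open>q\<close> contradicts one of them. In \<open>G\<close> the second
      is impossible, as the winning strategy plays only members of \<open>G\<close>.\<close>
    define D where "D q \<longleftrightarrow> (\<forall>x\<in>M. \<forall>y\<in>M. rel0 a x y \<longrightarrow> (\<forall>p\<in>Pc. le p q \<longrightarrow> \<not> perp p (ap f x))) \<or>
        (\<exists>x\<in>M. \<exists>y\<in>M. rel0 a x y \<and> perp q (ap f x))" for q
    have "\<exists>q\<in>G. D q"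
    proof (rule G_meet)
      show "dfn {} (\<lambda>e. D (e 0))" unfolding D_def by (intro df aM)
      fix p assume p: "p \<in> Pc"
      show "\<exists>d\<in>Pc. D d \<and> le d p"
      proof (cases "D p")
        case True with p show ?thesis by auto
      next
        case False
        then obtain x y q where "x \<in> M" "y \<in> M" "rel0 a x y" "q \<in> Pc" "le q p" "perp q (ap f x)" unfolding D_def by blast
        then show ?thesis unfolding D_def by blast
      qed
    qed
    then obtain q0 where q0: "q0 \<in> G" "D q0" by blast
    have "\<not> (\<exists>x\<in>M. \<exists>y\<in>M. rel0 a x y \<and> perp q0 (ap f x))"
      using V q0(1) perp_G unfolding V_def by blast
    then have q0': "\<not> perp p (ap f x)" if "rel0 a x y" "p \<in> Pc" "le p q0" for x y p
      using q0(2) that unfolding D_def rel0_def using mreal_M by blast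
    \<comment> \<open>Non-triviality puts into \<open>G\<close> some \<open>q\<close> with an
      incompatible \<open>p\<close>, both below \<open>q0\<close>. Player II plays \<open>q\<close>.
      The answer of player I is compatible with \<open>p\<close>, so it has an extension
      incompatible with \<open>q\<close>, and player I loses.\<close>
    have "\<exists>q\<in>G. (\<exists>p\<in>Pc. le p q0 \<and> perp p q) \<and> le q q0"
    proof (rule G_meet_below[OF _ q0(1)])
      show "dfn {} (\<lambda>e. \<exists>p\<in>Pc. le p q0 \<and> perp p (e 0))" by (intro df Pc_M GP q0)
      fix p assume p: "p \<in> Pc" "le p q0"
      obtain q r where qr: "q \<in> Pc" "r \<in> Pc" "le q p" "le r p" "perp q r" using split[OF p(1)] by blast
      then have "le q q0" using le_trans p GP q0 by blast
      with qr show "\<exists>d\<in>Pc. (\<exists>p\<in>Pc. le p q0 \<and> perp p d) \<and> le d p" by blast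
    qed
    then obtain q p where q: "q \<in> G" "p \<in> Pc" "le p q0" "perp p q" by blast
    obtain y where y: "mreal y" "ap f y = q" using f_onto GP q by blast
    obtain x where x: "rel0 a x y" using ex y by blast
    then obtain s where s: "s \<in> Pc" "le s p" "le s (ap f x)" using q0'[OF x q(2,3)] unfolding perp_def by blast
    have "perp s q" using q(4) s q GP le_trans unfolding perp_def by blast
    then show False using V[OF x] y q s unfolding V_def by blast
  next
    assume win: "\<forall>R. isreal R \<longrightarrow> fol1 A R \<longrightarrow> \<not> W R"
    have V: "\<not> V x y" if xy: "rel1 a x y" for x y
    proof -
      obtain r where r: "mreal x" "mreal y" "mreal r" "\<forall>k\<in>Om. ap r (D0 k) = ap x k \<and> ap r (D1 k) = ap y k \<and>
        (\<forall>t\<in>M. fsq (D1 k) t \<longrightarrow> (\<forall>i\<in>elts (D1 k). ap t i = ap r i) \<longrightarrow> ap r (D1 k) = ap a (kap t))"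
        using xy unfolding rel1_def by blast
      obtain R where R: "isreal R" "\<forall>n\<in>Om. rv R n = ap r n" using real_of[OF r(3)] by blast
      have "fol1 A R" unfolding fol1_def
      proof
        fix k assume k: "k \<in> Om"
        note h = hr[OF R(1) D_Om(2)[OF k]]
        have "\<forall>i\<in>elts (D1 k). ap (hr R (D1 k)) i = ap r i"
          using h(2) R(2) Om_trans[OF _ D_Om(2)[OF k]] by metis
        then have "ap r (D1 k) = ap a (kap (hr R (D1 k)))" using r(4) k h(1) hr_M by blast
        then show "rv R (D1 k) = rv A (kap (hr R (D1 k)))" using R(2) a(2)[OF kap_Om[OF h(1)]] D_Om(2)[OF k] by metis
      qed
      then have "\<not> W R" using win R by blast
      then show ?thesis using W_V[OF r(1,2)] R(2) r(4) D_Om by metis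
    qed
    have ex: "\<exists>y. rel1 a x y" if x: "mreal x" for x
    proof -
      obtain Y where Y: "isreal Y" "\<forall>n\<in>Om. rv Y n = ap x n" using real_of[OF x] by blast
      obtain R where R: "isreal R" "fol1 A R" "\<forall>k\<in>Om. rv R (D0 k) = rv Y k" using play_real[of _ _ True, unfolded fol_def DD_def not_True_eq_False if_True if_False, OF A(1) Y(1)] by blast
      obtain r where r: "mreal r" "\<forall>n\<in>Om. ap r n = rv R n" using old[OF R(1)] by blast
      have "\<exists>y. mreal y \<and> (\<forall>n\<in>Om. ap y n = ap r (D1 n))"
      proof (rule mreal_ex)
        show "dfn {} (\<lambda>e. e (Suc 0) = ap r (D1 (e 0)))" by (intro df mreal_M r)
      qed (use r mreal_ap D_Om(2) in blast)
      then obtain y where y: "mreal y" "\<forall>n\<in>Om. ap y n = ap r (D1 n)" by blast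
      have "ap r (D1 k) = ap a (kap t)" if k: "k \<in> Om" and t: "fsq (D1 k) t" "\<forall>i\<in>elts (D1 k). ap t i = ap r i" for k t
      proof -
        have "hr R (D1 k) = t"
        proof (rule hr_eq[OF R(1) t(1)])
          fix i assume i: "i \<in> elts (D1 k)"
          then have "i \<in> Om" using Om_trans D_Om(2)[OF k] by blast
          with i t(2) r(2) show "ap t i = rv R i" by metis
        qed
        then show ?thesis using R(2) k r(2) a(2)[OF kap_Om[OF t(1)]] D_Om(2)[OF k] unfolding fol1_def by metis
      qed
      moreover have "ap r (D0 k) = ap x k" if "k \<in> Om" for k using r(2) R(3) Y(2) D_Om(1)[OF that] that by metis
      ultimately show ?thesis unfolding rel1_def using x y r(1) mreal_M by (intro exI[of _ y]) auto
    qed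
    \<comment> \<open>Player I plays \<open>f x\<close>. If it has an extension incompatible with
      the answer, that extension is aimed at, otherwise \<open>f x\<close> itself. Such conditions
      are dense, and either kind in \<open>G\<close> refutes the strategy of player II.\<close>
    define D where "D q \<longleftrightarrow> (\<exists>x\<in>M. \<exists>y\<in>M. rel1 a x y \<and> le q (ap f x) \<and>
       (perp q (ap f y) \<or> \<not> (\<exists>p\<in>Pc. le p (ap f x) \<and> perp p (ap f y))))" for q
    have "\<exists>q\<in>G. D q"
    proof (rule G_meet)
      show "dfn {} (\<lambda>e. D (e 0))" unfolding D_def by (intro df aM)
      fix q assume q: "q \<in> Pc"
      obtain x where x: "mreal x" "ap f x = q" using f_onto q by blast
      obtain y where y: "rel1 a x y" using ex x by blast
      then have M: "x \<in> M" "y \<in> M" unfolding rel1_def using mreal_M by auto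
      show "\<exists>d\<in>Pc. D d \<and> le d q"
      proof (cases "\<exists>p\<in>Pc. le p q \<and> perp p (ap f y)")
        case True then show ?thesis unfolding D_def using x y M by blast
      next
        case False then show ?thesis unfolding D_def using x y M q le_refl by blast
      qed
    qed
    then obtain q x y where q: "q \<in> G" "rel1 a x y" "le q (ap f x)"
      "perp q (ap f y) \<or> \<not> (\<exists>p\<in>Pc. le p (ap f x) \<and> perp p (ap f y))" unfolding D_def by blast
    have "ap f x \<in> G" using G_up q f_P unfolding rel1_def by blast
    then have "ap f y \<in> G" "\<exists>p\<in>Pc. le p (ap f x) \<and> perp p (ap f y)" using V[OF q(2)] unfolding V_def by blast+
    with q perp_G show False by blast
  qed
qed

end

context zf_model
begin

section \<open>The tower\<close>

lemma Om_least:
  assumes "n \<in> Om" "Q n" "dfn {} (\<lambda>e. Q (e 0))"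
  shows "\<exists>n\<in>Om. Q n \<and> (\<forall>m\<in>elts n. \<not> Q m)"
proof -
  have B: "isset {n \<in> Om. Q n}" by (intro isset_sep isset_elts w assms)
  have "n \<in> elts (mk {n \<in> Om. Q n})" unfolding mk(2)[OF B] using assms by blast
  then obtain m where "m \<in> {n \<in> Om. Q n}" "elts m \<inter> {n \<in> Om. Q n} = {}"
    using foundE[OF mk(1)[OF B], of n] unfolding mk(2)[OF B] by blast
  then show ?thesis using Om_trans by blast
qed

end

text \<open>Transfinite iteration of \<open>Z \<mapsto> Z \<union> {r \<in> a. (r, Z) \<in> qr}\<close> without ordinals: the stages form the
  least family closed under this step and under unions, as in the Bourbaki-Witt theorem.\<close>

locale tower = zf_model +
  fixes a qr :: 'a
  assumes a [df]: "a \<in> M" and qr [df]: "qr \<in> M"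
begin

definition phi :: "'a \<Rightarrow> 'a" where
  "phi Z = mk (elts Z \<union> {r \<in> elts a. pr r Z \<in> elts qr})"

lemma isset_phi: "Z \<in> M \<Longrightarrow> isset (elts Z \<union> {r \<in> elts a. pr r Z \<in> elts qr})"
  by (intro isset_Un isset_sep isset_elts df)

lemma phi: "Z \<in> M \<Longrightarrow> phi Z \<in> M" "Z \<in> M \<Longrightarrow> elts (phi Z) = elts Z \<union> {r \<in> elts a. pr r Z \<in> elts qr}"
  unfolding phi_def by (intro mk isset_phi; assumption)+

lemma tm_phi0: "tm C (\<lambda>e. phi (e 0))"
proof (rule tmI[where S="\<lambda>v e. elts v = {u \<in> M. u \<in> elts (e 0) \<or> (u \<in> elts a \<and> pr u (e 0) \<in> elts qr)}"], goal_cases)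
  case (1 e) then show ?case by (intro phi envD)
next
  case (2 e v)
  have "{u \<in> M. u \<in> elts (e 0) \<or> (u \<in> elts a \<and> pr u (e 0) \<in> elts qr)} = elts (e 0) \<union> {r \<in> elts a. pr r (e 0) \<in> elts qr}"
    using elts_M by blast
  then show ?case unfolding phi_def using mk_iff[OF isset_phi[OF envD[OF 2(1)]] 2(2)] by simp
next
  case 3 show ?case by (intro df)
qed

lemmas tm_phi [df] = tm_inst1[where F=phi, OF tm_phi0]

definition cl :: "'a \<Rightarrow> bool" where
  "cl C \<longleftrightarrow> (\<forall>Z\<in>elts C. elts Z \<subseteq> elts a) \<and> (\<forall>Z\<in>elts C. phi Z \<in> elts C) \<and>
     (\<forall>S\<in>M. elts S \<subseteq> elts C \<longrightarrow> un S \<in> elts C)"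

lemma df_cl0: "dfn C (\<lambda>e. cl (e 0))" unfolding cl_def by (intro df)
lemmas df_cl [df] = inst1[where S=cl, OF df_cl0]

definition T :: 'a where "T = mk {Z \<in> Pw (elts a). \<forall>C\<in>M. cl C \<longrightarrow> Z \<in> elts C}"

lemma T: "T \<in> M" "elts T = {Z \<in> Pw (elts a). \<forall>C\<in>M. cl C \<longrightarrow> Z \<in> elts C}"
proof -
  have "isset {Z \<in> Pw (elts a). \<forall>C\<in>M. cl C \<longrightarrow> Z \<in> elts C}"
    by (intro isset_sep isset_Pw isset_elts df)
  then show "T \<in> M" "elts T = {Z \<in> Pw (elts a). \<forall>C\<in>M. cl C \<longrightarrow> Z \<in> elts C}"
    unfolding T_def by (intro mk; assumption)+
qed

lemma T_sub: "Z \<in> elts T \<Longrightarrow> elts Z \<subseteq> elts a" and T_M: "Z \<in> elts T \<Longrightarrow> Z \<in> M"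
  by (auto simp: T Pw_def)

lemma T_phi: "Z \<in> elts T \<Longrightarrow> phi Z \<in> elts T"
proof -
  assume Z: "Z \<in> elts T"
  then have "phi Z \<in> Pw (elts a)" using T_sub[OF Z] phi[OF T_M[OF Z]] by (auto simp: Pw_def)
  moreover have "phi Z \<in> elts C" if "C \<in> M" "cl C" for C
    using Z that unfolding T(2) cl_def by blast
  ultimately show ?thesis unfolding T(2) by blast
qed

lemma T_un: assumes S: "S \<in> M" "elts S \<subseteq> elts T" shows "un S \<in> elts T"
proof -
  have "un S \<in> Pw (elts a)" using S T_sub un[OF S(1)] by (auto simp: Pw_def)
  moreover have "un S \<in> elts C" if "C \<in> M" "cl C" for C
  proof -
    have "elts S \<subseteq> elts C" using S(2) that unfolding T(2) by blast
    with that S show ?thesis unfolding cl_def by blast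
  qed
  ultimately show ?thesis unfolding T(2) by blast
qed

lemma T_induct [consumes 1, case_names dfn step union]:
  assumes Z: "Z \<in> elts T" and d: "dfn {} (\<lambda>e. Q (e 0))"
    and 1: "\<And>Z. Z \<in> elts T \<Longrightarrow> Q Z \<Longrightarrow> Q (phi Z)"
    and 2: "\<And>S. S \<in> M \<Longrightarrow> elts S \<subseteq> elts T \<Longrightarrow> (\<And>Z. Z \<in> elts S \<Longrightarrow> Q Z) \<Longrightarrow> Q (un S)"
  shows "Q Z"
proof -
  have i: "isset {Z \<in> elts T. Q Z}" by (intro isset_sep isset_elts T(1) d)
  have "cl (mk {Z \<in> elts T. Q Z})"
    unfolding cl_def mk(2)[OF i]
  proof (intro conjI ballI impI)
    fix Z assume "Z \<in> {Z \<in> elts T. Q Z}"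
    then show "elts Z \<subseteq> elts a" "phi Z \<in> {Z \<in> elts T. Q Z}" using T_sub T_phi 1 by blast+
  next
    fix S assume "S \<in> M" "elts S \<subseteq> {Z \<in> elts T. Q Z}"
    then show "un S \<in> {Z \<in> elts T. Q Z}" using T_un 2 by blast
  qed
  then have "Z \<in> elts (mk {Z \<in> elts T. Q Z})" using Z mk(1)[OF i] unfolding T(2) by blast
  then show ?thesis unfolding mk(2)[OF i] by blast
qed

text \<open>The extreme points of the Bourbaki-Witt argument; they turn out to be all stages, which
  makes the stages a chain.\<close>

definition extr :: "'a \<Rightarrow> bool" where
  "extr c \<longleftrightarrow> (\<forall>Y\<in>elts T. elts Y \<subseteq> elts c \<longrightarrow> Y = c \<or> elts (phi Y) \<subseteq> elts c)"

lemma extr_lin: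
  assumes c: "c \<in> elts T" "extr c" and Y: "Y \<in> elts T"
  shows "elts Y \<subseteq> elts c \<or> elts (phi c) \<subseteq> elts Y"
  using Y
proof (induction Y rule: T_induct)
  case dfn show ?case by (intro df T_M c)
next
  case (step Y)
  show ?case
  proof (cases "elts Y \<subseteq> elts c")
    case True
    then have "Y = c \<or> elts (phi Y) \<subseteq> elts c" using c step unfolding extr_def by blast
    then show ?thesis by blast
  next
    case False
    then show ?thesis using step(2) by (simp add: phi(2)[OF T_M[OF step(1)]] le_supI1)
  qed
next
  case (union S)
  have "elts (un S) \<subseteq> elts c" if "\<forall>Y\<in>elts S. elts Y \<subseteq> elts c"
    unfolding un(2)[OF union(1)] by (rule UN_least) (use that in blast)
  moreover have "elts (phi c) \<subseteq> elts (un S)" if "Y \<in> elts S" "elts (phi c) \<subseteq> elts Y" for Y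
    unfolding un(2)[OF union(1)] using that(2) UN_upper[OF that(1), of elts] by (rule order_trans)
  ultimately show ?case using union(3) by metis
qed

lemma extr_all: "c \<in> elts T \<Longrightarrow> extr c"
proof (induction c rule: T_induct)
  case dfn show ?case unfolding extr_def by (intro df T)
next
  case (step c)
  show ?case
    unfolding extr_def
  proof (intro ballI impI)
    fix Y assume Y: "Y \<in> elts T" "elts Y \<subseteq> elts (phi c)"
    have cs: "elts c \<subseteq> elts (phi c)" using phi(2)[OF T_M[OF step(1)]] by blast
    from extr_lin[OF step Y(1)] show "Y = phi c \<or> elts (phi Y) \<subseteq> elts (phi c)"
    proof
      assume "elts Y \<subseteq> elts c"
      then have "Y = c \<or> elts (phi Y) \<subseteq> elts c" using step Y unfolding extr_def by blast
      with cs show ?thesis by blast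
    next
      assume "elts (phi c) \<subseteq> elts Y"
      then have "Y = phi c" using Y T_M[OF T_phi[OF step(1)]] T_M by (intro extn) auto
      then show ?thesis ..
    qed
  qed
next
  case (union S)
  show ?case
    unfolding extr_def
  proof (intro ballI impI)
    fix Y assume Y: "Y \<in> elts T" "elts Y \<subseteq> elts (un S)"
    note uS = un[OF union(1)]
    show "Y = un S \<or> elts (phi Y) \<subseteq> elts (un S)"
    proof (cases "elts (un S) \<subseteq> elts Y")
      case True
      then show ?thesis using Y T_M uS extn by blast
    next
      case False
      then obtain c where c: "c \<in> elts S" "\<not> elts c \<subseteq> elts Y" unfolding uS(2) by blast
      then have cT: "c \<in> elts T" "extr c" using union by blast+
      have "elts c \<subseteq> elts (phi c)" using phi(2)[OF T_M[OF cT(1)]] by blast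
      then have "elts Y \<subseteq> elts c" using extr_lin[OF cT Y(1)] c by blast
      then have "elts (phi Y) \<subseteq> elts c" using cT Y(1) c unfolding extr_def by blast
      then show ?thesis unfolding uS(2) using c by blast
    qed
  qed
qed

lemma T_lin: "c \<in> elts T \<Longrightarrow> Y \<in> elts T \<Longrightarrow> elts Y \<subseteq> elts c \<or> elts (phi c) \<subseteq> elts Y"
  using extr_lin extr_all by blast

lemma T_lin': "c \<in> elts T \<Longrightarrow> Y \<in> elts T \<Longrightarrow> elts Y \<subseteq> elts c \<or> elts c \<subseteq> elts Y"
  using T_lin phi(2)[OF T_M] by blast

definition W :: 'a where "W = un T"

lemma W_T: "W \<in> elts T" unfolding W_def by (intro T_un T order_refl)

lemma W_M [df]: "W \<in> M" by (intro T_M W_T)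

lemma W_a: "elts W \<subseteq> elts a" by (intro T_sub W_T)

lemma T_W: "Z \<in> elts T \<Longrightarrow> elts Z \<subseteq> elts W" unfolding W_def un(2)[OF T(1)] by blast

text \<open>The union of all stages is itself a stage, and the step applied to it yields a stage
  again.\<close>

lemma W_closed: "r \<in> elts a \<Longrightarrow> pr r W \<in> elts qr \<Longrightarrow> r \<in> elts W"
  using T_W[OF T_phi[OF W_T]] phi(2)[OF W_M] by blast

text \<open>The last stage without \<open>r\<close>. This replaces ordinal ranks: for elements of
  \<open>W\<close>, \<open>x \<in> elts (Ur r)\<close> means that \<open>x\<close> enters strictly
  before \<open>r\<close>.\<close>

definition Ur :: "'a \<Rightarrow> 'a" where "Ur r = un (mk {Z \<in> elts T. r \<notin> elts Z})"

lemma isset_Ur: "r \<in> M \<Longrightarrow> isset {Z \<in> elts T. r \<notin> elts Z}"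
  by (intro isset_sep isset_elts T(1) df)

lemma Ur_T: "r \<in> M \<Longrightarrow> Ur r \<in> elts T"
  unfolding Ur_def by (intro T_un mk(1) isset_Ur; (simp only: mk(2)[OF isset_Ur])?) auto

lemma Ur_iff: "r \<in> M \<Longrightarrow> x \<in> elts (Ur r) \<longleftrightarrow> (\<exists>Z\<in>elts T. r \<notin> elts Z \<and> x \<in> elts Z)"
proof -
  assume r: "r \<in> M"
  have "elts (Ur r) = (\<Union>Z\<in>{Z \<in> elts T. r \<notin> elts Z}. elts Z)"
    unfolding Ur_def un(2)[OF mk(1)[OF isset_Ur[OF r]]] mk(2)[OF isset_Ur[OF r]] ..
  then show ?thesis by blast
qed

lemma tm_Ur0: "tm C (\<lambda>e. Ur (e 0))"
proof (rule tmI[where S="\<lambda>v e. elts v = {x \<in> M. \<exists>Z\<in>elts T. e 0 \<notin> elts Z \<and> x \<in> elts Z}"], goal_cases)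
  case (1 e) then show ?case by (intro T_M Ur_T envD)
next
  case (2 e v)
  have e: "e 0 \<in> M" using 2 by (intro envD)
  have "elts (Ur (e 0)) = {x \<in> M. \<exists>Z\<in>elts T. e 0 \<notin> elts Z \<and> x \<in> elts Z}"
    using Ur_iff[OF e] elts_M by blast
  then show ?case using extn[of v "Ur (e 0)"] 2 T_M[OF Ur_T[OF e]] by auto
next
  case 3 show ?case by (intro df T)
qed

lemmas tm_Ur [df] = tm_inst1[where F=Ur, OF tm_Ur0]

lemma Ur_self: "r \<in> M \<Longrightarrow> r \<notin> elts (Ur r)"
  using Ur_iff by blast

lemma Ur_sub: "x \<in> M \<Longrightarrow> y \<in> M \<Longrightarrow> y \<notin> elts (Ur x) \<Longrightarrow> elts (Ur x) \<subseteq> elts (Ur y)"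
  using Ur_iff Ur_T by blast

lemma Ur_less: "x \<in> M \<Longrightarrow> y \<in> M \<Longrightarrow> x \<in> elts (Ur y) \<Longrightarrow> elts (Ur x) \<subseteq> elts (Ur y)"
  using T_lin'[OF Ur_T Ur_T] Ur_self by blast

lemma Ur_le_less: "x \<in> M \<Longrightarrow> y \<in> M \<Longrightarrow> z \<in> M \<Longrightarrow> y \<notin> elts (Ur x) \<Longrightarrow> y \<in> elts (Ur z) \<Longrightarrow> x \<in> elts (Ur z)"
  using Ur_sub[of x y] Ur_sub[of z x] Ur_self by blast

text \<open>Otherwise the last stage without \<open>r\<close> would be closed under the step, the
  tower would stop there, and \<open>r\<close> would never enter.\<close>

lemma Ur_qr:
  assumes r: "r \<in> elts W" shows "pr r (Ur r) \<in> elts qr"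
proof (rule ccontr)
  assume no: "\<not> ?thesis"
  have rM: "r \<in> M" using r elts_M by blast
  have UM: "Ur r \<in> M" by (intro T_M Ur_T rM)
  have "r \<notin> elts (phi (Ur r))" using phi(2)[OF UM] no Ur_self[OF rM] by blast
  then have s: "elts (phi (Ur r)) \<subseteq> elts (Ur r)" using Ur_iff[OF rM] T_phi[OF Ur_T[OF rM]] by blast
  have "elts Y \<subseteq> elts (Ur r)" if "Y \<in> elts T" for Y
    using that
  proof (induction Y rule: T_induct)
    case dfn show ?case by (intro df UM)
  next
    case (step Y)
    then have "Y = Ur r \<or> elts (phi Y) \<subseteq> elts (Ur r)" using extr_all[OF Ur_T[OF rM]] unfolding extr_def by blast
    with s show ?case by blast
  next
    case (union S)
    show ?case unfolding un(2)[OF union(1)] by (rule UN_least) (rule union(3))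
  qed
  with W_T r Ur_self[OF rM] show False by blast
qed

end

context forcing
begin

lemma rv_ext: "isreal R \<Longrightarrow> isreal R' \<Longrightarrow> (\<And>n. n \<in> Om \<Longrightarrow> rv R n = rv R' n) \<Longrightarrow> rv R = rv R'"
  by (rule ext) (simp add: rv_def)

section \<open>The tower game\<close>

definition lex :: "'a \<Rightarrow> 'a \<Rightarrow> 'a \<Rightarrow> 'a \<Rightarrow> bool" where
  "lex n' i' n i \<longleftrightarrow> n' \<in> elts n \<or> (n' = n \<and> i' \<in> elts i)"

lemma df_lex [df]: "tm C t1 \<Longrightarrow> tm C t2 \<Longrightarrow> tm C t3 \<Longrightarrow> tm C t4 \<Longrightarrow> dfn C (\<lambda>e. lex (t1 e) (t2 e) (t3 e) (t4 e))"
  unfolding lex_def by (intro df)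

end

text \<open>In the game below each player produces elements of a tower \<open>W\<close>, indexed
  lexicographically by pairs of naturals. The move with index \<open>(n, i)\<close> of a run consists of the
  code of a pair \<open>(x, q)\<close> of a strategy and a condition, and of two naturals.\<close>

locale tower_game = forcing +
  fixes N0 :: 'a and cd Hh :: "'a \<Rightarrow> 'a \<Rightarrow> bool"
  assumes N0 [df]: "N0 \<in> M"
    and cd_df: "dfn G (\<lambda>e. cd (e 0) (e (Suc 0)))"
    and cd_fun: "\<And>b b' y y'. isreal b \<Longrightarrow> isreal b' \<Longrightarrow> rv b = rv b' \<Longrightarrow> y \<in> M \<Longrightarrow> y' \<in> M \<Longrightarrow> cd b y \<Longrightarrow> cd b' y' \<Longrightarrow> y = y'"
    and cd_onto: "\<And>x q. x \<in> elts N0 \<Longrightarrow> q \<in> Pc \<Longrightarrow> \<exists>b. isreal b \<and> cd b (pr x q)"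
    and Hh_df: "dfn G (\<lambda>e. Hh (e 0) (e (Suc 0)))"
    and Hh_ex: "\<And>A. isreal A \<Longrightarrow> \<exists>x\<in>elts N0. Hh x A"
    and Hh_fun: "\<And>A A' x. x \<in> elts N0 \<Longrightarrow> isreal A \<Longrightarrow> isreal A' \<Longrightarrow> Hh x A \<Longrightarrow> Hh x A' \<Longrightarrow> rv A = rv A'"
begin

text \<open>\<open>Hh\<close> makes the ground model set \<open>N0\<close> represent strategies of
  the extension: a partial map from \<open>N0\<close> onto them. \<open>cd\<close> lets reals code
  pairs of a representative and a condition, so that such pairs can be played. Both may depend on
  \<open>G\<close>.\<close>

lemmas df_cd [df] = inst2[where S=cd, OF cd_df]
lemmas df_Hh [df] = inst2[where S=Hh, OF Hh_df]

text \<open>\<open>J\<close> splits the half of the run that belongs to player \<open>s\<close> into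
  one real for each index \<open>(n, i)\<close>: entries 0 and 1 are the two naturals, the rest is
  the code \<open>b\<close>. A move is thus complete only in the limit, and closure under a strategy
  is a statement about whole runs.\<close>

definition mv :: "bool \<Rightarrow> 'a \<Rightarrow> 'a \<Rightarrow> 'a \<Rightarrow> 'a \<Rightarrow> bool" where
  "mv s R n i r \<longleftrightarrow> (\<exists>b\<in>M. \<exists>y\<in>M. isreal b \<and> (\<forall>c\<in>Om. rv b c = rv R (DD s (J (J n i) (suc (suc c))))) \<and> cd b y \<and>
     r = pr y (pr (rv R (DD s (J (J n i) emp))) (rv R (DD s (J (J n i) (suc emp))))))"

lemma df_mv0: "dfn G (\<lambda>e. mv s (e 0) (e (Suc 0)) (e (Suc (Suc 0))) (e (Suc (Suc (Suc 0)))))"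
  unfolding mv_def by (intro df)
lemmas df_mv [df] = inst4[where S="mv s" for s, OF df_mv0]

lemma mv_cong: "rv R = rv R' \<Longrightarrow> mv s R = mv s R'"
  unfolding mv_def by (intro ext) simp

lemma mv_fun: "mv s R n i r \<Longrightarrow> mv s R n i r' \<Longrightarrow> r = r'"
proof -
  assume "mv s R n i r" "mv s R n i r'"
  then obtain b y b' y' where *: "y \<in> M" "y' \<in> M" "isreal b" "isreal b'" "cd b y" "cd b' y'"
    "\<forall>c\<in>Om. rv b c = rv R (DD s (J (J n i) (suc (suc c))))" "\<forall>c\<in>Om. rv b' c = rv R (DD s (J (J n i) (suc (suc c))))"
    and r: "r = pr y (pr (rv R (DD s (J (J n i) emp))) (rv R (DD s (J (J n i) (suc emp)))))"
    "r' = pr y' (pr (rv R (DD s (J (J n i) emp))) (rv R (DD s (J (J n i) (suc emp)))))"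
    unfolding mv_def by (elim bexE conjE)
  have "rv b = rv b'" by (rule rv_ext) (use * in auto)
  then have "y = y'" using cd_fun * by blast
  with r show ?thesis by simp
qed

text \<open>Supplies the opponent's moves in both runs of \<open>no_winner\<close>: one fixed pair
  \<open>y\<close> everywhere, with naturals \<open>n\<close> and \<open>sh n i\<close> at index
  \<open>(n, i)\<close>.\<close>

lemma mv_play:
  assumes b: "isreal b" "cd b y" "y \<in> M"
    and d: "dfn G (\<lambda>e. S (e 0) (e (Suc 0)) (e (Suc (Suc 0))))"
    and S: "\<And>n i m. n \<in> Om \<Longrightarrow> i \<in> Om \<Longrightarrow> S n i m \<longleftrightarrow> m = sh n i" "\<And>n i. n \<in> Om \<Longrightarrow> i \<in> Om \<Longrightarrow> sh n i \<in> Om"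
  shows "\<exists>Y. isreal Y \<and> (\<forall>R s. (\<forall>k\<in>Om. rv R (DD s k) = rv Y k) \<longrightarrow>
     (\<forall>n\<in>Om. \<forall>i\<in>Om. mv s R n i (pr y (pr n (sh n i)))))"
proof -
  note dS = inst3[where S=S, OF d]
  define Q where "Q k m \<longleftrightarrow> (\<exists>n\<in>Om. \<exists>i\<in>Om. k = J (J n i) emp \<and> m = n) \<or>
     (\<exists>n\<in>Om. \<exists>i\<in>Om. k = J (J n i) (suc emp) \<and> S n i m) \<or>
     (\<exists>n\<in>Om. \<exists>i\<in>Om. \<exists>c\<in>Om. k = J (J n i) (suc (suc c)) \<and> m = rv b c) \<or>
     ((\<forall>n\<in>Om. \<forall>i\<in>Om. \<forall>c\<in>Om. k \<noteq> J (J n i) c) \<and> m = emp)" for k m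
  have dQ: "dfn G (\<lambda>e. Q (e 0) (e (Suc 0)))"
    unfolding Q_def by (intro df dS isreal_M[OF b(1)])
  have Q0: "Q (J (J n i) emp) m \<longleftrightarrow> m = n" if "n \<in> Om" "i \<in> Om" for n i m
    unfolding Q_def using that Om_M by (auto simp: suc_ne)
  have Q1: "Q (J (J n i) (suc emp)) m \<longleftrightarrow> m = sh n i" if "n \<in> Om" "i \<in> Om" for n i m
    unfolding Q_def using that Om_M S(1)[OF that] by (auto simp: suc_ne)
  have Q2: "Q (J (J n i) (suc (suc c))) m \<longleftrightarrow> m = rv b c" if "n \<in> Om" "i \<in> Om" "c \<in> Om" for n i c m
    unfolding Q_def using that Om_M by (auto simp: suc_ne)
  have "\<exists>Y. isreal Y \<and> (\<forall>k\<in>Om. Q k (rv Y k))"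
  proof (rule real_ex[OF dQ])
    fix k assume k: "k \<in> Om"
    show "\<exists>m. m \<in> Om \<and> Q k m \<and> (\<forall>m'. m' \<in> Om \<and> Q k m' \<longrightarrow> m' = m)"
    proof (cases "\<exists>n\<in>Om. \<exists>i\<in>Om. \<exists>c\<in>Om. k = J (J n i) c")
      case True
      then obtain n i c where c: "n \<in> Om" "i \<in> Om" "c \<in> Om" "k = J (J n i) c" by blast
      consider "c = emp" | "c = suc emp" | d where "d \<in> Om" "c = suc (suc d)"
        using Om_cases[OF c(3)] Om_cases by metis
      then have "\<exists>m\<in>Om. \<forall>m'. Q k m' \<longleftrightarrow> m' = m"
        using Q0[OF c(1,2)] Q1[OF c(1,2)] Q2[OF c(1,2)] S(2)[OF c(1,2)] rv(1)[OF b(1)] c by cases metis+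
      then show ?thesis by metis
    next
      case False
      have "k \<noteq> J (J n i) c" if "n \<in> Om" "i \<in> Om" "c \<in> Om" for n i c using False that by blast
      then have "Q k m \<longleftrightarrow> m = emp" for m unfolding Q_def by auto
      then show ?thesis using emp_Om by metis
    qed
  qed
  then obtain Y where Y: "isreal Y" "\<forall>k\<in>Om. Q k (rv Y k)" by blast
  have Y0: "rv Y (J (J n i) emp) = n" "rv Y (J (J n i) (suc emp)) = sh n i" if "n \<in> Om" "i \<in> Om" for n i
    using Y(2) Q0[OF that, THEN iffD1] Q1[OF that, THEN iffD1] that by auto
  have Y2: "rv Y (J (J n i) (suc (suc c))) = rv b c" if "n \<in> Om" "i \<in> Om" "c \<in> Om" for n i c
    using Y(2) Q2[OF that, THEN iffD1] that by auto
  have "mv s R n i (pr y (pr n (sh n i)))" if R: "\<forall>k\<in>Om. rv R (DD s k) = rv Y k" and "n \<in> Om" "i \<in> Om" for R s n i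
    unfolding mv_def using isreal_M[OF b(1)] b R Y0[OF that(2,3)] Y2[OF that(2,3)] that
    by (intro bexI[of _ b] bexI[of _ y]) simp_all
  with Y(1) show ?thesis by blast
qed

text \<open>With \<open>suc i\<close> the lexicographic bound is weak: the move at
  \<open>(n, i)\<close> has to stay in \<open>Z\<close> only if the opponent's move at the same
  index does so, too.\<close>

definition CC :: "bool \<Rightarrow> 'a \<Rightarrow> 'a \<Rightarrow> bool" where
  "CC s R Z \<longleftrightarrow> (\<forall>n\<in>Om. \<forall>i\<in>Om. (\<forall>n'\<in>Om. \<forall>i'\<in>Om. lex n' i' n (suc i) \<longrightarrow> (\<exists>r\<in>elts Z. mv (\<not> s) R n' i' r)) \<longrightarrow>
     (\<exists>r\<in>elts Z. mv s R n i r))"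

definition Cl :: "'a \<Rightarrow> 'a \<Rightarrow> bool" where
  "Cl x Z \<longleftrightarrow> (\<forall>A\<in>M. \<forall>R\<in>M. isreal A \<longrightarrow> isreal R \<longrightarrow> Hh x A \<longrightarrow>
     (rv A emp = emp \<longrightarrow> fol0 A R \<longrightarrow> CC False R Z) \<and> (rv A emp \<noteq> emp \<longrightarrow> fol1 A R \<longrightarrow> CC True R Z))"

lemma ClI:
  "(\<And>A R. isreal A \<Longrightarrow> isreal R \<Longrightarrow> Hh x A \<Longrightarrow> fol (rv A emp \<noteq> emp) A R \<Longrightarrow> CC (rv A emp \<noteq> emp) R Z) \<Longrightarrow> Cl x Z"
  unfolding Cl_def fol_def by (smt (verit, best))

lemma ClD:
  "Cl x Z \<Longrightarrow> isreal A \<Longrightarrow> isreal R \<Longrightarrow> Hh x A \<Longrightarrow> fol (rv A emp \<noteq> emp) A R \<Longrightarrow> CC (rv A emp \<noteq> emp) R Z"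
  unfolding Cl_def fol_def using isreal_M by (cases "rv A emp = emp") auto

lemma df_CC0: "dfn G (\<lambda>e. CC s (e 0) (e (Suc 0)))" unfolding CC_def by (intro df)
lemmas df_CC [df] = inst2[where S="CC s" for s, OF df_CC0]

lemma df_Cl0: "dfn G (\<lambda>e. Cl (e 0) (e (Suc 0)))" unfolding Cl_def by (intro df)

end

text \<open>\<open>Cl x Z\<close> says that \<open>Z\<close> is closed under the strategy \<open>x\<close>, and \<open>F q x Z\<close> that \<open>q\<close> forces this.\<close>

locale tower_play = tower_game + tower +
  fixes F :: "'a \<Rightarrow> 'a \<Rightarrow> 'a \<Rightarrow> bool"
  assumes a_elts: "elts a = prd (prd (elts N0) Pc) (prd Om Om)"
    and F: "\<And>x Z. x \<in> M \<Longrightarrow> Z \<in> M \<Longrightarrow> Cl x Z \<longleftrightarrow> (\<exists>p\<in>G. F p x Z)"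
    and qr_iff: "\<And>x q n i Z. x \<in> elts N0 \<Longrightarrow> q \<in> Pc \<Longrightarrow> n \<in> Om \<Longrightarrow> i \<in> Om \<Longrightarrow> Z \<in> M \<Longrightarrow> elts Z \<subseteq> elts a \<Longrightarrow>
      pr (pr (pr x q) (pr n i)) Z \<in> elts qr \<longleftrightarrow>
      F q x Z \<and> (\<forall>n'\<in>Om. \<forall>i'\<in>Om. lex n' i' n i \<longrightarrow> pr (pr x q) (pr n' i') \<in> elts Z)"
begin

text \<open>Both comparisons of entry times are weak, so \<open>c n\<close> may be the opponent's
  own move at index \<open>(n, 1)\<close>.\<close>

definition Jc :: "'a \<Rightarrow> bool" where
  "Jc R \<longleftrightarrow> (\<exists>c\<in>M. \<forall>n\<in>Om. ap c n \<in> elts W \<and>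
     (\<forall>r\<in>M. mv False R n emp r \<or> mv True R n emp r \<longrightarrow> ap c n \<notin> elts (Ur r)) \<and>
     (\<exists>r\<in>M. (mv False R n (suc emp) r \<or> mv True R n (suc emp) r) \<and> r \<notin> elts (Ur (ap c n))))"

definition Lg :: "bool \<Rightarrow> 'a \<Rightarrow> 'a \<Rightarrow> 'a \<Rightarrow> bool" where
  "Lg s R n i \<longleftrightarrow> (\<exists>r\<in>elts W. mv s R n i r)"

lemma df_Lg0: "dfn G (\<lambda>e. Lg s (e 0) (e (Suc 0)) (e (Suc (Suc 0))))" unfolding Lg_def by (intro df)
lemmas df_Lg [df] = inst3[where S="Lg s" for s, OF df_Lg0]

text \<open>If both players leave the tower first at the same index, player II wins. This agrees
  with \<open>CC\<close>, which binds a move only as long as the opponent is inside up to and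
  including that index.\<close>

definition pay :: "'a \<Rightarrow> bool" where
  "pay R \<longleftrightarrow> (\<exists>n\<in>Om. \<exists>i\<in>Om. \<not> Lg True R n i \<and> (\<forall>n'\<in>Om. \<forall>i'\<in>Om. lex n' i' n (suc i) \<longrightarrow> Lg False R n' i')) \<or>
     ((\<forall>n\<in>Om. \<forall>i\<in>Om. Lg True R n i \<and> Lg False R n i) \<and> Jc R)"

lemma df_pay: "dfn G (\<lambda>e. pay (e 0))" unfolding pay_def Jc_def by (intro df)

lemma pay_cong: assumes "rv R = rv R'" shows "pay R = pay R'"
  unfolding pay_def Jc_def Lg_def mv_cong[OF assms] ..

text \<open>Leaving \<open>W\<close> while the opponent is still inside loses at once for player II.
  Player I could then win only through an offence of player II at an earlier index, which the
  hypothesis of \<open>CC\<close> excludes.\<close>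

lemma CC_W:
  assumes p: "pay R \<longleftrightarrow> \<not> s" shows "CC s R W"
proof -
  have "Lg s R n i" if n: "n \<in> Om" "i \<in> Om" and L: "\<And>n' i'. n' \<in> Om \<Longrightarrow> i' \<in> Om \<Longrightarrow> lex n' i' n (suc i) \<Longrightarrow> Lg (\<not> s) R n' i'" for n i
  proof (rule ccontr)
    assume nL: "\<not> Lg s R n i"
    show False
    proof (cases s)
      case True
      have "pay R" unfolding pay_def
        by (rule disjI1, intro bexI[of _ n] bexI[of _ i] n conjI) (use nL L True in auto)
      with p True show False by blast
    next
      case False
      then have sF: "s = False" by simp
      obtain m k where m: "m \<in> Om" "k \<in> Om" "\<not> Lg True R m k"
        and mk: "\<forall>n'\<in>Om. \<forall>i'\<in>Om. lex n' i' m (suc k) \<longrightarrow> Lg False R n' i'"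
        using p nL n unfolding pay_def sF by blast
      have "\<not> lex n i m (suc k)" using mk n nL unfolding sF by blast
      moreover have "\<not> lex m k n (suc i)" using L m unfolding sF by auto
      ultimately have "m = n" "\<not> i \<in> elts (suc k)" "\<not> k \<in> elts (suc i)"
        using Om_linear n m unfolding lex_def by metis+
      then show False using Om_linear[OF n(2)] m(2) elts_suc[OF Om_M[OF n(2)]] elts_suc[OF Om_M[OF m(2)]] by auto
    qed
  qed
  then show ?thesis unfolding CC_def Lg_def by blast
qed

lemma no_winner:
  assumes AD: "X.AD" and z: "isreal z" "\<And>n. n \<in> Om \<Longrightarrow> rv z n = emp \<or> rv z n = suc emp"
    and new: "\<not> (\<exists>x. mreal x \<and> (\<forall>n\<in>Om. ap x n = rv z n))"
  shows False
proof -
  have "\<exists>A. isreal A \<and> ((rv A emp = emp \<and> (\<forall>R. isreal R \<longrightarrow> fol0 A R \<longrightarrow> pay R)) \<or>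
     (rv A emp \<noteq> emp \<and> (\<forall>R. isreal R \<longrightarrow> fol1 A R \<longrightarrow> \<not> pay R)))"
    by (rule AD_names[OF AD df_pay]) (use pay_cong rv_ext in metis)
  then obtain A where A: "isreal A" "(rv A emp = emp \<and> (\<forall>R. isreal R \<longrightarrow> fol0 A R \<longrightarrow> pay R)) \<or>
     (rv A emp \<noteq> emp \<and> (\<forall>R. isreal R \<longrightarrow> fol1 A R \<longrightarrow> \<not> pay R))"
    by (elim exE conjE)
  define s where "s \<longleftrightarrow> rv A emp \<noteq> emp"
  have win: "pay R \<longleftrightarrow> \<not> s" if "isreal R" "fol s A R" for R
    using A(2) that unfolding s_def fol_def by auto
  obtain x where x: "x \<in> elts N0" "Hh x A" using Hh_ex A(1) by blast
  have xM: "x \<in> M" using x elts_M by blast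
  \<comment> \<open>Every strategy represented by \<open>x\<close> has the same values as
    \<open>A\<close>, so all its runs are won by the same player.\<close>
  have "Cl x W"
  proof (rule ClI)
    fix A' R assume *: "isreal A'" "isreal R" "Hh x A'" "fol (rv A' emp \<noteq> emp) A' R"
    have e: "rv A' = rv A" using Hh_fun x A(1) * by blast
    have "fol s A R" using * fol_cong[OF e] unfolding s_def e by blast
    then have "CC s R W" using CC_W win * by blast
    then show "CC (rv A' emp \<noteq> emp) R W" unfolding s_def e .
  qed
  then obtain q where q: "q \<in> G" "F q x W" using F[OF xM W_M] by blast
  have qP: "q \<in> Pc" using q GP by blast
  have qM: "q \<in> M" using qP Pc_M by blast
  define g where "g n i = pr (pr x q) (pr n i)" for n i
  have tg [df]: "tm C t1 \<Longrightarrow> tm C t2 \<Longrightarrow> tm C (\<lambda>e. g (t1 e) (t2 e))" for C t1 t2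
    unfolding g_def by (intro df xM qM)
  have gM: "g n i \<in> M" if "n \<in> Om" "i \<in> Om" for n i unfolding g_def using that by (intro pr_M xM qM Om_M)
  have ga: "g n i \<in> elts a" if "n \<in> Om" "i \<in> Om" for n i
    unfolding g_def a_elts using that x qP by (auto simp: prd_def)
  have gW: "g n i \<in> elts W" if n: "n \<in> Om" "i \<in> Om" for n i
  proof (rule ccontr)
    assume "\<not> ?thesis"
    then have "\<exists>i\<in>Om. g n i \<notin> elts W" using n by blast
    \<comment> \<open>The least \<open>m\<close>, and then the least \<open>l\<close> for it, give a
      lexicographically least quadruple outside \<open>W\<close>. Its predecessors are in
      \<open>W\<close>, so the step admits it.\<close>
    then have "\<exists>m\<in>Om. (\<exists>i\<in>Om. g m i \<notin> elts W) \<and> (\<forall>m'\<in>elts m. \<not> (\<exists>i\<in>Om. g m' i \<notin> elts W))"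
      by (rule Om_least[OF n(1)]) (intro df)
    then obtain m k where m: "m \<in> Om" "k \<in> Om" "g m k \<notin> elts W" "\<forall>m'\<in>elts m. \<forall>i\<in>Om. g m' i \<in> elts W" by blast
    have "\<exists>l\<in>Om. g m l \<notin> elts W \<and> (\<forall>l'\<in>elts l. \<not> (g m l' \<notin> elts W))"
      by (rule Om_least[where Q="\<lambda>l. g m l \<notin> elts W", OF m(2,3)]) (intro df Om_M m)
    then obtain l where l: "l \<in> Om" "g m l \<notin> elts W" "\<forall>l'\<in>elts l. g m l' \<in> elts W" by blast
    have "pr (g m l) W \<in> elts qr"
      unfolding g_def qr_iff[OF x(1) qP m(1) l(1) W_M W_a]
      using q(2) m(4) l(3) unfolding g_def lex_def by blast
    then show False using W_closed ga[OF m(1) l(1)] l(2) by blast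
  qed
  define U where "U n i = Ur (g n i)" for n i
  have UM: "U n i \<in> M" if "n \<in> Om" "i \<in> Om" for n i
    unfolding U_def by (intro T_M Ur_T gM that)
  have U: "F q x (U n i)" "\<And>n' i'. n' \<in> Om \<Longrightarrow> i' \<in> Om \<Longrightarrow> lex n' i' n i \<Longrightarrow> g n' i' \<in> elts (U n i)"
    if n: "n \<in> Om" "i \<in> Om" for n i
  proof -
    have "pr (g n i) (U n i) \<in> elts qr" unfolding U_def by (intro Ur_qr gW n)
    then have "F q x (U n i) \<and> (\<forall>n'\<in>Om. \<forall>i'\<in>Om. lex n' i' n i \<longrightarrow> g n' i' \<in> elts (U n i))"
      unfolding g_def using qr_iff[OF x(1) qP n UM[OF n]] T_sub[OF Ur_T[OF gM[OF n]]] unfolding U_def by blast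
    then show "F q x (U n i)" "\<And>n' i'. n' \<in> Om \<Longrightarrow> i' \<in> Om \<Longrightarrow> lex n' i' n i \<Longrightarrow> g n' i' \<in> elts (U n i)" by blast+
  qed
  have CU: "CC s R (U n i)" if "n \<in> Om" "i \<in> Om" "isreal R" "fol s A R" for R n i
  proof -
    have "Cl x (U n i)" using F[OF xM UM[OF that(1,2)]] q(1) U(1)[OF that(1,2)] by blast
    then show ?thesis using ClD[OF _ A(1) that(3) x(2)] that(4) unfolding s_def by blast
  qed
  obtain b where b: "isreal b" "cd b (pr x q)" using cd_onto x(1) qP by blast
  have play: "\<exists>R. isreal R \<and> fol s A R \<and> (\<forall>n\<in>Om. \<forall>i\<in>Om. mv (\<not> s) R n i (g n (sh n i)))"
    if d: "dfn G (\<lambda>e. S (e 0) (e (Suc 0)) (e (Suc (Suc 0))))"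
    and S: "\<And>n i m. n \<in> Om \<Longrightarrow> i \<in> Om \<Longrightarrow> S n i m \<longleftrightarrow> m = sh n i" "\<And>n i. n \<in> Om \<Longrightarrow> i \<in> Om \<Longrightarrow> sh n i \<in> Om" for S sh
  proof -
    have "\<exists>Y. isreal Y \<and> (\<forall>R s. (\<forall>k\<in>Om. rv R (DD s k) = rv Y k) \<longrightarrow>
      (\<forall>n\<in>Om. \<forall>i\<in>Om. mv s R n i (pr (pr x q) (pr n (sh n i)))))"
      by (rule mv_play[OF b pr_M[OF xM qM] d]) (use S in auto)
    then obtain Y where Y: "isreal Y" "\<And>R s. \<forall>k\<in>Om. rv R (DD s k) = rv Y k \<Longrightarrow>
      \<forall>n\<in>Om. \<forall>i\<in>Om. mv s R n i (g n (sh n i))" unfolding g_def by blast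
    obtain R where "isreal R" "fol s A R" "\<forall>k\<in>Om. rv R (DD (\<not> s) k) = rv Y k"
      using play_real[OF A(1) Y(1)] by blast
    with Y(2) show ?thesis by blast
  qed
  have legal: "Lg True R n i \<and> Lg False R n i" if R: "isreal R" "fol s A R" "\<forall>n\<in>Om. \<forall>i\<in>Om. mv (\<not> s) R n i (g n (sh n i))"
    and sh: "\<And>n i. n \<in> Om \<Longrightarrow> i \<in> Om \<Longrightarrow> sh n i \<in> Om" and n: "n \<in> Om" "i \<in> Om" for R sh n i
  proof -
    have 1: "Lg (\<not> s) R n' i'" if "n' \<in> Om" "i' \<in> Om" for n' i' unfolding Lg_def using R(3) gW sh that by blast
    moreover have "Lg s R n i" using CC_W[OF win[OF R(1,2)]] 1 n unfolding CC_def Lg_def by blast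
    ultimately show ?thesis using n by (cases s) auto
  qed
  have pJ: "pay R \<longleftrightarrow> Jc R" if R: "isreal R" "fol s A R" "\<forall>n\<in>Om. \<forall>i\<in>Om. mv (\<not> s) R n i (g n (sh n i))"
    and sh: "\<And>n i. n \<in> Om \<Longrightarrow> i \<in> Om \<Longrightarrow> sh n i \<in> Om" for R sh
    unfolding pay_def using legal[OF R sh] by blast
  have both: "(mv False R n i r \<or> mv True R n i r) \<longleftrightarrow> (mv s R n i r \<or> mv (\<not> s) R n i r)" for R n i r
    by (cases s) auto
  \<comment> \<open>If the opponent's shifted indices up to \<open>i\<close> stay below
    \<open>m\<close>, all moves of the opponent up to \<open>(n, i)\<close> enter before
    \<open>g n m\<close>. The stage \<open>U n m\<close> is closed under the strategy, so it
    contains the answer at \<open>(n, i)\<close>, too.\<close>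
  have below: "\<exists>r\<in>elts (U n m). mv s R n i r" if R: "isreal R" "fol s A R" "\<forall>n\<in>Om. \<forall>i\<in>Om. mv (\<not> s) R n i (g n (sh n i))"
    and sh: "\<And>n i. n \<in> Om \<Longrightarrow> i \<in> Om \<Longrightarrow> sh n i \<in> Om" and n: "n \<in> Om" "i \<in> Om" "m \<in> Om"
    and lt: "\<And>i'. i' \<in> elts (suc i) \<Longrightarrow> sh n i' \<in> elts m" for R sh n i m
  proof -
    have "\<exists>r\<in>elts (U n m). mv (\<not> s) R n' i' r" if "n' \<in> Om" "i' \<in> Om" "lex n' i' n (suc i)" for n' i'
    proof -
      have "lex n' (sh n' i') n m" using that lt unfolding lex_def by blast
      then show ?thesis using U(2)[OF n(1,3) that(1) sh[OF that(1,2)]] R(3) that by blast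
    qed
    then show ?thesis using CU[OF n(1,3) R(1,2)] n unfolding CC_def by blast
  qed
  note Om_M [simp]
  \<comment> \<open>The number 3 exceeds the indices 0 and 1 that the pay-off inspects: unshifted
    moves with these indices enter before \<open>g n 3\<close>, whereas the shifted move with index
    0 is \<open>g n 3\<close> itself.\<close>
  let ?h = "suc (suc (suc emp))"
  have yes: "\<exists>R. isreal R \<and> fol s A R \<and> pay R"
  proof -
    have "\<exists>R. isreal R \<and> fol s A R \<and> (\<forall>n\<in>Om. \<forall>i\<in>Om. mv (\<not> s) R n i (g n i))"
      by (rule play[where S="\<lambda>n i m. m = i"]) (auto intro!: df)
    then obtain R where R: "isreal R" "fol s A R" "\<forall>n\<in>Om. \<forall>i\<in>Om. mv (\<not> s) R n i (g n i)" by blast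
    have "\<exists>c\<in>M. maps c Om (elts W) \<and> (\<forall>n\<in>Om. ap c n = g n (suc emp))"
      by (rule maps_ex[OF isset_elts[OF w(1)] isset_elts[OF W_M]]) (auto intro!: df gW)
    then obtain c where c: "c \<in> M" "\<forall>n\<in>Om. ap c n = g n (suc emp)" by blast
    have "Jc R"
      unfolding Jc_def both
    proof (rule bexI[OF _ c(1)], intro ballI conjI impI)
      fix n assume n: "n \<in> Om"
      have cn: "ap c n = g n (suc emp)" using c(2) n by blast
      show "ap c n \<in> elts W" unfolding cn by (intro gW n) simp
      { fix r assume r: "r \<in> M" "mv s R n emp r \<or> mv (\<not> s) R n emp r"
        obtain r' where r': "r' \<in> elts (U n (suc emp))" "mv s R n emp r'"
          using below[OF R, of n emp "suc emp"] n by auto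
        have g0: "g n emp \<in> elts (U n (suc emp))" using U(2)[of n "suc emp" n emp] n by (auto simp: lex_def)
        have "r \<in> elts (U n (suc emp))"
          using r(2) r' g0 R(3) mv_fun n emp_Om by metis
        then show "ap c n \<notin> elts (Ur r)"
          unfolding cn U_def using Ur_less[of r "g n (suc emp)"] Ur_self[of "g n (suc emp)"] gM[of n "suc emp"] n r(1) by auto }
      show "\<exists>r\<in>M. (mv s R n (suc emp) r \<or> mv (\<not> s) R n (suc emp) r) \<and> r \<notin> elts (Ur (ap c n))"
        using R(3) n Ur_self[OF gM[OF n suc_Om[OF emp_Om]]] gM[OF n suc_Om[OF emp_Om]] suc_Om[OF emp_Om] unfolding cn by blast
    qed
    then have "pay R" using pJ[of R "\<lambda>n i. i"] R by blast
    with R show ?thesis by blast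
  qed
  have no: "\<exists>R. isreal R \<and> fol s A R \<and> \<not> pay R"
  proof -
    define sh where "sh n i = (if rv z n = emp then i else suc (suc (suc i)))" for n i
    have sh: "sh n i \<in> Om" if "n \<in> Om" "i \<in> Om" for n i using that by (simp add: sh_def)
    define S where "S n i m \<longleftrightarrow> (rv z n = emp \<and> m = i) \<or> (rv z n \<noteq> emp \<and> m = suc (suc (suc i)))" for n i m
    have dS: "dfn G (\<lambda>e. S (e 0) (e (Suc 0)) (e (Suc (Suc 0))))" unfolding S_def by (intro df isreal_M[OF z(1)])
    have "\<exists>R. isreal R \<and> fol s A R \<and> (\<forall>n\<in>Om. \<forall>i\<in>Om. mv (\<not> s) R n i (g n (sh n i)))"
      by (rule play[where S=S, OF dS]) (auto simp: sh_def S_def)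
    then obtain R where R: "isreal R" "fol s A R" "\<forall>n\<in>Om. \<forall>i\<in>Om. mv (\<not> s) R n i (g n (sh n i))" by blast
    have "\<not> Jc R"
    proof
      assume "Jc R"
      then obtain c where c: "c \<in> M" "\<And>n. n \<in> Om \<Longrightarrow> ap c n \<in> elts W"
        "\<And>n r. n \<in> Om \<Longrightarrow> r \<in> M \<Longrightarrow> mv s R n emp r \<or> mv (\<not> s) R n emp r \<Longrightarrow> ap c n \<notin> elts (Ur r)"
        "\<And>n. n \<in> Om \<Longrightarrow> \<exists>r\<in>M. (mv s R n (suc emp) r \<or> mv (\<not> s) R n (suc emp) r) \<and> r \<notin> elts (Ur (ap c n))"
        unfolding Jc_def both by blast
      have 0: "ap c n \<in> elts (Ur (g n ?h))" if n: "n \<in> Om" "rv z n = emp" for n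
      proof -
        obtain r where r: "r \<in> M" "mv s R n (suc emp) r \<or> mv (\<not> s) R n (suc emp) r" "r \<notin> elts (Ur (ap c n))"
          using c(4) n by blast
        obtain r' where r': "r' \<in> elts (U n ?h)" "mv s R n (suc emp) r'"
          using below[OF R sh, of n "suc emp" ?h] n by (auto simp: sh_def)
        have g1: "g n (suc emp) \<in> elts (U n ?h)" using U(2)[of n ?h n "suc emp"] n by (auto simp: lex_def)
        have "mv (\<not> s) R n (suc emp) (g n (suc emp))" using R(3) n by (auto simp: sh_def)
        then have "r \<in> elts (Ur (g n ?h))" using r(2) r' g1 mv_fun unfolding U_def by metis
        then show ?thesis using Ur_le_less[of "ap c n" r "g n ?h"] r gM[of n ?h] n by auto
      qed
      have 1: "ap c n \<notin> elts (Ur (g n ?h))" if n: "n \<in> Om" "rv z n \<noteq> emp" for n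
      proof -
        have "mv (\<not> s) R n emp (g n ?h)" using R(3) n by (auto simp: sh_def)
        then show ?thesis using c(3) gM[of n ?h] n by auto
      qed
      have "\<exists>y. mreal y \<and> (\<forall>n\<in>Om. (ap c n \<in> elts (Ur (g n ?h)) \<and> ap y n = emp) \<or>
        (ap c n \<notin> elts (Ur (g n ?h)) \<and> ap y n = suc emp))"
      proof (rule mreal_ex)
        show "dfn {} (\<lambda>e. (ap c (e 0) \<in> elts (Ur (g (e 0) ?h)) \<and> e (Suc 0) = emp) \<or>
          (ap c (e 0) \<notin> elts (Ur (g (e 0) ?h)) \<and> e (Suc 0) = suc emp))" by (intro df c(1))
      qed (metis emp_Om suc_Om)
      then obtain y where y: "mreal y" "\<forall>n\<in>Om. (ap c n \<in> elts (Ur (g n ?h)) \<and> ap y n = emp) \<or>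
        (ap c n \<notin> elts (Ur (g n ?h)) \<and> ap y n = suc emp)" by blast
      have "ap y n = rv z n" if "n \<in> Om" for n using 0 1 z(2) y(2) that by metis
      with y(1) new show False by blast
    qed
    then have "\<not> pay R" using pJ[OF R sh] by blast
    with R show ?thesis by blast
  qed
  from yes no win show False by blast
qed

end

context tower_game
begin

text \<open>By the truth lemma, that \<open>q\<close> forces \<open>Z\<close> to be closed under
  \<open>x\<close> is definable in the ground model; hence the step relation \<open>qr\<close> is a
  set there and the tower can be built.\<close>

lemma no_new_real:
  assumes AD: "X.AD" and z: "isreal z" "\<And>n. n \<in> Om \<Longrightarrow> rv z n = emp \<or> rv z n = suc emp"
    and new: "\<not> (\<exists>x. mreal x \<and> (\<forall>n\<in>Om. ap x n = rv z n))"
  shows False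
proof -
  obtain F where F: "dfn {} (\<lambda>e. F (e 0) (e (Suc 0)) (e (Suc (Suc 0))))"
    "\<And>x Z. x \<in> M \<Longrightarrow> Z \<in> M \<Longrightarrow> Cl x Z \<longleftrightarrow> (\<exists>p\<in>G. F p x Z)"
    using truth2[of Cl, OF df_Cl0] by (metis (no_types, lifting))
  note dF = inst3[where S=F, OF F(1)]
  have ia: "isset (prd (prd (elts N0) Pc) (prd Om Om))"
    by (intro isset_prd isset_elts PL w N0)
  define a where "a = mk (prd (prd (elts N0) Pc) (prd Om Om))"
  have a: "a \<in> M" "elts a = prd (prd (elts N0) Pc) (prd Om Om)" unfolding a_def by (rule mk[OF ia])+
  define Q where "Q u \<longleftrightarrow> (\<exists>x\<in>M. \<exists>q\<in>M. \<exists>n\<in>M. \<exists>i\<in>M. \<exists>Z\<in>M. u = pr (pr (pr x q) (pr n i)) Z \<and>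
      F q x Z \<and> (\<forall>n'\<in>Om. \<forall>i'\<in>Om. lex n' i' n i \<longrightarrow> pr (pr x q) (pr n' i') \<in> elts Z))" for u
  have iq: "isset {u \<in> prd (elts a) (Pw (elts a)). Q u}"
    unfolding Q_def by (intro isset_sep isset_prd isset_Pw isset_elts a) (intro df dF)
  define qr where "qr = mk {u \<in> prd (elts a) (Pw (elts a)). Q u}"
  have qr: "qr \<in> M" "elts qr = {u \<in> prd (elts a) (Pw (elts a)). Q u}" unfolding qr_def by (rule mk[OF iq])+
  interpret tower_play M E P L G N0 cd Hh a qr F
  proof (unfold_locales, goal_cases)
    case (5 x q n i Z)
    have M: "x \<in> M" "q \<in> M" "n \<in> M" "i \<in> M" using 5 elts_M Pc_M Om_M by blast+
    have "pr (pr x q) (pr n i) \<in> elts a" unfolding a(2) using 5 by (auto simp: prd_def)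
    then have "pr (pr (pr x q) (pr n i)) Z \<in> prd (elts a) (Pw (elts a))"
      using 5 unfolding prd_def Pw_def by blast
    moreover have "Q (pr (pr (pr x q) (pr n i)) Z) \<longleftrightarrow>
      F q x Z \<and> (\<forall>n'\<in>Om. \<forall>i'\<in>Om. lex n' i' n i \<longrightarrow> pr (pr x q) (pr n' i') \<in> elts Z)"
      unfolding Q_def using M 5(5) by (auto simp: pr_M)
    ultimately show ?case unfolding qr(2) by blast
  qed (use a qr F(2) in blast)+
  show False using no_winner[OF AD z new] .
qed

end

context forcing
begin

section \<open>Davis' game\<close>

text \<open>Runs of the extension whose moves are determined by the past coincide. The induction
  uses \<open>ind_G\<close>, since the runs are given by names only.\<close>

lemma run_eq:
  assumes R: "isreal R" "isreal R'"
    and S: "\<And>n. n \<in> Om \<Longrightarrow> hr R n = hr R' n \<Longrightarrow> (\<And>m. m \<in> elts n \<Longrightarrow> rv R m = rv R' m) \<Longrightarrow> rv R n = rv R' n"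
  shows "rv R = rv R'"
proof (rule rv_ext[OF R])
  have *: "\<forall>m\<in>elts n. rv R m = rv R' m" if "n \<in> Om" for n
    using ind_G that
  proof (induction n rule: ind_induct)
    case dfn show ?case by (intro df isreal_M R)
  next
    case zero show ?case by simp
  next
    case (suc n)
    then have "rv R n = rv R' n" using S[OF suc(1)] hr_cong[OF R suc(1)] by blast
    with suc show ?case using Om_M by simp
  qed
  fix n assume n: "n \<in> Om"
  show "rv R n = rv R' n" using *[OF suc_Om[OF n]] Om_M[OF n] by simp
qed

lemma hr_suc: "isreal R \<Longrightarrow> n \<in> Om \<Longrightarrow> hr R (suc n) = sn (hr R n) (rv R n)"
proof (rule hr_eq)
  assume R: "isreal R" and n: "n \<in> Om"
  note s = sn[OF hr(1)[OF R n] rv(1)[OF R n]]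
  show "fsq (suc n) (sn (hr R n) (rv R n))" by (rule s)
  fix k assume "k \<in> elts (suc n)"
  then show "ap (sn (hr R n) (rv R n)) k = rv R k"
    using s(2) s(3)[of k] hr(2)[OF R n, of k] Om_M[OF n] by auto
qed

lemma real_bin_ex:
  assumes d: "dfn G (\<lambda>e. Q (e 0))"
  shows "\<exists>R. isreal R \<and> (\<forall>k\<in>Om. (Q k \<and> rv R k = suc emp) \<or> (\<not> Q k \<and> rv R k = emp))"
proof -
  note dQ = inst1[where S=Q, OF d]
  show ?thesis
    by (rule real_ex) ((intro df dQ), metis emp_Om suc_Om)
qed

lemma mreal_bin_ex:
  assumes d: "dfn {} (\<lambda>e. Q (e 0))"
  shows "\<exists>x. mreal x \<and> (\<forall>k\<in>Om. (Q k \<and> ap x k = suc emp) \<or> (\<not> Q k \<and> ap x k = emp))"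
proof -
  note dQ = inst1[where S=Q, OF d]
  show ?thesis
    by (rule mreal_ex) ((intro df dQ), metis emp_Om suc_Om)
qed

section \<open>Binary reals and the rules of the game\<close>

definition bin :: "'a \<Rightarrow> bool" where
  "bin x \<longleftrightarrow> mreal x \<and> (\<forall>n\<in>Om. ap x n = emp \<or> ap x n = suc emp)"

lemma df_bin0: "dfn C (\<lambda>e. bin (e 0))" unfolding bin_def by (intro df)
lemmas df_bin [df] = inst1[where S=bin, OF df_bin0]

lemma bin_M: "bin x \<Longrightarrow> x \<in> M" using mreal_M by (simp add: bin_def)

text \<open>Players move arbitrary naturals; the digit meant by \<open>b\<close> is whether it is
  nonzero.\<close>

definition bt :: "'a \<Rightarrow> 'a \<Rightarrow> bool" where
  "bt b d \<longleftrightarrow> (b = emp \<and> d = emp) \<or> (b \<noteq> emp \<and> d = suc emp)"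

text \<open>\<open>c\<close> is the move of player I, \<open>b\<close> the reply of player II and
  \<open>d\<close> the digit that results.\<close>

definition Out :: "'a \<Rightarrow> 'a \<Rightarrow> 'a \<Rightarrow> bool" where
  "Out c b d \<longleftrightarrow> (c = emp \<and> d = emp) \<or> (c = suc emp \<and> d = suc emp) \<or> (\<exists>k\<in>Om. c = suc (suc k) \<and> bt b d)"

lemma df_bt [df]: "tm C t1 \<Longrightarrow> tm C t2 \<Longrightarrow> dfn C (\<lambda>e. bt (t1 e) (t2 e))"
  by (rule inst2[where S=bt]) (unfold bt_def, intro df)+
lemma df_Out [df]: "tm C t1 \<Longrightarrow> tm C t2 \<Longrightarrow> tm C t3 \<Longrightarrow> dfn C (\<lambda>e. Out (t1 e) (t2 e) (t3 e))"
  by (rule inst3[where S=Out]) (unfold Out_def, intro df)+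

lemma bt_fun: "bt b d \<Longrightarrow> bt b d' \<Longrightarrow> d = d'"
  unfolding bt_def by metis

lemma Out_fun: "Out c b d \<Longrightarrow> Out c b d' \<Longrightarrow> d = d'"
  unfolding Out_def using bt_fun Om_M by (metis emp_Om suc_M suc_inj suc_ne(1))

text \<open>Davis' game: player I builds a binary real \<open>x\<close> digit by digit, either choosing the digit or,
  with the move \<open>k + 2\<close>, letting player II choose it in answer to the question \<open>k\<close>. Player I wins
  if \<open>x\<close> lies in the ground model and all questions are asked.\<close>

definition Dv :: "'a \<Rightarrow> bool" where
  "Dv R \<longleftrightarrow> (\<exists>x\<in>M. bin x \<and> (\<forall>i\<in>Om. Out (rv R (D0 i)) (rv R (D1 i)) (ap x i)) \<and>
     (\<forall>k\<in>Om. \<exists>i\<in>Om. rv R (D0 i) = suc (suc k)))"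

lemma df_Dv: "dfn G (\<lambda>e. Dv (e 0))" unfolding Dv_def by (intro df)

text \<open>Player I follows \<open>A\<close>, player II answers question \<open>k\<close> by
  \<open>y k\<close> and replies 0 to a direct digit; \<open>x\<close> records the answers. For a
  winning \<open>A\<close>, each binary real \<open>y\<close> of the extension is thus related to a
  real \<open>x\<close> of the ground model.\<close>

definition Hrel :: "'a \<Rightarrow> 'a \<Rightarrow> 'a \<Rightarrow> bool" where
  "Hrel A x y \<longleftrightarrow> bin x \<and> isreal y \<and> (\<exists>R\<in>M. isreal R \<and> fol0 A R \<and>
     (\<forall>i\<in>Om. ((rv R (D0 i) = emp \<or> rv R (D0 i) = suc emp) \<and> rv R (D1 i) = emp) \<or>
       (\<exists>k\<in>Om. rv R (D0 i) = suc (suc k) \<and> rv R (D1 i) = rv y k \<and> rv y k = ap x i)) \<and>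
     (\<forall>k\<in>Om. \<exists>i\<in>Om. rv R (D0 i) = suc (suc k)))"

lemma df_Hrel0: "dfn G (\<lambda>e. Hrel (e 0) (e (Suc 0)) (e (Suc (Suc 0))))" unfolding Hrel_def by (intro df)
lemmas df_Hrel [df] = inst3[where S=Hrel, OF df_Hrel0]

text \<open>The run can be rebuilt from \<open>x\<close>: the moves of player I come from
  \<open>A\<close>, the answers to questions are digits of \<open>x\<close>. As every question is
  asked, all of \<open>y\<close> is recovered.\<close>

lemma Hrel_fun:
  assumes "Hrel A x y" "Hrel A x y'" shows "rv y = rv y'"
proof -
  obtain R where R: "isreal y" "isreal R" "fol0 A R"
    "\<And>i. i \<in> Om \<Longrightarrow> ((rv R (D0 i) = emp \<or> rv R (D0 i) = suc emp) \<and> rv R (D1 i) = emp) \<or>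
       (\<exists>k\<in>Om. rv R (D0 i) = suc (suc k) \<and> rv R (D1 i) = rv y k \<and> rv y k = ap x i)"
    "\<And>k. k \<in> Om \<Longrightarrow> \<exists>i\<in>Om. rv R (D0 i) = suc (suc k)"
    using assms(1) unfolding Hrel_def by blast
  obtain R' where R': "isreal y'" "isreal R'" "fol0 A R'"
    "\<And>i. i \<in> Om \<Longrightarrow> ((rv R' (D0 i) = emp \<or> rv R' (D0 i) = suc emp) \<and> rv R' (D1 i) = emp) \<or>
       (\<exists>k\<in>Om. rv R' (D0 i) = suc (suc k) \<and> rv R' (D1 i) = rv y' k \<and> rv y' k = ap x i)"
    using assms(2) unfolding Hrel_def by blast
  have ne: "suc (suc k) \<noteq> emp" "suc (suc k) \<noteq> suc emp" if "k \<in> Om" for k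
    using Om_M[OF that] by simp_all
  have e: "rv R = rv R'"
  proof (rule run_eq[OF R(2) R'(2)])
    fix n assume n: "n \<in> Om" and h: "hr R n = hr R' n" and b: "\<And>m. m \<in> elts n \<Longrightarrow> rv R m = rv R' m"
    from D_cases[OF n] show "rv R n = rv R' n"
    proof (elim disjE bexE)
      fix i assume "i \<in> Om" "n = D0 i"
      then show ?thesis using R(3) R'(3) h unfolding fol0_def by simp
    next
      fix i assume i: "i \<in> Om" "n = D1 i"
      then have "rv R (D0 i) = rv R' (D0 i)" using b[of "D0 i"] by simp
      then show ?thesis unfolding i(2) using R(4)[OF i(1)] R'(4)[OF i(1)] ne by metis
    qed
  qed
  show ?thesis
  proof (rule rv_ext[OF R(1) R'(1)])
    fix k assume k: "k \<in> Om"
    obtain i where i: "i \<in> Om" "rv R (D0 i) = suc (suc k)" using R(5)[OF k] by blast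
    then show "rv y k = rv y' k"
      using R(4)[OF i(1)] R'(4)[OF i(1)] ne k unfolding e[symmetric] by (metis Om_M suc_M suc_inj)
  qed
qed

lemma Hrel_ex:
  assumes A: "isreal A" and win: "\<And>R. isreal R \<Longrightarrow> fol0 A R \<Longrightarrow> Dv R"
    and y: "isreal y" "\<And>k. k \<in> Om \<Longrightarrow> rv y k = emp \<or> rv y k = suc emp"
  shows "\<exists>x. Hrel A x y"
proof -
  define B where "B c m \<longleftrightarrow> (\<exists>k\<in>Om. c = suc (suc k) \<and> m = rv y k) \<or> ((\<forall>k\<in>Om. c \<noteq> suc (suc k)) \<and> m = emp)" for c m
  have dB: "dfn G (\<lambda>e. B (e 0) (e (Suc 0)))" unfolding B_def by (intro df isreal_M[OF y(1)])
  note dB' = inst2[where S=B, OF dB]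
  have B: "\<exists>m\<in>Om. \<forall>m'. B c m' \<longleftrightarrow> m' = m" for c
  proof (cases "\<exists>k\<in>Om. c = suc (suc k)")
    case True
    then obtain k where k: "k \<in> Om" "c = suc (suc k)" by blast
    then have "B c m \<longleftrightarrow> m = rv y k" for m unfolding B_def using Om_M by (metis suc_M suc_inj)
    then show ?thesis using rv(1)[OF y(1) k(1)] by blast
  next
    case False
    then have "B c m \<longleftrightarrow> m = emp" for m unfolding B_def by blast
    then show ?thesis using emp_Om by blast
  qed
  define Q where "Q t m \<longleftrightarrow> (\<exists>i\<in>Om. len t = D1 i \<and> B (ap t (D0 i)) m) \<or> ((\<forall>i\<in>Om. len t \<noteq> D1 i) \<and> m = emp)" for t m
  have dQ: "dfn G (\<lambda>e. Q (e 0) (e (Suc 0)))" unfolding Q_def by (intro df dB')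
  have Q1: "Q t m \<longleftrightarrow> B (ap t (D0 i)) m" if "i \<in> Om" "len t = D1 i" for t m i
    unfolding Q_def using that by (metis D0_inj suc_inj ap_M)
  have "\<exists>R. isreal R \<and> fol0 A R \<and> (\<forall>k\<in>Om. Q (hr R (D1 k)) (rv R (D1 k)))"
  proof (rule play0[OF A dQ])
    fix t
    show "\<exists>m. m \<in> Om \<and> Q t m \<and> (\<forall>m'. m' \<in> Om \<and> Q t m' \<longrightarrow> m' = m)"
    proof (cases "\<exists>i\<in>Om. len t = D1 i")
      case True
      then show ?thesis using Q1 B by metis
    next
      case False
      then have "Q t m \<longleftrightarrow> m = emp" for m unfolding Q_def by blast
      then show ?thesis using emp_Om by blast
    qed
  qed
  then obtain R where R: "isreal R" "fol0 A R" "\<forall>k\<in>Om. Q (hr R (D1 k)) (rv R (D1 k))" by blast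
  have RB: "B (rv R (D0 i)) (rv R (D1 i))" if i: "i \<in> Om" for i
  proof -
    note h = hr[OF R(1) D_Om(2)[OF i]]
    have "B (ap (hr R (D1 i)) (D0 i)) (rv R (D1 i))" using R(3) i Q1[OF i len[OF h(1)]] by blast
    then show ?thesis using h(2)[of "D0 i"] by simp
  qed
  obtain x where x: "bin x" "\<And>i. i \<in> Om \<Longrightarrow> Out (rv R (D0 i)) (rv R (D1 i)) (ap x i)"
    "\<forall>k\<in>Om. \<exists>i\<in>Om. rv R (D0 i) = suc (suc k)" using win[OF R(1,2)] unfolding Dv_def by blast
  have "((rv R (D0 i) = emp \<or> rv R (D0 i) = suc emp) \<and> rv R (D1 i) = emp) \<or>
       (\<exists>k\<in>Om. rv R (D0 i) = suc (suc k) \<and> rv R (D1 i) = rv y k \<and> rv y k = ap x i)" if i: "i \<in> Om" for i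
    using RB[OF i] x(2)[OF i] y(2)
  proof (unfold B_def, elim disjE bexE conjE, goal_cases)
    case (1 k)
    then have "bt (rv R (D1 i)) (ap x i)" unfolding Out_def using Om_M by (metis emp_Om suc_M suc_inj suc_ne(1))
    then have "rv y k = ap x i" unfolding bt_def using 1 by metis
    with 1 show ?case by blast
  next
    case 2 then show ?case unfolding Out_def by blast
  qed
  then have "Hrel A x y" unfolding Hrel_def using x y(1) R isreal_M[OF R(1)] by blast
  then show ?thesis by blast
qed

text \<open>\<open>x\<close> is blocked by question \<open>k\<close> from position \<open>t\<close>
  on: asking \<open>k\<close> at a later turn would always bring the wrong digit, so player I plays
  all further digits himself.\<close>

definition Bl :: "'a \<Rightarrow> 'a \<Rightarrow> 'a \<Rightarrow> 'a \<Rightarrow> bool" where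
  "Bl A t k x \<longleftrightarrow> bin x \<and> (\<exists>R\<in>M. isreal R \<and> fol1 A R \<and>
     (\<forall>i\<in>Om. Out (rv R (D0 i)) (rv R (D1 i)) (ap x i)) \<and>
     (\<exists>n\<in>Om. t = hr R n \<and> (\<forall>i\<in>Om. D0 i \<notin> elts n \<longrightarrow>
        rv R (D0 i) = ap x i \<and> \<not> bt (rv A (kap (sn (hr R (D0 i)) (suc (suc k))))) (ap x i))))"

lemma df_Bl0: "dfn G (\<lambda>e. Bl (e 0) (e (Suc 0)) (e (Suc (Suc 0))) (e (Suc (Suc (Suc 0)))))" unfolding Bl_def by (intro df)
lemmas df_Bl [df] = inst4[where S=Bl, OF df_Bl0]

text \<open>With only two digits, the next digit must be the opposite of the answer that
  \<open>A\<close> would give to \<open>k\<close>. So \<open>t\<close> and \<open>k\<close>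
  determine the run, and the run determines \<open>x\<close>.\<close>

lemma Bl_fun:
  assumes "Bl A t k x" "Bl A t k x'" shows "x = x'"
proof -
  obtain R n where R: "bin x" "isreal R" "fol1 A R"
    "\<And>i. i \<in> Om \<Longrightarrow> Out (rv R (D0 i)) (rv R (D1 i)) (ap x i)" "n \<in> Om" "t = hr R n"
    "\<And>i. i \<in> Om \<Longrightarrow> D0 i \<notin> elts n \<Longrightarrow>
        rv R (D0 i) = ap x i \<and> \<not> bt (rv A (kap (sn (hr R (D0 i)) (suc (suc k))))) (ap x i)"
    using assms(1) unfolding Bl_def by blast
  obtain R' n' where R': "bin x'" "isreal R'" "fol1 A R'"
    "\<And>i. i \<in> Om \<Longrightarrow> Out (rv R' (D0 i)) (rv R' (D1 i)) (ap x' i)" "n' \<in> Om" "t = hr R' n'"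
    "\<And>i. i \<in> Om \<Longrightarrow> D0 i \<notin> elts n' \<Longrightarrow>
        rv R' (D0 i) = ap x' i \<and> \<not> bt (rv A (kap (sn (hr R' (D0 i)) (suc (suc k))))) (ap x' i)"
    using assms(2) unfolding Bl_def by blast
  note h = hr[OF R(2,5)] and h' = hr[OF R'(2,5)]
  have nn: "n' = n" using len[OF h(1)] len[OF h'(1)] R(6) R'(6) by simp
  have b: "ap x i = emp \<or> ap x i = suc emp" "ap x' i = emp \<or> ap x' i = suc emp" if "i \<in> Om" for i
    using R(1) R'(1) that unfolding bin_def by blast+
  have e: "rv R = rv R'"
  proof (rule run_eq[OF R(2) R'(2)])
    fix m assume m: "m \<in> Om" and hm: "hr R m = hr R' m"
    show "rv R m = rv R' m"
    proof (cases "m \<in> elts n")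
      case True
      then show ?thesis using h(2)[of m] h'(2)[of m] R(6) R'(6) nn by simp
    next
      case False
      from D_cases[OF m] show ?thesis
      proof (elim disjE bexE)
        fix i assume "i \<in> Om" "m = D1 i"
        then show ?thesis using R(3) R'(3) hm unfolding fol1_def by simp
      next
        fix i assume i: "i \<in> Om" "m = D0 i"
        have "\<not> bt (rv A (kap (sn (hr R m) (suc (suc k))))) (ap x i)" "rv R m = ap x i"
          "\<not> bt (rv A (kap (sn (hr R m) (suc (suc k))))) (ap x' i)" "rv R' m = ap x' i"
          using R(7)[OF i(1)] R'(7)[OF i(1)] False hm unfolding i(2) nn by auto
        then show ?thesis using b[OF i(1)] unfolding bt_def by metis
      qed
    qed
  qed
  show ?thesis
  proof (rule mreal_ext)
    fix i assume i: "i \<in> Om"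
    show "ap x i = ap x' i" using Out_fun[OF R(4)[OF i]] R'(4)[OF i] unfolding e by blast
  qed (use R(1) R'(1) in \<open>auto simp: bin_def\<close>)
qed

definition asked :: "'a \<Rightarrow> 'a \<Rightarrow> bool" where
  "asked t k \<longleftrightarrow> (\<exists>i\<in>Om. D0 i \<in> elts (len t) \<and> ap t (D0 i) = suc (suc k))"

definition nxt :: "'a \<Rightarrow> 'a \<Rightarrow> bool" where
  "nxt t k \<longleftrightarrow> \<not> asked t k \<and> (\<forall>k'\<in>elts k. asked t k')"

lemma df_nxt [df]: "tm C t1 \<Longrightarrow> tm C t2 \<Longrightarrow> dfn C (\<lambda>e. nxt (t1 e) (t2 e))"
  by (rule inst2[where S=nxt]) (unfold nxt_def asked_def, intro df)+

lemma nxt_fun: "k \<in> Om \<Longrightarrow> k' \<in> Om \<Longrightarrow> nxt t k \<Longrightarrow> nxt t k' \<Longrightarrow> k' = k"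
  using Om_linear[of k] unfolding nxt_def by blast

lemma asked_hr: "isreal R \<Longrightarrow> n \<in> Om \<Longrightarrow> asked (hr R n) k \<longleftrightarrow> (\<exists>i\<in>Om. D0 i \<in> elts n \<and> rv R (D0 i) = suc (suc k))"
  unfolding asked_def using len[OF hr(1)] hr(2) by auto

text \<open>To build \<open>x\<close> against a winning strategy, player I asks the least open question whenever the
  answer is the right digit. As not all questions get asked, some question \<open>k\<close> would from some
  position \<open>t\<close> on always be answered wrongly, and therefore \<open>t\<close> and \<open>k\<close> determine \<open>x\<close>.\<close>

lemma Bl_ex:
  assumes A: "isreal A" and win: "\<And>R. isreal R \<Longrightarrow> fol1 A R \<Longrightarrow> \<not> Dv R" and x: "bin x"
  shows "\<exists>t n k. fsq n t \<and> k \<in> Om \<and> Bl A t k x"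
proof (rule ccontr)
  assume no: "\<not> ?thesis"
  have xm: "mreal x" and xM: "x \<in> M" and xb: "\<And>i. i \<in> Om \<Longrightarrow> ap x i = emp \<or> ap x i = suc emp"
    using x mreal_M unfolding bin_def by blast+
  define good where "good t k d \<longleftrightarrow> nxt t k \<and> bt (rv A (kap (sn t (suc (suc k))))) d" for t k d
  have dg: "dfn G (\<lambda>e. good (e 0) (e (Suc 0)) (e (Suc (Suc 0))))" unfolding good_def by (intro df isreal_M A)
  note dg' = inst3[where S=good, OF dg]
  have good_fun: "k' = k" if "k \<in> Om" "k' \<in> Om" "good t k d" "good t k' d" for t k k' d
    using that nxt_fun unfolding good_def by blast
  define Q1 where "Q1 t d m \<longleftrightarrow> (\<exists>k\<in>Om. m = suc (suc k) \<and> good t k d) \<or> ((\<forall>k\<in>Om. \<not> good t k d) \<and> m = d)" for t d m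
  have dQ1: "dfn G (\<lambda>e. Q1 (e 0) (e (Suc 0)) (e (Suc (Suc 0))))" unfolding Q1_def by (intro df dg')
  note dQ1' = inst3[where S=Q1, OF dQ1]
  have Q1: "\<exists>m\<in>Om. \<forall>m'. Q1 t d m' \<longleftrightarrow> m' = m" if "d \<in> Om" for t d
  proof (cases "\<exists>k\<in>Om. good t k d")
    case True
    then obtain k where k: "k \<in> Om" "good t k d" by blast
    then have "Q1 t d m \<longleftrightarrow> m = suc (suc k)" for m unfolding Q1_def using good_fun by blast
    then show ?thesis using k by (intro bexI[of _ "suc (suc k)"]) auto
  next
    case False
    then have "Q1 t d m \<longleftrightarrow> m = d" for m unfolding Q1_def by blast
    with that show ?thesis by blast
  qed
  define Q where "Q t m \<longleftrightarrow> (\<exists>i\<in>Om. len t = D0 i \<and> Q1 t (ap x i) m) \<or> ((\<forall>i\<in>Om. len t \<noteq> D0 i) \<and> m = emp)" for t m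
  have dQ: "dfn G (\<lambda>e. Q (e 0) (e (Suc 0)))" unfolding Q_def by (intro df dQ1' xM)
  have QQ1: "Q t m \<longleftrightarrow> Q1 t (ap x i) m" if "i \<in> Om" "len t = D0 i" for t m i
    unfolding Q_def using that by (metis D0_inj)
  have "\<exists>R. isreal R \<and> fol1 A R \<and> (\<forall>k\<in>Om. Q (hr R (D0 k)) (rv R (D0 k)))"
  proof (rule play1[OF A dQ])
    fix t
    show "\<exists>m. m \<in> Om \<and> Q t m \<and> (\<forall>m'. m' \<in> Om \<and> Q t m' \<longrightarrow> m' = m)"
    proof (cases "\<exists>i\<in>Om. len t = D0 i")
      case True
      then show ?thesis using QQ1 Q1 mreal_ap[OF xm] by metis
    next
      case False
      then have "Q t m \<longleftrightarrow> m = emp" for m unfolding Q_def by blast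
      then show ?thesis using emp_Om by blast
    qed
  qed
  then obtain R where R: "isreal R" "fol1 A R" "\<forall>k\<in>Om. Q (hr R (D0 k)) (rv R (D0 k))" by blast
  have mv: "(\<exists>k\<in>Om. rv R (D0 i) = suc (suc k) \<and> good (hr R (D0 i)) k (ap x i)) \<or>
    ((\<forall>k\<in>Om. \<not> good (hr R (D0 i)) k (ap x i)) \<and> rv R (D0 i) = ap x i)" if i: "i \<in> Om" for i
    using R(3) i QQ1[OF i len[OF hr(1)[OF R(1) D_Om(1)[OF i]]]] unfolding Q1_def by blast
  have out: "Out (rv R (D0 i)) (rv R (D1 i)) (ap x i)" if i: "i \<in> Om" for i
    using mv[OF i]
  proof (elim disjE bexE conjE)
    fix k assume k: "k \<in> Om" "rv R (D0 i) = suc (suc k)" "good (hr R (D0 i)) k (ap x i)"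
    have "rv R (D1 i) = rv A (kap (sn (hr R (D0 i)) (suc (suc k))))"
      using R(2) i hr_suc[OF R(1) D_Om(1)[OF i]] k(2) unfolding fol1_def by simp
    then show ?thesis using k unfolding Out_def good_def by auto
  next
    assume "rv R (D0 i) = ap x i"
    then show ?thesis using xb[OF i] unfolding Out_def by auto
  qed
  \<comment> \<open>The bound \<open>n\<close> must serve all questions below \<open>k\<close> at
    once, because it becomes the position from which \<open>k\<close> is blocked.\<close>
  have all: "\<exists>n\<in>Om. \<forall>k'\<in>elts k. \<exists>i\<in>Om. D0 i \<in> elts n \<and> rv R (D0 i) = suc (suc k')" if "k \<in> Om" for k
    using ind_G that
  proof (induction k rule: ind_induct)
    case dfn show ?case by (intro df isreal_M R)
  next
    case zero show ?case by (intro bexI[OF _ emp_Om]) simp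
  next
    case (suc k)
    then obtain n where n: "n \<in> Om" "\<And>k'. k' \<in> elts k \<Longrightarrow> \<exists>i\<in>Om. D0 i \<in> elts n \<and> rv R (D0 i) = suc (suc k')" by blast
    have "\<exists>i\<in>Om. rv R (D0 i) = suc (suc k)"
    proof (rule ccontr)
      assume nk: "\<not> ?thesis"
      have "rv R (D0 i) = ap x i \<and> \<not> bt (rv A (kap (sn (hr R (D0 i)) (suc (suc k))))) (ap x i)"
        if i: "i \<in> Om" "D0 i \<notin> elts n" for i
      proof -
        have sub: "m \<in> elts (D0 i)" if "m \<in> elts n" for m
          using Om_linear[OF n(1)] i Om_less_trans[OF D_Om(1)[OF i(1)]] that D_Om(1)[OF i(1)] by metis
        have nx: "nxt (hr R (D0 i)) k"
          unfolding nxt_def asked_hr[OF R(1) D_Om(1)[OF i(1)]] using nk n(2) sub by blast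
        have "\<not> (\<exists>k'\<in>Om. rv R (D0 i) = suc (suc k') \<and> good (hr R (D0 i)) k' (ap x i))"
          using nxt_fun[OF suc(1) _ nx] nk i(1) unfolding good_def by blast
        then show ?thesis using mv[OF i(1)] nx suc(1) unfolding good_def by blast
      qed
      then have "Bl A (hr R n) k x"
        unfolding Bl_def using x R isreal_M[OF R(1)] out n(1) by blast
      with no hr(1)[OF R(1) n(1)] suc(1) show False by blast
    qed
    then obtain j where j: "j \<in> Om" "rv R (D0 j) = suc (suc k)" by blast
    have kM: "elts (suc k) = insert k (elts k)" using Om_M[OF suc(1)] by simp
    show ?case
    proof (cases "D0 j \<in> elts n")
      case True
      then show ?thesis unfolding kM using n j by blast
    next
      case False
      have "m \<in> elts (D1 j)" if "m \<in> elts n" for m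
        using Om_linear[OF n(1)] False Om_less_trans[OF D_Om(1)[OF j(1)]] that D_Om(1)[OF j(1)]
        by (metis ap_M elts_suc insertI1 insertI2)
      moreover have "D0 j \<in> elts (D1 j)" by simp
      ultimately show ?thesis unfolding kM using n(2) j D_Om(2)[OF j(1)] by (intro bexI[of _ "D1 j"]) blast+
    qed
  qed
  have "\<exists>i\<in>Om. rv R (D0 i) = suc (suc k)" if k: "k \<in> Om" for k
    using all[OF suc_Om[OF k]] Om_M[OF k] by auto
  then have "Dv R" unfolding Dv_def using x xM out by blast
  with win R show False by blast
qed

end

context forcing_R
begin

text \<open>\<open>z\<close> codes \<open>r\<close> as the characteristic function of its graph.
  Davis' game handles binary reals only, and other reals pass through it in this form.\<close>

definition Gr :: "('a \<Rightarrow> 'a) \<Rightarrow> ('a \<Rightarrow> 'a) \<Rightarrow> bool" where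
  "Gr z r \<longleftrightarrow> (\<forall>n\<in>Om. \<forall>m\<in>Om. z (J n m) = suc emp \<longleftrightarrow> r n = m)"

lemma GrD: "Gr z r \<Longrightarrow> n \<in> Om \<Longrightarrow> m \<in> Om \<Longrightarrow> z (J n m) = suc emp \<longleftrightarrow> r n = m"
  unfolding Gr_def by simp

lemma Gr_fun: "Gr z r \<Longrightarrow> Gr z r' \<Longrightarrow> n \<in> Om \<Longrightarrow> r n \<in> Om \<Longrightarrow> r n = r' n"
  using GrD[of z r n "r n"] GrD[of z r' n "r n"] by simp

lemma Gr_cong: "(\<And>n. n \<in> Om \<Longrightarrow> z n = z' n) \<Longrightarrow> Gr z r \<longleftrightarrow> Gr z' r"
  unfolding Gr_def by (simp cong: ball_cong)

lemma Gr_real: assumes R: "isreal R"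
  shows "\<exists>z. isreal z \<and> (\<forall>k\<in>Om. rv z k = emp \<or> rv z k = suc emp) \<and> Gr (rv z) (rv R)"
proof -
  let ?Q = "\<lambda>k. \<exists>n\<in>Om. \<exists>m\<in>Om. k = J n m \<and> rv R n = m"
  have "dfn G (\<lambda>e. ?Q (e 0))" by (intro df isreal_M R)
  then obtain z where z: "isreal z" "\<And>k. k \<in> Om \<Longrightarrow> (?Q k \<and> rv z k = suc emp) \<or> (\<not> ?Q k \<and> rv z k = emp)"
    using real_bin_ex[of ?Q] by blast
  have "rv z (J n m) = suc emp \<longleftrightarrow> rv R n = m" if "n \<in> Om" "m \<in> Om" for n m
  proof -
    have "?Q (J n m) \<longleftrightarrow> rv R n = m" using that J_inj by metis
    then show ?thesis using z(2)[OF J_Om[OF that]] by (metis emp_Om Om_M suc_ne(1))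
  qed
  with z show ?thesis unfolding Gr_def by blast
qed

lemma Gr_mreal: assumes v: "mreal v"
  shows "\<exists>x. bin x \<and> Gr (ap x) (ap v)"
proof -
  let ?Q = "\<lambda>k. \<exists>n\<in>Om. \<exists>m\<in>Om. k = J n m \<and> ap v n = m"
  have "dfn {} (\<lambda>e. ?Q (e 0))" by (intro df mreal_M v)
  then obtain x where x: "mreal x" "\<And>k. k \<in> Om \<Longrightarrow> (?Q k \<and> ap x k = suc emp) \<or> (\<not> ?Q k \<and> ap x k = emp)"
    using mreal_bin_ex[of ?Q] by blast
  have "ap x (J n m) = suc emp \<longleftrightarrow> ap v n = m" if "n \<in> Om" "m \<in> Om" for n m
  proof -
    have "?Q (J n m) \<longleftrightarrow> ap v n = m" using that J_inj by metis
    then show ?thesis using x(2)[OF J_Om[OF that]] by (metis emp_Om Om_M suc_ne(1))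
  qed
  with x show ?thesis unfolding Gr_def bin_def by blast
qed

text \<open>A real can be read off the characteristic function of its graph inside the ground model,
  so the graph of a new real is new.\<close>

lemma new_bin:
  assumes AD: "X.AD"
  shows "\<exists>z. isreal z \<and> (\<forall>k\<in>Om. rv z k = emp \<or> rv z k = suc emp) \<and> \<not> (\<exists>x. mreal x \<and> (\<forall>n\<in>Om. ap x n = rv z n))"
proof -
  obtain R where R: "isreal R" "\<not> (\<exists>x. mreal x \<and> (\<forall>n\<in>Om. ap x n = rv R n))" using new_real[OF AD] by blast
  obtain z where z: "isreal z" "\<forall>k\<in>Om. rv z k = emp \<or> rv z k = suc emp" "Gr (rv z) (rv R)" using Gr_real[OF R(1)] by blast
  have "\<not> (\<exists>x. mreal x \<and> (\<forall>n\<in>Om. ap x n = rv z n))"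
  proof
    assume "\<exists>x. mreal x \<and> (\<forall>n\<in>Om. ap x n = rv z n)"
    then obtain x where x: "mreal x" "\<And>n. n \<in> Om \<Longrightarrow> ap x n = rv z n" by blast
    have g: "Gr (ap x) (rv R)" using z(3) Gr_cong[of "ap x" "rv z" "rv R"] x(2) by blast
    have "\<exists>y. mreal y \<and> (\<forall>n\<in>Om. ap x (J n (ap y n)) = suc emp)"
    proof (rule mreal_ex)
      show "dfn {} (\<lambda>e. ap x (J (e 0) (e (Suc 0))) = suc emp)" by (intro df mreal_M x)
      fix n assume n: "n \<in> Om"
      show "\<exists>m. m \<in> Om \<and> ap x (J n m) = suc emp \<and> (\<forall>m'. m' \<in> Om \<and> ap x (J n m') = suc emp \<longrightarrow> m' = m)"
        using GrD[OF g n] rv(1)[OF R(1) n] by (intro exI[of _ "rv R n"]) metis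
    qed
    then obtain y where y: "mreal y" "\<forall>n\<in>Om. ap x (J n (ap y n)) = suc emp" by blast
    have "ap y n = rv R n" if "n \<in> Om" for n
      using y(2) GrD[OF g that mreal_ap[OF y(1) that]] that by simp
    with y(1) R(2) show False by blast
  qed
  with z show ?thesis by blast
qed

text \<open>A partial map onto the conditions, defined in the ground model on its binary reals:
  decode the graph, then apply \<open>f\<close>.\<close>

definition Pq :: "'a \<Rightarrow> 'a \<Rightarrow> bool" where
  "Pq x q \<longleftrightarrow> bin x \<and> (\<exists>v\<in>M. mreal v \<and> Gr (ap x) (ap v) \<and> q = ap f v)"

lemma df_Pq0: "dfn C (\<lambda>e. Pq (e 0) (e (Suc 0)))" unfolding Pq_def Gr_def by (intro df)
lemmas df_Pq [df] = inst2[where S=Pq, OF df_Pq0]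

lemma Pq_fun: "Pq x q \<Longrightarrow> Pq x q' \<Longrightarrow> q = q'"
  unfolding Pq_def using Gr_fun mreal_ap mreal_ext by metis

lemma Pq_ex: "q \<in> Pc \<Longrightarrow> \<exists>x. Pq x q"
  unfolding Pq_def using f_onto[of q] Gr_mreal mreal_M by metis

text \<open>Strategies are represented by binary reals of the ground model through
  \<open>Hrel\<close>, followed by decoding a graph. A pair is coded by interleaving its first
  component with a real that \<open>f\<close> sends to the condition.\<close>

lemma davis_I:
  assumes AD: "X.AD" and A0: "isreal A0" and win: "\<And>R. isreal R \<Longrightarrow> fol0 A0 R \<Longrightarrow> Dv R"
  shows False
proof -
  have ib: "isset {x \<in> Pw (prd Om Om). bin x}" by (intro isset_sep isset_Pw isset_prd isset_elts w df)
  define N0 where "N0 = mk {x \<in> Pw (prd Om Om). bin x}"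
  have "{x \<in> Pw (prd Om Om). bin x} = {x. bin x}"
    unfolding bin_def mreal_def Pw_def prd_def maps_iff[OF OmM OmM] by blast
  then have N0: "N0 \<in> M" "elts N0 = {x. bin x}" unfolding N0_def using mk[OF ib] by simp_all
  define cd where "cd b y \<longleftrightarrow> (\<exists>x\<in>M. \<exists>v\<in>M. bin x \<and> mreal v \<and> y = pr x (ap f v) \<and>
    (\<forall>n\<in>Om. rv b (D0 n) = ap x n \<and> rv b (D1 n) = ap v n))" for b y
  define Hh where "Hh x A \<longleftrightarrow> isreal A \<and> (\<exists>y\<in>M. Hrel A0 x y \<and> Gr (rv y) (rv A))" for x A
  obtain z where z: "isreal z" "\<forall>k\<in>Om. rv z k = emp \<or> rv z k = suc emp" "\<not> (\<exists>x. mreal x \<and> (\<forall>n\<in>Om. ap x n = rv z n))"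
    using new_bin[OF AD] by blast
  interpret tower_game M E P L G N0 cd Hh
  proof (unfold_locales, goal_cases)
    case 1 show ?case by (rule N0)
  next
    case 2 show ?case unfolding cd_def by (intro df)
  next
    case (3 b b' y y')
    obtain x v where *: "bin x" "mreal v" "y = pr x (ap f v)" "\<forall>n\<in>Om. rv b (D0 n) = ap x n \<and> rv b (D1 n) = ap v n"
      using 3(6) unfolding cd_def by blast
    obtain x' v' where **: "bin x'" "mreal v'" "y' = pr x' (ap f v')" "\<forall>n\<in>Om. rv b' (D0 n) = ap x' n \<and> rv b' (D1 n) = ap v' n"
      using 3(7) unfolding cd_def by blast
    have "x = x'" by (rule mreal_ext) (use * ** 3(3) in \<open>auto simp: bin_def\<close>)
    moreover have "v = v'" by (rule mreal_ext) (use * ** 3(3) in auto)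
    ultimately show ?case using * ** by simp
  next
    case (4 x q)
    then have x: "bin x" "mreal x" "x \<in> M" using N0(2) mreal_M by (auto simp: bin_def)
    obtain v where v: "mreal v" "ap f v = q" using f_onto[OF 4(2)] by blast
    have "\<exists>b. isreal b \<and> (\<forall>k\<in>Om. \<exists>n\<in>Om. (k = D0 n \<and> rv b k = ap x n) \<or> (k = D1 n \<and> rv b k = ap v n))"
    proof (rule real_ex)
      show "dfn G (\<lambda>e. \<exists>n\<in>Om. (e 0 = D0 n \<and> e (Suc 0) = ap x n) \<or> (e 0 = D1 n \<and> e (Suc 0) = ap v n))"
        by (intro df x mreal_M v)
      fix k assume "k \<in> Om"
      from D_cases[OF this] show "\<exists>m. m \<in> Om \<and> (\<exists>n\<in>Om. (k = D0 n \<and> m = ap x n) \<or> (k = D1 n \<and> m = ap v n)) \<and>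
        (\<forall>m'. m' \<in> Om \<and> (\<exists>n\<in>Om. (k = D0 n \<and> m' = ap x n) \<or> (k = D1 n \<and> m' = ap v n)) \<longrightarrow> m' = m)"
      proof (elim disjE bexE)
        fix n assume n: "n \<in> Om" "k = D0 n"
        then show ?thesis using mreal_ap[OF x(2) n(1)] by (intro exI[of _ "ap x n"]) auto
      next
        fix n assume n: "n \<in> Om" "k = D1 n"
        then show ?thesis using mreal_ap[OF v(1) n(1)] by (intro exI[of _ "ap v n"]) auto
      qed
    qed
    then obtain b where b: "isreal b" "\<forall>k\<in>Om. \<exists>n\<in>Om. (k = D0 n \<and> rv b k = ap x n) \<or> (k = D1 n \<and> rv b k = ap v n)" by blast
    have "rv b (D0 n) = ap x n \<and> rv b (D1 n) = ap v n" if n: "n \<in> Om" for n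
      using b(2)[rule_format, OF D_Om(1)[OF n]] b(2)[rule_format, OF D_Om(2)[OF n]] n by auto
    then show ?case unfolding cd_def using b(1) x v mreal_M by blast
  next
    case 5 show ?case unfolding Hh_def Gr_def by (intro df isreal_M A0)
  next
    case (6 A)
    obtain y where y: "isreal y" "\<And>k. k \<in> Om \<Longrightarrow> rv y k = emp \<or> rv y k = suc emp" "Gr (rv y) (rv A)"
      using Gr_real[OF 6] by blast
    obtain x where x: "Hrel A0 x y" using Hrel_ex[OF A0 _ y(1)] win y(2) by blast
    then have "bin x" unfolding Hrel_def by blast
    then show ?case unfolding Hh_def N0(2) using x y 6 isreal_M by blast
  next
    case (7 A A' x)
    obtain y y' where y: "Hrel A0 x y" "Hrel A0 x y'" "Gr (rv y) (rv A)" "Gr (rv y') (rv A')"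
      using 7(4,5) unfolding Hh_def by blast
    show ?case
      by (rule rv_ext[OF 7(2,3)], rule Gr_fun[OF y(3)])
        (use y(4) Hrel_fun[OF y(1,2)] rv(1)[OF 7(2)] in auto)
  qed
  show False by (rule no_new_real[OF AD z(1) _ z(3)]) (use z(2) in blast)
qed

text \<open>Here \<open>Bl\<close> makes the binary reals of the ground model, and with them the conditions, countable in
  the extension. Hence a real can code a whole name in \<open>NR\<close>.\<close>

lemma davis_II:
  assumes AD: "X.AD" and A0: "isreal A0" and win: "\<And>R. isreal R \<Longrightarrow> fol1 A0 R \<Longrightarrow> \<not> Dv R"
  shows False
proof -
  \<comment> \<open>A partial enumeration of the conditions by natural numbers, definable with
    \<open>G\<close>: the number codes a position and a question, these determine a blocked real,
    and the real determines a condition.\<close>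
  define En where "En i q \<longleftrightarrow> (\<exists>t\<in>M. fsq (len t) t \<and> (\<exists>k\<in>Om. i = J (kap t) k \<and> (\<exists>x\<in>M. Bl A0 t k x \<and> Pq x q)))" for i q
  have dEn: "dfn G (\<lambda>e. En (e 0) (e (Suc 0)))" unfolding En_def by (intro df isreal_M A0)
  note dEn' = inst2[where S=En, OF dEn]
  have En_fun: "q = q'" if En: "En i q" "En i q'" for i q q'
  proof -
    obtain t k x where t: "fsq (len t) t" "k \<in> Om" "i = J (kap t) k" "Bl A0 t k x" "Pq x q"
      using En(1) unfolding En_def by blast
    obtain t' k' x' where t': "fsq (len t') t'" "k' \<in> Om" "i = J (kap t') k'" "Bl A0 t' k' x'" "Pq x' q'"
      using En(2) unfolding En_def by blast
    have "t = t'" "k = k'" using t(3) t'(3) J_inj kap_Om kap_inj t t' by metis+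
    then have "x = x'" using t t' Bl_fun by blast
    then show ?thesis using t t' Pq_fun by blast
  qed
  have En_ex: "\<exists>i\<in>Om. En i q" if q: "q \<in> Pc" for q
  proof -
    obtain x where x: "Pq x q" using Pq_ex[OF q] by blast
    then have b: "bin x" unfolding Pq_def by blast
    obtain t n k where t: "fsq n t" "k \<in> Om" "Bl A0 t k x" using Bl_ex[OF A0 _ b] win by blast
    have "fsq (len t) t" using t(1) len by simp
    then have "En (J (kap t) k) q"
      unfolding En_def using t x bin_M[OF b] fsqD(2)[OF t(1)]
      by (intro bexI[of _ t] bexI[of _ k] bexI[of _ x] conjI refl)
    moreover have "J (kap t) k \<in> Om" using t by (intro J_Om kap_Om)
    ultimately show ?thesis by blast
  qed
  define K where "K R i n m \<longleftrightarrow> (\<exists>q\<in>Pc. En i q \<and> pr q (pr n m) \<in> elts R)" for R i n m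
  have dK: "dfn G (\<lambda>e. K (e 0) (e (Suc 0)) (e (Suc (Suc 0))) (e (Suc (Suc (Suc 0)))))"
    unfolding K_def by (intro df dEn')
  note dK' = inst4[where S=K, OF dK]
  \<comment> \<open>The value at 0 is an index of \<open>q\<close>. As 0 is no value of
    \<open>J\<close>, the other arguments are free to record which triples belong to
    \<open>R\<close>.\<close>
  define cd where "cd b y \<longleftrightarrow> (\<exists>R\<in>elts NR. \<exists>q\<in>Pc. y = pr R q \<and> En (rv b emp) q \<and>
    (\<forall>i\<in>Om. \<forall>n\<in>Om. \<forall>m\<in>Om. rv b (J i (J n m)) = suc emp \<longleftrightarrow> K R i n m))" for b y
  \<comment> \<open>Strategies are represented by their own names, which form the ground model set
    \<open>NR\<close>.\<close>
  define Hh where "Hh R A \<longleftrightarrow> isreal R \<and> isreal A \<and> (\<forall>n\<in>Om. rv R n = rv A n)" for R A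
  obtain z where z: "isreal z" "\<forall>k\<in>Om. rv z k = emp \<or> rv z k = suc emp" "\<not> (\<exists>x. mreal x \<and> (\<forall>n\<in>Om. ap x n = rv z n))"
    using new_bin[OF AD] by blast
  \<comment> \<open>Every condition has an index, so the indexed description \<open>K\<close>
    determines the name \<open>R\<close>.\<close>
  have K_sub: "elts R \<subseteq> elts R'" if R: "R \<in> elts NR" and eq: "\<And>i n m. i \<in> Om \<Longrightarrow> n \<in> Om \<Longrightarrow> m \<in> Om \<Longrightarrow> K R i n m \<longleftrightarrow> K R' i n m" for R R'
  proof
    fix u assume u: "u \<in> elts R"
    then obtain q n m where q: "q \<in> Pc" "n \<in> Om" "m \<in> Om" "u = pr q (pr n m)"
      using R unfolding NR(2) prd_def by blast
    obtain i where i: "i \<in> Om" "En i q" using En_ex[OF q(1)] by blast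
    have "K R i n m" unfolding K_def using u q i by blast
    then have "K R' i n m" using eq i q by blast
    then show "u \<in> elts R'" unfolding K_def using q(4) En_fun[OF i(2)] by blast
  qed
  interpret tower_game M E P L G NR cd Hh
  proof (unfold_locales, goal_cases)
    case 1 show ?case by (rule NR(1))
  next
    case 2 show ?case unfolding cd_def by (intro df dEn' dK' NR(1))
  next
    case (3 b b' y y')
    obtain R q where *: "R \<in> elts NR" "q \<in> Pc" "y = pr R q" "En (rv b emp) q"
      "\<And>i n m. i \<in> Om \<Longrightarrow> n \<in> Om \<Longrightarrow> m \<in> Om \<Longrightarrow> rv b (J i (J n m)) = suc emp \<longleftrightarrow> K R i n m"
      using 3(6) unfolding cd_def by blast
    obtain R' q' where **: "R' \<in> elts NR" "q' \<in> Pc" "y' = pr R' q'" "En (rv b' emp) q'"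
      "\<And>i n m. i \<in> Om \<Longrightarrow> n \<in> Om \<Longrightarrow> m \<in> Om \<Longrightarrow> rv b' (J i (J n m)) = suc emp \<longleftrightarrow> K R' i n m"
      using 3(7) unfolding cd_def by blast
    have e: "K R i n m \<longleftrightarrow> K R' i n m" if "i \<in> Om" "n \<in> Om" "m \<in> Om" for i n m
      using *(5)[OF that] **(5)[OF that] 3(3) by simp
    have "elts R = elts R'" using K_sub[OF *(1), of R'] K_sub[OF **(1), of R] e by blast
    then have "R = R'" using *(1) **(1) NR(2) extn by blast
    moreover have "q = q'" using *(4) **(4) 3(3) En_fun by simp
    ultimately show ?case using * ** by simp
  next
    case (4 R q)
    obtain i0 where i0: "i0 \<in> Om" "En i0 q" using En_ex[OF 4(2)] by blast
    have RM: "R \<in> M" using 4 elts_M by blast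
    define B where "B k \<longleftrightarrow> (\<exists>i\<in>Om. \<exists>n\<in>Om. \<exists>m\<in>Om. k = J i (J n m) \<and> K R i n m)" for k
    have dB: "dfn G (\<lambda>e. B (e 0))" unfolding B_def by (intro df dK' RM)
    note dB' = inst1[where S=B, OF dB]
    define S where "S k v \<longleftrightarrow> (k = emp \<and> v = i0) \<or> (k \<noteq> emp \<and> B k \<and> v = suc emp) \<or> (k \<noteq> emp \<and> \<not> B k \<and> v = emp)" for k v
    have "\<exists>b. isreal b \<and> (\<forall>k\<in>Om. S k (rv b k))"
    proof (rule real_ex)
      show "dfn G (\<lambda>e. S (e 0) (e (Suc 0)))" unfolding S_def by (intro df dB' Om_M[OF i0(1)])
      fix k assume "k \<in> Om"
      show "\<exists>m. m \<in> Om \<and> S k m \<and> (\<forall>m'. m' \<in> Om \<and> S k m' \<longrightarrow> m' = m)"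
        unfolding S_def using i0(1) by (metis emp_Om suc_Om)
    qed
    then obtain b where b: "isreal b" "\<forall>k\<in>Om. S k (rv b k)" by blast
    have "rv b emp = i0" using b(2) emp_Om unfolding S_def by blast
    moreover have "rv b (J i (J n m)) = suc emp \<longleftrightarrow> K R i n m" if "i \<in> Om" "n \<in> Om" "m \<in> Om" for i n m
    proof -
      have "J i (J n m) \<in> Om" "J i (J n m) \<noteq> emp" using that J_ne0 by simp_all
      then have "S (J i (J n m)) (rv b (J i (J n m)))" "J i (J n m) \<noteq> emp" using b(2) by blast+
      moreover have "B (J i (J n m)) \<longleftrightarrow> K R i n m"
        unfolding B_def using that by (metis J_inj J_Om)
      ultimately show ?thesis unfolding S_def by (metis emp_Om Om_M suc_ne(1))
    qed
    ultimately have "cd b (pr R q)" unfolding cd_def using 4 i0 by blast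
    with b(1) show ?case by blast
  next
    case 5 show ?case unfolding Hh_def by (intro df)
  next
    case (6 A)
    then have "A \<in> elts NR" by (simp add: isreal_def)
    with 6 show ?case unfolding Hh_def by blast
  next
    case (7 A A' x)
    then show ?case unfolding Hh_def by (intro rv_ext) auto
  qed
  show False by (rule no_new_real[OF AD z(1) _ z(3)]) (use z(2) in blast)
qed

lemma not_AD: "\<not> X.AD"
proof
  assume AD: "X.AD"
  have "\<exists>A. isreal A \<and> ((rv A emp = emp \<and> (\<forall>R. isreal R \<longrightarrow> fol0 A R \<longrightarrow> Dv R)) \<or>
     (rv A emp \<noteq> emp \<and> (\<forall>R. isreal R \<longrightarrow> fol1 A R \<longrightarrow> \<not> Dv R)))"
  proof (rule AD_names[OF AD df_Dv])
    fix R R' assume "isreal R" "isreal R'" "\<And>n. n \<in> Om \<Longrightarrow> rv R n = rv R' n" "Dv R"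
    moreover from this have "rv R = rv R'" by (intro rv_ext)
    ultimately show "Dv R'" unfolding Dv_def by simp
  qed
  then show False using davis_I[OF AD] davis_II[OF AD] by blast
qed

end

theorem theorem4p1:
  fixes M :: "'a set" and E :: "'a \<Rightarrow> 'a \<Rightarrow> bool" and P L :: 'a and G :: "'a set"
  assumes "set_structure.ZF M E"
    and "set_structure.AD M E"
    and "set_structure.is_poset M E P L"
    and "set_structure.nontrivial M E P L"
    and "set_structure.surjective_image_of_reals M E P"
    and "set_structure.generic M E P L G"
  shows "\<not> set_structure.AD
             (set_structure.ext_carrier M E P L G) (set_structure.ext_mem M E P L G)"
proof -
  interpret forcing M E P L G by unfold_locales (fact assms)+
  obtain v f where v: "v \<in> M" "is_omega v" and f: "f \<in> M" "maps f (reals v) (elts P)"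
    "\<forall>p\<in>elts P. \<exists>x\<in>reals v. (x, p) \<in> graph f"
    using assms(5) unfolding surjective_image_of_reals_def by blast
  have "v = w" by (rule w_unique[OF v])
  with f assms(4) interpret forcing_R M E P L G f by unfold_locales auto
  show ?thesis by (rule not_AD)
qed

end
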